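(* Let $(A,\Delta)$ be an algebraic quantum group and $(X,\alpha)$ a right $A$-Galois object. Let $\varphi_X$ be the functional on $X$ determined by $(\iota\otimes\varphi)(\alpha(x))=\varphi_X(x)1$, and let $\psi_X$ be a non-zero invariant functional on $X$. Then there exists a unique invertible element $\delta_X\in M(X)$ such that $\varphi_X(x\delta_X)=\psi_X(x)$ for all $x\in X$.
   Context: Conventions: $k$ is a field; all algebras are $k$-algebras, non-zero, possibly without unit, and non-degenerate ($ab=0$ for all $b$ implies $a=0$, and $ab=0$ for all $a$ implies $b=0$). $M(X)$ is the multiplier algebra of $X$, with $X\subseteq M(X)$ and $k=k\cdot 1\subseteq M(X)$; $\otimes$ is over $k$; $\iota$ is the identity map; functionals are linear. A regular multiplier Hopf algebra is a pair $(A,\Delta)$ with $A$ an algebra and $\Delta:A\to M(A\otimes A)$ a coassociative homomorphism which is non-degenerate ($\Delta(A)(A\otimes A)=A\otimes A=(A\otimes A)\Delta(A)$) and such that the maps sending $a\otimes b$ to $\Delta(a)(1\otimes b)$, $(a\otimes 1)\Delta(b)$, $\Delta(a)(b\otimes 1)$, $(1\otimes a)\Delta(b)$ are all bijections of $A\otimes A$ onto $A\otimes A$. An algebraic quantum group is a regular multiplier Hopf algebra with a non-zero functional $\varphi$ (the left invariant functional, faithful and unique up to scalar; a choice is fixed) such that $(\iota\otimes\varphi)(\Delta(a)(b\otimes 1))=\varphi(a)b$ for all $a,b\in A$. A right coaction of $A$ on an algebra $X$ is an injective homomorphism $\alpha:X\to M(X\otimes A)$ with $\alpha(X)(1\otimes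 A)\subseteq X\otimes A$, $(1\otimes A)\alpha(X)\subseteq X\otimes A$ and $(\alpha\otimes\iota)\alpha=(\iota\otimes\Delta)\alpha$; it extends canonically to $M(X)\to M(X\otimes A)$. It is reduced if also $(X\otimes 1)\alpha(X)\subseteq X\otimes A$ (then also $\alpha(X)(X\otimes 1)\subseteq X\otimes A$). The coinvariants are the $f\in M(X)$ with $\alpha(f)=f\otimes 1$. $(X,\alpha)$ is a right $A$-Galois object if $\alpha$ is a reduced right coaction, the algebra of coinvariants is $k$, and $V:X\otimes X\to X\otimes A$, $x\otimes y\mapsto (x\otimes 1)\alpha(y)$, is bijective. $(\iota\otimes\varphi)(\alpha(x))$ is a multiplier of $X$ which is a scalar (it is coinvariant), so $\varphi_X$ is well defined. A functional $\omega$ on $X$ is invariant if $(\omega\otimes\iota)\alpha(x)=\omega(x)1$ (as multipliers of $A$) for all $x\in X$. *)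

theory Defs
  imports "HOL-Algebra.Module"
begin

section \<open>Algebras without unit\<close>

text \<open>
  Algebras are records of type \<open>module\<close>, whose multiplication is the product of the algebra.
  The record field \<open>one\<close> is ignored for algebras such as \<open>A\<close> and \<open>X\<close>, which need not be unital;
  it is meaningful for multiplier algebras.
\<close>

definition linear_maps ::
  "('k, 'm) ring_scheme \<Rightarrow> ('k, 'v, 'p) module_scheme \<Rightarrow> ('k, 'w, 'q) module_scheme \<Rightarrow> ('v \<Rightarrow> 'w) set"
  where "linear_maps K V W =
    {f \<in> carrier V \<rightarrow> carrier W.
       (\<forall>u\<in>carrier V. \<forall>v\<in>carrier V. f (u \<oplus>\<^bsub>V\<^esub> v) = f u \<oplus>\<^bsub>W\<^esub> f v) \<and>
       (\<forall>c\<in>carrier K. \<forall>v\<in>carrier V. f (c \<odot>\<^bsub>V\<^esub> v) = c \<odot>\<^bsub>W\<^esub> f v)}"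

definition functionals ::
  "('k, 'm) ring_scheme \<Rightarrow> ('k, 'v, 'p) module_scheme \<Rightarrow> ('v \<Rightarrow> 'k) set"
  where "functionals K V =
    {f \<in> carrier V \<rightarrow> carrier K.
       (\<forall>u\<in>carrier V. \<forall>v\<in>carrier V. f (u \<oplus>\<^bsub>V\<^esub> v) = f u \<oplus>\<^bsub>K\<^esub> f v) \<and>
       (\<forall>c\<in>carrier K. \<forall>v\<in>carrier V. f (c \<odot>\<^bsub>V\<^esub> v) = c \<otimes>\<^bsub>K\<^esub> f v)}"

definition lin_span ::
  "('k, 'm) ring_scheme \<Rightarrow> ('k, 'v) module \<Rightarrow> 'v set \<Rightarrow> 'v set"
  where "lin_span K V S = \<Inter>{U. submodule U K V \<and> S \<subseteq> U}"

locale nd_algebra = K?: field K + B?: module K B for K and B +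
  assumes mult_closed:
      "\<lbrakk>a \<in> carrier B; b \<in> carrier B\<rbrakk> \<Longrightarrow> a \<otimes>\<^bsub>B\<^esub> b \<in> carrier B"
    and mult_assoc:
      "\<lbrakk>a \<in> carrier B; b \<in> carrier B; c \<in> carrier B\<rbrakk> \<Longrightarrow>
        (a \<otimes>\<^bsub>B\<^esub> b) \<otimes>\<^bsub>B\<^esub> c = a \<otimes>\<^bsub>B\<^esub> (b \<otimes>\<^bsub>B\<^esub> c)"
    and mult_linear_right: "a \<in> carrier B \<Longrightarrow> (\<lambda>b. a \<otimes>\<^bsub>B\<^esub> b) \<in> linear_maps K B B"
    and mult_linear_left: "a \<in> carrier B \<Longrightarrow> (\<lambda>b. b \<otimes>\<^bsub>B\<^esub> a) \<in> linear_maps K B B"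
    and non_zero: "carrier B \<noteq> {\<zero>\<^bsub>B\<^esub>}"
    and nondegenerate_left:
      "\<lbrakk>a \<in> carrier B; \<forall>b\<in>carrier B. a \<otimes>\<^bsub>B\<^esub> b = \<zero>\<^bsub>B\<^esub>\<rbrakk> \<Longrightarrow> a = \<zero>\<^bsub>B\<^esub>"
    and nondegenerate_right:
      "\<lbrakk>b \<in> carrier B; \<forall>a\<in>carrier B. a \<otimes>\<^bsub>B\<^esub> b = \<zero>\<^bsub>B\<^esub>\<rbrakk> \<Longrightarrow> b = \<zero>\<^bsub>B\<^esub>"

definition alg_homs ::
  "('k, 'm) ring_scheme \<Rightarrow> ('k, 'v, 'p) module_scheme \<Rightarrow> ('k, 'w, 'q) module_scheme \<Rightarrow> ('v \<Rightarrow> 'w) set"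
  where "alg_homs K B C =
    {f \<in> linear_maps K B C.
       \<forall>a\<in>carrier B. \<forall>b\<in>carrier B. f (a \<otimes>\<^bsub>B\<^esub> b) = f a \<otimes>\<^bsub>C\<^esub> f b}"


section \<open>Tensor products\<close>

text \<open>
  The tensor product of two vector spaces over a field is realised as the span of the evaluations
  \<open>v \<otimes> w : B \<mapsto> B v w\<close> in the space of functionals on the bilinear forms on \<open>V \<times> W\<close>.
\<close>

type_synonym ('k, 'v, 'w) tensor = "('v \<Rightarrow> 'w \<Rightarrow> 'k) \<Rightarrow> 'k"

definition bilinear_forms ::
  "('k, 'm) ring_scheme \<Rightarrow> ('k, 'v, 'p) module_scheme \<Rightarrow> ('k, 'w, 'q) module_scheme \<Rightarrow>
    ('v \<Rightarrow> 'w \<Rightarrow> 'k) set"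
  where "bilinear_forms K V W =
    {B. (\<forall>v\<in>carrier V. B v \<in> functionals K W) \<and>
        (\<forall>w\<in>carrier W. (\<lambda>v. B v w) \<in> functionals K V)}"

definition pure_tensor ::
  "('k, 'm) ring_scheme \<Rightarrow> ('k, 'v, 'p) module_scheme \<Rightarrow> ('k, 'w, 'q) module_scheme \<Rightarrow>
    'v \<Rightarrow> 'w \<Rightarrow> ('k, 'v, 'w) tensor"
  where "pure_tensor K V W v w = (\<lambda>B\<in>bilinear_forms K V W. B v w)"

text \<open>Closure under sums suffices: \<open>c (v \<otimes> w) = (c v) \<otimes> w\<close> and \<open>0 = 0 \<otimes> 0\<close>.\<close>

inductive_set tensor_carrier ::
  "('k, 'm) ring_scheme \<Rightarrow> ('k, 'v, 'p) module_scheme \<Rightarrow> ('k, 'w, 'q) module_scheme \<Rightarrow>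
    ('k, 'v, 'w) tensor set"
  for K :: "('k, 'm) ring_scheme"
    and V :: "('k, 'v, 'p) module_scheme" and W :: "('k, 'w, 'q) module_scheme"
  where
    pure: "\<lbrakk>v \<in> carrier V; w \<in> carrier W\<rbrakk> \<Longrightarrow> pure_tensor K V W v w \<in> tensor_carrier K V W"
  | sum: "\<lbrakk>s \<in> tensor_carrier K V W; t \<in> tensor_carrier K V W\<rbrakk> \<Longrightarrow>
      (\<lambda>B\<in>bilinear_forms K V W. s B \<oplus>\<^bsub>K\<^esub> t B) \<in> tensor_carrier K V W"

text \<open>
  The product is the bilinear extension of \<open>(v \<otimes> w) (v' \<otimes> w') = v v' \<otimes> w w'\<close>;
  see \<open>tensor_mult_pure\<close> below.
\<close>

definition tensor ::
  "('k, 'm) ring_scheme \<Rightarrow> ('k, 'v, 'p) module_scheme \<Rightarrow> ('k, 'w, 'q) module_scheme \<Rightarrow>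
    ('k, ('k, 'v, 'w) tensor) module"
  where "tensor K V W =
    \<lparr>carrier = tensor_carrier K V W,
     mult = (\<lambda>s t. \<lambda>B\<in>bilinear_forms K V W.
       s (\<lambda>v w. t (\<lambda>v' w'. B (v \<otimes>\<^bsub>V\<^esub> v') (w \<otimes>\<^bsub>W\<^esub> w')))),
     one = pure_tensor K V W \<one>\<^bsub>V\<^esub> \<one>\<^bsub>W\<^esub>,
     zero = (\<lambda>B\<in>bilinear_forms K V W. \<zero>\<^bsub>K\<^esub>),
     add = (\<lambda>s t. \<lambda>B\<in>bilinear_forms K V W. s B \<oplus>\<^bsub>K\<^esub> t B),
     smult = (\<lambda>c s. \<lambda>B\<in>bilinear_forms K V W. c \<otimes>\<^bsub>K\<^esub> s B)\<rparr>"

lemma functionals_comp: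
  assumes "\<theta> \<in> functionals K W" "f \<in> linear_maps K V W"
  shows "(\<lambda>v. \<theta> (f v)) \<in> functionals K V"
  using assms unfolding functionals_def linear_maps_def by (auto simp: Pi_iff)

lemma tensor_mult_pure:
  assumes "nd_algebra K V" "nd_algebra K W"
    and v: "v \<in> carrier V" "v' \<in> carrier V" and w: "w \<in> carrier W" "w' \<in> carrier W"
  shows "pure_tensor K V W v w \<otimes>\<^bsub>tensor K V W\<^esub> pure_tensor K V W v' w' =
    pure_tensor K V W (v \<otimes>\<^bsub>V\<^esub> v') (w \<otimes>\<^bsub>W\<^esub> w')"
proof
  interpret V: nd_algebra K V by fact
  interpret W: nd_algebra K W by fact
  fix B
  show "(pure_tensor K V W v w \<otimes>\<^bsub>tensor K V W\<^esub> pure_tensor K V W v' w') B =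
    pure_tensor K V W (v \<otimes>\<^bsub>V\<^esub> v') (w \<otimes>\<^bsub>W\<^esub> w') B"
  proof (cases "B \<in> bilinear_forms K V W")
    case True
    then have B1: "B x \<in> functionals K W" if "x \<in> carrier V" for x
      using that by (auto simp: bilinear_forms_def)
    from True have B2: "(\<lambda>x. B x y) \<in> functionals K V" if "y \<in> carrier W" for y
      using that by (auto simp: bilinear_forms_def)
    have 1: "(\<lambda>x' y'. B (x \<otimes>\<^bsub>V\<^esub> x') (y \<otimes>\<^bsub>W\<^esub> y')) \<in> bilinear_forms K V W"
      if "x \<in> carrier V" "y \<in> carrier W" for x y
      using that functionals_comp[OF B1 W.mult_linear_right]
        functionals_comp[OF B2 V.mult_linear_right] V.mult_closed W.mult_closed
      by (auto simp: bilinear_forms_def)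
    have 2: "(\<lambda>x y. B (x \<otimes>\<^bsub>V\<^esub> v') (y \<otimes>\<^bsub>W\<^esub> w')) \<in> bilinear_forms K V W"
      using v w functionals_comp[OF B1 W.mult_linear_left]
        functionals_comp[OF B2 V.mult_linear_left] V.mult_closed W.mult_closed
      by (auto simp: bilinear_forms_def)
    have "(\<lambda>x y. pure_tensor K V W v' w' (\<lambda>x' y'. B (x \<otimes>\<^bsub>V\<^esub> x') (y \<otimes>\<^bsub>W\<^esub> y')))
        \<in> bilinear_forms K V W"
      using 2 1
      by (auto simp: bilinear_forms_def functionals_def pure_tensor_def Pi_iff
          V.B.M.a_closed W.B.M.a_closed V.B.smult_closed W.B.smult_closed)
    with True 1 v w show ?thesis
      by (simp add: tensor_def pure_tensor_def)
  qed (simp add: tensor_def pure_tensor_def)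
qed

text \<open>The linear map \<open>V \<otimes> W \<rightarrow> U\<close> with \<open>v \<otimes> w \<mapsto> \<beta> v w\<close>, for bilinear \<open>\<beta>\<close>.\<close>

definition tensor_lift ::
  "('k, 'm) ring_scheme \<Rightarrow> ('k, 'v, 'p) module_scheme \<Rightarrow> ('k, 'w, 'q) module_scheme \<Rightarrow>
    ('k, 'u, 'r) module_scheme \<Rightarrow> ('v \<Rightarrow> 'w \<Rightarrow> 'u) \<Rightarrow> ('k, 'v, 'w) tensor \<Rightarrow> 'u"
  where "tensor_lift K V W U \<beta> =
    (THE T. T \<in> linear_maps K (tensor K V W) U \<inter> extensional (carrier (tensor K V W)) \<and>
      (\<forall>v\<in>carrier V. \<forall>w\<in>carrier W. T (pure_tensor K V W v w) = \<beta> v w))"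

definition tensor_map ::
  "('k, 'm) ring_scheme \<Rightarrow> ('k, 'v, 'p) module_scheme \<Rightarrow> ('k, 'w, 'q) module_scheme \<Rightarrow>
    ('k, 'v1, 'p1) module_scheme \<Rightarrow> ('k, 'w1, 'q1) module_scheme \<Rightarrow>
    ('v \<Rightarrow> 'v1) \<Rightarrow> ('w \<Rightarrow> 'w1) \<Rightarrow> ('k, 'v, 'w) tensor \<Rightarrow> ('k, 'v1, 'w1) tensor"
  where "tensor_map K V W V' W' f g =
    tensor_lift K V W (tensor K V' W') (\<lambda>v w. pure_tensor K V' W' (f v) (g w))"

definition tensor_assoc ::
  "('k, 'm) ring_scheme \<Rightarrow> ('k, 'u, 'p) module_scheme \<Rightarrow> ('k, 'v, 'q) module_scheme \<Rightarrow>
    ('k, 'w, 'r) module_scheme \<Rightarrow>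
    ('k, ('k, 'u, 'v) tensor, 'w) tensor \<Rightarrow> ('k, 'u, ('k, 'v, 'w) tensor) tensor"
  where "tensor_assoc K U V W =
    tensor_lift K (tensor K U V) W (tensor K U (tensor K V W))
      (\<lambda>s w. tensor_lift K U V (tensor K U (tensor K V W))
        (\<lambda>u v. pure_tensor K U (tensor K V W) u (pure_tensor K V W v w)) s)"


section \<open>Multiplier algebras\<close>

text \<open>
  A multiplier \<open>m\<close> of \<open>B\<close> is the pair of the maps \<open>b \<mapsto> m b\<close> and \<open>b \<mapsto> b m\<close>. Both are kept
  extensional, so that equality of multipliers is equality in the type.
\<close>

type_synonym 'b multiplier = "('b \<Rightarrow> 'b) \<times> ('b \<Rightarrow> 'b)"

definition multipliers ::
  "('k, 'm) ring_scheme \<Rightarrow> ('k, 'b, 'p) module_scheme \<Rightarrow> 'b multiplier set"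
  where "multipliers K B =
    {(L, R).
       L \<in> linear_maps K B B \<inter> extensional (carrier B) \<and>
       R \<in> linear_maps K B B \<inter> extensional (carrier B) \<and>
       (\<forall>a\<in>carrier B. \<forall>b\<in>carrier B.
          L (a \<otimes>\<^bsub>B\<^esub> b) = L a \<otimes>\<^bsub>B\<^esub> b \<and> R (a \<otimes>\<^bsub>B\<^esub> b) = a \<otimes>\<^bsub>B\<^esub> R b \<and>
          R a \<otimes>\<^bsub>B\<^esub> b = a \<otimes>\<^bsub>B\<^esub> L b)}"

definition mult_alg ::
  "('k, 'm) ring_scheme \<Rightarrow> ('k, 'b, 'p) module_scheme \<Rightarrow> ('k, 'b multiplier) module"
  where "mult_alg K B =
    \<lparr>carrier = multipliers K B,
     mult = (\<lambda>m n. (compose (carrier B) (fst m) (fst n), compose (carrier B) (snd n) (snd m))),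
     one = (\<lambda>b\<in>carrier B. b, \<lambda>b\<in>carrier B. b),
     zero = (\<lambda>b\<in>carrier B. \<zero>\<^bsub>B\<^esub>, \<lambda>b\<in>carrier B. \<zero>\<^bsub>B\<^esub>),
     add = (\<lambda>m n. (\<lambda>b\<in>carrier B. fst m b \<oplus>\<^bsub>B\<^esub> fst n b, \<lambda>b\<in>carrier B. snd m b \<oplus>\<^bsub>B\<^esub> snd n b)),
     smult = (\<lambda>c m. (\<lambda>b\<in>carrier B. c \<odot>\<^bsub>B\<^esub> fst m b, \<lambda>b\<in>carrier B. c \<odot>\<^bsub>B\<^esub> snd m b))\<rparr>"

definition mult_of :: "('k, 'b, 'p) module_scheme \<Rightarrow> 'b \<Rightarrow> 'b multiplier"
  where "mult_of B a = (\<lambda>b\<in>carrier B. a \<otimes>\<^bsub>B\<^esub> b, \<lambda>b\<in>carrier B. b \<otimes>\<^bsub>B\<^esub> a)"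

definition inner_mults :: "('k, 'b, 'p) module_scheme \<Rightarrow> 'b multiplier set"
  where "inner_mults B = mult_of B ` carrier B"

text \<open>The element of \<open>B\<close> that a multiplier in \<open>inner_mults B\<close> comes from (unique if \<open>B\<close> is non-degenerate).\<close>

definition elem_of :: "('k, 'b, 'p) module_scheme \<Rightarrow> 'b multiplier \<Rightarrow> 'b"
  where "elem_of B = inv_into (carrier B) (mult_of B)"

definition mult_tensor ::
  "('k, 'm) ring_scheme \<Rightarrow> ('k, 'v, 'p) module_scheme \<Rightarrow> ('k, 'w, 'q) module_scheme \<Rightarrow>
    'v multiplier \<Rightarrow> 'w multiplier \<Rightarrow> ('k, 'v, 'w) tensor multiplier"
  where "mult_tensor K V W m n =
    (tensor_map K V W V W (fst m) (fst n), tensor_map K V W V W (snd m) (snd n))"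

text \<open>\<open>leg1\<close> and \<open>leg2\<close> give \<open>v \<otimes> 1\<close> and \<open>1 \<otimes> w\<close> in \<open>M(V \<otimes> W)\<close>.\<close>

definition leg1 ::
  "('k, 'm) ring_scheme \<Rightarrow> ('k, 'v, 'p) module_scheme \<Rightarrow> ('k, 'w, 'q) module_scheme \<Rightarrow>
    'v \<Rightarrow> ('k, 'v, 'w) tensor multiplier"
  where "leg1 K V W v = mult_tensor K V W (mult_of V v) \<one>\<^bsub>mult_alg K W\<^esub>"

definition leg2 ::
  "('k, 'm) ring_scheme \<Rightarrow> ('k, 'v, 'p) module_scheme \<Rightarrow> ('k, 'w, 'q) module_scheme \<Rightarrow>
    'w \<Rightarrow> ('k, 'v, 'w) tensor multiplier"
  where "leg2 K V W w = mult_tensor K V W \<one>\<^bsub>mult_alg K V\<^esub> (mult_of W w)"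

text \<open>
  The canonical extension of a homomorphism \<open>f : B \<rightarrow> M(C)\<close> to \<open>M(B)\<close>, determined by
  \<open>f(m) f(b) = f(m b)\<close> and \<open>f(b) f(m) = f(b m)\<close>.
\<close>

definition mult_ext ::
  "('k, 'm) ring_scheme \<Rightarrow> ('k, 'b, 'p) module_scheme \<Rightarrow> ('k, 'c, 'q) module_scheme \<Rightarrow>
    ('b \<Rightarrow> 'c multiplier) \<Rightarrow> 'b multiplier \<Rightarrow> 'c multiplier"
  where "mult_ext K B C f m =
    (THE n. n \<in> carrier (mult_alg K C) \<and>
      (\<forall>b\<in>carrier B. n \<otimes>\<^bsub>mult_alg K C\<^esub> f b = f (fst m b) \<and>
        f b \<otimes>\<^bsub>mult_alg K C\<^esub> n = f (snd m b)))"

definition mult_transport ::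
  "('k, 'b, 'p) module_scheme \<Rightarrow> ('k, 'c, 'q) module_scheme \<Rightarrow> ('b \<Rightarrow> 'c) \<Rightarrow>
    'b multiplier \<Rightarrow> 'c multiplier"
  where "mult_transport B C h m =
    (\<lambda>c\<in>carrier C. h (fst m (inv_into (carrier B) h c)),
     \<lambda>c\<in>carrier C. h (snd m (inv_into (carrier B) h c)))"


section \<open>Slice maps\<close>

text \<open>\<open>\<iota> \<otimes> \<phi>\<close> and \<open>\<omega> \<otimes> \<iota>\<close> on \<open>V \<otimes> W\<close>.\<close>

definition slice_right ::
  "('k, 'm) ring_scheme \<Rightarrow> ('k, 'v, 'p) module_scheme \<Rightarrow> ('k, 'w, 'q) module_scheme \<Rightarrow>
    ('w \<Rightarrow> 'k) \<Rightarrow> ('k, 'v, 'w) tensor \<Rightarrow> 'v"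
  where "slice_right K V W \<phi> = tensor_lift K V W V (\<lambda>v w. \<phi> w \<odot>\<^bsub>V\<^esub> v)"

definition slice_left ::
  "('k, 'm) ring_scheme \<Rightarrow> ('k, 'v, 'p) module_scheme \<Rightarrow> ('k, 'w, 'q) module_scheme \<Rightarrow>
    ('v \<Rightarrow> 'k) \<Rightarrow> ('k, 'v, 'w) tensor \<Rightarrow> 'w"
  where "slice_left K V W \<omega> = tensor_lift K V W W (\<lambda>v w. \<omega> v \<odot>\<^bsub>W\<^esub> w)"

text \<open>
  The slices of a multiplier \<open>m\<close> of \<open>V \<otimes> W\<close>: \<open>(\<iota> \<otimes> \<phi>)(m)\<close> is the multiplier of \<open>V\<close> given by
  \<open>v \<mapsto> (\<iota> \<otimes> \<phi>)(m (v \<otimes> 1))\<close> and \<open>v \<mapsto> (\<iota> \<otimes> \<phi>)((v \<otimes> 1) m)\<close>, and similarly on the other side.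
  They are meaningful when these products lie in \<open>V \<otimes> W\<close>.
\<close>

definition mult_slice_right ::
  "('k, 'm) ring_scheme \<Rightarrow> ('k, 'v, 'p) module_scheme \<Rightarrow> ('k, 'w, 'q) module_scheme \<Rightarrow>
    ('w \<Rightarrow> 'k) \<Rightarrow> ('k, 'v, 'w) tensor multiplier \<Rightarrow> 'v multiplier"
  where "mult_slice_right K V W \<phi> m =
    (\<lambda>v\<in>carrier V. slice_right K V W \<phi>
       (elem_of (tensor K V W) (m \<otimes>\<^bsub>mult_alg K (tensor K V W)\<^esub> leg1 K V W v)),
     \<lambda>v\<in>carrier V. slice_right K V W \<phi>
       (elem_of (tensor K V W) (leg1 K V W v \<otimes>\<^bsub>mult_alg K (tensor K V W)\<^esub> m)))"

definition mult_slice_left ::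
  "('k, 'm) ring_scheme \<Rightarrow> ('k, 'v, 'p) module_scheme \<Rightarrow> ('k, 'w, 'q) module_scheme \<Rightarrow>
    ('v \<Rightarrow> 'k) \<Rightarrow> ('k, 'v, 'w) tensor multiplier \<Rightarrow> 'w multiplier"
  where "mult_slice_left K V W \<omega> m =
    (\<lambda>w\<in>carrier W. slice_left K V W \<omega>
       (elem_of (tensor K V W) (m \<otimes>\<^bsub>mult_alg K (tensor K V W)\<^esub> leg2 K V W w)),
     \<lambda>w\<in>carrier W. slice_left K V W \<omega>
       (elem_of (tensor K V W) (leg2 K V W w \<otimes>\<^bsub>mult_alg K (tensor K V W)\<^esub> m)))"


section \<open>Multiplier Hopf algebras and coactions\<close>

text \<open>
  For \<open>\<alpha> : X \<rightarrow> M(X \<otimes> A)\<close> and a multiplier \<open>m\<close> of \<open>X \<otimes> A\<close> such that \<open>m (1 \<otimes> a)\<close> and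
  \<open>(1 \<otimes> a) m\<close> lie in \<open>X \<otimes> A\<close> for all \<open>a\<close>, the multiplier \<open>(\<alpha> \<otimes> \<iota>)(m)\<close> of \<open>(X \<otimes> A) \<otimes> A\<close>
  is determined by \<open>(\<alpha> \<otimes> \<iota>)(m) (1 \<otimes> a) = (\<alpha> \<otimes> \<iota>)(m (1 \<otimes> a))\<close> and
  \<open>(1 \<otimes> a) (\<alpha> \<otimes> \<iota>)(m) = (\<alpha> \<otimes> \<iota>)((1 \<otimes> a) m)\<close>. This applies to every \<open>m = \<alpha> x\<close>, and it does
  not presuppose that \<open>\<alpha>\<close> is non-degenerate.
\<close>

definition coact_id ::
  "('k, 'm) ring_scheme \<Rightarrow> ('k, 'x, 'p) module_scheme \<Rightarrow> ('k, 'a, 'q) module_scheme \<Rightarrow>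
    ('x \<Rightarrow> ('k, 'x, 'a) tensor multiplier) \<Rightarrow>
    ('k, 'x, 'a) tensor \<Rightarrow> ('k, ('k, 'x, 'a) tensor, 'a) tensor multiplier"
  where "coact_id K X A \<alpha> =
    tensor_lift K X A (mult_alg K (tensor K (tensor K X A) A))
      (\<lambda>x a. mult_tensor K (tensor K X A) A (\<alpha> x) (mult_of A a))"

definition coact_id_ext ::
  "('k, 'm) ring_scheme \<Rightarrow> ('k, 'x, 'p) module_scheme \<Rightarrow> ('k, 'a, 'q) module_scheme \<Rightarrow>
    ('x \<Rightarrow> ('k, 'x, 'a) tensor multiplier) \<Rightarrow>
    ('k, 'x, 'a) tensor multiplier \<Rightarrow> ('k, ('k, 'x, 'a) tensor, 'a) tensor multiplier"
  where "coact_id_ext K X A \<alpha> m =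
    (let XA = tensor K X A; M = mult_alg K XA; N = mult_alg K (tensor K XA A) in
      THE n. n \<in> carrier N \<and>
        (\<forall>a\<in>carrier A.
           n \<otimes>\<^bsub>N\<^esub> leg2 K XA A a = coact_id K X A \<alpha> (elem_of XA (m \<otimes>\<^bsub>M\<^esub> leg2 K X A a)) \<and>
           leg2 K XA A a \<otimes>\<^bsub>N\<^esub> n = coact_id K X A \<alpha> (elem_of XA (leg2 K X A a \<otimes>\<^bsub>M\<^esub> m))))"

definition id_comult ::
  "('k, 'm) ring_scheme \<Rightarrow> ('k, 'x, 'p) module_scheme \<Rightarrow> ('k, 'a, 'q) module_scheme \<Rightarrow>
    ('a \<Rightarrow> ('k, 'a, 'a) tensor multiplier) \<Rightarrow>
    ('k, 'x, 'a) tensor \<Rightarrow> ('k, 'x, ('k, 'a, 'a) tensor) tensor multiplier"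
  where "id_comult K X A \<Delta> =
    tensor_lift K X A (mult_alg K (tensor K X (tensor K A A)))
      (\<lambda>x a. mult_tensor K X (tensor K A A) (mult_of X x) (\<Delta> a))"

text \<open>
  \<open>(\<alpha> \<otimes> \<iota>) \<alpha> = (\<iota> \<otimes> \<Delta>) \<alpha>\<close>, where \<open>M((X \<otimes> A) \<otimes> A)\<close> is identified with \<open>M(X \<otimes> (A \<otimes> A))\<close>.
  For \<open>X = A\<close> and \<open>\<alpha> = \<Delta>\<close> this is coassociativity of \<open>\<Delta>\<close>.
\<close>

definition coassociative ::
  "('k, 'm) ring_scheme \<Rightarrow> ('k, 'a, 'q) module_scheme \<Rightarrow> ('a \<Rightarrow> ('k, 'a, 'a) tensor multiplier) \<Rightarrow>
    ('k, 'x, 'p) module_scheme \<Rightarrow> ('x \<Rightarrow> ('k, 'x, 'a) tensor multiplier) \<Rightarrow> bool"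
  where "coassociative K A \<Delta> X \<alpha> \<longleftrightarrow>
    (\<forall>x\<in>carrier X.
       mult_transport (tensor K (tensor K X A) A) (tensor K X (tensor K A A)) (tensor_assoc K X A A)
         (coact_id_ext K X A \<alpha> (\<alpha> x)) =
       mult_ext K (tensor K X A) (tensor K X (tensor K A A)) (id_comult K X A \<Delta>) (\<alpha> x))"

text \<open>
  That the four canonical maps are bijections of \<open>A \<otimes> A\<close> onto \<open>A \<otimes> A\<close> is expressed by taking
  their values in \<open>M(A \<otimes> A)\<close> and requiring bijectivity onto the copy \<open>inner_mults (A \<otimes> A)\<close> of \<open>A \<otimes> A\<close>.
\<close>

locale regular_multiplier_hopf_algebra = nd_algebra K A
  for K :: "'k ring" and A :: "('k, 'a) module" +
  fixes \<Delta> :: "'a \<Rightarrow> ('k, 'a, 'a) tensor multiplier"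
  assumes comult_hom: "\<Delta> \<in> alg_homs K A (mult_alg K (tensor K A A))"
    and comult_nondegenerate_left:
      "lin_span K (tensor K A A) {fst (\<Delta> a) t | a t. a \<in> carrier A \<and> t \<in> carrier (tensor K A A)} =
        carrier (tensor K A A)"
    and comult_nondegenerate_right:
      "lin_span K (tensor K A A) {snd (\<Delta> a) t | a t. a \<in> carrier A \<and> t \<in> carrier (tensor K A A)} =
        carrier (tensor K A A)"
    and comult_coassociative: "coassociative K A \<Delta> A \<Delta>"
    and canonical_bij1:
      "bij_betw (tensor_lift K A A (mult_alg K (tensor K A A))
          (\<lambda>a b. \<Delta> a \<otimes>\<^bsub>mult_alg K (tensor K A A)\<^esub> leg2 K A A b))
        (carrier (tensor K A A)) (inner_mults (tensor K A A))"
    and canonical_bij2: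
      "bij_betw (tensor_lift K A A (mult_alg K (tensor K A A))
          (\<lambda>a b. leg1 K A A a \<otimes>\<^bsub>mult_alg K (tensor K A A)\<^esub> \<Delta> b))
        (carrier (tensor K A A)) (inner_mults (tensor K A A))"
    and canonical_bij3:
      "bij_betw (tensor_lift K A A (mult_alg K (tensor K A A))
          (\<lambda>a b. \<Delta> a \<otimes>\<^bsub>mult_alg K (tensor K A A)\<^esub> leg1 K A A b))
        (carrier (tensor K A A)) (inner_mults (tensor K A A))"
    and canonical_bij4:
      "bij_betw (tensor_lift K A A (mult_alg K (tensor K A A))
          (\<lambda>a b. leg2 K A A a \<otimes>\<^bsub>mult_alg K (tensor K A A)\<^esub> \<Delta> b))
        (carrier (tensor K A A)) (inner_mults (tensor K A A))"

locale algebraic_quantum_group = regular_multiplier_hopf_algebra +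
  fixes \<phi> :: "'b \<Rightarrow> 'a"
  assumes phi_functional: "\<phi> \<in> functionals K A"
    and phi_nonzero: "\<exists>a\<in>carrier A. \<phi> a \<noteq> \<zero>\<^bsub>K\<^esub>"
    and phi_left_invariant:
      "\<lbrakk>a \<in> carrier A; b \<in> carrier A\<rbrakk> \<Longrightarrow>
        slice_right K A A \<phi>
          (elem_of (tensor K A A) (\<Delta> a \<otimes>\<^bsub>mult_alg K (tensor K A A)\<^esub> leg1 K A A b)) =
        \<phi> a \<odot>\<^bsub>A\<^esub> b"

locale right_coaction =
  A?: regular_multiplier_hopf_algebra K A \<Delta> + X?: nd_algebra K X
  for K :: "'k ring" and A :: "('k, 'a) module" and \<Delta> and X :: "('k, 'x) module" +
  fixes \<alpha> :: "'x \<Rightarrow> ('k, 'x, 'a) tensor multiplier"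
  assumes coact_hom: "\<alpha> \<in> alg_homs K X (mult_alg K (tensor K X A))"
    and coact_inj: "inj_on \<alpha> (carrier X)"
    and coact_leg2:
      "\<lbrakk>x \<in> carrier X; a \<in> carrier A\<rbrakk> \<Longrightarrow>
        \<alpha> x \<otimes>\<^bsub>mult_alg K (tensor K X A)\<^esub> leg2 K X A a \<in> inner_mults (tensor K X A)"
    and leg2_coact:
      "\<lbrakk>x \<in> carrier X; a \<in> carrier A\<rbrakk> \<Longrightarrow>
        leg2 K X A a \<otimes>\<^bsub>mult_alg K (tensor K X A)\<^esub> \<alpha> x \<in> inner_mults (tensor K X A)"
    and coact_coassociative: "coassociative K A \<Delta> X \<alpha>"

locale reduced_right_coaction = right_coaction +
  assumes leg1_coact:
    "\<lbrakk>x \<in> carrier X; y \<in> carrier X\<rbrakk> \<Longrightarrow>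
      leg1 K X A y \<otimes>\<^bsub>mult_alg K (tensor K X A)\<^esub> \<alpha> x \<in> inner_mults (tensor K X A)"

definition coinvariants ::
  "('k, 'm) ring_scheme \<Rightarrow> ('k, 'x, 'p) module_scheme \<Rightarrow> ('k, 'a, 'q) module_scheme \<Rightarrow>
    ('x \<Rightarrow> ('k, 'x, 'a) tensor multiplier) \<Rightarrow> 'x multiplier set"
  where "coinvariants K X A \<alpha> =
    {f \<in> carrier (mult_alg K X).
       mult_ext K X (tensor K X A) \<alpha> f = mult_tensor K X A f \<one>\<^bsub>mult_alg K A\<^esub>}"

locale galois_object = reduced_right_coaction +
  assumes coinvariants_scalar:
      "coinvariants K X A \<alpha> = {c \<odot>\<^bsub>mult_alg K X\<^esub> \<one>\<^bsub>mult_alg K X\<^esub> | c. c \<in> carrier K}"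
    and galois_map_bij:
      "bij_betw (tensor_lift K X X (mult_alg K (tensor K X A))
          (\<lambda>x y. leg1 K X A x \<otimes>\<^bsub>mult_alg K (tensor K X A)\<^esub> \<alpha> y))
        (carrier (tensor K X X)) (inner_mults (tensor K X A))"

definition invariant_functional ::
  "('k, 'm) ring_scheme \<Rightarrow> ('k, 'a, 'q) module_scheme \<Rightarrow> ('k, 'x, 'p) module_scheme \<Rightarrow>
    ('x \<Rightarrow> ('k, 'x, 'a) tensor multiplier) \<Rightarrow> ('x \<Rightarrow> 'k) \<Rightarrow> bool"
  where "invariant_functional K A X \<alpha> \<omega> \<longleftrightarrow>
    \<omega> \<in> functionals K X \<and>
    (\<forall>x\<in>carrier X.
       mult_slice_left K X A \<omega> (\<alpha> x) = \<omega> x \<odot>\<^bsub>mult_alg K A\<^esub> \<one>\<^bsub>mult_alg K A\<^esub>)"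

end

theory Submission
  imports Defs
begin

text \<open>
  The element \<open>\<delta>\<^sub>X\<close> is found by comparing functionals. If \<open>\<phi>\<^sub>X\<close> is faithful and every functional \<open>\<psi>\<^sub>X(\<cdot> w)\<close>
  on \<open>X\<close> has the form \<open>\<phi>\<^sub>X(\<cdot> w')\<close>, then \<open>w \<mapsto> w'\<close> is a well defined map, and it commutes with left
  multiplication: it is the right multiplication by a candidate for \<open>\<delta>\<^sub>X\<close>. For it to be half of a
  multiplier, a left multiplication is needed as well. It exists as soon as elements can be moved around
  both functionals, that is, as soon as the functionals \<open>\<phi>\<^sub>X(z \<cdot>)\<close>, \<open>\<phi>\<^sub>X(\<cdot> z)\<close>, \<open>\<psi>\<^sub>X(z \<cdot>)\<close> and \<open>\<psi>\<^sub>X(\<cdot> z)\<close>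
  form one and the same set. Exchanging \<open>\<phi>\<^sub>X\<close> and \<open>\<psi>\<^sub>X\<close> produces the inverse, and uniqueness is
  faithfulness of \<open>\<phi>\<^sub>X\<close>. This last part is \<open>modular_element\<close>.

  The comparison of left translates, \<open>psiX_left\<close> and \<open>phiX_left\<close>, is a computation of
  \<open>(\<psi>\<^sub>X \<otimes> \<phi>)((x \<otimes> b) \<alpha>(y))\<close> in two ways, using that \<open>X \<otimes> A\<close> is spanned by the elements \<open>(s \<otimes> 1) \<alpha>(t)\<close> as
  well as by the elements \<open>(1 \<otimes> c) \<alpha>(t)\<close>. For right translates one needs products
  \<open>\<alpha>(y) (x \<otimes> 1)\<close>, and these are written through the antipode of \<open>A\<close> as \<open>W (\<iota> \<otimes> S) V\<close>; this gives \<open>psiX_right\<close>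
  and \<open>phiX_right\<close>. The link between left and right translates of \<open>\<phi>\<^sub>X\<close>, \<open>phiX_left_right\<close> and
  \<open>phiX_right_left\<close>, comes from the corresponding property of \<open>\<phi>\<close> on \<open>A\<close>. There it results from the strong
  invariance of \<open>\<phi>\<close> and of a right invariant functional \<open>\<psi>\<close> on \<open>A\<close>, evaluated on
  \<open>(b \<otimes> 1) \<Delta>(a) (1 \<otimes> d)\<close>. Faithfulness of \<open>\<phi>\<close> (\<open>phi_faithful\<close>) is proved on \<open>A\<close> and passed on to \<open>\<phi>\<^sub>X\<close>
  (\<open>phiX_faithful\<close>).

  Two inputs are produced on the way. The functional \<open>\<psi>\<close> is obtained by carrying \<open>\<psi>\<^sub>X\<close> from \<open>X\<close> to \<open>A\<close>
  along the Galois map (\<open>hopf_integral_exists\<close>). The antipode is obtained from \<open>\<psi>\<close>: the composite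
  \<open>T\<^sub>1\<inverse> T\<^sub>3 T\<^sub>2\<inverse>\<close> of canonical maps is left linear and left colinear in the first leg, and invariance of
  \<open>\<psi>\<close> then shows that it acts on the second leg only, by a map \<open>S\<close> that is bijective and reverses products
  (\<open>galois_flip_eq\<close>, \<open>S_antimult\<close>).

  All of this takes place in a covered form in which no multiplier occurs: the canonical maps are maps
  between lists of pairs, and tensors are tested on multilinear forms (locales \<open>hopf_lists\<close> and
  \<open>coaction_lists\<close>). An identity between multipliers becomes an identity between forms after multiplication of
  a leg by an arbitrary element, which is cancelled again by non-degeneracy (\<open>formal_cancel\<close>). The second half
  of the text connects this with tensor products and multiplier algebras. Most axioms of the two locales
  are associativity in \<open>M(X \<otimes> A)\<close>. Coassociativity is the exception: both of its sides are multipliers given by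
  descriptions, and they have to be shown to exist and to be computed (\<open>coact_id_ext_snd\<close>,
  \<open>mult_ext_snd\<close>, \<open>coassoc_lists\<close>).
\<close>

section \<open>Finite sums over lists of pairs\<close>

text \<open>
  Tensors are represented by lists of pairs throughout, with repetitions and without any normal form.
  A list \<open>l\<close> represents the tensor on which a bilinear form \<open>B\<close> takes the value \<open>esum K l B\<close>, and two
  lists represent the same tensor iff they agree on all bilinear forms.
\<close>

definition esum :: "('c, 'm) ring_scheme \<Rightarrow> ('v \<times> 'w) list \<Rightarrow> ('v \<Rightarrow> 'w \<Rightarrow> 'c) \<Rightarrow> 'c"
  where "esum G l F = foldr (\<lambda>p s. F (fst p) (snd p) \<oplus>\<^bsub>G\<^esub> s) l \<zero>\<^bsub>G\<^esub>"

lemma esum_Nil [simp]: "esum G [] F = \<zero>\<^bsub>G\<^esub>"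
  by (simp add: esum_def)

lemma esum_Cons [simp]: "esum G (p # l) F = F (fst p) (snd p) \<oplus>\<^bsub>G\<^esub> esum G l F"
  by (simp add: esum_def)

lemma esum_cong:
  assumes "l \<in> lists (P \<times> Q)" "\<And>v w. v \<in> P \<Longrightarrow> w \<in> Q \<Longrightarrow> F v w = F' v w"
  shows "esum G l F = esum G l F'"
  using assms(1) by induction (auto simp: assms(2))

lemma esum_map: "esum G (map h l) F = esum G l (\<lambda>v w. F (fst (h (v, w))) (snd (h (v, w))))"
  by (induction l) auto

lemma esum_swap_list [simp]: "esum G (map prod.swap l) F = esum G l (\<lambda>v w. F w v)"
  by (simp add: esum_map)

lemma swap_lists: "l \<in> lists (P \<times> Q) \<Longrightarrow> map prod.swap l \<in> lists (Q \<times> P)"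
  by (induction l) auto

context abelian_monoid
begin

lemma esum_closed:
  assumes "l \<in> lists (P \<times> Q)" "\<And>v w. v \<in> P \<Longrightarrow> w \<in> Q \<Longrightarrow> F v w \<in> carrier G"
  shows "esum G l F \<in> carrier G"
  using assms(1) by induction (auto simp: assms(2))

lemma esum_append:
  assumes "l \<in> lists (P \<times> Q)" "l' \<in> lists (P \<times> Q)"
    and "\<And>v w. v \<in> P \<Longrightarrow> w \<in> Q \<Longrightarrow> F v w \<in> carrier G"
  shows "esum G (l @ l') F = esum G l F \<oplus> esum G l' F"
  using assms(1)
proof induction
  case (Cons p l)
  have "esum G l F \<in> carrier G" "esum G l' F \<in> carrier G"
    using esum_closed[OF Cons.hyps(2) assms(3)] esum_closed[OF assms(2,3)] by auto
  with Cons assms show ?case by (auto simp: a_assoc)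
qed (simp add: esum_closed[OF assms(2,3)])

lemma esum_add:
  assumes "l \<in> lists (P \<times> Q)" "\<And>v w. v \<in> P \<Longrightarrow> w \<in> Q \<Longrightarrow> F v w \<in> carrier G"
    "\<And>v w. v \<in> P \<Longrightarrow> w \<in> Q \<Longrightarrow> F' v w \<in> carrier G"
  shows "esum G l (\<lambda>v w. F v w \<oplus> F' v w) = esum G l F \<oplus> esum G l F'"
  using assms(1)
proof induction
  case (Cons p l)
  have "esum G l F \<in> carrier G" "esum G l F' \<in> carrier G"
    using esum_closed[OF Cons.hyps(2) assms(2)] esum_closed[OF Cons.hyps(2) assms(3)] by auto
  with Cons assms show ?case by (auto simp: a_ac)
qed simp

lemma esum_zero [simp]: "esum G l (\<lambda>v w. \<zero>) = \<zero>"
  by (induction l) auto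

lemma esum_swap:
  assumes "l \<in> lists (P \<times> Q)" "l' \<in> lists (P' \<times> Q')"
    "\<And>v w v' w'. v \<in> P \<Longrightarrow> w \<in> Q \<Longrightarrow> v' \<in> P' \<Longrightarrow> w' \<in> Q' \<Longrightarrow> F v w v' w' \<in> carrier G"
  shows "esum G l (\<lambda>v w. esum G l' (\<lambda>v' w'. F v w v' w')) = esum G l' (\<lambda>v' w'. esum G l (\<lambda>v w. F v w v' w'))"
  using assms(1)
proof induction
  case (Cons p l)
  have c: "esum G l (\<lambda>v w. F v w v' w') \<in> carrier G" if "v' \<in> P'" "w' \<in> Q'" for v' w'
    by (rule esum_closed[OF Cons.hyps(2)]) (use that assms(3) in auto)
  have "esum G l' (\<lambda>v' w'. esum G (p # l) (\<lambda>v w. F v w v' w'))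
    = esum G l' (\<lambda>v' w'. F (fst p) (snd p) v' w') \<oplus> esum G l' (\<lambda>v' w'. esum G l (\<lambda>v w. F v w v' w'))"
    unfolding esum_Cons by (rule esum_add[OF assms(2)]) (use Cons.hyps(1) assms(3) c in auto)
  with Cons.IH show ?case by simp
qed simp

lemma esum_concat:
  assumes "l \<in> lists (P \<times> Q)" "\<And>v w. v \<in> P \<Longrightarrow> w \<in> Q \<Longrightarrow> k v w \<in> lists (P' \<times> Q')"
    "\<And>v w. v \<in> P' \<Longrightarrow> w \<in> Q' \<Longrightarrow> F v w \<in> carrier G"
  shows "esum G (concat (map (\<lambda>(v, w). k v w) l)) F = esum G l (\<lambda>v w. esum G (k v w) F)"
    and "concat (map (\<lambda>(v, w). k v w) l) \<in> lists (P' \<times> Q')"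
proof -
  have "concat (map (\<lambda>(v, w). k v w) l) \<in> lists (P' \<times> Q') \<and>
    esum G (concat (map (\<lambda>(v, w). k v w) l)) F = esum G l (\<lambda>v w. esum G (k v w) F)"
    using assms(1)
  proof induction
    case (Cons p l)
    have k: "k (fst p) (snd p) \<in> lists (P' \<times> Q')"
      using Cons.hyps(1) by (intro assms(2)) auto
    moreover have "concat (map (\<lambda>(v, w). k v w) (p # l)) = k (fst p) (snd p) @ concat (map (\<lambda>(v, w). k v w) l)"
      by (simp add: case_prod_beta)
    ultimately show ?case
      using Cons.IH esum_append[OF k _ assms(3)] by (simp only: append_in_lists_conv esum_Cons simp_thms)
  qed simp
  then show "esum G (concat (map (\<lambda>(v, w). k v w) l)) F = esum G l (\<lambda>v w. esum G (k v w) F)"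
    and "concat (map (\<lambda>(v, w). k v w) l) \<in> lists (P' \<times> Q')" by auto
qed

end

lemma esum_additive:
  assumes G: "abelian_monoid G" and l: "l \<in> lists (P \<times> Q)"
    and F: "\<And>v w. v \<in> P \<Longrightarrow> w \<in> Q \<Longrightarrow> F v w \<in> carrier G"
    and h: "h \<zero>\<^bsub>G\<^esub> = \<zero>\<^bsub>H\<^esub>" "\<And>x y. x \<in> carrier G \<Longrightarrow> y \<in> carrier G \<Longrightarrow> h (x \<oplus>\<^bsub>G\<^esub> y) = h x \<oplus>\<^bsub>H\<^esub> h y"
  shows "h (esum G l F) = esum H l (\<lambda>v w. h (F v w))"
  using l
proof induction
  case (Cons p l)
  have "esum G l F \<in> carrier G" by (rule abelian_monoid.esum_closed[OF G Cons.hyps(2) F])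
  with Cons show ?case by (auto simp: h F)
qed (simp add: h)

section \<open>Functionals\<close>

locale vec = K?: field K + V?: module K V for K (structure) and V

lemma vec_of_nd: "nd_algebra K B \<Longrightarrow> vec K B"
  by (simp add: nd_algebra_def vec_def)

lemma functionalsI:
  assumes "\<And>v. v \<in> carrier V \<Longrightarrow> f v \<in> carrier K"
    "\<And>u v. u \<in> carrier V \<Longrightarrow> v \<in> carrier V \<Longrightarrow> f (u \<oplus>\<^bsub>V\<^esub> v) = f u \<oplus>\<^bsub>K\<^esub> f v"
    "\<And>c v. c \<in> carrier K \<Longrightarrow> v \<in> carrier V \<Longrightarrow> f (c \<odot>\<^bsub>V\<^esub> v) = c \<otimes>\<^bsub>K\<^esub> f v"
  shows "f \<in> functionals K V"
  using assms by (auto simp: functionals_def)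

lemma functionalsD:
  assumes "f \<in> functionals K V"
  shows "v \<in> carrier V \<Longrightarrow> f v \<in> carrier K"
    "u \<in> carrier V \<Longrightarrow> v \<in> carrier V \<Longrightarrow> f (u \<oplus>\<^bsub>V\<^esub> v) = f u \<oplus>\<^bsub>K\<^esub> f v"
    "c \<in> carrier K \<Longrightarrow> v \<in> carrier V \<Longrightarrow> f (c \<odot>\<^bsub>V\<^esub> v) = c \<otimes>\<^bsub>K\<^esub> f v"
  using assms by (auto simp: functionals_def)

lemma linear_mapsI:
  assumes "\<And>v. v \<in> carrier V \<Longrightarrow> f v \<in> carrier W"
    "\<And>u v. u \<in> carrier V \<Longrightarrow> v \<in> carrier V \<Longrightarrow> f (u \<oplus>\<^bsub>V\<^esub> v) = f u \<oplus>\<^bsub>W\<^esub> f v"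
    "\<And>c v. c \<in> carrier K \<Longrightarrow> v \<in> carrier V \<Longrightarrow> f (c \<odot>\<^bsub>V\<^esub> v) = c \<odot>\<^bsub>W\<^esub> f v"
  shows "f \<in> linear_maps K V W"
  using assms by (auto simp: linear_maps_def)

lemma linear_mapsD:
  assumes "f \<in> linear_maps K V W"
  shows "v \<in> carrier V \<Longrightarrow> f v \<in> carrier W"
    "u \<in> carrier V \<Longrightarrow> v \<in> carrier V \<Longrightarrow> f (u \<oplus>\<^bsub>V\<^esub> v) = f u \<oplus>\<^bsub>W\<^esub> f v"
    "c \<in> carrier K \<Longrightarrow> v \<in> carrier V \<Longrightarrow> f (c \<odot>\<^bsub>V\<^esub> v) = c \<odot>\<^bsub>W\<^esub> f v"
  using assms by (auto simp: linear_maps_def)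

context vec
begin

lemma functional_zero:
  assumes "f \<in> functionals K V" shows "f \<zero>\<^bsub>V\<^esub> = \<zero>"
proof -
  have "f \<zero>\<^bsub>V\<^esub> = f (\<zero> \<odot>\<^bsub>V\<^esub> \<zero>\<^bsub>V\<^esub>)" by simp
  also have "\<dots> = \<zero> \<otimes> f \<zero>\<^bsub>V\<^esub>" by (rule functionalsD(3)[OF assms]) auto
  finally show ?thesis using functionalsD(1)[OF assms] by simp
qed

lemma functional_esum:
  assumes "f \<in> functionals K V" "l \<in> lists (P \<times> Q)"
    "\<And>v w. v \<in> P \<Longrightarrow> w \<in> Q \<Longrightarrow> F v w \<in> carrier V"
  shows "f (esum V l F) = esum K l (\<lambda>v w. f (F v w))"
  by (rule esum_additive[OF V.M.abelian_monoid_axioms assms(2,3)])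
    (auto simp: functional_zero functionalsD assms(1))

definition subspace :: "'c set \<Rightarrow> bool"
  where "subspace U \<longleftrightarrow> U \<subseteq> carrier V \<and> \<zero>\<^bsub>V\<^esub> \<in> U \<and>
    (\<forall>u\<in>U. \<forall>v\<in>U. u \<oplus>\<^bsub>V\<^esub> v \<in> U) \<and> (\<forall>c\<in>carrier K. \<forall>u\<in>U. c \<odot>\<^bsub>V\<^esub> u \<in> U)"

text \<open>
  A subspace that is maximal among those missing \<open>v\<close> is a hyperplane; the functional is the
  coordinate along \<open>v\<close>.
\<close>

lemma functional_separating:
  assumes U: "subspace U" and v: "v \<in> carrier V" "v \<notin> U"
  shows "\<exists>f\<in>functionals K V. f v = \<one> \<and> (\<forall>u\<in>U. f u = \<zero>)"
proof -
  let ?S = "{M. subspace M \<and> U \<subseteq> M \<and> v \<notin> M}"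
  have "\<exists>M\<in>?S. \<forall>X\<in>?S. M \<subseteq> X \<longrightarrow> X = M"
  proof (rule subset_Zorn_nonempty)
    show "?S \<noteq> {}" using assms by auto
    fix C assume C: "C \<noteq> {}" "subset.chain ?S C"
    then have CS: "\<And>M. M \<in> C \<Longrightarrow> subspace M \<and> U \<subseteq> M \<and> v \<notin> M"
      and ch: "\<And>M N. M \<in> C \<Longrightarrow> N \<in> C \<Longrightarrow> M \<subseteq> N \<or> N \<subseteq> M"
      by (auto simp: subset.chain_def)
    have "subspace (\<Union>C)"
      unfolding subspace_def
    proof (intro conjI ballI)
      show "\<Union>C \<subseteq> carrier V" using CS unfolding subspace_def by blast
      show "\<zero>\<^bsub>V\<^esub> \<in> \<Union>C" using CS C(1) by (auto simp: subspace_def)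
      show "u \<oplus>\<^bsub>V\<^esub> w \<in> \<Union>C" if "u \<in> \<Union>C" "w \<in> \<Union>C" for u w
      proof -
        from that obtain M N where MN: "M \<in> C" "N \<in> C" "u \<in> M" "w \<in> N" by auto
        with ch[of M N] obtain L where "L \<in> C" "u \<in> L" "w \<in> L" by blast
        then show ?thesis using CS[of L] by (auto simp: subspace_def)
      qed
      show "c \<odot>\<^bsub>V\<^esub> u \<in> \<Union>C" if "c \<in> carrier K" "u \<in> \<Union>C" for c u
        using that CS unfolding subspace_def by blast
    qed
    then show "\<Union>C \<in> ?S" using CS C(1) by auto
  qed
  then obtain M where MS: "M \<in> ?S" and Mmax: "\<forall>X\<in>?S. M \<subseteq> X \<longrightarrow> X = M" by (rule bexE)
  have M: "subspace M" "U \<subseteq> M" "v \<notin> M" using MS by simp_all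
  have max: "X = M" if "subspace X" "M \<subseteq> X" "v \<notin> X" for X
    using Mmax[rule_format, of X] that M(2) by auto
  have Msub: "\<And>m. m \<in> M \<Longrightarrow> m \<in> carrier V"
    and Mz: "\<zero>\<^bsub>V\<^esub> \<in> M" and Madd: "\<And>u w. u \<in> M \<Longrightarrow> w \<in> M \<Longrightarrow> u \<oplus>\<^bsub>V\<^esub> w \<in> M"
    and Msm: "\<And>c u. c \<in> carrier K \<Longrightarrow> u \<in> M \<Longrightarrow> c \<odot>\<^bsub>V\<^esub> u \<in> M"
    using M(1) by (auto simp: subspace_def)
  have Mneg: "\<ominus>\<^bsub>V\<^esub> u \<in> M" if "u \<in> M" for u
  proof -
    have "(\<ominus> \<one>) \<odot>\<^bsub>V\<^esub> u \<in> M" using that by (intro Msm) auto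
    then show ?thesis using that Msub by (simp add: smult_l_minus)
  qed
  have ex: "\<exists>c\<in>carrier K. \<exists>m\<in>M. w = m \<oplus>\<^bsub>V\<^esub> c \<odot>\<^bsub>V\<^esub> v" if w: "w \<in> carrier V" for w
  proof (cases "w \<in> M")
    case True then show ?thesis using v w by (intro bexI[of _ \<zero>] bexI[of _ w]) auto
  next
    case False
    let ?N = "{m \<oplus>\<^bsub>V\<^esub> c \<odot>\<^bsub>V\<^esub> w | m c. m \<in> M \<and> c \<in> carrier K}"
    have "subspace ?N"
      unfolding subspace_def
    proof (intro conjI ballI)
      show "?N \<subseteq> carrier V" using Msub w by auto
      have "\<zero>\<^bsub>V\<^esub> = \<zero>\<^bsub>V\<^esub> \<oplus>\<^bsub>V\<^esub> \<zero> \<odot>\<^bsub>V\<^esub> w" using w by simp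
      then show "\<zero>\<^bsub>V\<^esub> \<in> ?N" using Mz K.zero_closed by blast
      show "u \<oplus>\<^bsub>V\<^esub> u' \<in> ?N" if uu: "u \<in> ?N" "u' \<in> ?N" for u u'
      proof -
        from uu obtain m c m' c' where mc: "m \<in> M" "c \<in> carrier K" "m' \<in> M" "c' \<in> carrier K"
          "u = m \<oplus>\<^bsub>V\<^esub> c \<odot>\<^bsub>V\<^esub> w" "u' = m' \<oplus>\<^bsub>V\<^esub> c' \<odot>\<^bsub>V\<^esub> w" by blast
        then have "u \<oplus>\<^bsub>V\<^esub> u' = (m \<oplus>\<^bsub>V\<^esub> m') \<oplus>\<^bsub>V\<^esub> (c \<oplus> c') \<odot>\<^bsub>V\<^esub> w"
          using w Msub by (simp add: smult_l_distr V.M.a_ac)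
        then show ?thesis using mc Madd by blast
      qed
      show "c \<odot>\<^bsub>V\<^esub> u \<in> ?N" if cu: "c \<in> carrier K" "u \<in> ?N" for c u
      proof -
        from cu obtain m d where md: "m \<in> M" "d \<in> carrier K" "u = m \<oplus>\<^bsub>V\<^esub> d \<odot>\<^bsub>V\<^esub> w" by blast
        then have "c \<odot>\<^bsub>V\<^esub> u = c \<odot>\<^bsub>V\<^esub> m \<oplus>\<^bsub>V\<^esub> (c \<otimes> d) \<odot>\<^bsub>V\<^esub> w"
          using w Msub cu by (simp add: smult_r_distr smult_assoc1)
        then show ?thesis using md Msm cu by blast
      qed
    qed
    moreover have "M \<subseteq> ?N"
    proof
      fix m assume m: "m \<in> M"
      then have "m = m \<oplus>\<^bsub>V\<^esub> \<zero> \<odot>\<^bsub>V\<^esub> w" using w Msub by simp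
      then show "m \<in> ?N" using m K.zero_closed by blast
    qed
    moreover have "w \<in> ?N"
    proof -
      have "w = \<zero>\<^bsub>V\<^esub> \<oplus>\<^bsub>V\<^esub> \<one> \<odot>\<^bsub>V\<^esub> w" using w by simp
      then show ?thesis using Mz K.one_closed by blast
    qed
    ultimately have "v \<in> ?N" using max[of ?N] False by blast
    then obtain m c where mc: "m \<in> M" "c \<in> carrier K" "v = m \<oplus>\<^bsub>V\<^esub> c \<odot>\<^bsub>V\<^esub> w" by blast
    have c0: "c \<noteq> \<zero>" using mc M(3) w Msub by auto
    then have ic: "inv c \<in> carrier K" "inv c \<otimes> c = \<one>" using mc(2) by (auto simp: field_Units)
    have "inv c \<odot>\<^bsub>V\<^esub> v = inv c \<odot>\<^bsub>V\<^esub> m \<oplus>\<^bsub>V\<^esub> w"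
      using mc ic w Msub by (simp add: smult_r_distr smult_assoc1[symmetric])
    then have "w = \<ominus>\<^bsub>V\<^esub> (inv c \<odot>\<^bsub>V\<^esub> m) \<oplus>\<^bsub>V\<^esub> inv c \<odot>\<^bsub>V\<^esub> v"
      using mc ic w Msub by (simp add: V.M.r_neg1)
    then show ?thesis using ic Mneg Msm mc by blast
  qed
  have uniq: "c = c'" if "c \<in> carrier K" "c' \<in> carrier K" "m \<in> M" "m' \<in> M"
    "m \<oplus>\<^bsub>V\<^esub> c \<odot>\<^bsub>V\<^esub> v = m' \<oplus>\<^bsub>V\<^esub> c' \<odot>\<^bsub>V\<^esub> v" for c c' m m'
  proof (rule ccontr)
    assume ne: "c \<noteq> c'"
    define d where "d = c \<ominus> c'"
    have cd: "c = d \<oplus> c'" using that by (simp add: d_def K.minus_eq K.a_assoc K.l_neg)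
    have d: "d \<in> carrier K" using that by (simp add: d_def)
    have d0: "d \<noteq> \<zero>"
    proof
      assume "d = \<zero>"
      then show False using cd ne that by simp
    qed
    have "(m \<oplus>\<^bsub>V\<^esub> d \<odot>\<^bsub>V\<^esub> v) \<oplus>\<^bsub>V\<^esub> c' \<odot>\<^bsub>V\<^esub> v = m' \<oplus>\<^bsub>V\<^esub> c' \<odot>\<^bsub>V\<^esub> v"
      using that(5) that d v Msub unfolding cd by (simp add: smult_l_distr V.M.a_assoc)
    then have "m \<oplus>\<^bsub>V\<^esub> d \<odot>\<^bsub>V\<^esub> v = m'"
      using that d v Msub by simp
    then have "d \<odot>\<^bsub>V\<^esub> v = \<ominus>\<^bsub>V\<^esub> m \<oplus>\<^bsub>V\<^esub> m'"
      using that d v Msub by (auto simp: V.M.r_neg1)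
    then have "d \<odot>\<^bsub>V\<^esub> v \<in> M" using that Mneg Madd by simp
    moreover have id: "inv d \<in> carrier K" "inv d \<otimes> d = \<one>" using d d0 by (auto simp: field_Units)
    ultimately have "inv d \<odot>\<^bsub>V\<^esub> (d \<odot>\<^bsub>V\<^esub> v) \<in> M" using Msm by blast
    moreover have "inv d \<odot>\<^bsub>V\<^esub> (d \<odot>\<^bsub>V\<^esub> v) = v"
      using d v id smult_assoc1[of "inv d" d v] by simp
    ultimately have "v \<in> M" by simp
    then show False using M by simp
  qed
  define f where "f w = (THE c. c \<in> carrier K \<and> (\<exists>m\<in>M. w = m \<oplus>\<^bsub>V\<^esub> c \<odot>\<^bsub>V\<^esub> v))" for w
  have fI: "f w = c" if "c \<in> carrier K" "m \<in> M" "w = m \<oplus>\<^bsub>V\<^esub> c \<odot>\<^bsub>V\<^esub> v" for w c m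
    unfolding f_def by (rule the_equality) (use that uniq in blast)+
  have fv: "f v = \<one>" by (rule fI[of _ "\<zero>\<^bsub>V\<^esub>"]) (use v Mz in auto)
  have fU: "f u = \<zero>" if "u \<in> U" for u by (rule fI[of _ u]) (use v M(2) that Msub in auto)
  have "f \<in> functionals K V"
  proof (rule functionalsI)
    fix u assume "u \<in> carrier V"
    then obtain c m where cm: "c \<in> carrier K" "m \<in> M" "u = m \<oplus>\<^bsub>V\<^esub> c \<odot>\<^bsub>V\<^esub> v" using ex by blast
    then show "f u \<in> carrier K" using fI by auto
    {
      fix d assume d: "d \<in> carrier K"
      have "d \<odot>\<^bsub>V\<^esub> u = d \<odot>\<^bsub>V\<^esub> m \<oplus>\<^bsub>V\<^esub> (d \<otimes> c) \<odot>\<^bsub>V\<^esub> v"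
        using d cm v Msub by (simp add: smult_r_distr smult_assoc1)
      then show "f (d \<odot>\<^bsub>V\<^esub> u) = d \<otimes> f u" using fI[OF _ Msm[OF d cm(2)], of "d \<otimes> c"] fI[OF cm] d cm by auto
    }
    fix u' assume "u' \<in> carrier V"
    then obtain c' m' where cm': "c' \<in> carrier K" "m' \<in> M" "u' = m' \<oplus>\<^bsub>V\<^esub> c' \<odot>\<^bsub>V\<^esub> v" using ex by blast
    have "u \<oplus>\<^bsub>V\<^esub> u' = (m \<oplus>\<^bsub>V\<^esub> m') \<oplus>\<^bsub>V\<^esub> (c \<oplus> c') \<odot>\<^bsub>V\<^esub> v"
      using cm cm' v Msub by (simp add: smult_l_distr V.M.a_ac)
    then show "f (u \<oplus>\<^bsub>V\<^esub> u') = f u \<oplus> f u'"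
      using fI[OF _ Madd[OF cm(2) cm'(2)], of "c \<oplus> c'"] fI[OF cm] fI[OF cm'] cm cm' by auto
  qed
  then show ?thesis using fv fU by blast
qed

text \<open>
  Functionals separate the points of a vector space. Identities between elements can thus be checked
  as identities between scalars, where all sums are sums in \<open>K\<close>.
\<close>

lemma functional_ext:
  assumes "u \<in> carrier V" "v \<in> carrier V" "\<And>f. f \<in> functionals K V \<Longrightarrow> f u = f v"
  shows "u = v"
proof (rule ccontr)
  assume ne: "u \<noteq> v"
  let ?w = "u \<oplus>\<^bsub>V\<^esub> \<ominus>\<^bsub>V\<^esub> v"
  have "?w \<noteq> \<zero>\<^bsub>V\<^esub>"
  proof
    assume "?w = \<zero>\<^bsub>V\<^esub>"
    then have "\<ominus>\<^bsub>V\<^esub> (\<ominus>\<^bsub>V\<^esub> v) = u" using assms(1,2) by (intro V.M.minus_equality) auto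
    then show False using ne assms(2) by simp
  qed
  moreover have "subspace {\<zero>\<^bsub>V\<^esub>}" by (auto simp: subspace_def)
  ultimately obtain f where f: "f \<in> functionals K V" "f ?w = \<one>"
    using functional_separating[of "{\<zero>\<^bsub>V\<^esub>}" ?w] assms(1,2) by auto
  have "u = ?w \<oplus>\<^bsub>V\<^esub> v" using assms(1,2) by (simp add: V.M.a_assoc V.M.l_neg)
  then have "f u = f ?w \<oplus> f v" using f assms(1,2) functionalsD(2)[OF f(1), of ?w v] by simp
  then have "\<one> \<oplus> f v = f v" using f assms(3)[OF f(1)] by simp
  then show False using functionalsD(1)[OF f(1) assms(2)] by simp
qed

lemma functional_zeroI:
  assumes "u \<in> carrier V" "\<And>f. f \<in> functionals K V \<Longrightarrow> f u = \<zero>"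
  shows "u = \<zero>\<^bsub>V\<^esub>"
  using assms by (intro functional_ext) (auto simp: functional_zero)

text \<open>
  Every finite set lies in the range of a finite-rank projection \<open>v \<mapsto> \<Sum> f\<^sub>j(v) e\<^sub>j\<close>. It plays
  the role of a basis.
\<close>

lemma finite_dual_system:
  assumes "finite F" "F \<subseteq> carrier V"
  shows "\<exists>l\<in>lists (functionals K V \<times> carrier V). \<forall>v\<in>F. v = esum V l (\<lambda>f e. f v \<odot>\<^bsub>V\<^esub> e)"
  using assms
proof induction
  case empty show ?case by (auto intro: bexI[of _ "[]"])
next
  case (insert v F)
  then obtain l where l: "l \<in> lists (functionals K V \<times> carrier V)"
    and lF: "\<And>v. v \<in> F \<Longrightarrow> v = esum V l (\<lambda>f e. f v \<odot>\<^bsub>V\<^esub> e)" by auto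
  let ?p = "\<lambda>v. esum V l (\<lambda>f e. f v \<odot>\<^bsub>V\<^esub> e)"
  let ?U = "{u \<in> carrier V. u = ?p u}"
  have pc: "?p u \<in> carrier V" if "u \<in> carrier V" for u
    by (rule V.M.esum_closed[OF l]) (use that in \<open>auto intro: functionalsD\<close>)
  have U: "subspace ?U"
    unfolding subspace_def
  proof (intro conjI ballI)
    show "?U \<subseteq> carrier V" by auto
    have "esum V l (\<lambda>f e. f \<zero>\<^bsub>V\<^esub> \<odot>\<^bsub>V\<^esub> e) = esum V l (\<lambda>f e. \<zero>\<^bsub>V\<^esub>)"
      by (rule esum_cong[OF l]) (auto simp: functional_zero)
    then show "\<zero>\<^bsub>V\<^esub> \<in> ?U" by simp
    show "u \<oplus>\<^bsub>V\<^esub> w \<in> ?U" if "u \<in> ?U" "w \<in> ?U" for u w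
    proof -
      have "esum V l (\<lambda>f e. f (u \<oplus>\<^bsub>V\<^esub> w) \<odot>\<^bsub>V\<^esub> e) = esum V l (\<lambda>f e. f u \<odot>\<^bsub>V\<^esub> e \<oplus>\<^bsub>V\<^esub> f w \<odot>\<^bsub>V\<^esub> e)"
        by (rule esum_cong[OF l]) (use that in \<open>simp add: functionalsD smult_l_distr\<close>)
      also have "\<dots> = ?p u \<oplus>\<^bsub>V\<^esub> ?p w"
        by (rule V.M.esum_add[OF l]) (use that in \<open>auto intro: functionalsD\<close>)
      finally show ?thesis using that by auto
    qed
    show "c \<odot>\<^bsub>V\<^esub> u \<in> ?U" if "c \<in> carrier K" "u \<in> ?U" for c u
    proof -
      have "c \<odot>\<^bsub>V\<^esub> ?p u = esum V l (\<lambda>f e. c \<odot>\<^bsub>V\<^esub> (f u \<odot>\<^bsub>V\<^esub> e))"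
        by (rule esum_additive[OF V.M.abelian_monoid_axioms l])
          (use that in \<open>auto simp: smult_r_distr intro: functionalsD\<close>)
      also have "\<dots> = ?p (c \<odot>\<^bsub>V\<^esub> u)"
        by (rule esum_cong[OF l]) (use that in \<open>simp add: functionalsD smult_assoc1\<close>)
      finally show ?thesis using that by auto
    qed
  qed
  have FU: "F \<subseteq> ?U" using lF insert.prems by auto
  have vc: "v \<in> carrier V" using insert.prems by simp
  show ?case
  proof (cases "v \<in> ?U")
    case True then show ?thesis using l lF by (intro bexI[of _ l]) auto
  next
    case False
    then obtain g where g: "g \<in> functionals K V" "g v = \<one>" "\<And>u. u \<in> ?U \<Longrightarrow> g u = \<zero>"
      using functional_separating[OF U vc] by blast
    let ?v' = "v \<oplus>\<^bsub>V\<^esub> \<ominus>\<^bsub>V\<^esub> ?p v"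
    have vv: "v = ?v' \<oplus>\<^bsub>V\<^esub> ?p v" using vc pc[OF vc] by (simp add: V.M.a_assoc V.M.l_neg)
    show ?thesis
    proof (intro bexI[of _ "(g, ?v') # l"] ballI)
      show "(g, ?v') # l \<in> lists (functionals K V \<times> carrier V)" using g l vc pc by simp
      fix u assume "u \<in> insert v F"
      then show "u = esum V ((g, ?v') # l) (\<lambda>f e. f u \<odot>\<^bsub>V\<^esub> e)"
      proof
        assume "u = v"
        then show ?thesis using g vv vc pc[OF vc] by simp
      next
        assume "u \<in> F"
        then have "u \<in> ?U" using FU by blast
        then show ?thesis using g(3)[of u] vc pc[OF vc] by auto
      qed
    qed
  qed
qed

end

section \<open>Multilinear forms and formal sums\<close>

definition trilinear_forms ::
  "('k, 'm) ring_scheme \<Rightarrow> ('k, 'u, 'p) module_scheme \<Rightarrow> ('k, 'v, 'q) module_scheme \<Rightarrow>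
    ('k, 'w, 'r) module_scheme \<Rightarrow> ('u \<Rightarrow> 'v \<Rightarrow> 'w \<Rightarrow> 'k) set"
  where "trilinear_forms K U V W =
    {C. (\<forall>u\<in>carrier U. C u \<in> bilinear_forms K V W) \<and>
        (\<forall>v\<in>carrier V. \<forall>w\<in>carrier W. (\<lambda>u. C u v w) \<in> functionals K U)}"

text \<open>
  \<open>T v w\<close> is a list for the value at \<open>v \<otimes> w\<close> of a linear map \<open>V \<otimes> W \<rightarrow> X \<otimes> Y\<close>. The list need not depend
  on \<open>v\<close> and \<open>w\<close> linearly; its pairings with bilinear forms do.
\<close>

definition bilinear_lists ::
  "('k, 'm) ring_scheme \<Rightarrow> ('k, 'v, 'p) module_scheme \<Rightarrow> ('k, 'w, 'q) module_scheme \<Rightarrow>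
    ('k, 'x, 'r) module_scheme \<Rightarrow> ('k, 'y, 's) module_scheme \<Rightarrow> ('v \<Rightarrow> 'w \<Rightarrow> ('x \<times> 'y) list) set"
  where "bilinear_lists K V W X Y =
    {T. (\<forall>v\<in>carrier V. \<forall>w\<in>carrier W. T v w \<in> lists (carrier X \<times> carrier Y)) \<and>
        (\<forall>B\<in>bilinear_forms K X Y. (\<lambda>v w. esum K (T v w) B) \<in> bilinear_forms K V W)}"

text \<open>
  \<open>F\<close> is a formal sum of point evaluations, and it is the same sum for all functions \<open>D\<close>, linear or not.
  This uniformity is what allows one leg to be expanded while the other legs stay fixed.
\<close>

definition formal :: "('k, 'm) ring_scheme \<Rightarrow> 'z set \<Rightarrow> 'i set \<Rightarrow> (('z \<Rightarrow> 'i \<Rightarrow> 'k) \<Rightarrow> 'k) \<Rightarrow> bool"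
  where "formal K P I F \<longleftrightarrow> (\<exists>l\<in>lists (P \<times> I).
    \<forall>D. (\<forall>z\<in>P. \<forall>i\<in>I. D z i \<in> carrier K) \<longrightarrow> F D = esum K l D)"

lemma bilinear_formsI:
  assumes "\<And>v. v \<in> carrier V \<Longrightarrow> (\<lambda>w. B v w) \<in> functionals K W"
    "\<And>w. w \<in> carrier W \<Longrightarrow> (\<lambda>v. B v w) \<in> functionals K V"
  shows "(\<lambda>v w. B v w) \<in> bilinear_forms K V W"
  using assms by (simp add: bilinear_forms_def)

lemma bilinear_formsD:
  assumes "B \<in> bilinear_forms K V W"
  shows "v \<in> carrier V \<Longrightarrow> B v \<in> functionals K W"
    "w \<in> carrier W \<Longrightarrow> (\<lambda>v. B v w) \<in> functionals K V"
    "v \<in> carrier V \<Longrightarrow> w \<in> carrier W \<Longrightarrow> B v w \<in> carrier K"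
  using assms by (auto simp: bilinear_forms_def functionals_def)

lemma trilinear_formsI:
  assumes "\<And>u v. u \<in> carrier U \<Longrightarrow> v \<in> carrier V \<Longrightarrow> (\<lambda>w. C u v w) \<in> functionals K W"
    "\<And>u w. u \<in> carrier U \<Longrightarrow> w \<in> carrier W \<Longrightarrow> (\<lambda>v. C u v w) \<in> functionals K V"
    "\<And>v w. v \<in> carrier V \<Longrightarrow> w \<in> carrier W \<Longrightarrow> (\<lambda>u. C u v w) \<in> functionals K U"
  shows "(\<lambda>u v w. C u v w) \<in> trilinear_forms K U V W"
  using assms by (simp add: trilinear_forms_def bilinear_forms_def)

lemma trilinear_formsD:
  assumes "C \<in> trilinear_forms K U V W"
  shows "u \<in> carrier U \<Longrightarrow> C u \<in> bilinear_forms K V W"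
    "u \<in> carrier U \<Longrightarrow> v \<in> carrier V \<Longrightarrow> (\<lambda>w. C u v w) \<in> functionals K W"
    "u \<in> carrier U \<Longrightarrow> w \<in> carrier W \<Longrightarrow> (\<lambda>v. C u v w) \<in> functionals K V"
    "v \<in> carrier V \<Longrightarrow> w \<in> carrier W \<Longrightarrow> (\<lambda>u. C u v w) \<in> functionals K U"
    "u \<in> carrier U \<Longrightarrow> v \<in> carrier V \<Longrightarrow> w \<in> carrier W \<Longrightarrow> C u v w \<in> carrier K"
  using assms bilinear_formsD(3)[of "C u" K V W v w] by (auto simp: trilinear_forms_def bilinear_forms_def)

lemma bilinear_listsD:
  assumes "T \<in> bilinear_lists K V W X Y"
  shows "v \<in> carrier V \<Longrightarrow> w \<in> carrier W \<Longrightarrow> T v w \<in> lists (carrier X \<times> carrier Y)"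
    "B \<in> bilinear_forms K X Y \<Longrightarrow> (\<lambda>v w. esum K (T v w) B) \<in> bilinear_forms K V W"
  using assms by (auto simp: bilinear_lists_def)

lemma linear_id: "(\<lambda>v. v) \<in> linear_maps K V V"
  by (auto simp: linear_maps_def)

lemma linear_comp: "f \<in> linear_maps K V W \<Longrightarrow> g \<in> linear_maps K U V \<Longrightarrow> (\<lambda>u. f (g u)) \<in> linear_maps K U W"
  by (auto simp: linear_maps_def Pi_iff)

lemma functional_comp: "f \<in> functionals K W \<Longrightarrow> g \<in> linear_maps K V W \<Longrightarrow> (\<lambda>v. f (g v)) \<in> functionals K V"
  by (rule functionals_comp)

lemma bilinear_comp_left:
  "B \<in> bilinear_forms K V W \<Longrightarrow> g \<in> linear_maps K U V \<Longrightarrow> w \<in> carrier W \<Longrightarrow> (\<lambda>u. B (g u) w) \<in> functionals K U"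
  by (rule functional_comp[OF bilinear_formsD(2)])

lemma bilinear_comp_right:
  "B \<in> bilinear_forms K V W \<Longrightarrow> g \<in> linear_maps K U W \<Longrightarrow> v \<in> carrier V \<Longrightarrow> (\<lambda>u. B v (g u)) \<in> functionals K U"
  by (rule functional_comp[OF bilinear_formsD(1)])

lemmas bilinear_comp = bilinear_comp_left bilinear_comp_right bilinear_formsD(1,3)

lemma trilinear_comp:
  assumes "C \<in> trilinear_forms K U V W"
  shows "g \<in> linear_maps K Z U \<Longrightarrow> v \<in> carrier V \<Longrightarrow> w \<in> carrier W \<Longrightarrow> (\<lambda>z. C (g z) v w) \<in> functionals K Z"
    "h \<in> linear_maps K Z V \<Longrightarrow> u \<in> carrier U \<Longrightarrow> w \<in> carrier W \<Longrightarrow> (\<lambda>z. C u (h z) w) \<in> functionals K Z"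
    "k \<in> linear_maps K Z W \<Longrightarrow> u \<in> carrier U \<Longrightarrow> v \<in> carrier V \<Longrightarrow> (\<lambda>z. C u v (k z)) \<in> functionals K Z"
    "u \<in> carrier U \<Longrightarrow> v \<in> carrier V \<Longrightarrow> w \<in> carrier W \<Longrightarrow> C u v w \<in> carrier K"
    "u \<in> carrier U \<Longrightarrow> C u \<in> bilinear_forms K V W"
  using functional_comp[OF trilinear_formsD(4)[OF assms], of v w g Z]
    functional_comp[OF trilinear_formsD(3)[OF assms], of u w h Z]
    functional_comp[OF trilinear_formsD(2)[OF assms], of u v k Z]
    trilinear_formsD(1,5)[OF assms]
  by auto

lemma lists_left:
  assumes "T \<in> bilinear_lists K V W X Y" "g \<in> linear_maps K U V" "w \<in> carrier W" "(\<lambda>x y. B x y) \<in> bilinear_forms K X Y"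
  shows "(\<lambda>u. esum K (T (g u) w) (\<lambda>x y. B x y)) \<in> functionals K U"
  by (rule bilinear_comp_left[OF bilinear_listsD(2)[OF assms(1,4)] assms(2,3)])

lemma lists_right:
  assumes "T \<in> bilinear_lists K V W X Y" "g \<in> linear_maps K U W" "v \<in> carrier V" "(\<lambda>x y. B x y) \<in> bilinear_forms K X Y"
  shows "(\<lambda>u. esum K (T v (g u)) (\<lambda>x y. B x y)) \<in> functionals K U"
  by (rule bilinear_comp_right[OF bilinear_listsD(2)[OF assms(1,4)] assms(2,3)])

lemma (in nd_algebra) linear_mult_left:
  "a \<in> carrier B \<Longrightarrow> g \<in> linear_maps K V B \<Longrightarrow> (\<lambda>v. a \<otimes>\<^bsub>B\<^esub> g v) \<in> linear_maps K V B"
  by (rule linear_comp[OF mult_linear_right])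

lemma (in nd_algebra) linear_mult_right:
  "a \<in> carrier B \<Longrightarrow> g \<in> linear_maps K V B \<Longrightarrow> (\<lambda>v. g v \<otimes>\<^bsub>B\<^esub> a) \<in> linear_maps K V B"
  by (rule linear_comp[OF mult_linear_left])

text \<open>
  Non-degeneracy in the form in which it is used: elements are determined by their products with all
  other elements.
\<close>

lemma (in nd_algebra) eq_by_left_mult:
  assumes "u \<in> carrier B" "v \<in> carrier B" "\<And>b. b \<in> carrier B \<Longrightarrow> b \<otimes>\<^bsub>B\<^esub> u = b \<otimes>\<^bsub>B\<^esub> v"
  shows "u = v"
proof -
  have "u \<oplus>\<^bsub>B\<^esub> \<ominus>\<^bsub>B\<^esub> v = \<zero>\<^bsub>B\<^esub>"
  proof (rule nondegenerate_right)
    show "\<forall>a\<in>carrier B. a \<otimes>\<^bsub>B\<^esub> (u \<oplus>\<^bsub>B\<^esub> \<ominus>\<^bsub>B\<^esub> v) = \<zero>\<^bsub>B\<^esub>"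
    proof
      fix a assume a: "a \<in> carrier B"
      have "a \<otimes>\<^bsub>B\<^esub> (u \<oplus>\<^bsub>B\<^esub> \<ominus>\<^bsub>B\<^esub> v) \<oplus>\<^bsub>B\<^esub> a \<otimes>\<^bsub>B\<^esub> v = a \<otimes>\<^bsub>B\<^esub> ((u \<oplus>\<^bsub>B\<^esub> \<ominus>\<^bsub>B\<^esub> v) \<oplus>\<^bsub>B\<^esub> v)"
        using linear_mapsD(2)[OF mult_linear_right[OF a], of "u \<oplus>\<^bsub>B\<^esub> \<ominus>\<^bsub>B\<^esub> v" v] assms by simp
      also have "\<dots> = a \<otimes>\<^bsub>B\<^esub> v" using assms a by (simp add: B.M.a_assoc B.M.l_neg)
      finally show "a \<otimes>\<^bsub>B\<^esub> (u \<oplus>\<^bsub>B\<^esub> \<ominus>\<^bsub>B\<^esub> v) = \<zero>\<^bsub>B\<^esub>"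
        using assms a mult_closed by simp
    qed
  qed (use assms in auto)
  then have "\<ominus>\<^bsub>B\<^esub> (\<ominus>\<^bsub>B\<^esub> v) = u" using assms(1,2) by (intro B.M.minus_equality) auto
  then show ?thesis using assms by simp
qed

lemma (in nd_algebra) eq_by_right_mult:
  assumes "u \<in> carrier B" "v \<in> carrier B" "\<And>b. b \<in> carrier B \<Longrightarrow> u \<otimes>\<^bsub>B\<^esub> b = v \<otimes>\<^bsub>B\<^esub> b"
  shows "u = v"
proof -
  have "u \<oplus>\<^bsub>B\<^esub> \<ominus>\<^bsub>B\<^esub> v = \<zero>\<^bsub>B\<^esub>"
  proof (rule nondegenerate_left)
    show "\<forall>a\<in>carrier B. (u \<oplus>\<^bsub>B\<^esub> \<ominus>\<^bsub>B\<^esub> v) \<otimes>\<^bsub>B\<^esub> a = \<zero>\<^bsub>B\<^esub>"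
    proof
      fix a assume a: "a \<in> carrier B"
      have "(u \<oplus>\<^bsub>B\<^esub> \<ominus>\<^bsub>B\<^esub> v) \<otimes>\<^bsub>B\<^esub> a \<oplus>\<^bsub>B\<^esub> v \<otimes>\<^bsub>B\<^esub> a = ((u \<oplus>\<^bsub>B\<^esub> \<ominus>\<^bsub>B\<^esub> v) \<oplus>\<^bsub>B\<^esub> v) \<otimes>\<^bsub>B\<^esub> a"
        using linear_mapsD(2)[OF mult_linear_left[OF a], of "u \<oplus>\<^bsub>B\<^esub> \<ominus>\<^bsub>B\<^esub> v" v] assms by simp
      also have "\<dots> = v \<otimes>\<^bsub>B\<^esub> a" using assms a by (simp add: B.M.a_assoc B.M.l_neg)
      finally show "(u \<oplus>\<^bsub>B\<^esub> \<ominus>\<^bsub>B\<^esub> v) \<otimes>\<^bsub>B\<^esub> a = \<zero>\<^bsub>B\<^esub>"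
        using assms a mult_closed by simp
    qed
  qed (use assms in auto)
  then have "\<ominus>\<^bsub>B\<^esub> (\<ominus>\<^bsub>B\<^esub> v) = u" using assms(1,2) by (intro B.M.minus_equality) auto
  then show ?thesis using assms by simp
qed

locale base = K?: field K for K (structure)
begin

lemma functional_esum_param:
  assumes "l \<in> lists (P \<times> Q)" "\<And>x y. x \<in> P \<Longrightarrow> y \<in> Q \<Longrightarrow> (\<lambda>v. G v x y) \<in> functionals K V"
  shows "(\<lambda>v. esum K l (\<lambda>x y. G v x y)) \<in> functionals K V"
proof (rule functionalsI)
  show "esum K l (G v) \<in> carrier K" if "v \<in> carrier V" for v
    using esum_closed[OF assms(1)] functionalsD(1)[OF assms(2) that] by blast
  show "esum K l (G (u \<oplus>\<^bsub>V\<^esub> v)) = esum K l (G u) \<oplus> esum K l (G v)" if "u \<in> carrier V" "v \<in> carrier V" for u v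
    by (subst esum_add[OF assms(1), symmetric])
      (use functionalsD(1)[OF assms(2)] functionalsD(2)[OF assms(2)] that in \<open>auto intro!: esum_cong[OF assms(1)]\<close>)
  show "esum K l (G (c \<odot>\<^bsub>V\<^esub> v)) = c \<otimes> esum K l (G v)" if "c \<in> carrier K" "v \<in> carrier V" for c v
  proof -
    have "esum K l (G (c \<odot>\<^bsub>V\<^esub> v)) = esum K l (\<lambda>x y. c \<otimes> G v x y)"
      by (rule esum_cong[OF assms(1)]) (use functionalsD(3)[OF assms(2)] that in auto)
    also have "\<dots> = c \<otimes> esum K l (G v)"
      by (rule esum_additive[OF K.abelian_monoid_axioms assms(1), symmetric])
        (use functionalsD(1)[OF assms(2)] that in \<open>auto simp: r_distr\<close>)
    finally show ?thesis .
  qed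
qed

lemma functional_scale_left:
  "c \<in> carrier K \<Longrightarrow> f \<in> functionals K V \<Longrightarrow> (\<lambda>v. c \<otimes> f v) \<in> functionals K V"
  by (rule functionalsI) (simp_all add: functionalsD r_distr m_lcomm)

lemma functional_scale_right:
  "c \<in> carrier K \<Longrightarrow> f \<in> functionals K V \<Longrightarrow> (\<lambda>v. f v \<otimes> c) \<in> functionals K V"
  by (rule functionalsI) (simp_all add: functionalsD l_distr m_assoc)

lemma esum_scale:
  assumes "l \<in> lists (P \<times> Q)" "\<And>v w. v \<in> P \<Longrightarrow> w \<in> Q \<Longrightarrow> F v w \<in> carrier K" "c \<in> carrier K"
  shows "esum K l (\<lambda>v w. c \<otimes> F v w) = c \<otimes> esum K l F"
  by (rule esum_additive[OF K.abelian_monoid_axioms assms(1), symmetric]) (use assms in \<open>auto simp: r_distr\<close>)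

lemma esum_scale_right:
  assumes "l \<in> lists (P \<times> Q)" "\<And>v w. v \<in> P \<Longrightarrow> w \<in> Q \<Longrightarrow> F v w \<in> carrier K" "c \<in> carrier K"
  shows "esum K l (\<lambda>v w. F v w \<otimes> c) = esum K l F \<otimes> c"
  by (rule esum_additive[OF K.abelian_monoid_axioms assms(1), symmetric]) (use assms in \<open>auto simp: l_distr\<close>)

lemma formal_base: "z \<in> P \<Longrightarrow> i \<in> I \<Longrightarrow> formal K P I (\<lambda>D. D z i)"
  unfolding formal_def by (rule bexI[of _ "[(z, i)]"]) auto

lemma formal_esum:
  assumes l: "l \<in> lists (X \<times> Y)" and G: "\<And>x y. x \<in> X \<Longrightarrow> y \<in> Y \<Longrightarrow> formal K P I (\<lambda>D. G x y D)"
  shows "formal K P I (\<lambda>D. esum K l (\<lambda>x y. G x y D))"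
proof -
  have "\<forall>x y. \<exists>m. x \<in> X \<longrightarrow> y \<in> Y \<longrightarrow> m \<in> lists (P \<times> I) \<and>
    (\<forall>D. (\<forall>z\<in>P. \<forall>i\<in>I. D z i \<in> carrier K) \<longrightarrow> G x y D = esum K m D)"
    using G unfolding formal_def by blast
  then obtain m where m: "\<And>x y. x \<in> X \<Longrightarrow> y \<in> Y \<Longrightarrow> m x y \<in> lists (P \<times> I)"
    "\<And>x y D. x \<in> X \<Longrightarrow> y \<in> Y \<Longrightarrow> (\<forall>z\<in>P. \<forall>i\<in>I. D z i \<in> carrier K) \<Longrightarrow> G x y D = esum K (m x y) D"
    by metis
  show ?thesis
    unfolding formal_def
  proof (intro bexI allI impI)
    fix D assume D: "\<forall>z\<in>P. \<forall>i\<in>I. D z i \<in> carrier K"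
    have "esum K l (\<lambda>x y. G x y D) = esum K l (\<lambda>x y. esum K (m x y) D)"
      by (rule esum_cong[OF l]) (use m(2) D in blast)
    also have "\<dots> = esum K (concat (map (\<lambda>(x, y). m x y) l)) D"
      by (rule esum_concat(1)[OF l m(1), symmetric]) (use D in auto)
    finally show "esum K l (\<lambda>x y. G x y D) = esum K (concat (map (\<lambda>(x, y). m x y) l)) D" .
  next
    show "concat (map (\<lambda>(x, y). m x y) l) \<in> lists (P \<times> I)"
      by (rule esum_concat(2)[OF l m(1), where F = "\<lambda>_ _. \<zero>"]) auto
  qed
qed

text \<open>
  Only finitely many elements of \<open>Z\<close> occur in the two formal sums. On them the identity is
  \<open>z \<mapsto> \<Sum> f\<^sub>j(z) e\<^sub>j\<close> for a finite dual system, so a function that is linear in \<open>z\<close> may be replaced by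
  a combination of functions \<open>f\<^sub>j(z) D(e\<^sub>j, i)\<close>, in which the variables are separated.
\<close>

lemma formal_expand:
  assumes Z: "module K Z" and FG: "formal K (carrier Z) I F" "formal K (carrier Z) I G"
  shows "\<exists>m\<in>lists (functionals K Z \<times> carrier Z). \<forall>D. (\<forall>i\<in>I. (\<lambda>z. D z i) \<in> functionals K Z) \<longrightarrow>
    F D = esum K m (\<lambda>f e. F (\<lambda>z i. f z \<otimes> D e i)) \<and> G D = esum K m (\<lambda>f e. G (\<lambda>z i. f z \<otimes> D e i))"
proof -
  interpret Z: vec K Z using Z by (simp add: vec_def K.field_axioms)
  obtain l l' where l: "l \<in> lists (carrier Z \<times> I)" "l' \<in> lists (carrier Z \<times> I)"
    "\<And>D. (\<forall>z\<in>carrier Z. \<forall>i\<in>I. D z i \<in> carrier K) \<Longrightarrow> F D = esum K l D"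
    "\<And>D. (\<forall>z\<in>carrier Z. \<forall>i\<in>I. D z i \<in> carrier K) \<Longrightarrow> G D = esum K l' D"
    using FG unfolding formal_def by blast
  let ?S = "fst ` (set l \<union> set l')"
  have "finite ?S" "?S \<subseteq> carrier Z" using l(1,2) by auto
  then obtain m where m: "m \<in> lists (functionals K Z \<times> carrier Z)"
    and mS: "\<And>z. z \<in> ?S \<Longrightarrow> z = esum Z m (\<lambda>f e. f z \<odot>\<^bsub>Z\<^esub> e)"
    using Z.finite_dual_system by metis
  have key: "esum K n D = esum K m (\<lambda>f e. esum K n (\<lambda>z i. f z \<otimes> D e i))"
    if n: "n \<in> lists (carrier Z \<times> I)" "fst ` set n \<subseteq> ?S" and D: "\<forall>i\<in>I. (\<lambda>z. D z i) \<in> functionals K Z" for n D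
  proof -
    have "fst p \<in> ?S" if "p \<in> set n" for p using n(2) that by blast
    then have n': "n \<in> lists ((?S \<inter> carrier Z) \<times> I)"
      using n(1) by (simp add: in_lists_conv_set mem_Times_iff)
    have "esum K n D = esum K n (\<lambda>z i. esum K m (\<lambda>f e. f z \<otimes> D e i))"
    proof (rule esum_cong[OF n'])
      fix z i assume zi: "z \<in> ?S \<inter> carrier Z" "i \<in> I"
      have Di: "(\<lambda>z. D z i) \<in> functionals K Z" using D zi by blast
      have "D z i = D (esum Z m (\<lambda>f e. f z \<odot>\<^bsub>Z\<^esub> e)) i"
        using zi(1) by (intro arg_cong[OF mS, where f = "\<lambda>z. D z i"]) blast
      also have "\<dots> = esum K m (\<lambda>f e. D (f z \<odot>\<^bsub>Z\<^esub> e) i)"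
        by (rule Z.functional_esum[OF Di m]) (use zi in \<open>auto intro!: Z.smult_closed intro: functionalsD(1)\<close>)
      also have "\<dots> = esum K m (\<lambda>f e. f z \<otimes> D e i)"
        by (rule esum_cong[OF m], rule functionalsD(3)[OF Di]) (use zi in \<open>auto intro: functionalsD(1)\<close>)
      finally show "D z i = esum K m (\<lambda>f e. f z \<otimes> D e i)" .
    qed
    also have "\<dots> = esum K m (\<lambda>f e. esum K n (\<lambda>z i. f z \<otimes> D e i))"
    proof (rule esum_swap[OF n(1) m])
      fix v w v' w' assume "v \<in> carrier Z" "w \<in> I" "v' \<in> functionals K Z" "w' \<in> carrier Z"
      then show "v' v \<otimes> D w' w \<in> carrier K"
        by (intro m_closed functionalsD(1)[of v' K Z] functionalsD(1)[of "\<lambda>z. D z w" K Z])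
          (use D in auto)
    qed
    finally show ?thesis .
  qed
  show ?thesis
  proof (intro bexI[OF _ m] allI impI)
    fix D assume D: "\<forall>i\<in>I. (\<lambda>z. D z i) \<in> functionals K Z"
    have c: "\<forall>z\<in>carrier Z. \<forall>i\<in>I. D z i \<in> carrier K"
      using functionalsD(1)[OF D[rule_format]] by blast
    then have c': "\<forall>z\<in>carrier Z. \<forall>i\<in>I. f z \<otimes> D e i \<in> carrier K" if "f \<in> functionals K Z" "e \<in> carrier Z" for f e
      using that functionalsD(1)[OF that(1)] c by auto
    have "F D = esum K m (\<lambda>f e. F (\<lambda>z i. f z \<otimes> D e i))"
      unfolding l(3)[OF c] by (subst key[OF l(1) _ D]) (auto intro!: esum_cong[OF m] simp: l(3)[OF c'])
    moreover have "G D = esum K m (\<lambda>f e. G (\<lambda>z i. f z \<otimes> D e i))"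
      unfolding l(4)[OF c] by (subst key[OF l(2) _ D]) (auto intro!: esum_cong[OF m] simp: l(4)[OF c'])
    ultimately show "F D = esum K m (\<lambda>f e. F (\<lambda>z i. f z \<otimes> D e i)) \<and> G D = esum K m (\<lambda>f e. G (\<lambda>z i. f z \<otimes> D e i))" ..
  qed
qed

text \<open>
  The functionals \<open>f \<otimes> g\<close> separate \<open>V \<otimes> W\<close>.
\<close>

lemma formal_eq_by_products:
  assumes V: "module K V" and F: "formal K (carrier V) (carrier W) F" "formal K (carrier V) (carrier W) G"
    and eq: "\<And>f g. f \<in> functionals K V \<Longrightarrow> g \<in> functionals K W \<Longrightarrow> F (\<lambda>v w. f v \<otimes> g w) = G (\<lambda>v w. f v \<otimes> g w)"
    and B: "B \<in> bilinear_forms K V W"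
  shows "F B = G B"
proof -
  obtain m where m: "m \<in> lists (functionals K V \<times> carrier V)"
    and mD: "\<And>D. (\<forall>i\<in>carrier W. (\<lambda>z. D z i) \<in> functionals K V) \<Longrightarrow>
    F D = esum K m (\<lambda>f e. F (\<lambda>z i. f z \<otimes> D e i)) \<and> G D = esum K m (\<lambda>f e. G (\<lambda>z i. f z \<otimes> D e i))"
    using formal_expand[OF V F] by blast
  have "\<forall>i\<in>carrier W. (\<lambda>z. B z i) \<in> functionals K V" using bilinear_formsD(2)[OF B] by blast
  note this = mD[OF this]
  moreover have "esum K m (\<lambda>f e. F (\<lambda>z i. f z \<otimes> B e i)) = esum K m (\<lambda>f e. G (\<lambda>z i. f z \<otimes> B e i))"
    by (rule esum_cong[OF m]) (use eq bilinear_formsD(1)[OF B] in blast)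
  ultimately show ?thesis by simp
qed

text \<open>
  Cancellation of a multiplication in one leg: expanding that leg by a dual system reduces the claim
  to elements of \<open>Z\<close>.
\<close>

lemma formal_cancel:
  assumes Z: "module K Z" and FG: "formal K (carrier Z) I F" "formal K (carrier Z) I G"
    and lin: "\<And>D i. D \<in> \<D> \<Longrightarrow> i \<in> I \<Longrightarrow> (\<lambda>z. D z i) \<in> functionals K Z"
    and cls: "\<And>D f e. D \<in> \<D> \<Longrightarrow> f \<in> functionals K Z \<Longrightarrow> e \<in> carrier Z \<Longrightarrow> (\<lambda>z i. f z \<otimes> D e i) \<in> \<D>"
    and \<rho>: "\<And>d. d \<in> J \<Longrightarrow> \<rho> d \<in> linear_maps K Z Z"
    and faithful: "\<And>z z'. z \<in> carrier Z \<Longrightarrow> z' \<in> carrier Z \<Longrightarrow> (\<And>d. d \<in> J \<Longrightarrow> \<rho> d z = \<rho> d z') \<Longrightarrow> z = z'"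
    and eq: "\<And>d D. d \<in> J \<Longrightarrow> D \<in> \<D> \<Longrightarrow> F (\<lambda>z i. D (\<rho> d z) i) = G (\<lambda>z i. D (\<rho> d z) i)"
    and D: "D \<in> \<D>"
  shows "F D = G D"
proof -
  interpret Z: vec K Z using Z by (simp add: vec_def K.field_axioms)
  obtain m where m: "m \<in> lists (functionals K Z \<times> carrier Z)"
    and mD: "\<And>D. (\<forall>i\<in>I. (\<lambda>z. D z i) \<in> functionals K Z) \<Longrightarrow>
    F D = esum K m (\<lambda>f e. F (\<lambda>z i. f z \<otimes> D e i)) \<and> G D = esum K m (\<lambda>f e. G (\<lambda>z i. f z \<otimes> D e i))"
    using formal_expand[OF Z FG] by blast
  obtain l l' where l: "l \<in> lists (carrier Z \<times> I)" "l' \<in> lists (carrier Z \<times> I)"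
    and FGl: "\<And>D. (\<forall>z\<in>carrier Z. \<forall>i\<in>I. D z i \<in> carrier K) \<Longrightarrow> F D = esum K l D"
    "\<And>D. (\<forall>z\<in>carrier Z. \<forall>i\<in>I. D z i \<in> carrier K) \<Longrightarrow> G D = esum K l' D"
    using FG unfolding formal_def by blast
  have Dc: "D z i \<in> carrier K" if "z \<in> carrier Z" "i \<in> I" for z i
    using functionalsD(1)[OF lin[OF D that(2)] that(1)] .
  have "esum K m (\<lambda>f e. F (\<lambda>z i. f z \<otimes> D e i)) = esum K m (\<lambda>f e. G (\<lambda>z i. f z \<otimes> D e i))"
  proof (rule esum_cong[OF m])
    fix f e assume fe: "f \<in> functionals K Z" "e \<in> carrier Z"
    have wt: "h (esum Z n (\<lambda>z i. D e i \<odot>\<^bsub>Z\<^esub> z)) = esum K n (\<lambda>z i. h z \<otimes> D e i)"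
      if h: "h \<in> functionals K Z" and n: "n \<in> lists (carrier Z \<times> I)" for h n
    proof -
      have "h (esum Z n (\<lambda>z i. D e i \<odot>\<^bsub>Z\<^esub> z)) = esum K n (\<lambda>z i. h (D e i \<odot>\<^bsub>Z\<^esub> z))"
        by (rule Z.functional_esum[OF h n]) (use fe Dc in auto)
      also have "\<dots> = esum K n (\<lambda>z i. h z \<otimes> D e i)"
        by (rule esum_cong[OF n]) (use fe Dc h functionalsD[OF h] in \<open>auto simp: m_comm\<close>)
      finally show ?thesis .
    qed
    let ?z = "esum Z l (\<lambda>z i. D e i \<odot>\<^bsub>Z\<^esub> z)" and ?z' = "esum Z l' (\<lambda>z i. D e i \<odot>\<^bsub>Z\<^esub> z)"
    have zc: "?z \<in> carrier Z" "?z' \<in> carrier Z"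
      by (auto intro!: Z.M.esum_closed[OF l(1)] Z.M.esum_closed[OF l(2)] simp: Dc fe)
    have "?z = ?z'"
    proof (rule faithful[OF zc])
      fix d assume d: "d \<in> J"
      show "\<rho> d ?z = \<rho> d ?z'"
      proof (rule Z.functional_ext)
        fix h assume h: "h \<in> functionals K Z"
        note hd = functional_comp[OF h \<rho>[OF d]]
        have c: "\<forall>z\<in>carrier Z. \<forall>i\<in>I. h (\<rho> d z) \<otimes> D e i \<in> carrier K"
          using functionalsD(1)[OF hd] Dc fe by simp
        show "h (\<rho> d ?z) = h (\<rho> d ?z')"
          unfolding wt[OF hd l(1)] wt[OF hd l(2)] FGl[OF c, symmetric]
          by (rule eq[OF d cls[OF D h fe(2)]])
      qed (rule linear_mapsD(1)[OF \<rho>[OF d] zc(1)] linear_mapsD(1)[OF \<rho>[OF d] zc(2)])+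
    qed
    moreover have c: "\<forall>z\<in>carrier Z. \<forall>i\<in>I. f z \<otimes> D e i \<in> carrier K"
      using functionalsD(1)[OF fe(1)] Dc fe by simp
    ultimately show "F (\<lambda>z i. f z \<otimes> D e i) = G (\<lambda>z i. f z \<otimes> D e i)"
      unfolding FGl[OF c] wt[OF fe(1) l(1), symmetric] wt[OF fe(1) l(2), symmetric] by simp
  qed
  then show ?thesis using mD[of D] lin[OF D] by simp
qed

text \<open>
  For a tensor with three legs, \<open>I\<close> is the set of pairs made of the two other legs. These rules are how
  identities between multipliers are proved: after multiplication of one leg by an arbitrary element
  everything lies in a genuine tensor product.
\<close>

lemma cancel_leg1:
  assumes Z: "module K U" and FG: "formal K (carrier U) (carrier V \<times> carrier W) (\<lambda>D. F (\<lambda>p q s. D p (q, s)))"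
    "formal K (carrier U) (carrier V \<times> carrier W) (\<lambda>D. G (\<lambda>p q s. D p (q, s)))"
    and \<rho>: "\<And>d. d \<in> J \<Longrightarrow> \<rho> d \<in> linear_maps K U U"
    and faithful: "\<And>z z'. z \<in> carrier U \<Longrightarrow> z' \<in> carrier U \<Longrightarrow> (\<And>d. d \<in> J \<Longrightarrow> \<rho> d z = \<rho> d z') \<Longrightarrow> z = z'"
    and eq: "\<And>d C. d \<in> J \<Longrightarrow> C \<in> trilinear_forms K U V W \<Longrightarrow> F (\<lambda>p q s. C (\<rho> d p) q s) = G (\<lambda>p q s. C (\<rho> d p) q s)"
    and C: "C \<in> trilinear_forms K U V W"
  shows "F C = G C"
proof -
  let ?D = "{D. (\<lambda>p q s. D p (q, s)) \<in> trilinear_forms K U V W}"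
  have "F (\<lambda>p q s. (\<lambda>p i. C p (fst i) (snd i)) p (q, s)) = G (\<lambda>p q s. (\<lambda>p i. C p (fst i) (snd i)) p (q, s))"
  proof (rule formal_cancel[OF Z FG, where \<D> = ?D and J = J and \<rho> = \<rho>, OF _ _ \<rho> faithful])
    show "(\<lambda>z i. f z \<otimes> D e i) \<in> ?D" if "D \<in> ?D" "f \<in> functionals K U" "e \<in> carrier U" for D f e
      using that functionalsD(1)[OF that(2)] trilinear_formsD[of "\<lambda>p q s. D p (q, s)" K U V W]
      by (auto intro!: trilinear_formsI functional_scale_left functional_scale_right)
  qed (use trilinear_formsD C eq in auto)
  then show ?thesis by simp
qed

lemma cancel_leg2:
  assumes Z: "module K V" and FG: "formal K (carrier V) (carrier U \<times> carrier W) (\<lambda>D. F (\<lambda>p q s. D q (p, s)))"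
    "formal K (carrier V) (carrier U \<times> carrier W) (\<lambda>D. G (\<lambda>p q s. D q (p, s)))"
    and \<rho>: "\<And>d. d \<in> J \<Longrightarrow> \<rho> d \<in> linear_maps K V V"
    and faithful: "\<And>z z'. z \<in> carrier V \<Longrightarrow> z' \<in> carrier V \<Longrightarrow> (\<And>d. d \<in> J \<Longrightarrow> \<rho> d z = \<rho> d z') \<Longrightarrow> z = z'"
    and eq: "\<And>d C. d \<in> J \<Longrightarrow> C \<in> trilinear_forms K U V W \<Longrightarrow> F (\<lambda>p q s. C p (\<rho> d q) s) = G (\<lambda>p q s. C p (\<rho> d q) s)"
    and C: "C \<in> trilinear_forms K U V W"
  shows "F C = G C"
proof -
  let ?D = "{D. (\<lambda>p q s. D q (p, s)) \<in> trilinear_forms K U V W}"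
  have "F (\<lambda>p q s. (\<lambda>q i. C (fst i) q (snd i)) q (p, s)) = G (\<lambda>p q s. (\<lambda>q i. C (fst i) q (snd i)) q (p, s))"
  proof (rule formal_cancel[OF Z FG, where \<D> = ?D and J = J and \<rho> = \<rho>, OF _ _ \<rho> faithful])
    show "(\<lambda>z i. f z \<otimes> D e i) \<in> ?D" if "D \<in> ?D" "f \<in> functionals K V" "e \<in> carrier V" for D f e
      using that functionalsD(1)[OF that(2)] trilinear_formsD[of "\<lambda>p q s. D q (p, s)" K U V W]
      by (auto intro!: trilinear_formsI functional_scale_left functional_scale_right)
  qed (use trilinear_formsD C eq in auto)
  then show ?thesis by simp
qed

lemma cancel_leg3:
  assumes Z: "module K W" and FG: "formal K (carrier W) (carrier U \<times> carrier V) (\<lambda>D. F (\<lambda>p q s. D s (p, q)))"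
    "formal K (carrier W) (carrier U \<times> carrier V) (\<lambda>D. G (\<lambda>p q s. D s (p, q)))"
    and \<rho>: "\<And>d. d \<in> J \<Longrightarrow> \<rho> d \<in> linear_maps K W W"
    and faithful: "\<And>z z'. z \<in> carrier W \<Longrightarrow> z' \<in> carrier W \<Longrightarrow> (\<And>d. d \<in> J \<Longrightarrow> \<rho> d z = \<rho> d z') \<Longrightarrow> z = z'"
    and eq: "\<And>d C. d \<in> J \<Longrightarrow> C \<in> trilinear_forms K U V W \<Longrightarrow> F (\<lambda>p q s. C p q (\<rho> d s)) = G (\<lambda>p q s. C p q (\<rho> d s))"
    and C: "C \<in> trilinear_forms K U V W"
  shows "F C = G C"
proof -
  let ?D = "{D. (\<lambda>p q s. D s (p, q)) \<in> trilinear_forms K U V W}"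
  have "F (\<lambda>p q s. (\<lambda>s i. C (fst i) (snd i) s) s (p, q)) = G (\<lambda>p q s. (\<lambda>s i. C (fst i) (snd i) s) s (p, q))"
  proof (rule formal_cancel[OF Z FG, where \<D> = ?D and J = J and \<rho> = \<rho>, OF _ _ \<rho> faithful])
    show "(\<lambda>z i. f z \<otimes> D e i) \<in> ?D" if "D \<in> ?D" "f \<in> functionals K W" "e \<in> carrier W" for D f e
      using that functionalsD(1)[OF that(2)] trilinear_formsD[of "\<lambda>p q s. D s (p, q)" K U V W]
      by (auto intro!: trilinear_formsI functional_scale_left functional_scale_right)
  qed (use trilinear_formsD C eq in auto)
  then show ?thesis by simp
qed

lemma cancel_left:
  assumes Z: "module K V" and FG: "formal K (carrier V) (carrier W) F" "formal K (carrier V) (carrier W) G"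
    and \<rho>: "\<And>d. d \<in> J \<Longrightarrow> \<rho> d \<in> linear_maps K V V"
    and faithful: "\<And>z z'. z \<in> carrier V \<Longrightarrow> z' \<in> carrier V \<Longrightarrow> (\<And>d. d \<in> J \<Longrightarrow> \<rho> d z = \<rho> d z') \<Longrightarrow> z = z'"
    and eq: "\<And>d C. d \<in> J \<Longrightarrow> C \<in> bilinear_forms K V W \<Longrightarrow> F (\<lambda>p q. C (\<rho> d p) q) = G (\<lambda>p q. C (\<rho> d p) q)"
    and C: "C \<in> bilinear_forms K V W"
  shows "F C = G C"
proof (rule formal_cancel[OF Z FG, where \<D> = "bilinear_forms K V W" and J = J and \<rho> = \<rho>, OF _ _ \<rho> faithful])
  show "(\<lambda>z i. f z \<otimes> D e i) \<in> bilinear_forms K V W"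
    if "D \<in> bilinear_forms K V W" "f \<in> functionals K V" "e \<in> carrier V" for D f e
    using that functionalsD(1)[OF that(2)] bilinear_formsD[OF that(1)]
    by (auto intro!: bilinear_formsI functional_scale_left functional_scale_right)
qed (use bilinear_formsD C eq in auto)

lemma cancel_right:
  assumes Z: "module K W" and FG: "formal K (carrier W) (carrier V) (\<lambda>D. F (\<lambda>p q. D q p))"
     "formal K (carrier W) (carrier V) (\<lambda>D. G (\<lambda>p q. D q p))"
    and \<rho>: "\<And>d. d \<in> J \<Longrightarrow> \<rho> d \<in> linear_maps K W W"
    and faithful: "\<And>z z'. z \<in> carrier W \<Longrightarrow> z' \<in> carrier W \<Longrightarrow> (\<And>d. d \<in> J \<Longrightarrow> \<rho> d z = \<rho> d z') \<Longrightarrow> z = z'"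
    and eq: "\<And>d C. d \<in> J \<Longrightarrow> C \<in> bilinear_forms K V W \<Longrightarrow> F (\<lambda>p q. C p (\<rho> d q)) = G (\<lambda>p q. C p (\<rho> d q))"
    and C: "C \<in> bilinear_forms K V W"
  shows "F C = G C"
proof -
  let ?D = "{D. (\<lambda>p q. D q p) \<in> bilinear_forms K V W}"
  have "F (\<lambda>p q. (\<lambda>q p. C p q) q p) = G (\<lambda>p q. (\<lambda>q p. C p q) q p)"
  proof (rule formal_cancel[OF Z FG, where \<D> = ?D and J = J and \<rho> = \<rho>, OF _ _ \<rho> faithful])
    show "(\<lambda>z i. f z \<otimes> D e i) \<in> ?D" if "D \<in> ?D" "f \<in> functionals K W" "e \<in> carrier W" for D f e
      using that functionalsD(1)[OF that(2)] bilinear_formsD[of "\<lambda>p q. D q p" K V W]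
      by (auto intro!: bilinear_formsI functional_scale_left functional_scale_right)
  qed (use bilinear_formsD[of "\<lambda>p q. D q p" K V W for D] C eq in auto)
  then show ?thesis by simp
qed

end

context nd_algebra
begin

lemma cancel_leg3_right:
  assumes "formal K (carrier B) (carrier U \<times> carrier V) (\<lambda>D. F (\<lambda>p q s. D s (p, q)))"
    "formal K (carrier B) (carrier U \<times> carrier V) (\<lambda>D. G (\<lambda>p q s. D s (p, q)))"
    and "\<And>d C. d \<in> carrier B \<Longrightarrow> C \<in> trilinear_forms K U V B \<Longrightarrow>
      F (\<lambda>p q s. C p q (s \<otimes>\<^bsub>B\<^esub> d)) = G (\<lambda>p q s. C p q (s \<otimes>\<^bsub>B\<^esub> d))"
    and "C \<in> trilinear_forms K U V B"
  shows "F C = G C"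
  by (rule base.cancel_leg3[OF base.intro[OF K.field_axioms] B.module_axioms assms(1,2),
        where J = "carrier B" and \<rho> = "\<lambda>d s. s \<otimes>\<^bsub>B\<^esub> d"])
    (use assms(3,4) mult_linear_left in \<open>auto intro: eq_by_right_mult\<close>)

lemma cancel_leg2_left:
  assumes "formal K (carrier B) (carrier U \<times> carrier W) (\<lambda>D. F (\<lambda>p q s. D q (p, s)))"
    "formal K (carrier B) (carrier U \<times> carrier W) (\<lambda>D. G (\<lambda>p q s. D q (p, s)))"
    and "\<And>d C. d \<in> carrier B \<Longrightarrow> C \<in> trilinear_forms K U B W \<Longrightarrow>
      F (\<lambda>p q s. C p (d \<otimes>\<^bsub>B\<^esub> q) s) = G (\<lambda>p q s. C p (d \<otimes>\<^bsub>B\<^esub> q) s)"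
    and "C \<in> trilinear_forms K U B W"
  shows "F C = G C"
  by (rule base.cancel_leg2[OF base.intro[OF K.field_axioms] B.module_axioms assms(1,2),
        where J = "carrier B" and \<rho> = "\<lambda>d s. d \<otimes>\<^bsub>B\<^esub> s"])
    (use assms(3,4) mult_linear_right in \<open>auto intro: eq_by_left_mult\<close>)

lemma cancel_leg1_left:
  assumes "formal K (carrier B) (carrier V \<times> carrier W) (\<lambda>D. F (\<lambda>p q s. D p (q, s)))"
    "formal K (carrier B) (carrier V \<times> carrier W) (\<lambda>D. G (\<lambda>p q s. D p (q, s)))"
    and "\<And>d C. d \<in> carrier B \<Longrightarrow> C \<in> trilinear_forms K B V W \<Longrightarrow>
      F (\<lambda>p q s. C (d \<otimes>\<^bsub>B\<^esub> p) q s) = G (\<lambda>p q s. C (d \<otimes>\<^bsub>B\<^esub> p) q s)"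
    and "C \<in> trilinear_forms K B V W"
  shows "F C = G C"
  by (rule base.cancel_leg1[OF base.intro[OF K.field_axioms] B.module_axioms assms(1,2),
        where J = "carrier B" and \<rho> = "\<lambda>d s. d \<otimes>\<^bsub>B\<^esub> s"])
    (use assms(3,4) mult_linear_right in \<open>auto intro: eq_by_left_mult\<close>)

lemma cancel_left_left:
  assumes "formal K (carrier B) (carrier W) F" "formal K (carrier B) (carrier W) G"
    and "\<And>d C. d \<in> carrier B \<Longrightarrow> C \<in> bilinear_forms K B W \<Longrightarrow>
      F (\<lambda>p q. C (d \<otimes>\<^bsub>B\<^esub> p) q) = G (\<lambda>p q. C (d \<otimes>\<^bsub>B\<^esub> p) q)"
    and "C \<in> bilinear_forms K B W"
  shows "F C = G C"
  by (rule base.cancel_left[OF base.intro[OF K.field_axioms] B.module_axioms assms(1,2),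
        where J = "carrier B" and \<rho> = "\<lambda>d s. d \<otimes>\<^bsub>B\<^esub> s"])
    (use assms(3,4) mult_linear_right in \<open>auto intro: eq_by_left_mult\<close>)

lemma cancel_right_right:
  assumes "formal K (carrier B) (carrier W) (\<lambda>D. F (\<lambda>p q. D q p))" "formal K (carrier B) (carrier W) (\<lambda>D. G (\<lambda>p q. D q p))"
    and "\<And>d C. d \<in> carrier B \<Longrightarrow> C \<in> bilinear_forms K W B \<Longrightarrow>
      F (\<lambda>p q. C p (q \<otimes>\<^bsub>B\<^esub> d)) = G (\<lambda>p q. C p (q \<otimes>\<^bsub>B\<^esub> d))"
    and "C \<in> bilinear_forms K W B"
  shows "F C = G C"
  by (rule base.cancel_right[OF base.intro[OF K.field_axioms] B.module_axioms assms(1,2),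
        where J = "carrier B" and \<rho> = "\<lambda>d s. s \<otimes>\<^bsub>B\<^esub> d"])
    (use assms(3,4) mult_linear_left in \<open>auto intro: eq_by_right_mult\<close>)

end

section \<open>Covered comultiplications\<close>

definition inverse_lists ::
  "('k, 'm) ring_scheme \<Rightarrow> ('k, 'v, 'p) module_scheme \<Rightarrow> ('k, 'w, 'q) module_scheme \<Rightarrow>
    ('k, 'x, 'r) module_scheme \<Rightarrow> ('k, 'y, 's) module_scheme \<Rightarrow>
    ('v \<Rightarrow> 'w \<Rightarrow> ('x \<times> 'y) list) \<Rightarrow> ('x \<Rightarrow> 'y \<Rightarrow> ('v \<times> 'w) list) \<Rightarrow> bool"
  where "inverse_lists K V W X Y T T' \<longleftrightarrow>
    T \<in> bilinear_lists K V W X Y \<and> T' \<in> bilinear_lists K X Y V W \<and>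
    (\<forall>B\<in>bilinear_forms K X Y. \<forall>x\<in>carrier X. \<forall>y\<in>carrier Y.
      esum K (T' x y) (\<lambda>v w. esum K (T v w) B) = B x y) \<and>
    (\<forall>B\<in>bilinear_forms K V W. \<forall>v\<in>carrier V. \<forall>w\<in>carrier W.
      esum K (T v w) (\<lambda>x y. esum K (T' x y) B) = B v w)"

lemma inverse_listsD:
  assumes "inverse_lists K V W X Y T T'"
  shows "T \<in> bilinear_lists K V W X Y" "T' \<in> bilinear_lists K X Y V W"
    "B \<in> bilinear_forms K X Y \<Longrightarrow> x \<in> carrier X \<Longrightarrow> y \<in> carrier Y \<Longrightarrow>
      esum K (T' x y) (\<lambda>v w. esum K (T v w) B) = B x y"
    "B' \<in> bilinear_forms K V W \<Longrightarrow> v \<in> carrier V \<Longrightarrow> w \<in> carrier W \<Longrightarrow>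
      esum K (T v w) (\<lambda>x y. esum K (T' x y) B') = B' v w"
  using assms by (auto simp: inverse_lists_def)

text \<open>
  The four canonical maps of a regular multiplier Hopf algebra, as maps between lists:
  \<open>T1 a c\<close> is \<open>\<Delta>(a) (1 \<otimes> c)\<close>, \<open>T2 c a\<close> is \<open>(c \<otimes> 1) \<Delta>(a)\<close>, \<open>T3 a c\<close> is \<open>\<Delta>(a) (c \<otimes> 1)\<close> and
  \<open>T4 a c\<close> is \<open>(1 \<otimes> c) \<Delta>(a)\<close>. The values of \<open>\<Delta>\<close> itself, which are multipliers, are not mentioned.
  The axioms whose names have two digits express the associativity of products such as
  \<open>(c \<otimes> 1) \<Delta>(a) (1 \<otimes> d)\<close>; the remaining ones say that \<open>\<Delta>\<close> is multiplicative and coassociative.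
  Coassociativity is covered on both sides: \<open>T_coassoc\<close> compares two ways of computing
  \<open>(b \<otimes> 1 \<otimes> 1) (\<Delta> \<otimes> \<iota>)(\<Delta>(a)) (1 \<otimes> 1 \<otimes> c)\<close>.
\<close>

locale hopf_lists = K?: base K + A?: nd_algebra K A for K :: "'k ring" (structure) and A :: "('k, 'a) module" +
  fixes T1 T2 T3 T4 T1' T2' T3' T4' :: "'a \<Rightarrow> 'a \<Rightarrow> ('a \<times> 'a) list"
  assumes T1: "inverse_lists K A A A A T1 T1'" and T2: "inverse_lists K A A A A T2 T2'"
    and T3: "inverse_lists K A A A A T3 T3'" and T4: "inverse_lists K A A A A T4 T4'"
    and T11: "\<lbrakk>B \<in> bilinear_forms K A A; a \<in> carrier A; c \<in> carrier A; d \<in> carrier A\<rbrakk> \<Longrightarrow>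
      esum K (T1 a (c \<otimes>\<^bsub>A\<^esub> d)) B = esum K (T1 a c) (\<lambda>u v. B u (v \<otimes>\<^bsub>A\<^esub> d))"
    and T22: "\<lbrakk>B \<in> bilinear_forms K A A; a \<in> carrier A; c \<in> carrier A; d \<in> carrier A\<rbrakk> \<Longrightarrow>
      esum K (T2 (d \<otimes>\<^bsub>A\<^esub> c) a) B = esum K (T2 c a) (\<lambda>u v. B (d \<otimes>\<^bsub>A\<^esub> u) v)"
    and T33: "\<lbrakk>B \<in> bilinear_forms K A A; a \<in> carrier A; c \<in> carrier A; d \<in> carrier A\<rbrakk> \<Longrightarrow>
      esum K (T3 a (c \<otimes>\<^bsub>A\<^esub> d)) B = esum K (T3 a c) (\<lambda>u v. B (u \<otimes>\<^bsub>A\<^esub> d) v)"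
    and T44: "\<lbrakk>B \<in> bilinear_forms K A A; a \<in> carrier A; c \<in> carrier A; d \<in> carrier A\<rbrakk> \<Longrightarrow>
      esum K (T4 a (d \<otimes>\<^bsub>A\<^esub> c)) B = esum K (T4 a c) (\<lambda>u v. B u (d \<otimes>\<^bsub>A\<^esub> v))"
    and T21: "\<lbrakk>B \<in> bilinear_forms K A A; a \<in> carrier A; c \<in> carrier A; d \<in> carrier A\<rbrakk> \<Longrightarrow>
      esum K (T2 c a) (\<lambda>u v. B u (v \<otimes>\<^bsub>A\<^esub> d)) = esum K (T1 a d) (\<lambda>u v. B (c \<otimes>\<^bsub>A\<^esub> u) v)"
    and T24: "\<lbrakk>B \<in> bilinear_forms K A A; a \<in> carrier A; c \<in> carrier A; d \<in> carrier A\<rbrakk> \<Longrightarrow>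
      esum K (T2 c a) (\<lambda>u v. B u (d \<otimes>\<^bsub>A\<^esub> v)) = esum K (T4 a d) (\<lambda>u v. B (c \<otimes>\<^bsub>A\<^esub> u) v)"
    and T31: "\<lbrakk>B \<in> bilinear_forms K A A; a \<in> carrier A; c \<in> carrier A; d \<in> carrier A\<rbrakk> \<Longrightarrow>
      esum K (T3 a c) (\<lambda>u v. B u (v \<otimes>\<^bsub>A\<^esub> d)) = esum K (T1 a d) (\<lambda>u v. B (u \<otimes>\<^bsub>A\<^esub> c) v)"
    and T34: "\<lbrakk>B \<in> bilinear_forms K A A; a \<in> carrier A; c \<in> carrier A; d \<in> carrier A\<rbrakk> \<Longrightarrow>
      esum K (T3 a c) (\<lambda>u v. B u (d \<otimes>\<^bsub>A\<^esub> v)) = esum K (T4 a d) (\<lambda>u v. B (u \<otimes>\<^bsub>A\<^esub> c) v)"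
    and T41: "\<lbrakk>B \<in> bilinear_forms K A A; a \<in> carrier A; c \<in> carrier A; d \<in> carrier A\<rbrakk> \<Longrightarrow>
      esum K (T4 a c) (\<lambda>u v. B u (v \<otimes>\<^bsub>A\<^esub> d)) = esum K (T1 a d) (\<lambda>u v. B u (c \<otimes>\<^bsub>A\<^esub> v))"
    and T23: "\<lbrakk>B \<in> bilinear_forms K A A; a \<in> carrier A; c \<in> carrier A; d \<in> carrier A\<rbrakk> \<Longrightarrow>
      esum K (T2 c a) (\<lambda>u v. B (u \<otimes>\<^bsub>A\<^esub> d) v) = esum K (T3 a d) (\<lambda>u v. B (c \<otimes>\<^bsub>A\<^esub> u) v)"
    and T1_hom: "\<lbrakk>B \<in> bilinear_forms K A A; a \<in> carrier A; b \<in> carrier A; c \<in> carrier A\<rbrakk> \<Longrightarrow>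
      esum K (T1 (a \<otimes>\<^bsub>A\<^esub> b) c) B = esum K (T1 b c) (\<lambda>u v. esum K (T1 a v) (\<lambda>p q. B (p \<otimes>\<^bsub>A\<^esub> u) q))"
    and T2_hom: "\<lbrakk>B \<in> bilinear_forms K A A; a \<in> carrier A; b \<in> carrier A; c \<in> carrier A\<rbrakk> \<Longrightarrow>
      esum K (T2 c (a \<otimes>\<^bsub>A\<^esub> b)) B = esum K (T2 c a) (\<lambda>u v. esum K (T2 u b) (\<lambda>p q. B p (v \<otimes>\<^bsub>A\<^esub> q)))"
    and T3_hom: "\<lbrakk>B \<in> bilinear_forms K A A; a \<in> carrier A; b \<in> carrier A; c \<in> carrier A\<rbrakk> \<Longrightarrow>
      esum K (T3 (a \<otimes>\<^bsub>A\<^esub> b) c) B = esum K (T3 b c) (\<lambda>u v. esum K (T1 a v) (\<lambda>p q. B (p \<otimes>\<^bsub>A\<^esub> u) q))"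
    and T4_hom: "\<lbrakk>B \<in> bilinear_forms K A A; a \<in> carrier A; b \<in> carrier A; c \<in> carrier A\<rbrakk> \<Longrightarrow>
      esum K (T4 (a \<otimes>\<^bsub>A\<^esub> b) c) B = esum K (T4 a c) (\<lambda>u v. esum K (T2 u b) (\<lambda>p q. B p (v \<otimes>\<^bsub>A\<^esub> q)))"
    and T_coassoc: "\<lbrakk>C \<in> trilinear_forms K A A A; a \<in> carrier A; b \<in> carrier A; c \<in> carrier A\<rbrakk> \<Longrightarrow>
      esum K (T1 a c) (\<lambda>u v. esum K (T2 b u) (\<lambda>p q. C p q v)) =
      esum K (T2 b a) (\<lambda>p u. esum K (T1 u c) (\<lambda>q v. C p q v))"

text \<open>
  The same for a coaction \<open>\<alpha>\<close>: \<open>V x y\<close> is \<open>(x \<otimes> 1) \<alpha>(y)\<close>, the Galois map, which is invertible;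
  \<open>W y c\<close> is \<open>\<alpha>(y) (1 \<otimes> c)\<close> and \<open>W4 y c\<close> is \<open>(1 \<otimes> c) \<alpha>(y)\<close>. The product \<open>\<alpha>(y) (x \<otimes> 1)\<close> is missing here
  on purpose: it is only obtained later, from the antipode of \<open>A\<close>.
\<close>

locale coaction_lists = hopf_lists K A T1 T2 T3 T4 T1' T2' T3' T4' + X?: nd_algebra K X
  for K :: "'k ring" (structure) and A :: "('k, 'a) module" and T1 T2 T3 T4 T1' T2' T3' T4'
    and X :: "('k, 'x) module" +
  fixes V :: "'x \<Rightarrow> 'x \<Rightarrow> ('x \<times> 'a) list" and V' :: "'x \<Rightarrow> 'a \<Rightarrow> ('x \<times> 'x) list"
    and W W4 :: "'x \<Rightarrow> 'a \<Rightarrow> ('x \<times> 'a) list"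
  assumes V: "inverse_lists K X X X A V V'"
    and W: "W \<in> bilinear_lists K X A X A" and W4: "W4 \<in> bilinear_lists K X A X A"
    and VV: "\<lbrakk>B \<in> bilinear_forms K X A; x \<in> carrier X; y \<in> carrier X; z \<in> carrier X\<rbrakk> \<Longrightarrow>
      esum K (V (z \<otimes>\<^bsub>X\<^esub> x) y) B = esum K (V x y) (\<lambda>u v. B (z \<otimes>\<^bsub>X\<^esub> u) v)"
    and WW: "\<lbrakk>B \<in> bilinear_forms K X A; x \<in> carrier X; c \<in> carrier A; d \<in> carrier A\<rbrakk> \<Longrightarrow>
      esum K (W x (c \<otimes>\<^bsub>A\<^esub> d)) B = esum K (W x c) (\<lambda>u v. B u (v \<otimes>\<^bsub>A\<^esub> d))"
    and VW: "\<lbrakk>B \<in> bilinear_forms K X A; x \<in> carrier X; y \<in> carrier X; d \<in> carrier A\<rbrakk> \<Longrightarrow>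
      esum K (V x y) (\<lambda>u v. B u (v \<otimes>\<^bsub>A\<^esub> d)) = esum K (W y d) (\<lambda>u v. B (x \<otimes>\<^bsub>X\<^esub> u) v)"
    and W4W: "\<lbrakk>B \<in> bilinear_forms K X A; x \<in> carrier X; c \<in> carrier A; d \<in> carrier A\<rbrakk> \<Longrightarrow>
      esum K (W4 x c) (\<lambda>u v. B u (v \<otimes>\<^bsub>A\<^esub> d)) = esum K (W x d) (\<lambda>u v. B u (c \<otimes>\<^bsub>A\<^esub> v))"
    and V_hom: "\<lbrakk>B \<in> bilinear_forms K X A; x \<in> carrier X; y \<in> carrier X; z \<in> carrier X\<rbrakk> \<Longrightarrow>
      esum K (V z (x \<otimes>\<^bsub>X\<^esub> y)) B = esum K (V z x) (\<lambda>u v. esum K (V u y) (\<lambda>p q. B p (v \<otimes>\<^bsub>A\<^esub> q)))"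
    and W_hom: "\<lbrakk>B \<in> bilinear_forms K X A; x \<in> carrier X; y \<in> carrier X; c \<in> carrier A\<rbrakk> \<Longrightarrow>
      esum K (W (x \<otimes>\<^bsub>X\<^esub> y) c) B = esum K (W y c) (\<lambda>u v. esum K (W x v) (\<lambda>p q. B (p \<otimes>\<^bsub>X\<^esub> u) q))"
    and W4_hom: "\<lbrakk>B \<in> bilinear_forms K X A; x \<in> carrier X; y \<in> carrier X; c \<in> carrier A\<rbrakk> \<Longrightarrow>
      esum K (W4 (x \<otimes>\<^bsub>X\<^esub> y) c) B = esum K (W4 x c) (\<lambda>u v. esum K (V u y) (\<lambda>p q. B p (v \<otimes>\<^bsub>A\<^esub> q)))"
    and V_coassoc: "\<lbrakk>C \<in> trilinear_forms K X A A; x \<in> carrier X; y \<in> carrier X; c \<in> carrier A\<rbrakk> \<Longrightarrow>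
      esum K (W y c) (\<lambda>u v. esum K (V x u) (\<lambda>p q. C p q v)) =
      esum K (V x y) (\<lambda>p u. esum K (T1 u c) (\<lambda>q v. C p q v))"

context base
begin

lemmas list_rules = lists_left lists_right functional_esum_param[OF bilinear_listsD(1)]
  esum_closed[OF bilinear_listsD(1)] formal_esum[OF bilinear_listsD(1)]

lemmas ml_base = bilinear_formsI trilinear_formsI functional_scale_left functional_scale_right
  K.m_closed K.one_closed linear_id formal_base SigmaI

end

context hopf_lists
begin

lemmas T_rules = list_rules[OF inverse_listsD(1)[OF T1]] list_rules[OF inverse_listsD(1)[OF T2]]
  list_rules[OF inverse_listsD(1)[OF T3]] list_rules[OF inverse_listsD(1)[OF T4]]
  list_rules[OF inverse_listsD(2)[OF T1]] list_rules[OF inverse_listsD(2)[OF T2]]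
  list_rules[OF inverse_listsD(2)[OF T3]] list_rules[OF inverse_listsD(2)[OF T4]]

lemmas ml_A = ml_base T_rules A.linear_mult_left A.linear_mult_right A.mult_closed

lemmas T1_inv = inverse_listsD(3)[OF T1] and T2_inv = inverse_listsD(3)[OF T2]
  and T3_inv = inverse_listsD(3)[OF T3] and T4_inv = inverse_listsD(3)[OF T4]
  and inv_T1 = inverse_listsD(4)[OF T1] and inv_T2 = inverse_listsD(4)[OF T2]
  and inv_T3 = inverse_listsD(4)[OF T3] and inv_T4 = inverse_listsD(4)[OF T4]

lemmas T1_cong = esum_cong[OF bilinear_listsD(1)[OF inverse_listsD(1)[OF T1]]]
  and T2_cong = esum_cong[OF bilinear_listsD(1)[OF inverse_listsD(1)[OF T2]]]
  and T3_cong = esum_cong[OF bilinear_listsD(1)[OF inverse_listsD(1)[OF T3]]]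
  and T4_cong = esum_cong[OF bilinear_listsD(1)[OF inverse_listsD(1)[OF T4]]]
  and T1'_cong = esum_cong[OF bilinear_listsD(1)[OF inverse_listsD(2)[OF T1]]]
  and T2'_cong = esum_cong[OF bilinear_listsD(1)[OF inverse_listsD(2)[OF T2]]]
  and T3'_cong = esum_cong[OF bilinear_listsD(1)[OF inverse_listsD(2)[OF T3]]]

lemmas T_in = bilinear_listsD(1)[OF inverse_listsD(1)[OF T1]] bilinear_listsD(1)[OF inverse_listsD(1)[OF T2]]
  bilinear_listsD(1)[OF inverse_listsD(1)[OF T3]] bilinear_listsD(1)[OF inverse_listsD(1)[OF T4]]
  bilinear_listsD(1)[OF inverse_listsD(2)[OF T1]] bilinear_listsD(1)[OF inverse_listsD(2)[OF T2]]
  bilinear_listsD(1)[OF inverse_listsD(2)[OF T3]] bilinear_listsD(1)[OF inverse_listsD(2)[OF T4]]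

end

context coaction_lists
begin

lemmas ml = ml_A list_rules[OF inverse_listsD(1)[OF V]] list_rules[OF inverse_listsD(2)[OF V]]
  list_rules[OF W] list_rules[OF W4] X.linear_mult_left X.linear_mult_right X.mult_closed

lemmas V_inv = inverse_listsD(3)[OF V] and inv_V = inverse_listsD(4)[OF V]

lemmas V_cong = esum_cong[OF bilinear_listsD(1)[OF inverse_listsD(1)[OF V]]]
  and V'_cong = esum_cong[OF bilinear_listsD(1)[OF inverse_listsD(2)[OF V]]]
  and W_cong = esum_cong[OF bilinear_listsD(1)[OF W]]
  and W4_cong = esum_cong[OF bilinear_listsD(1)[OF W4]]

lemmas V_in = bilinear_listsD(1)[OF inverse_listsD(1)[OF V]]
  and V'_in = bilinear_listsD(1)[OF inverse_listsD(2)[OF V]]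
  and W_in = bilinear_listsD(1)[OF W] and W4_in = bilinear_listsD(1)[OF W4]

text \<open>
  The variant of coassociativity with \<open>(1 \<otimes> 1 \<otimes> c)\<close> on the left follows from the one on the right
  because the two agree after a further multiplication of the third leg.
\<close>

lemma V_coassoc4:
  assumes C: "C \<in> trilinear_forms K X A A" and x: "x \<in> carrier X" "y \<in> carrier X" "c \<in> carrier A"
  shows "esum K (W4 y c) (\<lambda>u v. esum K (V x u) (\<lambda>p q. C p q v)) =
    esum K (V x y) (\<lambda>p u. esum K (T4 u c) (\<lambda>q v. C p q v))"
proof (rule A.cancel_leg3_right[OF _ _ _ C])
  fix d C assume d: "d \<in> carrier A" and C: "C \<in> trilinear_forms K X A A"
  note c = trilinear_comp[OF C]
  have "esum K (W4 y c) (\<lambda>u v. esum K (V x u) (\<lambda>p q. C p q (v \<otimes>\<^bsub>A\<^esub> d)))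
    = esum K (W y d) (\<lambda>u v. esum K (V x u) (\<lambda>p q. C p q (c \<otimes>\<^bsub>A\<^esub> v)))"
    by (rule W4W[where B = "\<lambda>u v. esum K (V x u) (\<lambda>p q. C p q v)"]; (intro ml c)?; simp add: x d)
  also have "\<dots> = esum K (V x y) (\<lambda>p u. esum K (T1 u d) (\<lambda>q v. C p q (c \<otimes>\<^bsub>A\<^esub> v)))"
    by (rule V_coassoc[where C = "\<lambda>p q v. C p q (c \<otimes>\<^bsub>A\<^esub> v)"]; (intro ml c)?; simp add: x d)
  also have "\<dots> = esum K (V x y) (\<lambda>p u. esum K (T4 u c) (\<lambda>q v. C p q (v \<otimes>\<^bsub>A\<^esub> d)))"
    by (intro V_cong x T41[symmetric] c d; assumption)
  finally show "esum K (W4 y c) (\<lambda>u v. esum K (V x u) (\<lambda>p q. C p q (v \<otimes>\<^bsub>A\<^esub> d))) =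
    esum K (V x y) (\<lambda>p u. esum K (T4 u c) (\<lambda>q v. C p q (v \<otimes>\<^bsub>A\<^esub> d)))" .
qed ((intro ml; simp add: x)+)

text \<open>
  \<open>(w \<otimes> 1 \<otimes> 1) (\<alpha> \<otimes> \<iota>)((x \<otimes> 1) \<alpha>(y))\<close> computed by multiplicativity of \<open>\<alpha>\<close> and by coassociativity.
\<close>

lemma coassoc_left:
  assumes C: "C \<in> trilinear_forms K X A A" and x: "w \<in> carrier X" "x \<in> carrier X" "y \<in> carrier X"
  shows "esum K (V x y) (\<lambda>u a. esum K (V w u) (\<lambda>p q. C p q a)) =
    esum K (V w x) (\<lambda>u v. esum K (V u y) (\<lambda>p q. esum K (T2 v q) (\<lambda>r s. C p r s)))"
proof (rule A.cancel_leg3_right[OF _ _ _ C])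
  fix d C assume d: "d \<in> carrier A" and C: "C \<in> trilinear_forms K X A A"
  note c = trilinear_comp[OF C]
  have "esum K (V x y) (\<lambda>u a. esum K (V w u) (\<lambda>p q. C p q (a \<otimes>\<^bsub>A\<^esub> d)))
    = esum K (W y d) (\<lambda>u a. esum K (V w (x \<otimes>\<^bsub>X\<^esub> u)) (\<lambda>p q. C p q a))"
    by (rule VW[where B = "\<lambda>u a. esum K (V w u) (\<lambda>p q. C p q a)"]; (intro ml c)?; simp add: x d)
  also have "\<dots> = esum K (W y d) (\<lambda>u a. esum K (V w x) (\<lambda>u' v. esum K (V u' u) (\<lambda>p q. C p (v \<otimes>\<^bsub>A\<^esub> q) a)))"
    by (intro W_cong x d V_hom[where B = "\<lambda>p q. C p q a" for a]; (intro ml c)?; simp)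
  also have "\<dots> = esum K (V w x) (\<lambda>u' v. esum K (W y d) (\<lambda>u a. esum K (V u' u) (\<lambda>p q. C p (v \<otimes>\<^bsub>A\<^esub> q) a)))"
    by (rule K.esum_swap[OF W_in V_in]; (intro ml c)?; simp add: x d)
  also have "\<dots> = esum K (V w x) (\<lambda>u' v. esum K (V u' y) (\<lambda>p q. esum K (T1 q d) (\<lambda>r a. C p (v \<otimes>\<^bsub>A\<^esub> r) a)))"
    by (intro V_cong x; rule V_coassoc[where C = "\<lambda>p q a. C p (v \<otimes>\<^bsub>A\<^esub> q) a" for v]; (intro ml c)?; simp add: x d)
  also have "\<dots> = esum K (V w x) (\<lambda>u v. esum K (V u y) (\<lambda>p q. esum K (T2 v q) (\<lambda>r s. C p r (s \<otimes>\<^bsub>A\<^esub> d))))"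
    by (intro V_cong x T21[symmetric] c d; assumption)
  finally show "esum K (V x y) (\<lambda>u a. esum K (V w u) (\<lambda>p q. C p q (a \<otimes>\<^bsub>A\<^esub> d))) =
    esum K (V w x) (\<lambda>u v. esum K (V u y) (\<lambda>p q. esum K (T2 v q) (\<lambda>r s. C p r (s \<otimes>\<^bsub>A\<^esub> d))))" .
qed ((intro ml; simp add: x)+)

end

section \<open>A left linear and colinear composite of canonical maps\<close>

context hopf_lists
begin

text \<open>
  \<open>A\<close> coacts on itself by \<open>\<Delta>\<close>, and \<open>T2\<close> is the Galois map of this coaction.
\<close>

lemma self_coaction: "coaction_lists K A T1 T2 T3 T4 T1' T2' T3' T4' A T2 T2' T1 T4"
  by unfold_locales
    (assumption | rule T2 inverse_listsD(1)[OF T1] inverse_listsD(1)[OF T4] T22 T11 T21 T41 T2_hom T1_hom T4_hom T_coassoc)+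

lemmas T2_coassoc_left = coaction_lists.coassoc_left[OF self_coaction]

text \<open>
  This lemma and the next three say how \<open>T1\<inverse>\<close>, \<open>T2\<inverse>\<close> and \<open>T3\<close> interact with left multiplication of the
  first leg and with the application of \<open>\<Delta>\<close> to it. They are assembled below into the linearity and
  colinearity of the composite \<open>T1\<inverse> T3 T2\<inverse>\<close>.
\<close>

lemma T3_coassoc:
  assumes C: "C \<in> trilinear_forms K A A A" and x: "w \<in> carrier A" "x \<in> carrier A" "z \<in> carrier A"
  shows "esum K (T3 x z) (\<lambda>r s. esum K (T2 w r) (\<lambda>p q. C p q s)) =
    esum K (T2 w x) (\<lambda>u v. esum K (T2 u z) (\<lambda>p q. esum K (T3 v q) (\<lambda>r s. C p r s)))"
proof (rule A.cancel_leg3_right[OF _ _ _ C])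
  fix d C assume d: "d \<in> carrier A" and C: "C \<in> trilinear_forms K A A A"
  note c = trilinear_comp[OF C]
  have "esum K (T3 x z) (\<lambda>r s. esum K (T2 w r) (\<lambda>p q. C p q (s \<otimes>\<^bsub>A\<^esub> d)))
    = esum K (T1 x d) (\<lambda>r s. esum K (T2 w (r \<otimes>\<^bsub>A\<^esub> z)) (\<lambda>p q. C p q s))"
    by (rule T31[where B = "\<lambda>r s. esum K (T2 w r) (\<lambda>p q. C p q s)"]; (intro ml_A c)?; simp add: x d)
  also have "\<dots> = esum K (T1 x d) (\<lambda>r s. esum K (T2 w r) (\<lambda>u v. esum K (T2 u z) (\<lambda>p q. C p (v \<otimes>\<^bsub>A\<^esub> q) s)))"
    by (intro T1_cong x d T2_hom[where B = "\<lambda>p q. C p q s" for s]; (intro ml_A c)?; simp)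
  also have "\<dots> = esum K (T2 w x) (\<lambda>u v. esum K (T1 v d) (\<lambda>r s. esum K (T2 u z) (\<lambda>p q. C p (r \<otimes>\<^bsub>A\<^esub> q) s)))"
    by (rule T_coassoc[where C = "\<lambda>u v s. esum K (T2 u z) (\<lambda>p q. C p (v \<otimes>\<^bsub>A\<^esub> q) s)"]; (intro ml_A c)?; simp add: x d)
  also have "\<dots> = esum K (T2 w x) (\<lambda>u v. esum K (T2 u z) (\<lambda>p q. esum K (T1 v d) (\<lambda>r s. C p (r \<otimes>\<^bsub>A\<^esub> q) s)))"
    by (intro T2_cong x; rule K.esum_swap[OF T_in(1) T_in(2)]; (intro ml_A c)?; simp add: x d)
  also have "\<dots> = esum K (T2 w x) (\<lambda>u v. esum K (T2 u z) (\<lambda>p q. esum K (T3 v q) (\<lambda>r s. C p r (s \<otimes>\<^bsub>A\<^esub> d))))"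
    by (intro T2_cong x T31[symmetric] c d; assumption)
  finally show "esum K (T3 x z) (\<lambda>r s. esum K (T2 w r) (\<lambda>p q. C p q (s \<otimes>\<^bsub>A\<^esub> d)))
    = esum K (T2 w x) (\<lambda>u v. esum K (T2 u z) (\<lambda>p q. esum K (T3 v q) (\<lambda>r s. C p r (s \<otimes>\<^bsub>A\<^esub> d))))" .
qed ((intro ml_A; simp add: x)+)

lemma T1'_coassoc:
  assumes C: "C \<in> trilinear_forms K A A A" and x: "w \<in> carrier A" "x \<in> carrier A" "z \<in> carrier A"
  shows "esum K (T1' x z) (\<lambda>r s. esum K (T2 w r) (\<lambda>p q. C p q s)) =
    esum K (T2 w x) (\<lambda>p q. esum K (T1' q z) (\<lambda>r s. C p r s))"
proof -
  note c = trilinear_comp[OF C]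
  have "esum K (T1' x z) (\<lambda>r s. esum K (T2 w r) (\<lambda>p q. C p q s)) =
    esum K (T1' x z) (\<lambda>r s. esum K (T2 w r) (\<lambda>p q. esum K (T1 q s) (\<lambda>a b. esum K (T1' a b) (\<lambda>a b. C p a b))))"
    by (intro T1'_cong T2_cong x; (rule inv_T1[symmetric, where B' = "\<lambda>a b. C p a b" for p])?; (intro ml_A c)?; simp add: x)
  also have "\<dots> = esum K (T1' x z) (\<lambda>r s. esum K (T1 r s) (\<lambda>a b. esum K (T2 w a) (\<lambda>p q. esum K (T1' q b) (\<lambda>a b. C p a b))))"
    by (intro T1'_cong x; rule T_coassoc[symmetric, where C = "\<lambda>p q v. esum K (T1' q v) (\<lambda>a b. C p a b)"]; (intro ml_A c)?; simp add: x)
  also have "\<dots> = esum K (T2 w x) (\<lambda>p q. esum K (T1' q z) (\<lambda>r s. C p r s))"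
    by (rule T1_inv[where B = "\<lambda>a b. esum K (T2 w a) (\<lambda>p q. esum K (T1' q b) (\<lambda>a b. C p a b))"]; (intro ml_A c)?; simp add: x)
  finally show ?thesis .
qed

lemma T2'_left:
  assumes B: "B \<in> bilinear_forms K A A" and x: "d \<in> carrier A" "u \<in> carrier A" "v \<in> carrier A"
  shows "esum K (T2' (d \<otimes>\<^bsub>A\<^esub> u) v) B = esum K (T2' u v) (\<lambda>x z. B (d \<otimes>\<^bsub>A\<^esub> x) z)"
proof -
  note c = bilinear_comp[OF B]
  have "esum K (T2' (d \<otimes>\<^bsub>A\<^esub> u) v) B = esum K (T2' u v) (\<lambda>x z. esum K (T2 x z) (\<lambda>u v. esum K (T2' (d \<otimes>\<^bsub>A\<^esub> u) v) B))"
    by (rule T2_inv[symmetric, where B = "\<lambda>u v. esum K (T2' (d \<otimes>\<^bsub>A\<^esub> u) v) B"]; (intro ml_A c)?; simp add: x)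
  also have "\<dots> = esum K (T2' u v) (\<lambda>x z. esum K (T2 (d \<otimes>\<^bsub>A\<^esub> x) z) (\<lambda>u v. esum K (T2' u v) B))"
    by (intro T2'_cong x; rule T22[symmetric, where B = "\<lambda>u v. esum K (T2' u v) B"]; (intro ml_A c)?; simp add: x)
  also have "\<dots> = esum K (T2' u v) (\<lambda>x z. B (d \<otimes>\<^bsub>A\<^esub> x) z)"
    by (intro T2'_cong x inv_T2 B A.mult_closed)
  finally show ?thesis .
qed

lemma T1'_left:
  assumes B: "B \<in> bilinear_forms K A A" and x: "d \<in> carrier A" "p \<in> carrier A" "r \<in> carrier A"
  shows "esum K (T1 d r) (\<lambda>p' r'. esum K (T1' (p' \<otimes>\<^bsub>A\<^esub> p) r') B) = esum K (T1' p r) (\<lambda>a c. B (d \<otimes>\<^bsub>A\<^esub> a) c)"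
proof -
  note c = bilinear_comp[OF B]
  have "esum K (T1 d r) (\<lambda>p' r'. esum K (T1' (p' \<otimes>\<^bsub>A\<^esub> p) r') B) =
    esum K (T1' p r) (\<lambda>a c. esum K (T1 a c) (\<lambda>p r. esum K (T1 d r) (\<lambda>p' r'. esum K (T1' (p' \<otimes>\<^bsub>A\<^esub> p) r') B)))"
    by (rule T1_inv[symmetric, where B = "\<lambda>p r. esum K (T1 d r) (\<lambda>p' r'. esum K (T1' (p' \<otimes>\<^bsub>A\<^esub> p) r') B)"]; (intro ml_A c)?; simp add: x)
  also have "\<dots> = esum K (T1' p r) (\<lambda>a c. esum K (T1 (d \<otimes>\<^bsub>A\<^esub> a) c) (\<lambda>p r. esum K (T1' p r) B))"
    by (intro T1'_cong x; rule T1_hom[symmetric, where B = "\<lambda>p r. esum K (T1' p r) B"]; (intro ml_A c)?; simp add: x)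
  also have "\<dots> = esum K (T1' p r) (\<lambda>a c. B (d \<otimes>\<^bsub>A\<^esub> a) c)"
    by (intro T1'_cong x inv_T1 B A.mult_closed)
  finally show ?thesis .
qed

text \<open>\<open>galois_flip u v\<close> evaluates forms on \<open>T\<^sub>1\<inverse> T\<^sub>3 T\<^sub>2\<inverse> (u \<otimes> v)\<close>, which will turn out to be \<open>u \<otimes> S(v)\<close>.\<close>

abbreviation galois_flip :: "'a \<Rightarrow> 'a \<Rightarrow> ('a \<Rightarrow> 'a \<Rightarrow> 'k) \<Rightarrow> 'k"
  where "galois_flip u v D \<equiv>
    esum K (T2' u v) (\<lambda>x z. esum K (T3 x z) (\<lambda>p r. esum K (T1' p r) (\<lambda>a c. D a c)))"

lemma galois_flip_left:
  assumes B: "B \<in> bilinear_forms K A A" and x: "d \<in> carrier A" "u \<in> carrier A" "v \<in> carrier A"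
  shows "galois_flip (d \<otimes>\<^bsub>A\<^esub> u) v B = galois_flip u v (\<lambda>a c. B (d \<otimes>\<^bsub>A\<^esub> a) c)"
proof -
  note c = bilinear_comp[OF B]
  have "galois_flip (d \<otimes>\<^bsub>A\<^esub> u) v B =
    esum K (T2' u v) (\<lambda>x z. esum K (T3 (d \<otimes>\<^bsub>A\<^esub> x) z) (\<lambda>p r. esum K (T1' p r) (\<lambda>a c. B a c)))"
    by (rule T2'_left[where B = "\<lambda>x z. esum K (T3 x z) (\<lambda>p r. esum K (T1' p r) (\<lambda>a c. B a c))"]; (intro ml_A c)?; simp add: x)
  also have "\<dots> = esum K (T2' u v) (\<lambda>x z. esum K (T3 x z) (\<lambda>p r. esum K (T1 d r) (\<lambda>p' r'. esum K (T1' (p' \<otimes>\<^bsub>A\<^esub> p) r') (\<lambda>a c. B a c))))"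
    by (intro T2'_cong x; rule T3_hom[where B = "\<lambda>p r. esum K (T1' p r) (\<lambda>a c. B a c)"]; (intro ml_A c)?; simp add: x)
  also have "\<dots> = galois_flip u v (\<lambda>a c. B (d \<otimes>\<^bsub>A\<^esub> a) c)"
    by (intro T2'_cong T3_cong T1'_left B x; assumption)
  finally show ?thesis .
qed

lemma galois_flip_colinear_left:
  assumes C: "C \<in> trilinear_forms K A A A" and x: "w \<in> carrier A" "u \<in> carrier A" "v \<in> carrier A"
  shows "esum K (T2 w u) (\<lambda>p q. galois_flip q v (\<lambda>a c. C p a c)) =
    galois_flip u v (\<lambda>r s. esum K (T2 w r) (\<lambda>p q. C p q s))" (is "?L u v = ?R u v")
proof -
  note c = trilinear_comp[OF C]
  have "esum K (T2 x z) (\<lambda>u v. ?L u v) = esum K (T2 x z) (\<lambda>u v. ?R u v)" if xz: "x \<in> carrier A" "z \<in> carrier A" for x z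
  proof -
    have "esum K (T2 x z) (\<lambda>u v. ?L u v) =
      esum K (T2 w x) (\<lambda>u v. esum K (T2 u z) (\<lambda>p q. esum K (T2 v q) (\<lambda>r s. galois_flip r s (\<lambda>a c. C p a c))))"
      by (rule T2_coassoc_left[where C = "\<lambda>p q a. galois_flip q a (\<lambda>a c. C p a c)"]; (intro ml_A c)?; simp add: x xz)
    also have "\<dots> = esum K (T2 w x) (\<lambda>u v. esum K (T2 u z) (\<lambda>p q. esum K (T3 v q) (\<lambda>r s. esum K (T1' r s) (\<lambda>a c. C p a c))))"
      by (intro T2_cong x xz; (rule inv_T2[where B' = "\<lambda>x z. esum K (T3 x z) (\<lambda>r s. esum K (T1' r s) (\<lambda>a c. C p a c))" for p])?; (intro ml_A c)?; simp)
    also have "\<dots> = esum K (T3 x z) (\<lambda>r s. esum K (T2 w r) (\<lambda>p q. esum K (T1' q s) (\<lambda>a c. C p a c)))"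
      by (rule T3_coassoc[symmetric, where C = "\<lambda>p q s. esum K (T1' q s) (\<lambda>a c. C p a c)"]; (intro ml_A c)?; simp add: x xz)
    also have "\<dots> = esum K (T3 x z) (\<lambda>r s. esum K (T1' r s) (\<lambda>r s. esum K (T2 w r) (\<lambda>p q. C p q s)))"
      by (intro T3_cong xz; rule T1'_coassoc[symmetric, OF C]; simp add: x)
    also have "\<dots> = esum K (T2 x z) (\<lambda>u v. ?R u v)"
      by (rule inv_T2[symmetric, where B' = "\<lambda>x z. esum K (T3 x z) (\<lambda>r s. esum K (T1' r s) (\<lambda>r s. esum K (T2 w r) (\<lambda>p q. C p q s)))"]; (intro ml_A c)?; simp add: x xz)
    finally show ?thesis .
  qed
  then have "esum K (T2' u v) (\<lambda>x z. esum K (T2 x z) (\<lambda>u v. ?L u v)) = esum K (T2' u v) (\<lambda>x z. esum K (T2 x z) (\<lambda>u v. ?R u v))"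
    by (intro T2'_cong x)
  moreover have "esum K (T2' u v) (\<lambda>x z. esum K (T2 x z) (\<lambda>u v. ?L u v)) = ?L u v"
    by (rule T2_inv[where B = "\<lambda>u v. ?L u v"]; (intro ml_A c)?; simp add: x)
  moreover have "esum K (T2' u v) (\<lambda>x z. esum K (T2 x z) (\<lambda>u v. ?R u v)) = ?R u v"
    by (rule T2_inv[where B = "\<lambda>u v. ?R u v"]; (intro ml_A c)?; simp add: x)
  ultimately show ?thesis by simp
qed

lemma galois_flip_colinear:
  assumes C: "C \<in> trilinear_forms K A A A" and x: "d \<in> carrier A" "u \<in> carrier A" "v \<in> carrier A"
  shows "esum K (T4 u d) (\<lambda>p q. galois_flip q v (\<lambda>a c. C p a c)) =
    galois_flip u v (\<lambda>r s. esum K (T4 r d) (\<lambda>p q. C p q s))"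
proof (rule A.cancel_leg1_left[OF _ _ _ C])
  fix w C assume w: "w \<in> carrier A" and C: "C \<in> trilinear_forms K A A A"
  note c = trilinear_comp[OF C]
  have "esum K (T4 u d) (\<lambda>p q. galois_flip q v (\<lambda>a c. C (w \<otimes>\<^bsub>A\<^esub> p) a c)) =
    esum K (T2 w u) (\<lambda>p q. galois_flip (d \<otimes>\<^bsub>A\<^esub> q) v (\<lambda>a c. C p a c))"
    by (rule T24[symmetric, where B = "\<lambda>p q. galois_flip q v (\<lambda>a c. C p a c)"]; (intro ml_A c)?; simp add: x w)
  also have "\<dots> = esum K (T2 w u) (\<lambda>p q. galois_flip q v (\<lambda>a c. C p (d \<otimes>\<^bsub>A\<^esub> a) c))"
    by (intro T2_cong x w galois_flip_left c; assumption)
  also have "\<dots> = galois_flip u v (\<lambda>r s. esum K (T2 w r) (\<lambda>p q. C p (d \<otimes>\<^bsub>A\<^esub> q) s))"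
    by (rule galois_flip_colinear_left[where C = "\<lambda>p q s. C p (d \<otimes>\<^bsub>A\<^esub> q) s"]; (intro ml_A c)?; simp add: x w)
  also have "\<dots> = galois_flip u v (\<lambda>r s. esum K (T4 r d) (\<lambda>p q. C (w \<otimes>\<^bsub>A\<^esub> p) q s))"
    by (intro T2'_cong T3_cong T1'_cong x; (rule T24[where B = "\<lambda>p q. C p q s" for s])?; (intro ml_A c)?; simp add: x w)
  finally show "esum K (T4 u d) (\<lambda>p q. galois_flip q v (\<lambda>a c. C (w \<otimes>\<^bsub>A\<^esub> p) a c)) =
    galois_flip u v (\<lambda>r s. esum K (T4 r d) (\<lambda>p q. C (w \<otimes>\<^bsub>A\<^esub> p) q s))" .
qed ((intro ml_A; simp add: x)+)

end

section \<open>The antipode from a right invariant functional\<close>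

lemma functionals_esum:
  assumes "module K V" "field K" "f \<in> functionals K V" "l \<in> lists (P \<times> Q)"
    "\<And>v w. v \<in> P \<Longrightarrow> w \<in> Q \<Longrightarrow> F v w \<in> carrier V"
  shows "f (esum V l F) = esum K l (\<lambda>v w. f (F v w))"
  by (rule vec.functional_esum[OF vec.intro[OF assms(2,1)] assms(3-5)])

text \<open>
  \<open>\<psi>\<close> is a right invariant functional. Invariance is assumed in the two covered forms
  \<open>(\<psi> \<otimes> \<iota>)(\<Delta>(a) (1 \<otimes> c)) = \<psi>(a) c\<close> and \<open>(\<psi> \<otimes> \<iota>)((1 \<otimes> c) \<Delta>(a)) = \<psi>(a) c\<close>; the element \<open>e\<close> fixes a normalisation.
\<close>

locale hopf_integral = hopf_lists K A T1 T2 T3 T4 T1' T2' T3' T4'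
  for K :: "'k ring" (structure) and A :: "('k, 'a) module" and T1 T2 T3 T4 T1' T2' T3' T4' +
  fixes \<psi> :: "'a \<Rightarrow> 'k" and e :: 'a
  assumes psi: "\<psi> \<in> functionals K A" and e: "e \<in> carrier A" "\<psi> e = \<one>"
    and psi1: "\<lbrakk>f \<in> functionals K A; a \<in> carrier A; c \<in> carrier A\<rbrakk> \<Longrightarrow>
      esum K (T1 a c) (\<lambda>u v. \<psi> u \<otimes> f v) = \<psi> a \<otimes> f c"
    and psi4: "\<lbrakk>f \<in> functionals K A; a \<in> carrier A; c \<in> carrier A\<rbrakk> \<Longrightarrow>
      esum K (T4 a c) (\<lambda>u v. \<psi> u \<otimes> f v) = \<psi> a \<otimes> f c"
begin

lemmas psi_rules = functional_comp[OF psi] functionalsD(1)[OF psi]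

lemma psi_product:
  assumes f: "f \<in> functionals K A"
  shows "(\<lambda>u v. \<psi> u \<otimes> f v) \<in> bilinear_forms K A A"
  by (intro ml_A psi_rules functional_comp[OF f] functionalsD(1)[OF f]; assumption)

text \<open>
  The antipode is read off from the composite \<open>T1\<inverse> T3 T2\<inverse>\<close> at \<open>e \<otimes> v\<close> by applying \<open>\<psi>\<close> to the first leg.
\<close>

definition S :: "'a \<Rightarrow> 'a"
  where "S v = esum A (T2' e v) (\<lambda>x z. esum A (T3 x z) (\<lambda>p r. esum A (T1' p r) (\<lambda>a c. \<psi> a \<odot>\<^bsub>A\<^esub> c)))"

lemma S_closed: "v \<in> carrier A \<Longrightarrow> S v \<in> carrier A"
  unfolding S_def
  by (intro A.B.M.esum_closed[OF T_in(6)] A.B.M.esum_closed[OF T_in(3)] A.B.M.esum_closed[OF T_in(5)]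
      A.B.smult_closed psi_rules e; assumption)

lemma functional_S:
  assumes h: "h \<in> functionals K A" and v: "v \<in> carrier A"
  shows "h (S v) = galois_flip e v (\<lambda>a c. \<psi> a \<otimes> h c)"
proof -
  note sc = A.B.M.esum_closed[OF T_in(3)] A.B.M.esum_closed[OF T_in(5)] A.B.smult_closed psi_rules
  have "h (S v) = esum K (T2' e v) (\<lambda>x z. h (esum A (T3 x z) (\<lambda>p r. esum A (T1' p r) (\<lambda>a c. \<psi> a \<odot>\<^bsub>A\<^esub> c))))"
    unfolding S_def
    by (rule functionals_esum[OF A.B.module_axioms K.field_axioms h T_in(6)[OF e(1) v]]; intro sc; assumption)
  also have "\<dots> = esum K (T2' e v) (\<lambda>x z. esum K (T3 x z) (\<lambda>p r. h (esum A (T1' p r) (\<lambda>a c. \<psi> a \<odot>\<^bsub>A\<^esub> c))))"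
    by (intro T2'_cong e v; rule functionals_esum[OF A.B.module_axioms K.field_axioms h T_in(3)]; (intro sc)?; assumption)
  also have "\<dots> = esum K (T2' e v) (\<lambda>x z. esum K (T3 x z) (\<lambda>p r. esum K (T1' p r) (\<lambda>a c. h (\<psi> a \<odot>\<^bsub>A\<^esub> c))))"
    by (intro T2'_cong T3_cong e v; (rule functionals_esum[OF A.B.module_axioms K.field_axioms h T_in(5)])?; (intro sc)?; assumption)
  also have "\<dots> = galois_flip e v (\<lambda>a c. \<psi> a \<otimes> h c)"
    by (intro T2'_cong T3_cong T1'_cong e v functionalsD(3)[OF h] psi_rules; assumption)
  finally show ?thesis .
qed

text \<open>
  \<open>T\<^sub>1\<inverse> T\<^sub>3 T\<^sub>2\<inverse>\<close> is left \<open>A\<close>-linear and left colinear in its first leg. Comparing both sides of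
  colinearity after applying the invariant functional to the first leg shows that it acts on the
  second leg only.
\<close>

lemma galois_flip_eq:
  assumes D: "D \<in> bilinear_forms K A A" and x: "d \<in> carrier A" "v \<in> carrier A"
  shows "galois_flip d v D = D d (S v)"
proof -
  note c = bilinear_comp[OF D] psi_rules
  have "galois_flip d v (\<lambda>a c. D a c) = \<psi> e \<otimes> galois_flip d v (\<lambda>a c. D a c)"
    unfolding e(2) by (rule K.l_one[symmetric]; (intro ml_A c)?; simp add: x)
  also have "\<dots> = esum K (T4 e d) (\<lambda>p q. \<psi> p \<otimes> galois_flip q v (\<lambda>a c. D a c))"
    by (rule psi4[symmetric]; (intro ml_A c)?; simp add: x e)
  also have "\<dots> = esum K (T4 e d) (\<lambda>p q. galois_flip q v (\<lambda>a c. \<psi> p \<otimes> D a c))"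
  proof (intro T4_cong e x)
    fix p q assume pq: "p \<in> carrier A" "q \<in> carrier A"
    have "galois_flip q v (\<lambda>a c. \<psi> p \<otimes> D a c) = esum K (T2' q v) (\<lambda>x z. esum K (T3 x z) (\<lambda>r s. \<psi> p \<otimes> esum K (T1' r s) (\<lambda>a c. D a c)))"
      by (intro T2'_cong T3_cong x pq; (rule esum_scale[OF T_in(5)])?; (intro ml_A c)?; simp add: pq)
    also have "\<dots> = esum K (T2' q v) (\<lambda>x z. \<psi> p \<otimes> esum K (T3 x z) (\<lambda>r s. esum K (T1' r s) (\<lambda>a c. D a c)))"
      by (intro T2'_cong x pq; rule esum_scale[OF T_in(3)]; (intro ml_A c)?; simp add: pq)
    also have "\<dots> = \<psi> p \<otimes> galois_flip q v (\<lambda>a c. D a c)"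
      by (rule esum_scale[OF T_in(6)]; (intro ml_A c)?; simp add: pq x)
    finally show "\<psi> p \<otimes> galois_flip q v (\<lambda>a c. D a c) = galois_flip q v (\<lambda>a c. \<psi> p \<otimes> D a c)" ..
  qed
  also have "\<dots> = galois_flip e v (\<lambda>r s. esum K (T4 r d) (\<lambda>p q. \<psi> p \<otimes> D q s))"
    by (rule galois_flip_colinear[where C = "\<lambda>p q s. \<psi> p \<otimes> D q s"]; (intro ml_A c)?; simp add: x e)
  also have "\<dots> = galois_flip e v (\<lambda>r s. \<psi> r \<otimes> D d s)"
    by (intro T2'_cong T3_cong T1'_cong e x; (rule psi4[where f = "\<lambda>q. D q s" for s])?; (intro c linear_id)?; simp add: x)
  also have "\<dots> = D d (S v)"
    by (rule functional_S[symmetric]) (use x bilinear_formsD(1)[OF D] in auto)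
  finally show ?thesis .
qed

lemma galois_flip_functional:
  assumes B: "B \<in> bilinear_forms K A A" and "d \<in> carrier A"
  shows "(\<lambda>v. galois_flip d v B) \<in> functionals K A"
  by (intro ml_A bilinear_comp[OF B]; simp add: assms)

lemma S_linear: "S \<in> linear_maps K A A"
proof (rule linear_mapsI[OF S_closed])
  interpret vA: vec K A using vec_of_nd A.nd_algebra_axioms .
  have fS: "(\<lambda>v. h (S v)) \<in> functionals K A" if h: "h \<in> functionals K A" for h
  proof -
    have f: "(\<lambda>v. galois_flip e v (\<lambda>a c. \<psi> a \<otimes> h c)) \<in> functionals K A"
      by (rule galois_flip_functional[OF psi_product[OF h] e(1)])
    show ?thesis
      by (rule functionalsI) (simp_all add: functional_S h functionalsD[OF f])
  qed
  show "S (u \<oplus>\<^bsub>A\<^esub> v) = S u \<oplus>\<^bsub>A\<^esub> S v" if "u \<in> carrier A" "v \<in> carrier A" for u v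
    by (rule vA.functional_ext) (simp_all add: that S_closed functionalsD(2)[OF fS] functionalsD(2))
  show "S (c \<odot>\<^bsub>A\<^esub> v) = c \<odot>\<^bsub>A\<^esub> S v" if "c \<in> carrier K" "v \<in> carrier A" for c v
    by (rule vA.functional_ext) (simp_all add: that S_closed functionalsD(3)[OF fS] functionalsD(3))
qed

lemma linear_S: "g \<in> linear_maps K V A \<Longrightarrow> (\<lambda>v. S (g v)) \<in> linear_maps K V A"
  by (rule linear_comp[OF S_linear])

lemmas ml_S = ml_A linear_S S_closed

text \<open>
  The antipode in covered form: \<open>\<Delta>(x) (z \<otimes> 1)\<close> is obtained from
  \<open>(x \<otimes> 1) \<Delta>(z) = \<Sum> u \<otimes> v\<close> as \<open>\<Sum> \<Delta>(u) (1 \<otimes> S(v))\<close>.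
\<close>

lemma T3_antipode:
  assumes D: "D \<in> bilinear_forms K A A" and x: "x \<in> carrier A" "z \<in> carrier A"
  shows "esum K (T3 x z) D = esum K (T2 x z) (\<lambda>u v. esum K (T1 u (S v)) D)"
proof -
  note c = bilinear_comp[OF D]
  have "esum K (T2 x z) (\<lambda>u v. esum K (T1 u (S v)) (\<lambda>p q. D p q)) =
    esum K (T2 x z) (\<lambda>u v. galois_flip u v (\<lambda>a c. esum K (T1 a c) (\<lambda>p q. D p q)))"
    by (intro T2_cong x; rule galois_flip_eq[symmetric]; (intro ml_A c)?; simp)
  also have "\<dots> = esum K (T2 x z) (\<lambda>u v. esum K (T2' u v) (\<lambda>x z. esum K (T3 x z) (\<lambda>p r. D p r)))"
    by (intro T2_cong T2'_cong T3_cong x T1_inv D; assumption)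
  also have "\<dots> = esum K (T3 x z) (\<lambda>p r. D p r)"
    by (rule inv_T2[where B' = "\<lambda>x z. esum K (T3 x z) (\<lambda>p r. D p r)"]; (intro ml_A c)?; simp add: x)
  finally show ?thesis by simp
qed

lemma functional_eq_by_forms:
  assumes "u \<in> carrier A" "v \<in> carrier A" "\<And>D. D \<in> bilinear_forms K A A \<Longrightarrow> D e u = D e v"
  shows "u = v"
proof -
  interpret vA: vec K A using vec_of_nd A.nd_algebra_axioms .
  show ?thesis
  proof (rule vA.functional_ext[OF assms(1,2)])
    fix f assume f: "f \<in> functionals K A"
    show "f u = f v"
      using assms(3)[OF psi_product[OF f]] e(2) functionalsD(1)[OF f] assms(1,2) by simp
  qed
qed

text \<open>
  The inverse composite \<open>T2 T3\<inverse> T1\<close>, which shows that \<open>S\<close> is bijective.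
\<close>

abbreviation galois_unflip :: "'a \<Rightarrow> 'a \<Rightarrow> ('a \<Rightarrow> 'a \<Rightarrow> 'k) \<Rightarrow> 'k"
  where "galois_unflip u v D \<equiv>
    esum K (T1 u v) (\<lambda>p r. esum K (T3' p r) (\<lambda>x z. esum K (T2 x z) (\<lambda>a c. D a c)))"

lemma galois_flip_unflip:
  assumes D: "D \<in> bilinear_forms K A A" and x: "u \<in> carrier A" "v \<in> carrier A"
  shows "galois_flip u v (\<lambda>a c. galois_unflip a c D) = D u v"
    and "galois_unflip u v (\<lambda>a c. galois_flip a c D) = D u v"
proof -
  note c = bilinear_comp[OF D]
  have "galois_flip u v (\<lambda>a c. galois_unflip a c D) =
    esum K (T2' u v) (\<lambda>x z. esum K (T3 x z) (\<lambda>p r. esum K (T3' p r) (\<lambda>x z. esum K (T2 x z) (\<lambda>a c. D a c))))"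
    by (intro T2'_cong T3_cong x; (rule T1_inv[where B = "\<lambda>p r. esum K (T3' p r) (\<lambda>x z. esum K (T2 x z) (\<lambda>a c. D a c))"])?; (intro ml_A c)?; simp)
  also have "\<dots> = esum K (T2' u v) (\<lambda>x z. esum K (T2 x z) (\<lambda>a c. D a c))"
    by (intro T2'_cong x; rule inv_T3[where B' = "\<lambda>x z. esum K (T2 x z) (\<lambda>a c. D a c)"]; (intro ml_A c)?; simp)
  also have "\<dots> = D u v" by (rule T2_inv[OF D x])
  finally show "galois_flip u v (\<lambda>a c. galois_unflip a c D) = D u v" .
  have "galois_unflip u v (\<lambda>a c. galois_flip a c D) =
    esum K (T1 u v) (\<lambda>p r. esum K (T3' p r) (\<lambda>x z. esum K (T3 x z) (\<lambda>p r. esum K (T1' p r) (\<lambda>a c. D a c))))"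
    by (intro T1_cong T3'_cong x; (rule inv_T2[where B' = "\<lambda>x z. esum K (T3 x z) (\<lambda>p r. esum K (T1' p r) (\<lambda>a c. D a c))"])?; (intro ml_A c)?; simp)
  also have "\<dots> = esum K (T1 u v) (\<lambda>p r. esum K (T1' p r) (\<lambda>a c. D a c))"
    by (intro T1_cong x; rule T3_inv[where B = "\<lambda>p r. esum K (T1' p r) (\<lambda>a c. D a c)"]; (intro ml_A c)?; simp)
  also have "\<dots> = D u v" by (rule inv_T1[OF D x])
  finally show "galois_unflip u v (\<lambda>a c. galois_flip a c D) = D u v" .
qed

lemma S_inj:
  assumes "u \<in> carrier A" "v \<in> carrier A" "S u = S v"
  shows "u = v"
proof (rule functional_eq_by_forms[OF assms(1,2)])
  fix D assume D: "D \<in> bilinear_forms K A A"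
  note c = bilinear_comp[OF D]
  have b: "(\<lambda>a c. galois_unflip a c D) \<in> bilinear_forms K A A"
    by (intro ml_A c; assumption)
  show "D e u = D e v"
    using galois_flip_unflip(1)[OF D e(1) assms(1)] galois_flip_unflip(1)[OF D e(1) assms(2)]
      galois_flip_eq[OF b e(1) assms(1)] galois_flip_eq[OF b e(1) assms(2)] assms(3) by simp
qed

lemma S_surj:
  assumes w: "w \<in> carrier A"
  shows "\<exists>v\<in>carrier A. S v = w"
proof -
  interpret vA: vec K A using vec_of_nd A.nd_algebra_axioms .
  note sc = A.B.M.esum_closed[OF T_in(7)] A.B.M.esum_closed[OF T_in(2)] A.B.smult_closed psi_rules
  let ?v = "esum A (T1 e w) (\<lambda>p r. esum A (T3' p r) (\<lambda>x z. esum A (T2 x z) (\<lambda>a c. \<psi> a \<odot>\<^bsub>A\<^esub> c)))"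
  have v: "?v \<in> carrier A"
    by (intro A.B.M.esum_closed[OF T_in(1)] sc e w; assumption)
  have hv: "h ?v = galois_unflip e w (\<lambda>a c. \<psi> a \<otimes> h c)" if h: "h \<in> functionals K A" for h
  proof -
    have "h ?v = esum K (T1 e w) (\<lambda>x z. h (esum A (T3' x z) (\<lambda>p r. esum A (T2 p r) (\<lambda>a c. \<psi> a \<odot>\<^bsub>A\<^esub> c))))"
      by (rule functionals_esum[OF A.B.module_axioms K.field_axioms h T_in(1)[OF e(1) w]]; intro sc; assumption)
    also have "\<dots> = esum K (T1 e w) (\<lambda>x z. esum K (T3' x z) (\<lambda>p r. h (esum A (T2 p r) (\<lambda>a c. \<psi> a \<odot>\<^bsub>A\<^esub> c))))"
      by (intro T1_cong e w; rule functionals_esum[OF A.B.module_axioms K.field_axioms h T_in(7)]; (intro sc)?; assumption)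
    also have "\<dots> = esum K (T1 e w) (\<lambda>x z. esum K (T3' x z) (\<lambda>p r. esum K (T2 p r) (\<lambda>a c. h (\<psi> a \<odot>\<^bsub>A\<^esub> c))))"
      by (intro T1_cong T3'_cong e w; (rule functionals_esum[OF A.B.module_axioms K.field_axioms h T_in(2)])?; (intro sc)?; assumption)
    also have "\<dots> = galois_unflip e w (\<lambda>a c. \<psi> a \<otimes> h c)"
      by (intro T1_cong T3'_cong T2_cong e w functionalsD(3)[OF h] psi_rules; assumption)
    finally show ?thesis .
  qed
  have "S ?v = w"
  proof (rule vA.functional_ext[OF S_closed[OF v] w])
    fix h assume h: "h \<in> functionals K A"
    note c = functional_comp[OF h] functionalsD(1)[OF h] psi_rules
    have "h (S ?v) = galois_unflip e w (\<lambda>a c. \<psi> a \<otimes> h (S c))"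
      by (rule hv[OF functional_comp[OF h S_linear]])
    also have "\<dots> = galois_unflip e w (\<lambda>a c. galois_flip a c (\<lambda>a c. \<psi> a \<otimes> h c))"
      by (intro T1_cong T3'_cong T2_cong e w; (rule galois_flip_eq[OF psi_product[OF h], symmetric])?; assumption)
    also have "\<dots> = h w"
      using galois_flip_unflip(2)[OF psi_product[OF h] e(1) w] e(2) functionalsD(1)[OF h w] by simp
    finally show "h (S ?v) = h w" .
  qed
  with v show ?thesis by blast
qed

text \<open>
  \<open>\<Delta>(x) (z z' \<otimes> 1)\<close> is computed by \<open>T3_antipode\<close> in one step for \<open>z z'\<close> and in two steps for \<open>z\<close> and \<open>z'\<close>.
  Since \<open>T2\<close> is onto and \<open>T1\<close> is injective, the elements that enter the second legs agree.
\<close>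

lemma S_antimult:
  assumes x: "q \<in> carrier A" "v \<in> carrier A"
  shows "S (v \<otimes>\<^bsub>A\<^esub> q) = S q \<otimes>\<^bsub>A\<^esub> S v"
proof -
  have eq2: "f u v = g u v" if fg: "(\<lambda>u v. f u v) \<in> bilinear_forms K A A" "(\<lambda>u v. g u v) \<in> bilinear_forms K A A"
    and eq: "\<And>x z. x \<in> carrier A \<Longrightarrow> z \<in> carrier A \<Longrightarrow> esum K (T2 x z) f = esum K (T2 x z) g"
    and u: "u \<in> carrier A" "v \<in> carrier A" for f g u v
  proof -
    have "f u v = esum K (T2' u v) (\<lambda>x z. esum K (T2 x z) f)" using T2_inv[OF fg(1) u] by simp
    also have "\<dots> = esum K (T2' u v) (\<lambda>x z. esum K (T2 x z) g)" by (intro T2'_cong u eq)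
    also have "\<dots> = g u v" using T2_inv[OF fg(2) u] by simp
    finally show ?thesis .
  qed
  show ?thesis
  proof (rule functional_eq_by_forms)
    fix D0 assume D0: "D0 \<in> bilinear_forms K A A"
    define D where "D = (\<lambda>p q. esum K (T1' p q) (\<lambda>a c. D0 a c))"
    have D: "D \<in> bilinear_forms K A A"
      unfolding D_def by (intro ml_A bilinear_comp[OF D0]; assumption)
    note c = bilinear_comp[OF D]
    have step: "esum K (T2 u z') (\<lambda>p q. esum K (T1 p (S (v \<otimes>\<^bsub>A\<^esub> q))) (\<lambda>a b. D a b)) =
      esum K (T1 u (S v)) (\<lambda>a b. D (a \<otimes>\<^bsub>A\<^esub> z') b)"
      if uv: "u \<in> carrier A" "v \<in> carrier A" "z' \<in> carrier A" for u v z'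
    proof (rule eq2[where f = "\<lambda>u v. esum K (T2 u z') (\<lambda>p q. esum K (T1 p (S (v \<otimes>\<^bsub>A\<^esub> q))) (\<lambda>a b. D a b))"
          and g = "\<lambda>u v. esum K (T1 u (S v)) (\<lambda>a b. D (a \<otimes>\<^bsub>A\<^esub> z') b)", OF _ _ _ uv(1,2)])
      fix x z assume xz: "x \<in> carrier A" "z \<in> carrier A"
      have "esum K (T2 x z) (\<lambda>u v. esum K (T2 u z') (\<lambda>p q. esum K (T1 p (S (v \<otimes>\<^bsub>A\<^esub> q))) (\<lambda>a b. D a b)))
        = esum K (T2 x (z \<otimes>\<^bsub>A\<^esub> z')) (\<lambda>p q. esum K (T1 p (S q)) (\<lambda>a b. D a b))"
        by (rule T2_hom[symmetric, where B = "\<lambda>p q. esum K (T1 p (S q)) (\<lambda>a b. D a b)"]; (intro ml_S c)?; simp add: uv xz)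
      also have "\<dots> = esum K (T3 x (z \<otimes>\<^bsub>A\<^esub> z')) (\<lambda>a b. D a b)"
        by (rule T3_antipode[symmetric]; (intro ml_A c)?; simp add: uv xz)
      also have "\<dots> = esum K (T3 x z) (\<lambda>a b. D (a \<otimes>\<^bsub>A\<^esub> z') b)"
        by (rule T33; (intro ml_A c)?; simp add: uv xz)
      also have "\<dots> = esum K (T2 x z) (\<lambda>u v. esum K (T1 u (S v)) (\<lambda>a b. D (a \<otimes>\<^bsub>A\<^esub> z') b))"
        by (rule T3_antipode; (intro ml_A c)?; simp add: uv xz)
      finally show "esum K (T2 x z) (\<lambda>u v. esum K (T2 u z') (\<lambda>p q. esum K (T1 p (S (v \<otimes>\<^bsub>A\<^esub> q))) (\<lambda>a b. D a b))) =
        esum K (T2 x z) (\<lambda>u v. esum K (T1 u (S v)) (\<lambda>a b. D (a \<otimes>\<^bsub>A\<^esub> z') b))" .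
    qed ((intro ml_S c; simp add: uv)+)
    have "esum K (T1 e (S (v \<otimes>\<^bsub>A\<^esub> q))) (\<lambda>a b. D a b) = esum K (T1 e (S q \<otimes>\<^bsub>A\<^esub> S v)) (\<lambda>a b. D a b)"
    proof (rule eq2[where f = "\<lambda>p q. esum K (T1 p (S (v \<otimes>\<^bsub>A\<^esub> q))) (\<lambda>a b. D a b)"
          and g = "\<lambda>p q. esum K (T1 p (S q \<otimes>\<^bsub>A\<^esub> S v)) (\<lambda>a b. D a b)", OF _ _ _ e(1) x(1)])
      fix u z' assume uz: "u \<in> carrier A" "z' \<in> carrier A"
      have "esum K (T2 u z') (\<lambda>p q. esum K (T1 p (S (v \<otimes>\<^bsub>A\<^esub> q))) (\<lambda>a b. D a b)) =
        esum K (T1 u (S v)) (\<lambda>a b. D (a \<otimes>\<^bsub>A\<^esub> z') b)" by (rule step[OF uz(1) x(2) uz(2)])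
      also have "\<dots> = esum K (T3 u z') (\<lambda>a b. D a (b \<otimes>\<^bsub>A\<^esub> S v))"
        by (rule T31[symmetric]; (intro ml_S c)?; simp add: uz x)
      also have "\<dots> = esum K (T2 u z') (\<lambda>p q. esum K (T1 p (S q)) (\<lambda>a b. D a (b \<otimes>\<^bsub>A\<^esub> S v)))"
        by (rule T3_antipode; (intro ml_S c)?; simp add: uz x)
      also have "\<dots> = esum K (T2 u z') (\<lambda>p q. esum K (T1 p (S q \<otimes>\<^bsub>A\<^esub> S v)) (\<lambda>a b. D a b))"
        by (intro T2_cong uz T11[symmetric] D S_closed x; assumption)
      finally show "esum K (T2 u z') (\<lambda>p q. esum K (T1 p (S (v \<otimes>\<^bsub>A\<^esub> q))) (\<lambda>a b. D a b)) =
        esum K (T2 u z') (\<lambda>p q. esum K (T1 p (S q \<otimes>\<^bsub>A\<^esub> S v)) (\<lambda>a b. D a b))" .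
    qed ((intro ml_S c; simp add: x)+)
    then show "D0 e (S (v \<otimes>\<^bsub>A\<^esub> q)) = D0 e (S q \<otimes>\<^bsub>A\<^esub> S v)"
      unfolding D_def using inv_T1[OF D0] e(1) S_closed x A.mult_closed by simp
  qed (use x S_closed A.mult_closed in auto)
qed

end

section \<open>Functionals of the form \<open>\<chi>(z \<cdot>)\<close> and \<open>\<chi>(\<cdot> z)\<close>\<close>

context nd_algebra
begin

text \<open>
  The comparison of invariant functionals is phrased as inclusions between these sets of functionals:
  if every \<open>\<chi>(\<cdot> w)\<close> lies in \<open>right_translates \<chi>'\<close>, then \<open>\<chi>\<close> and \<open>\<chi>'\<close> are related without any mention of
  multipliers, and such inclusions can be composed.
\<close>

definition left_translates :: "('c \<Rightarrow> 'a) \<Rightarrow> ('c \<Rightarrow> 'a) set"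
  where "left_translates \<chi> = {F. \<exists>z\<in>carrier B. \<forall>y\<in>carrier B. F y = \<chi> (z \<otimes>\<^bsub>B\<^esub> y)}"

definition right_translates :: "('c \<Rightarrow> 'a) \<Rightarrow> ('c \<Rightarrow> 'a) set"
  where "right_translates \<chi> = {F. \<exists>z\<in>carrier B. \<forall>y\<in>carrier B. F y = \<chi> (y \<otimes>\<^bsub>B\<^esub> z)}"

lemma left_translatesI: "z \<in> carrier B \<Longrightarrow> (\<lambda>y. \<chi> (z \<otimes>\<^bsub>B\<^esub> y)) \<in> left_translates \<chi>"
  by (auto simp: left_translates_def)

lemma right_translatesI: "z \<in> carrier B \<Longrightarrow> (\<lambda>y. \<chi> (y \<otimes>\<^bsub>B\<^esub> z)) \<in> right_translates \<chi>"
  by (auto simp: right_translates_def)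

lemma left_translates_cong:
  "F \<in> left_translates \<chi> \<Longrightarrow> (\<And>y. y \<in> carrier B \<Longrightarrow> G y = F y) \<Longrightarrow> G \<in> left_translates \<chi>"
  by (auto simp: left_translates_def)

lemma right_translates_cong:
  "F \<in> right_translates \<chi> \<Longrightarrow> (\<And>y. y \<in> carrier B \<Longrightarrow> G y = F y) \<Longrightarrow> G \<in> right_translates \<chi>"
  by (auto simp: right_translates_def)

lemma left_translates_esum:
  assumes \<chi>: "\<chi> \<in> functionals K B" and l: "l \<in> lists (P \<times> Q)"
    and F: "\<And>p q. p \<in> P \<Longrightarrow> q \<in> Q \<Longrightarrow> (\<lambda>y. F p q y) \<in> left_translates \<chi>"
  shows "(\<lambda>y. esum K l (\<lambda>p q. F p q y)) \<in> left_translates \<chi>"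
proof -
  have "\<forall>p q. \<exists>z. p \<in> P \<longrightarrow> q \<in> Q \<longrightarrow> z \<in> carrier B \<and> (\<forall>y\<in>carrier B. F p q y = \<chi> (z \<otimes>\<^bsub>B\<^esub> y))"
    using F unfolding left_translates_def by blast
  then obtain z where z: "\<And>p q. p \<in> P \<Longrightarrow> q \<in> Q \<Longrightarrow> z p q \<in> carrier B"
    "\<And>p q y. p \<in> P \<Longrightarrow> q \<in> Q \<Longrightarrow> y \<in> carrier B \<Longrightarrow> F p q y = \<chi> (z p q \<otimes>\<^bsub>B\<^esub> y)" by metis
  have "esum K l (\<lambda>p q. F p q y) = \<chi> (esum B l z \<otimes>\<^bsub>B\<^esub> y)" if y: "y \<in> carrier B" for y
  proof -
    have "\<chi> (esum B l z \<otimes>\<^bsub>B\<^esub> y) = esum K l (\<lambda>p q. \<chi> (z p q \<otimes>\<^bsub>B\<^esub> y))"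
      by (rule functionals_esum[OF B.module_axioms K.field_axioms functional_comp[OF \<chi> mult_linear_left[OF y]] l z(1)])
    also have "\<dots> = esum K l (\<lambda>p q. F p q y)"
      by (rule esum_cong[OF l]) (simp add: z y)
    finally show ?thesis by simp
  qed
  moreover have "esum B l z \<in> carrier B" by (rule B.M.esum_closed[OF l z(1)])
  ultimately show ?thesis by (auto simp: left_translates_def)
qed

lemma right_translates_esum:
  assumes \<chi>: "\<chi> \<in> functionals K B" and l: "l \<in> lists (P \<times> Q)"
    and F: "\<And>p q. p \<in> P \<Longrightarrow> q \<in> Q \<Longrightarrow> (\<lambda>y. F p q y) \<in> right_translates \<chi>"
  shows "(\<lambda>y. esum K l (\<lambda>p q. F p q y)) \<in> right_translates \<chi>"
proof -
  have "\<forall>p q. \<exists>z. p \<in> P \<longrightarrow> q \<in> Q \<longrightarrow> z \<in> carrier B \<and> (\<forall>y\<in>carrier B. F p q y = \<chi> (y \<otimes>\<^bsub>B\<^esub> z))"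
    using F unfolding right_translates_def by blast
  then obtain z where z: "\<And>p q. p \<in> P \<Longrightarrow> q \<in> Q \<Longrightarrow> z p q \<in> carrier B"
    "\<And>p q y. p \<in> P \<Longrightarrow> q \<in> Q \<Longrightarrow> y \<in> carrier B \<Longrightarrow> F p q y = \<chi> (y \<otimes>\<^bsub>B\<^esub> z p q)" by metis
  have "esum K l (\<lambda>p q. F p q y) = \<chi> (y \<otimes>\<^bsub>B\<^esub> esum B l z)" if y: "y \<in> carrier B" for y
  proof -
    have "\<chi> (y \<otimes>\<^bsub>B\<^esub> esum B l z) = esum K l (\<lambda>p q. \<chi> (y \<otimes>\<^bsub>B\<^esub> z p q))"
      by (rule functionals_esum[OF B.module_axioms K.field_axioms functional_comp[OF \<chi> mult_linear_right[OF y]] l z(1)])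
    also have "\<dots> = esum K l (\<lambda>p q. F p q y)"
      by (rule esum_cong[OF l]) (simp add: z y)
    finally show ?thesis by simp
  qed
  moreover have "esum B l z \<in> carrier B" by (rule B.M.esum_closed[OF l z(1)])
  ultimately show ?thesis by (auto simp: right_translates_def)
qed

lemma left_translates_scale:
  assumes \<chi>: "\<chi> \<in> functionals K B" and c: "c \<in> carrier K" and F: "F \<in> left_translates \<chi>"
  shows "(\<lambda>y. c \<otimes>\<^bsub>K\<^esub> F y) \<in> left_translates \<chi>"
proof -
  obtain z where z: "z \<in> carrier B" "\<And>y. y \<in> carrier B \<Longrightarrow> F y = \<chi> (z \<otimes>\<^bsub>B\<^esub> y)"
    using F unfolding left_translates_def by blast
  have "c \<otimes>\<^bsub>K\<^esub> F y = \<chi> ((c \<odot>\<^bsub>B\<^esub> z) \<otimes>\<^bsub>B\<^esub> y)" if y: "y \<in> carrier B" for y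
    using functionalsD(3)[OF functional_comp[OF \<chi> mult_linear_left[OF y]] c z(1)] z(2)[OF y] by simp
  then show ?thesis using z c by (auto simp: left_translates_def)
qed

lemma right_translates_scale:
  assumes \<chi>: "\<chi> \<in> functionals K B" and c: "c \<in> carrier K" and F: "F \<in> right_translates \<chi>"
  shows "(\<lambda>y. c \<otimes>\<^bsub>K\<^esub> F y) \<in> right_translates \<chi>"
proof -
  obtain z where z: "z \<in> carrier B" "\<And>y. y \<in> carrier B \<Longrightarrow> F y = \<chi> (y \<otimes>\<^bsub>B\<^esub> z)"
    using F unfolding right_translates_def by blast
  have "c \<otimes>\<^bsub>K\<^esub> F y = \<chi> (y \<otimes>\<^bsub>B\<^esub> (c \<odot>\<^bsub>B\<^esub> z))" if y: "y \<in> carrier B" for y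
    using functionalsD(3)[OF functional_comp[OF \<chi> mult_linear_right[OF y]] c z(1)] z(2)[OF y] by simp
  then show ?thesis using z c by (auto simp: right_translates_def)
qed

end

context hopf_integral
begin

definition S' :: "'a \<Rightarrow> 'a" where "S' = inv_into (carrier A) S"

lemma S_image: "v \<in> carrier A \<Longrightarrow> v \<in> S ` carrier A"
  using S_surj[of v] by (auto simp: image_iff)

lemma S'_closed: "v \<in> carrier A \<Longrightarrow> S' v \<in> carrier A"
  unfolding S'_def by (rule inv_into_into[OF S_image])

lemma S_S': "v \<in> carrier A \<Longrightarrow> S (S' v) = v"
  unfolding S'_def by (rule f_inv_into_f[OF S_image])

lemma S'_S: "v \<in> carrier A \<Longrightarrow> S' (S v) = v"
  by (rule S_inj) (simp_all add: S'_closed S_closed S_S')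

lemma S'_linear: "S' \<in> linear_maps K A A"
proof (rule linear_mapsI[OF S'_closed])
  show "S' (u \<oplus>\<^bsub>A\<^esub> v) = S' u \<oplus>\<^bsub>A\<^esub> S' v" if "u \<in> carrier A" "v \<in> carrier A" for u v
    by (rule S_inj) (simp_all add: that S'_closed S_S' linear_mapsD(2)[OF S_linear])
  show "S' (c \<odot>\<^bsub>A\<^esub> v) = c \<odot>\<^bsub>A\<^esub> S' v" if "c \<in> carrier K" "v \<in> carrier A" for c v
    by (rule S_inj) (simp_all add: that S'_closed S_S' linear_mapsD(3)[OF S_linear])
qed

lemma linear_S': "g \<in> linear_maps K V A \<Longrightarrow> (\<lambda>v. S' (g v)) \<in> linear_maps K V A"
  by (rule linear_comp[OF S'_linear])

lemma T3_psi:
  assumes f: "f \<in> functionals K A" and x: "b \<in> carrier A" "a \<in> carrier A"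
  shows "esum K (T3 b a) (\<lambda>u v. \<psi> u \<otimes> f v) = esum K (T2 b a) (\<lambda>u v. \<psi> u \<otimes> f (S v))"
  unfolding T3_antipode[OF psi_product[OF f] x]
  by (intro T2_cong x psi1 f S_closed; assumption)

text \<open>
  The strong invariance of \<open>\<psi>\<close>: \<open>\<psi>\<close> applied to the first leg of \<open>\<Delta>(b) (a \<otimes> 1)\<close> and of \<open>(b \<otimes> 1) \<Delta>(a)\<close>
  gives elements that correspond under \<open>S\<close>. It comes from applying \<open>\<psi> \<otimes> \<iota>\<close> to \<open>T3_antipode\<close>.
\<close>

lemma T2_psi:
  assumes g: "g \<in> functionals K A" and x: "b \<in> carrier A" "a \<in> carrier A" "d \<in> carrier A"
  shows "esum K (T2 b a) (\<lambda>u v. \<psi> u \<otimes> g (v \<otimes>\<^bsub>A\<^esub> d)) = esum K (T4 b (S d)) (\<lambda>u v. \<psi> (u \<otimes>\<^bsub>A\<^esub> a) \<otimes> g (S' v))"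
proof -
  note c = functional_comp[OF g] functionalsD(1)[OF g] psi_rules
  have "esum K (T2 b a) (\<lambda>u v. \<psi> u \<otimes> g (v \<otimes>\<^bsub>A\<^esub> d)) = esum K (T2 b a) (\<lambda>u v. \<psi> u \<otimes> g (S' (S d \<otimes>\<^bsub>A\<^esub> S v)))"
    by (intro T2_cong x) (simp add: S_antimult[symmetric] x S'_S A.mult_closed)
  also have "\<dots> = esum K (T3 b a) (\<lambda>u v. \<psi> u \<otimes> g (S' (S d \<otimes>\<^bsub>A\<^esub> v)))"
    by (rule T3_psi[symmetric]; (intro ml_S linear_S' c)?; simp add: x S_closed)
  also have "\<dots> = esum K (T4 b (S d)) (\<lambda>u v. \<psi> (u \<otimes>\<^bsub>A\<^esub> a) \<otimes> g (S' v))"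
    by (rule T34[where B = "\<lambda>u v. \<psi> u \<otimes> g (S' v)"]; (intro ml_S linear_S' S'_closed c)?; simp add: x S_closed)
  finally show ?thesis .
qed

text \<open>
  By strong invariance the functional is \<open>a \<mapsto> \<psi>(w a)\<close> for the element \<open>w\<close> that is obtained from
  \<open>(1 \<otimes> S(d)) \<Delta>(b)\<close> by applying \<open>g \<circ> S\<inverse>\<close> to the second leg. Since \<open>T4\<close> is onto, all \<open>w\<close> are sums of
  elements of this form, which is the converse \<open>psi_translate_expand\<close>.
\<close>

lemma T2_psi_translate:
  assumes g: "g \<in> functionals K A" and x: "b \<in> carrier A" "d \<in> carrier A"
  shows "(\<lambda>a. esum K (T2 b a) (\<lambda>u v. \<psi> u \<otimes> g (v \<otimes>\<^bsub>A\<^esub> d))) \<in> A.left_translates \<psi>"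
proof -
  have "(\<lambda>a. g (S' v) \<otimes> \<psi> (u \<otimes>\<^bsub>A\<^esub> a)) \<in> A.left_translates \<psi>"
    if "u \<in> carrier A" "v \<in> carrier A" for u v
    using A.left_translates_scale[OF psi functionalsD(1)[OF g S'_closed[OF that(2)]] A.left_translatesI[OF that(1), where \<chi> = \<psi>]] .
  note A.left_translates_esum[OF psi T_in(4)[OF x(1) S_closed[OF x(2)]] this]
  then show ?thesis
  proof (rule A.left_translates_cong)
    fix a assume a: "a \<in> carrier A"
    show "esum K (T2 b a) (\<lambda>u v. \<psi> u \<otimes> g (v \<otimes>\<^bsub>A\<^esub> d)) = esum K (T4 b (S d)) (\<lambda>u v. g (S' v) \<otimes> \<psi> (u \<otimes>\<^bsub>A\<^esub> a))"
      unfolding T2_psi[OF g x(1) a x(2)]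
      by (rule T4_cong[OF x(1) S_closed[OF x(2)]], rule K.m_comm)
        (simp_all add: a psi_rules(2) functionalsD(1)[OF g] S'_closed A.mult_closed)
  qed
qed

lemma psi_translate_expand:
  assumes g: "g \<in> functionals K A" "t \<in> carrier A" "g t = \<one>" and w: "w \<in> carrier A"
  shows "\<exists>l\<in>lists (carrier A \<times> carrier A). \<forall>a\<in>carrier A.
    \<psi> (w \<otimes>\<^bsub>A\<^esub> a) = esum K l (\<lambda>b d. esum K (T2 b a) (\<lambda>u v. \<psi> u \<otimes> g (v \<otimes>\<^bsub>A\<^esub> d)))"
proof -
  define l where "l = map (\<lambda>p. (fst p, S' (snd p))) (T4' w (S t))"
  have T: "T4' w (S t) \<in> lists (carrier A \<times> carrier A)" by (rule T_in(8)[OF w S_closed[OF g(2)]])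
  then have l: "l \<in> lists (carrier A \<times> carrier A)"
    unfolding l_def by induction (simp_all add: mem_Times_iff S'_closed)
  have "\<psi> (w \<otimes>\<^bsub>A\<^esub> a) = esum K l (\<lambda>b d. esum K (T2 b a) (\<lambda>u v. \<psi> u \<otimes> g (v \<otimes>\<^bsub>A\<^esub> d)))"
    if a: "a \<in> carrier A" for a
  proof -
  note c = functional_comp[OF g(1)] functionalsD(1)[OF g(1)] psi_rules
  have "esum K l (\<lambda>b d. esum K (T2 b a) (\<lambda>u v. \<psi> u \<otimes> g (v \<otimes>\<^bsub>A\<^esub> d))) =
    esum K (T4' w (S t)) (\<lambda>b d. esum K (T4 b d) (\<lambda>u v. \<psi> (u \<otimes>\<^bsub>A\<^esub> a) \<otimes> g (S' v)))"
    unfolding l_def esum_map fst_conv snd_conv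
    by (rule esum_cong[OF T]) (simp add: T2_psi[OF g(1)] a S'_closed S_S')
  also have "\<dots> = \<psi> (w \<otimes>\<^bsub>A\<^esub> a) \<otimes> g (S' (S t))"
    by (rule T4_inv[where B = "\<lambda>u v. \<psi> (u \<otimes>\<^bsub>A\<^esub> a) \<otimes> g (S' v)"]; (intro ml_S linear_S' S'_closed c)?; simp add: a w g S_closed)
  also have "\<dots> = \<psi> (w \<otimes>\<^bsub>A\<^esub> a)"
    using g w a by (simp add: S'_S psi_rules(2) A.mult_closed)
  finally show ?thesis ..
  qed
  with l show ?thesis by blast
qed

end

section \<open>The opposite co-opposite algebra\<close>

text \<open>
  Reversing the multiplication and flipping the comultiplication produces another algebra of the
  same kind. This saves the mirror images of the proofs above.
\<close>

abbreviation (in nd_algebra) op_alg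
  where "op_alg \<equiv> B\<lparr>mult := \<lambda>a b. b \<otimes>\<^bsub>B\<^esub> a\<rparr>"

lemma functionals_mult_update [simp]: "functionals K (A\<lparr>mult := m\<rparr>) = functionals K A"
  by (simp add: functionals_def)

lemma linear_maps_mult_update [simp]: "linear_maps K (A\<lparr>mult := m\<rparr>) (A\<lparr>mult := m\<rparr>) = linear_maps K A A"
  by (simp add: linear_maps_def)

lemma bilinear_forms_mult_update [simp]: "bilinear_forms K (A\<lparr>mult := m\<rparr>) (A\<lparr>mult := m\<rparr>) = bilinear_forms K A A"
  by (simp add: bilinear_forms_def)

lemma trilinear_forms_mult_update [simp]:
  "trilinear_forms K (A\<lparr>mult := m\<rparr>) (A\<lparr>mult := m\<rparr>) (A\<lparr>mult := m\<rparr>) = trilinear_forms K A A A"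
  by (simp add: trilinear_forms_def)

lemma bilinear_flip: "B \<in> bilinear_forms K V W \<Longrightarrow> (\<lambda>v w. B w v) \<in> bilinear_forms K W V"
  by (auto simp: bilinear_forms_def)

lemma trilinear_flip: "C \<in> trilinear_forms K U V W \<Longrightarrow> (\<lambda>w v u. C u v w) \<in> trilinear_forms K W V U"
  by (auto simp: trilinear_forms_def bilinear_forms_def)

lemma (in nd_algebra) nd_algebra_op: "nd_algebra K op_alg"
proof -
  have eq: "add_monoid op_alg = add_monoid B" by simp
  have ab: "abelian_group op_alg"
    using B.M.abelian_group_axioms
    unfolding abelian_group_def abelian_monoid_def abelian_group_axioms_def eq .
  have md: "module K op_alg"
    using B.module_axioms ab by (simp add: module_def module_axioms_def)
  show ?thesis
  proof (intro nd_algebra.intro[OF K.field_axioms md] nd_algebra_axioms.intro)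
    fix a assume a: "a \<in> carrier op_alg"
    then have a': "a \<in> carrier B" by simp
    show "(\<lambda>b. a \<otimes>\<^bsub>op_alg\<^esub> b) \<in> linear_maps K op_alg op_alg"
      using mult_linear_left[OF a'] by simp
    show "(\<lambda>b. b \<otimes>\<^bsub>op_alg\<^esub> a) \<in> linear_maps K op_alg op_alg"
      using mult_linear_right[OF a'] by simp
    show "a = \<zero>\<^bsub>op_alg\<^esub>" if "\<forall>b\<in>carrier op_alg. a \<otimes>\<^bsub>op_alg\<^esub> b = \<zero>\<^bsub>op_alg\<^esub>"
      using nondegenerate_right[OF a'] that by simp
    show "a = \<zero>\<^bsub>op_alg\<^esub>" if "\<forall>b\<in>carrier op_alg. b \<otimes>\<^bsub>op_alg\<^esub> a = \<zero>\<^bsub>op_alg\<^esub>"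
      using nondegenerate_left[OF a'] that by simp
  next
    show "a \<otimes>\<^bsub>op_alg\<^esub> b \<in> carrier op_alg" if "a \<in> carrier op_alg" "b \<in> carrier op_alg" for a b
      using that by (simp add: mult_closed)
    show "a \<otimes>\<^bsub>op_alg\<^esub> b \<otimes>\<^bsub>op_alg\<^esub> c = a \<otimes>\<^bsub>op_alg\<^esub> (b \<otimes>\<^bsub>op_alg\<^esub> c)"
      if "a \<in> carrier op_alg" "b \<in> carrier op_alg" "c \<in> carrier op_alg" for a b c
      using mult_assoc[of c b a] that by simp
    show "carrier op_alg \<noteq> {\<zero>\<^bsub>op_alg\<^esub>}" using non_zero by simp
  qed
qed

text \<open>
  An inverse pair of maps stays one when the legs on either side are exchanged. The three variants
  \<open>flip\<close>, \<open>swap\<close> and \<open>exchange\<close> differ in the sides that are affected: both, the target, the source.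
\<close>

lemma inverse_lists_flip:
  assumes "inverse_lists K V W X Y T T'"
  shows "inverse_lists K W V Y X (\<lambda>w v. map prod.swap (T v w)) (\<lambda>y x. map prod.swap (T' x y))"
proof -
  note T = inverse_listsD[OF assms]
  have 1: "map prod.swap (T v w) \<in> lists (carrier Y \<times> carrier X)" if "v \<in> carrier V" "w \<in> carrier W" for v w
    by (rule swap_lists[OF bilinear_listsD(1)[OF T(1) that]])
  have 2: "map prod.swap (T' x y) \<in> lists (carrier W \<times> carrier V)" if "x \<in> carrier X" "y \<in> carrier Y" for x y
    by (rule swap_lists[OF bilinear_listsD(1)[OF T(2) that]])
  show ?thesis
    unfolding inverse_lists_def bilinear_lists_def
    using 1 2 bilinear_flip[OF bilinear_listsD(2)[OF T(1) bilinear_flip]]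
      bilinear_flip[OF bilinear_listsD(2)[OF T(2) bilinear_flip]] T(3,4)[OF bilinear_flip]
    by (simp del: in_lists_conv_set)
qed

lemma inverse_lists_swap:
  assumes "inverse_lists K V W X Y T T'"
  shows "inverse_lists K V W Y X (\<lambda>v w. map prod.swap (T v w)) (\<lambda>y x. T' x y)"
proof -
  note T = inverse_listsD[OF assms]
  have 1: "map prod.swap (T v w) \<in> lists (carrier Y \<times> carrier X)" if "v \<in> carrier V" "w \<in> carrier W" for v w
    by (rule swap_lists[OF bilinear_listsD(1)[OF T(1) that]])
  have 2: "T' x y \<in> lists (carrier V \<times> carrier W)" if "x \<in> carrier X" "y \<in> carrier Y" for x y
    by (rule bilinear_listsD(1)[OF T(2) that])
  show ?thesis
    unfolding inverse_lists_def bilinear_lists_def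
    using 1 2 bilinear_listsD(2)[OF T(1) bilinear_flip]
      bilinear_flip[OF bilinear_listsD(2)[OF T(2)]] T(3)[OF bilinear_flip] T(4)
    by (simp del: in_lists_conv_set)
qed

context hopf_lists
begin

lemma inverse_lists_op:
  "inverse_lists K A.op_alg A.op_alg A.op_alg A.op_alg T T' = inverse_lists K A A A A T T'"
  by (simp add: inverse_lists_def bilinear_lists_def)

text \<open>
  Passing to the opposite product and the flipped comultiplication exchanges \<open>T\<^sub>1\<close> with \<open>T\<^sub>2\<close> and
  \<open>T\<^sub>3\<close> with \<open>T\<^sub>4\<close>, and left invariant functionals with right invariant ones.
\<close>

lemma opposite:
  "hopf_lists K A.op_alg (\<lambda>a c. map prod.swap (T2 c a)) (\<lambda>c a. map prod.swap (T1 a c))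
    (\<lambda>a c. map prod.swap (T4 a c)) (\<lambda>a c. map prod.swap (T3 a c))
    (\<lambda>p q. map prod.swap (T2' q p)) (\<lambda>p q. map prod.swap (T1' q p)) (\<lambda>p q. T4' q p) (\<lambda>p q. T3' q p)"
proof (rule hopf_lists.intro[OF base.intro[OF K.field_axioms] A.nd_algebra_op], rule hopf_lists_axioms.intro, goal_cases)
  case 1 show ?case unfolding inverse_lists_op by (rule inverse_lists_flip[OF T2])
next
  case 2 show ?case unfolding inverse_lists_op by (rule inverse_lists_flip[OF T1])
next
  case 3 show ?case unfolding inverse_lists_op by (rule inverse_lists_swap[OF T4])
next
  case 4 show ?case unfolding inverse_lists_op by (rule inverse_lists_swap[OF T3])
next
  case (5 B a c d) then show ?case
    using T22[OF bilinear_flip[of B K A A], where a = a and c = c and d = d] by simp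
next
  case (6 B a c d) then show ?case
    using T11[OF bilinear_flip[of B K A A], where a = a and c = c and d = d] by simp
next
  case (7 B a c d) then show ?case
    using T44[OF bilinear_flip[of B K A A], where a = a and c = c and d = d] by simp
next
  case (8 B a c d) then show ?case
    using T33[OF bilinear_flip[of B K A A], where a = a and c = c and d = d] by simp
next
  case (9 B a c d) then show ?case
    using T21[OF bilinear_flip[of B K A A], where a = a and c = d and d = c] by simp
next
  case (10 B a c d) then show ?case
    using T31[OF bilinear_flip[of B K A A], where a = a and c = d and d = c] by simp
next
  case (11 B a c d) then show ?case
    using T24[OF bilinear_flip[of B K A A], where a = a and c = d and d = c] by simp
next
  case (12 B a c d) then show ?case
    using T34[OF bilinear_flip[of B K A A], where a = a and c = d and d = c] by simp
next
  case (13 B a c d) then show ?case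
    using T23[OF bilinear_flip[of B K A A], where a = a and c = d and d = c] by simp
next
  case (14 B a c d) then show ?case
    using T41[OF bilinear_flip[of B K A A], where a = a and c = d and d = c] by simp
next
  case (15 B a b c) then show ?case
    using T2_hom[OF bilinear_flip[of B K A A], where a = b and b = a and c = c] by simp
next
  case (16 B a b c) then show ?case
    using T1_hom[OF bilinear_flip[of B K A A], where a = b and b = a and c = c] by simp
next
  case (17 B a b c) then show ?case
    using T4_hom[OF bilinear_flip[of B K A A], where a = b and b = a and c = c] by simp
next
  case (18 B a b c) then show ?case
    using T3_hom[OF bilinear_flip[of B K A A], where a = b and b = a and c = c] by simp
next
  case (19 C a b c) then show ?case
    using T_coassoc[OF trilinear_flip[of C K A A A], where a = a and b = c and c = b] by simp
qed

end

section \<open>Coactions with invariant functionals\<close>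

context coaction_lists
begin

text \<open>
  Conjugating by the bijection \<open>V\<close> turns \<open>\<iota> \<otimes> W\<close> into \<open>\<iota> \<otimes> T\<^sub>1\<close> (coassociativity), so \<open>W\<close> is onto
  because \<open>T\<^sub>1\<close> is. The same argument applies to the pair \<open>W\<^sub>4\<close>, \<open>T\<^sub>4\<close>.
\<close>

lemma conjugate_onto:
  assumes U: "U \<in> bilinear_lists K X A X A" and T: "inverse_lists K A A A A T T'"
    and coassoc: "\<And>C x y c. C \<in> trilinear_forms K X A A \<Longrightarrow> x \<in> carrier X \<Longrightarrow> y \<in> carrier X \<Longrightarrow> c \<in> carrier A \<Longrightarrow>
      esum K (U y c) (\<lambda>u v. esum K (V x u) (\<lambda>p q. C p q v)) =
      esum K (V x y) (\<lambda>p u. esum K (T u c) (\<lambda>q v. C p q v))"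
    and z: "z \<in> carrier X" "a \<in> carrier A"
  shows "\<exists>l\<in>lists (carrier X \<times> carrier A). \<forall>B\<in>bilinear_forms K X A. esum K l (\<lambda>t c. esum K (U t c) B) = B z a"
proof -
  interpret vX: vec K X using vec_of_nd X.nd_algebra_axioms .
  obtain x where x: "x \<in> carrier X" "x \<noteq> \<zero>\<^bsub>X\<^esub>" using X.non_zero X.B.M.zero_closed by blast
  then obtain \<theta> where \<theta>: "\<theta> \<in> functionals K X" "\<theta> x = \<one>"
    using vX.functional_separating[of "{\<zero>\<^bsub>X\<^esub>}" x] by (auto simp: vX.subspace_def)
  note tc = functional_comp[OF \<theta>(1)] functionalsD(1)[OF \<theta>(1)]
  note mt = ml list_rules[OF inverse_listsD(1)[OF T]] list_rules[OF inverse_listsD(2)[OF T]] list_rules[OF U] tc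
  have "formal K (carrier X) (carrier A) (\<lambda>D. esum K (V x z) (\<lambda>p q. esum K (T' q a) (\<lambda>r c. esum K (V' p r) (\<lambda>s t. D (\<theta> s \<odot>\<^bsub>X\<^esub> t) c))))"
    by (intro mt X.B.smult_closed; simp add: x z)
  then obtain l where l: "l \<in> lists (carrier X \<times> carrier A)"
    and lD: "\<And>D. (\<And>t c. t \<in> carrier X \<Longrightarrow> c \<in> carrier A \<Longrightarrow> D t c \<in> carrier K) \<Longrightarrow>
      esum K (V x z) (\<lambda>p q. esum K (T' q a) (\<lambda>r c. esum K (V' p r) (\<lambda>s t. D (\<theta> s \<odot>\<^bsub>X\<^esub> t) c))) = esum K l D"
    unfolding formal_def by meson
  have "esum K l (\<lambda>t c. esum K (U t c) B) = B z a" if B: "B \<in> bilinear_forms K X A" for B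
  proof -
    note c = bilinear_comp[OF B]
    have "esum K l (\<lambda>t c. esum K (U t c) (\<lambda>x a. B x a)) =
      esum K (V x z) (\<lambda>p q. esum K (T' q a) (\<lambda>r c. esum K (V' p r) (\<lambda>s t. esum K (U (\<theta> s \<odot>\<^bsub>X\<^esub> t) c) (\<lambda>x a. B x a))))"
      by (rule lD[symmetric]) (intro mt c; assumption)
    also have "\<dots> = esum K (V x z) (\<lambda>p q. esum K (T' q a) (\<lambda>r c. esum K (V' p r) (\<lambda>s t. esum K (V s t) (\<lambda>p q. esum K (T q c) (\<lambda>q c. esum K (V' p q) (\<lambda>s t. \<theta> s \<otimes> B t c))))))"
    proof (intro V_cong esum_cong[OF bilinear_listsD(1)[OF inverse_listsD(2)[OF T]]] V'_cong x z)
      fix s t c assume st: "s \<in> carrier X" "t \<in> carrier X" "c \<in> carrier A"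
      have "(\<lambda>t. esum K (U t c) (\<lambda>x a. B x a)) \<in> functionals K X"
        by (intro mt bilinear_comp[OF B]; simp add: st)
      note functionalsD(3)[OF this functionalsD(1)[OF \<theta>(1) st(1)] st(2)]
      also have "\<theta> s \<otimes> esum K (U t c) (\<lambda>x a. B x a) = esum K (U t c) (\<lambda>x a. \<theta> s \<otimes> B x a)"
        by (rule esum_scale[OF bilinear_listsD(1)[OF U], symmetric]; (intro mt bilinear_comp[OF B])?; simp add: st)
      also have "\<dots> = esum K (U t c) (\<lambda>x a. esum K (V s x) (\<lambda>p q. esum K (V' p q) (\<lambda>s t. \<theta> s \<otimes> B t a)))"
        by (intro esum_cong[OF bilinear_listsD(1)[OF U]] st; (rule inv_V[symmetric, where B' = "\<lambda>s t. \<theta> s \<otimes> B t a" for a])?; (intro mt bilinear_comp[OF B])?; simp add: st)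
      also have "\<dots> = esum K (V s t) (\<lambda>p q. esum K (T q c) (\<lambda>q a. esum K (V' p q) (\<lambda>s t. \<theta> s \<otimes> B t a)))"
        by (rule coassoc[where C = "\<lambda>p q a. esum K (V' p q) (\<lambda>s t. \<theta> s \<otimes> B t a)"]; (intro mt bilinear_comp[OF B])?; simp add: st)
      finally show "esum K (U (\<theta> s \<odot>\<^bsub>X\<^esub> t) c) (\<lambda>x a. B x a) =
        esum K (V s t) (\<lambda>p q. esum K (T q c) (\<lambda>q c. esum K (V' p q) (\<lambda>s t. \<theta> s \<otimes> B t c)))" .
    qed (use z in auto)
    also have "\<dots> = esum K (V x z) (\<lambda>p q. esum K (T' q a) (\<lambda>r c. esum K (T r c) (\<lambda>q c. esum K (V' p q) (\<lambda>s t. \<theta> s \<otimes> B t c))))"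
      by (intro V_cong esum_cong[OF bilinear_listsD(1)[OF inverse_listsD(2)[OF T]]] x z;
          (rule V_inv[where B = "\<lambda>p q. esum K (T q c) (\<lambda>q c. esum K (V' p q) (\<lambda>s t. \<theta> s \<otimes> B t c))" for c])?; (intro mt c)?; simp add: z)
    also have "\<dots> = esum K (V x z) (\<lambda>p q. esum K (V' p q) (\<lambda>s t. \<theta> s \<otimes> B t a))"
      by (intro V_cong x z; rule inverse_listsD(3)[OF T, where B = "\<lambda>q c. esum K (V' p q) (\<lambda>s t. \<theta> s \<otimes> B t c)" for p]; (intro mt c)?; simp add: z)
    also have "\<dots> = \<theta> x \<otimes> B z a"
      by (rule inv_V[where B' = "\<lambda>s t. \<theta> s \<otimes> B t a"]; (intro mt c)?; simp add: x z)
    also have "\<dots> = B z a" using \<theta> bilinear_formsD(3)[OF B z] by simp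
    finally show ?thesis .
  qed
  with l show ?thesis by blast
qed

lemma W_onto:
  assumes "z \<in> carrier X" "a \<in> carrier A"
  shows "\<exists>l\<in>lists (carrier X \<times> carrier A). \<forall>B\<in>bilinear_forms K X A. esum K l (\<lambda>t c. esum K (W t c) B) = B z a"
  by (rule conjugate_onto[OF W T1]) (assumption | rule V_coassoc assms)+

lemma W4_onto:
  assumes "z \<in> carrier X" "a \<in> carrier A"
  shows "\<exists>l\<in>lists (carrier X \<times> carrier A). \<forall>B\<in>bilinear_forms K X A. esum K l (\<lambda>t c. esum K (W4 t c) B) = B z a"
  by (rule conjugate_onto[OF W4 T4]) (assumption | rule V_coassoc4 assms)+

end

text \<open>
  \<open>\<psi>\<^sub>X\<close> is an invariant functional on \<open>X\<close>, normalised at \<open>x0\<close>.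
\<close>

locale coaction_psi = coaction_lists K A T1 T2 T3 T4 T1' T2' T3' T4' X V V' W W4
  for K :: "'k ring" (structure) and A :: "('k, 'a) module" and T1 T2 T3 T4 T1' T2' T3' T4'
    and X :: "('k, 'x) module" and V V' W W4 +
  fixes \<psi>\<^sub>X :: "'x \<Rightarrow> 'k" and x0 :: 'x
  assumes psiX: "\<psi>\<^sub>X \<in> functionals K X" and x0: "x0 \<in> carrier X" "\<psi>\<^sub>X x0 = \<one>"
    and W_psi: "\<lbrakk>f \<in> functionals K A; x \<in> carrier X; c \<in> carrier A\<rbrakk> \<Longrightarrow>
      esum K (W x c) (\<lambda>u v. \<psi>\<^sub>X u \<otimes> f v) = \<psi>\<^sub>X x \<otimes> f c"
    and W4_psi: "\<lbrakk>f \<in> functionals K A; x \<in> carrier X; c \<in> carrier A\<rbrakk> \<Longrightarrow>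
      esum K (W4 x c) (\<lambda>u v. \<psi>\<^sub>X u \<otimes> f v) = \<psi>\<^sub>X x \<otimes> f c"
begin

lemmas psiX_rules = functional_comp[OF psiX] functionalsD(1)[OF psiX]

text \<open>
  \<open>V\<close> identifies the right comodules \<open>X \<otimes> X\<close> and \<open>X \<otimes> A\<close> coacting on the second leg, so an invariant
  functional on \<open>X\<close> can be carried over to \<open>A\<close>.
\<close>

lemma transported_invariance:
  assumes U: "U \<in> bilinear_lists K X A X A" and T: "inverse_lists K A A A A T T'"
    and coassoc: "\<And>C x y c. C \<in> trilinear_forms K X A A \<Longrightarrow> x \<in> carrier X \<Longrightarrow> y \<in> carrier X \<Longrightarrow> c \<in> carrier A \<Longrightarrow>
      esum K (U y c) (\<lambda>u v. esum K (V x u) (\<lambda>p q. C p q v)) =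
      esum K (V x y) (\<lambda>p u. esum K (T u c) (\<lambda>q v. C p q v))"
    and inv: "\<And>f x c. f \<in> functionals K A \<Longrightarrow> x \<in> carrier X \<Longrightarrow> c \<in> carrier A \<Longrightarrow>
      esum K (U x c) (\<lambda>u v. \<psi>\<^sub>X u \<otimes> f v) = \<psi>\<^sub>X x \<otimes> f c"
    and f: "f \<in> functionals K A" and x: "x \<in> carrier X" "a \<in> carrier A" "d \<in> carrier A"
  shows "esum K (T a d) (\<lambda>u v. esum K (V' x u) (\<lambda>s t. \<psi>\<^sub>X s \<otimes> \<psi>\<^sub>X t) \<otimes> f v) =
    esum K (V' x a) (\<lambda>s t. \<psi>\<^sub>X s \<otimes> \<psi>\<^sub>X t) \<otimes> f d"
proof -
  note c = functional_comp[OF f] functionalsD(1)[OF f] psiX_rules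
  note mt = ml list_rules[OF inverse_listsD(1)[OF T]] list_rules[OF U] c
  note T_cong = esum_cong[OF bilinear_listsD(1)[OF inverse_listsD(1)[OF T]]]
  have out: "esum K (V' x u) (\<lambda>s t. \<psi>\<^sub>X s \<otimes> \<psi>\<^sub>X t) \<otimes> f v = esum K (V' x u) (\<lambda>s t. \<psi>\<^sub>X s \<otimes> (\<psi>\<^sub>X t \<otimes> f v))"
    if "u \<in> carrier A" "v \<in> carrier A" for u v
  proof -
    have "esum K (V' x u) (\<lambda>s t. \<psi>\<^sub>X s \<otimes> \<psi>\<^sub>X t) \<otimes> f v = esum K (V' x u) (\<lambda>s t. (\<psi>\<^sub>X s \<otimes> \<psi>\<^sub>X t) \<otimes> f v)"
      by (rule esum_scale_right[OF V'_in, symmetric]; (intro mt)?; simp add: x that)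
    also have "\<dots> = esum K (V' x u) (\<lambda>s t. \<psi>\<^sub>X s \<otimes> (\<psi>\<^sub>X t \<otimes> f v))"
      by (intro V'_cong x that; (rule K.m_assoc)?; (intro c)?; simp add: that)
    finally show ?thesis .
  qed
  have "esum K (T a d) (\<lambda>u v. esum K (V' x u) (\<lambda>s t. \<psi>\<^sub>X s \<otimes> \<psi>\<^sub>X t) \<otimes> f v) =
    esum K (T a d) (\<lambda>u v. esum K (V' x u) (\<lambda>s t. \<psi>\<^sub>X s \<otimes> (\<psi>\<^sub>X t \<otimes> f v)))"
    by (intro T_cong x out; assumption)
  also have "\<dots> = esum K (V' x a) (\<lambda>s t. esum K (V s t) (\<lambda>p u. esum K (T u d) (\<lambda>q v. esum K (V' p q) (\<lambda>s t. \<psi>\<^sub>X s \<otimes> (\<psi>\<^sub>X t \<otimes> f v)))))"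
    by (rule V_inv[symmetric, where B = "\<lambda>p u. esum K (T u d) (\<lambda>q v. esum K (V' p q) (\<lambda>s t. \<psi>\<^sub>X s \<otimes> (\<psi>\<^sub>X t \<otimes> f v)))"]; (intro mt)?; simp add: x)
  also have "\<dots> = esum K (V' x a) (\<lambda>s t. esum K (U t d) (\<lambda>u v. esum K (V s u) (\<lambda>p q. esum K (V' p q) (\<lambda>s t. \<psi>\<^sub>X s \<otimes> (\<psi>\<^sub>X t \<otimes> f v)))))"
    by (intro V'_cong x; rule coassoc[symmetric, where C = "\<lambda>p q v. esum K (V' p q) (\<lambda>s t. \<psi>\<^sub>X s \<otimes> (\<psi>\<^sub>X t \<otimes> f v))"]; (intro mt)?; simp add: x)
  also have "\<dots> = esum K (V' x a) (\<lambda>s t. esum K (U t d) (\<lambda>u v. \<psi>\<^sub>X s \<otimes> (\<psi>\<^sub>X u \<otimes> f v)))"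
    by (intro V'_cong esum_cong[OF bilinear_listsD(1)[OF U]] x; (rule inv_V[where B' = "\<lambda>s t. \<psi>\<^sub>X s \<otimes> (\<psi>\<^sub>X t \<otimes> f v)" for v])?; (intro mt)?; simp add: x)
  also have "\<dots> = esum K (V' x a) (\<lambda>s t. \<psi>\<^sub>X s \<otimes> (\<psi>\<^sub>X t \<otimes> f d))"
  proof (intro V'_cong x)
    fix s t assume st: "s \<in> carrier X" "t \<in> carrier X"
    have "esum K (U t d) (\<lambda>u v. \<psi>\<^sub>X s \<otimes> (\<psi>\<^sub>X u \<otimes> f v)) = \<psi>\<^sub>X s \<otimes> esum K (U t d) (\<lambda>u v. \<psi>\<^sub>X u \<otimes> f v)"
      by (rule esum_scale[OF bilinear_listsD(1)[OF U]]; (intro mt)?; simp add: x st)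
    then show "esum K (U t d) (\<lambda>u v. \<psi>\<^sub>X s \<otimes> (\<psi>\<^sub>X u \<otimes> f v)) = \<psi>\<^sub>X s \<otimes> (\<psi>\<^sub>X t \<otimes> f d)"
      using inv[OF f st(2) x(3)] by simp
  qed
  also have "\<dots> = esum K (V' x a) (\<lambda>s t. \<psi>\<^sub>X s \<otimes> \<psi>\<^sub>X t) \<otimes> f d" by (rule out[symmetric, OF x(2,3)])
  finally show ?thesis .
qed

text \<open>
  An algebraic quantum group is only given with a left invariant functional. A right invariant one on
  \<open>A\<close> is obtained here from \<open>\<psi>\<^sub>X\<close> by transport along the Galois map, as
  \<open>a \<mapsto> (\<psi>\<^sub>X \<otimes> \<psi>\<^sub>X)(V\<inverse>(p \<otimes> a))\<close> for some \<open>p\<close> that makes it non-zero. The usual construction \<open>\<phi> \<circ> S\<close> would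
  presuppose the antipode, which is only defined by means of \<open>\<psi>\<close>.
\<close>

lemma hopf_integral_exists:
  "\<exists>\<psi> e. hopf_integral K A T1 T2 T3 T4 T1' T2' T3' T4' \<psi> e"
proof -
  let ?B = "\<lambda>s t. \<psi>\<^sub>X s \<otimes> \<psi>\<^sub>X t"
  have B: "?B \<in> bilinear_forms K X X" by (intro ml psiX_rules; assumption)
  have "\<exists>p\<in>carrier X. \<exists>q\<in>carrier A. esum K (V' p q) ?B \<noteq> \<zero>"
  proof (rule ccontr)
    assume "\<not> ?thesis"
    then have "esum K (V x0 x0) (\<lambda>p q. esum K (V' p q) ?B) = esum K (V x0 x0) (\<lambda>p q. \<zero>)"
      by (intro V_cong x0) auto
    then show False using inv_V[OF B x0(1) x0(1)] x0(2) by simp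
  qed
  then obtain p q where pq: "p \<in> carrier X" "q \<in> carrier A" "esum K (V' p q) ?B \<noteq> \<zero>" by blast
  define \<psi> where "\<psi> = (\<lambda>a. esum K (V' p a) ?B)"
  define e where "e = inv (\<psi> q) \<odot>\<^bsub>A\<^esub> q"
  have psi: "\<psi> \<in> functionals K A"
    unfolding \<psi>_def by (intro ml psiX_rules; simp add: pq)
  have i: "inv (\<psi> q) \<in> carrier K" "inv (\<psi> q) \<otimes> \<psi> q = \<one>"
    using pq(3) functionalsD(1)[OF psi pq(2)] unfolding \<psi>_def[symmetric] by (auto simp: K.field_Units \<psi>_def)
  have e: "e \<in> carrier A" "\<psi> e = \<one>"
    using functionalsD(3)[OF psi i(1) pq(2)] i pq(2) by (simp_all add: e_def)
  have "hopf_integral K A T1 T2 T3 T4 T1' T2' T3' T4' \<psi> e"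
  proof (rule hopf_integral.intro[OF hopf_lists_axioms], rule hopf_integral_axioms.intro)
    fix f a d assume fad: "f \<in> functionals K A" "a \<in> carrier A" "d \<in> carrier A"
    show "esum K (T1 a d) (\<lambda>u v. \<psi> u \<otimes> f v) = \<psi> a \<otimes> f d"
      unfolding \<psi>_def by (rule transported_invariance[OF W T1]) (assumption | rule V_coassoc W_psi fad pq)+
    show "esum K (T4 a d) (\<lambda>u v. \<psi> u \<otimes> f v) = \<psi> a \<otimes> f d"
      unfolding \<psi>_def by (rule transported_invariance[OF W4 T4]) (assumption | rule V_coassoc4 W4_psi fad pq)+
  qed (rule psi e)+
  then show ?thesis by blast
qed

end

text \<open>
  \<open>\<phi>\<^sub>X\<close> is determined by \<open>(\<iota> \<otimes> \<phi>)((x \<otimes> 1) \<alpha>(y)) = \<phi>\<^sub>X(y) x\<close>. Taking \<open>X = A\<close> and \<open>\<phi>\<^sub>X = \<phi>\<close> is allowed.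
\<close>

locale coaction_integrals = coaction_psi K A T1 T2 T3 T4 T1' T2' T3' T4' X V V' W W4 \<psi>\<^sub>X x0
  for K :: "'k ring" (structure) and A :: "('k, 'a) module" and T1 T2 T3 T4 T1' T2' T3' T4'
    and X :: "('k, 'x) module" and V V' W W4 and \<psi>\<^sub>X x0 +
  fixes \<phi> :: "'a \<Rightarrow> 'k" and f :: 'a and \<phi>\<^sub>X :: "'x \<Rightarrow> 'k"
  assumes phi: "\<phi> \<in> functionals K A" and f: "f \<in> carrier A" "\<phi> f = \<one>"
    and phiX: "\<phi>\<^sub>X \<in> functionals K X"
    and V_phi: "\<lbrakk>g \<in> functionals K X; x \<in> carrier X; y \<in> carrier X\<rbrakk> \<Longrightarrow>
      esum K (V x y) (\<lambda>u v. \<phi> v \<otimes> g u) = \<phi>\<^sub>X y \<otimes> g x"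
begin

lemmas phi_rules = functional_comp[OF phi] functionalsD(1)[OF phi]
lemmas phiX_rules = functional_comp[OF phiX] functionalsD(1)[OF phiX]

text \<open>
  Both lemmas evaluate \<open>\<psi>\<^sub>X \<otimes> \<phi>\<close> on \<open>(x \<otimes> b) \<alpha>(y)\<close>, writing \<open>x \<otimes> b\<close> as a sum of elements
  \<open>(s \<otimes> 1) \<alpha>(t)\<close> or of elements \<open>(1 \<otimes> c) \<alpha>(t)\<close>.
\<close>

lemma V_phi_psi:
  assumes x: "x \<in> carrier X" "z \<in> carrier X" "y \<in> carrier X" and g: "g \<in> functionals K X"
  shows "esum K (V x z) (\<lambda>u b. esum K (V u y) (\<lambda>p q. \<phi> (b \<otimes>\<^bsub>A\<^esub> q) \<otimes> g p)) = \<phi>\<^sub>X (z \<otimes>\<^bsub>X\<^esub> y) \<otimes> g x"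
proof -
  note c = functional_comp[OF g] functionalsD(1)[OF g] phi_rules
  have "esum K (V x z) (\<lambda>u b. esum K (V u y) (\<lambda>p q. \<phi> (b \<otimes>\<^bsub>A\<^esub> q) \<otimes> g p)) =
    esum K (V x (z \<otimes>\<^bsub>X\<^esub> y)) (\<lambda>p q. \<phi> q \<otimes> g p)"
    by (rule V_hom[symmetric, where B = "\<lambda>p q. \<phi> q \<otimes> g p"]; (intro ml c)?; simp add: x)
  also have "\<dots> = \<phi>\<^sub>X (z \<otimes>\<^bsub>X\<^esub> y) \<otimes> g x" by (rule V_phi[OF g x(1) X.mult_closed[OF x(2,3)]])
  finally show ?thesis .
qed

lemma W4_phi_psi:
  assumes x: "w \<in> carrier X" "y \<in> carrier X" "a \<in> carrier A"
  shows "esum K (W4 w a) (\<lambda>u b. esum K (V u y) (\<lambda>p q. \<phi> (b \<otimes>\<^bsub>A\<^esub> q) \<otimes> \<psi>\<^sub>X p)) = \<phi> a \<otimes> \<psi>\<^sub>X (w \<otimes>\<^bsub>X\<^esub> y)"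
proof -
  note c = psiX_rules phi_rules
  have "esum K (W4 w a) (\<lambda>u b. esum K (V u y) (\<lambda>p q. \<phi> (b \<otimes>\<^bsub>A\<^esub> q) \<otimes> \<psi>\<^sub>X p)) =
    esum K (W4 (w \<otimes>\<^bsub>X\<^esub> y) a) (\<lambda>p q. \<phi> q \<otimes> \<psi>\<^sub>X p)"
    by (rule W4_hom[symmetric, where B = "\<lambda>p q. \<phi> q \<otimes> \<psi>\<^sub>X p"]; (intro ml c)?; simp add: x)
  also have "\<dots> = esum K (W4 (w \<otimes>\<^bsub>X\<^esub> y) a) (\<lambda>p q. \<psi>\<^sub>X p \<otimes> \<phi> q)"
    by (intro W4_cong x X.mult_closed; (rule K.m_comm)?; (intro c)?; assumption)
  also have "\<dots> = \<psi>\<^sub>X (w \<otimes>\<^bsub>X\<^esub> y) \<otimes> \<phi> a" by (rule W4_psi[OF phi X.mult_closed[OF x(1,2)] x(3)])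
  also have "\<dots> = \<phi> a \<otimes> \<psi>\<^sub>X (w \<otimes>\<^bsub>X\<^esub> y)"
    by (rule K.m_comm) (simp_all add: c(2,4) x X.mult_closed)
  finally show ?thesis .
qed

text \<open>
  By invariance \<open>\<psi>\<^sub>X(w y)\<close> is \<open>(\<psi>\<^sub>X \<otimes> \<phi>)((1 \<otimes> f) \<alpha>(w) \<alpha>(y))\<close>. Expanding \<open>(1 \<otimes> f) \<alpha>(w)\<close> in elements
  \<open>(s \<otimes> 1) \<alpha>(t)\<close> gives a combination of the functionals \<open>\<phi>\<^sub>X(t \<cdot>)\<close>. For the converse inclusion, \<open>phiX_left\<close>,
  \<open>(x0 \<otimes> 1) \<alpha>(z)\<close> is expanded in elements \<open>(1 \<otimes> c) \<alpha>(t)\<close>.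
\<close>

lemma psiX_left:
  assumes w: "w \<in> carrier X"
  shows "(\<lambda>y. \<psi>\<^sub>X (w \<otimes>\<^bsub>X\<^esub> y)) \<in> X.left_translates \<phi>\<^sub>X"
proof -
  note c = psiX_rules phi_rules
  have 0: "(\<lambda>y. \<psi>\<^sub>X s \<otimes> \<phi>\<^sub>X (t \<otimes>\<^bsub>X\<^esub> y)) \<in> X.left_translates \<phi>\<^sub>X" if "s \<in> carrier X" "t \<in> carrier X" for s t
    by (rule X.left_translates_scale[OF phiX functionalsD(1)[OF psiX that(1)] X.left_translatesI[OF that(2), where \<chi> = \<phi>\<^sub>X]])
  have 1: "(\<lambda>y. esum K (V' x b) (\<lambda>s t. \<psi>\<^sub>X s \<otimes> \<phi>\<^sub>X (t \<otimes>\<^bsub>X\<^esub> y))) \<in> X.left_translates \<phi>\<^sub>X"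
    if "x \<in> carrier X" "b \<in> carrier A" for x b
    by (rule X.left_translates_esum[OF phiX V'_in[OF that] 0])
  have "(\<lambda>y. esum K (W4 w f) (\<lambda>x b. esum K (V' x b) (\<lambda>s t. \<psi>\<^sub>X s \<otimes> \<phi>\<^sub>X (t \<otimes>\<^bsub>X\<^esub> y)))) \<in> X.left_translates \<phi>\<^sub>X"
    by (rule X.left_translates_esum[OF phiX W4_in[OF w f(1)] 1])
  then show ?thesis
  proof (rule X.left_translates_cong)
    fix y assume y: "y \<in> carrier X"
    have "\<psi>\<^sub>X (w \<otimes>\<^bsub>X\<^esub> y) = esum K (W4 w f) (\<lambda>u b. esum K (V u y) (\<lambda>p q. \<phi> (b \<otimes>\<^bsub>A\<^esub> q) \<otimes> \<psi>\<^sub>X p))"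
      using W4_phi_psi[OF w y f(1)] f(2) c(2) w y by (simp add: X.mult_closed)
    also have "\<dots> = esum K (W4 w f) (\<lambda>x b. esum K (V' x b) (\<lambda>s t. esum K (V s t) (\<lambda>u b. esum K (V u y) (\<lambda>p q. \<phi> (b \<otimes>\<^bsub>A\<^esub> q) \<otimes> \<psi>\<^sub>X p))))"
      by (intro W4_cong w f; rule V_inv[symmetric, where B = "\<lambda>u b. esum K (V u y) (\<lambda>p q. \<phi> (b \<otimes>\<^bsub>A\<^esub> q) \<otimes> \<psi>\<^sub>X p)"]; (intro ml c)?; simp add: y)
    also have "\<dots> = esum K (W4 w f) (\<lambda>x b. esum K (V' x b) (\<lambda>s t. \<psi>\<^sub>X s \<otimes> \<phi>\<^sub>X (t \<otimes>\<^bsub>X\<^esub> y)))"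
      by (intro W4_cong V'_cong w f) (simp_all add: V_phi_psi[OF _ _ y psiX] K.m_comm c(2) phiX_rules(2) y X.mult_closed)
    finally show "\<psi>\<^sub>X (w \<otimes>\<^bsub>X\<^esub> y) = \<dots>" .
  qed
qed

lemma phiX_left:
  assumes z: "z \<in> carrier X"
  shows "(\<lambda>y. \<phi>\<^sub>X (z \<otimes>\<^bsub>X\<^esub> y)) \<in> X.left_translates \<psi>\<^sub>X"
proof -
  note c = psiX_rules phi_rules
  let ?R = "\<lambda>u b y. esum K (V u y) (\<lambda>p q. \<phi> (b \<otimes>\<^bsub>A\<^esub> q) \<otimes> \<psi>\<^sub>X p)"
  have 1: "(\<lambda>y. ?R u b y) \<in> X.left_translates \<psi>\<^sub>X" if u: "u \<in> carrier X" "b \<in> carrier A" for u b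
  proof -
    obtain l where l: "l \<in> lists (carrier X \<times> carrier A)"
      and lB: "\<And>B. B \<in> bilinear_forms K X A \<Longrightarrow> esum K l (\<lambda>t c. esum K (W4 t c) B) = B u b"
      using W4_onto[OF u] by blast
    have 0: "(\<lambda>y. \<phi> d \<otimes> \<psi>\<^sub>X (t \<otimes>\<^bsub>X\<^esub> y)) \<in> X.left_translates \<psi>\<^sub>X" if "t \<in> carrier X" "d \<in> carrier A" for t d
      by (rule X.left_translates_scale[OF psiX functionalsD(1)[OF phi that(2)] X.left_translatesI[OF that(1), where \<chi> = \<psi>\<^sub>X]])
    have "(\<lambda>y. esum K l (\<lambda>t d. \<phi> d \<otimes> \<psi>\<^sub>X (t \<otimes>\<^bsub>X\<^esub> y))) \<in> X.left_translates \<psi>\<^sub>X"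
      by (rule X.left_translates_esum[OF psiX l 0])
    then show ?thesis
    proof (rule X.left_translates_cong)
      fix y assume y: "y \<in> carrier X"
      have B: "(\<lambda>u b. ?R u b y) \<in> bilinear_forms K X A" by (intro ml c; simp add: y)
      show "?R u b y = esum K l (\<lambda>t d. \<phi> d \<otimes> \<psi>\<^sub>X (t \<otimes>\<^bsub>X\<^esub> y))"
        unfolding lB[OF B, symmetric] by (rule esum_cong[OF l]) (rule W4_phi_psi[OF _ y])
    qed
  qed
  have "(\<lambda>y. esum K (V x0 z) (\<lambda>u b. ?R u b y)) \<in> X.left_translates \<psi>\<^sub>X"
    by (rule X.left_translates_esum[OF psiX V_in[OF x0(1) z] 1])
  then show ?thesis
  proof (rule X.left_translates_cong)
    fix y assume y: "y \<in> carrier X"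
    show "\<phi>\<^sub>X (z \<otimes>\<^bsub>X\<^esub> y) = esum K (V x0 z) (\<lambda>u b. ?R u b y)"
      using V_phi_psi[OF x0(1) z y psiX] x0(2) phiX_rules(2) z y by (simp add: X.mult_closed)
  qed
qed

end

section \<open>The modular property on the quantum group\<close>

text \<open>
  A right invariant \<open>\<psi>\<close> and a left invariant \<open>\<phi>\<close> on the same algebra. Left invariance is assumed in the
  single form \<open>(\<iota> \<otimes> \<phi>)(\<Delta>(a) (c \<otimes> 1)) = \<phi>(a) c\<close>.
\<close>

locale hopf_haar = hopf_integral K A T1 T2 T3 T4 T1' T2' T3' T4' \<psi> e
  for K :: "'k ring" (structure) and A :: "('k, 'a) module" and T1 T2 T3 T4 T1' T2' T3' T4' and \<psi> e +
  fixes \<phi> :: "'a \<Rightarrow> 'k" and f :: 'a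
  assumes phi: "\<phi> \<in> functionals K A" and f: "f \<in> carrier A" "\<phi> f = \<one>"
    and phi3: "\<lbrakk>g \<in> functionals K A; a \<in> carrier A; c \<in> carrier A\<rbrakk> \<Longrightarrow>
      esum K (T3 a c) (\<lambda>u v. \<phi> v \<otimes> g u) = \<phi> a \<otimes> g c"
begin

lemmas phi_A_rules = functional_comp[OF phi] functionalsD(1)[OF phi]

text \<open>
  Left invariance with the cover on the other side. The two agree after multiplication by a further
  element of the first leg.
\<close>

lemma phi2:
  assumes g: "g \<in> functionals K A" and x: "a \<in> carrier A" "d \<in> carrier A"
  shows "esum K (T2 d a) (\<lambda>u v. \<phi> v \<otimes> g u) = \<phi> a \<otimes> g d"
proof -
  interpret vA: vec K A using vec_of_nd A.nd_algebra_axioms .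
  let ?z = "esum A (T2 d a) (\<lambda>u v. \<phi> v \<odot>\<^bsub>A\<^esub> u)"
  have z: "?z \<in> carrier A" by (rule A.B.M.esum_closed[OF T_in(2)]) (simp_all add: x phi_A_rules(2))
  have gz: "h ?z = esum K (T2 d a) (\<lambda>u v. \<phi> v \<otimes> h u)" if h: "h \<in> functionals K A" for h
  proof -
    have "h ?z = esum K (T2 d a) (\<lambda>u v. h (\<phi> v \<odot>\<^bsub>A\<^esub> u))"
      by (rule functionals_esum[OF A.B.module_axioms K.field_axioms h T_in(2)]) (simp_all add: x phi_A_rules(2))
    also have "\<dots> = esum K (T2 d a) (\<lambda>u v. \<phi> v \<otimes> h u)"
      by (intro T2_cong x functionalsD(3)[OF h] phi_A_rules(2))
    finally show ?thesis .
  qed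
  have "?z = \<phi> a \<odot>\<^bsub>A\<^esub> d"
  proof (rule A.eq_by_right_mult[OF z])
    fix b assume b: "b \<in> carrier A"
    show "?z \<otimes>\<^bsub>A\<^esub> b = (\<phi> a \<odot>\<^bsub>A\<^esub> d) \<otimes>\<^bsub>A\<^esub> b"
    proof (rule vA.functional_ext)
      fix h assume h: "h \<in> functionals K A"
      note hb = functional_comp[OF h A.mult_linear_left[OF b]]
      note c = functional_comp[OF h] functionalsD(1)[OF h] phi_A_rules
      have "h (?z \<otimes>\<^bsub>A\<^esub> b) = esum K (T2 d a) (\<lambda>u v. \<phi> v \<otimes> h (u \<otimes>\<^bsub>A\<^esub> b))" by (rule gz[OF hb])
      also have "\<dots> = esum K (T3 a b) (\<lambda>u v. \<phi> v \<otimes> h (d \<otimes>\<^bsub>A\<^esub> u))"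
        by (rule T23[where B = "\<lambda>u v. \<phi> v \<otimes> h u"]; (intro ml_A c)?; simp add: x b)
      also have "\<dots> = \<phi> a \<otimes> h (d \<otimes>\<^bsub>A\<^esub> b)"
        by (rule phi3[OF functional_comp[OF h A.mult_linear_right[OF x(2)]] x(1) b])
      also have "\<dots> = h ((\<phi> a \<odot>\<^bsub>A\<^esub> d) \<otimes>\<^bsub>A\<^esub> b)"
        using functionalsD(3)[OF hb phi_A_rules(2)[OF x(1)] x(2)] by simp
      finally show "h (?z \<otimes>\<^bsub>A\<^esub> b) = h ((\<phi> a \<odot>\<^bsub>A\<^esub> d) \<otimes>\<^bsub>A\<^esub> b)" .
    qed (simp_all add: z x b A.mult_closed phi_A_rules(2))
  qed (simp_all add: x phi_A_rules(2))
  then have "g ?z = \<phi> a \<otimes> g d" using functionalsD(3)[OF g phi_A_rules(2)[OF x(1)] x(2)] by simp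
  then show ?thesis using gz[OF g] by simp
qed

lemma op_integral:
  "hopf_integral K A.op_alg (\<lambda>a c. map prod.swap (T2 c a)) (\<lambda>c a. map prod.swap (T1 a c))
    (\<lambda>a c. map prod.swap (T4 a c)) (\<lambda>a c. map prod.swap (T3 a c))
    (\<lambda>p q. map prod.swap (T2' q p)) (\<lambda>p q. map prod.swap (T1' q p)) (\<lambda>p q. T4' q p) (\<lambda>p q. T3' q p) \<phi> f"
  by (rule hopf_integral.intro[OF opposite], rule hopf_integral_axioms.intro)
    (simp_all add: phi f phi2 phi3)

lemma T1_phi_translate:
  assumes g: "g \<in> functionals K A" and x: "b \<in> carrier A" "d \<in> carrier A"
  shows "(\<lambda>a. esum K (T1 a b) (\<lambda>u v. \<phi> v \<otimes> g (d \<otimes>\<^bsub>A\<^esub> u))) \<in> A.right_translates \<phi>"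
  using hopf_integral.T2_psi_translate[OF op_integral, of g b d] g x
  by (simp add: nd_algebra.left_translates_def[OF A.nd_algebra_op] A.right_translates_def)

lemma phi_translate_expand:
  assumes g: "g \<in> functionals K A" "t \<in> carrier A" "g t = \<one>" and w: "w \<in> carrier A"
  shows "\<exists>l\<in>lists (carrier A \<times> carrier A). \<forall>a\<in>carrier A.
    \<phi> (a \<otimes>\<^bsub>A\<^esub> w) = esum K l (\<lambda>b d. esum K (T1 a b) (\<lambda>u v. \<phi> v \<otimes> g (d \<otimes>\<^bsub>A\<^esub> u)))"
  using hopf_integral.psi_translate_expand[OF op_integral, of g t w] g w by simp

text \<open>
  Both sides are \<open>(\<psi> \<otimes> \<phi>)((b \<otimes> 1) \<Delta>(a) (1 \<otimes> d))\<close>. Read from the left it is a left translate of \<open>\<psi>\<close> and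
  read from the right it is a right translate of \<open>\<phi>\<close>, as functions of \<open>a\<close>.
\<close>

lemma T2_T1_swap:
  assumes "b \<in> carrier A" "d \<in> carrier A" "a \<in> carrier A"
  shows "esum K (T2 b a) (\<lambda>u v. \<psi> u \<otimes> \<phi> (v \<otimes>\<^bsub>A\<^esub> d)) = esum K (T1 a d) (\<lambda>u v. \<phi> v \<otimes> \<psi> (b \<otimes>\<^bsub>A\<^esub> u))"
proof -
  have "esum K (T2 b a) (\<lambda>u v. \<psi> u \<otimes> \<phi> (v \<otimes>\<^bsub>A\<^esub> d)) = esum K (T1 a d) (\<lambda>u v. \<psi> (b \<otimes>\<^bsub>A\<^esub> u) \<otimes> \<phi> v)"
    by (rule T21[where B = "\<lambda>u v. \<psi> u \<otimes> \<phi> v"]; (intro ml_A phi_A_rules psi_rules)?; simp add: assms)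
  also have "\<dots> = esum K (T1 a d) (\<lambda>u v. \<phi> v \<otimes> \<psi> (b \<otimes>\<^bsub>A\<^esub> u))"
    by (intro T1_cong assms; (rule K.m_comm)?; (intro psi_rules phi_A_rules A.mult_closed)?; simp add: assms)
  finally show ?thesis .
qed

lemma psi_left_phi_right:
  assumes w: "w \<in> carrier A"
  shows "(\<lambda>a. \<psi> (w \<otimes>\<^bsub>A\<^esub> a)) \<in> A.right_translates \<phi>"
proof -
  obtain l where l: "l \<in> lists (carrier A \<times> carrier A)"
    and lw: "\<And>a. a \<in> carrier A \<Longrightarrow> \<psi> (w \<otimes>\<^bsub>A\<^esub> a) = esum K l (\<lambda>b d. esum K (T2 b a) (\<lambda>u v. \<psi> u \<otimes> \<phi> (v \<otimes>\<^bsub>A\<^esub> d)))"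
    using psi_translate_expand[OF phi f w] by blast
  have "(\<lambda>a. esum K l (\<lambda>b d. esum K (T1 a d) (\<lambda>u v. \<phi> v \<otimes> \<psi> (b \<otimes>\<^bsub>A\<^esub> u)))) \<in> A.right_translates \<phi>"
    by (rule A.right_translates_esum[OF phi l T1_phi_translate[OF psi]])
  then show ?thesis
  proof (rule A.right_translates_cong)
    fix a assume a: "a \<in> carrier A"
    show "\<psi> (w \<otimes>\<^bsub>A\<^esub> a) = esum K l (\<lambda>b d. esum K (T1 a d) (\<lambda>u v. \<phi> v \<otimes> \<psi> (b \<otimes>\<^bsub>A\<^esub> u)))"
      unfolding lw[OF a] by (rule esum_cong[OF l]) (rule T2_T1_swap[OF _ _ a])
  qed
qed

lemma phi_right_psi_left:
  assumes w: "w \<in> carrier A"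
  shows "(\<lambda>a. \<phi> (a \<otimes>\<^bsub>A\<^esub> w)) \<in> A.left_translates \<psi>"
proof -
  obtain l where l: "l \<in> lists (carrier A \<times> carrier A)"
    and lw: "\<And>a. a \<in> carrier A \<Longrightarrow> \<phi> (a \<otimes>\<^bsub>A\<^esub> w) = esum K l (\<lambda>b d. esum K (T1 a b) (\<lambda>u v. \<phi> v \<otimes> \<psi> (d \<otimes>\<^bsub>A\<^esub> u)))"
    using phi_translate_expand[OF psi e w] by blast
  have "(\<lambda>a. esum K l (\<lambda>b d. esum K (T2 d a) (\<lambda>u v. \<psi> u \<otimes> \<phi> (v \<otimes>\<^bsub>A\<^esub> b)))) \<in> A.left_translates \<psi>"
    by (rule A.left_translates_esum[OF psi l T2_psi_translate[OF phi]])
  then show ?thesis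
  proof (rule A.left_translates_cong)
    fix a assume a: "a \<in> carrier A"
    show "\<phi> (a \<otimes>\<^bsub>A\<^esub> w) = esum K l (\<lambda>b d. esum K (T2 d a) (\<lambda>u v. \<psi> u \<otimes> \<phi> (v \<otimes>\<^bsub>A\<^esub> b)))"
      unfolding lw[OF a] by (rule esum_cong[OF l]) (rule T2_T1_swap[OF _ _ a, symmetric])
  qed
qed

lemma self_integrals: "coaction_integrals K A T1 T2 T3 T4 T1' T2' T3' T4' A T2 T2' T1 T4 \<psi> e \<phi> f \<phi>"
  by (intro coaction_integrals.intro coaction_psi.intro self_coaction coaction_psi_axioms.intro coaction_integrals_axioms.intro)
    (simp_all add: psi e psi1 psi4 phi f phi2)

lemmas psi_left_phi_left = coaction_integrals.psiX_left[OF self_integrals]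
  and phi_left_psi_left = coaction_integrals.phiX_left[OF self_integrals]

text \<open>
  The existence of a modular automorphism for \<open>\<phi>\<close>, without constructing it: the functionals \<open>\<phi>(b \<cdot>)\<close> are
  functionals \<open>\<psi>(w \<cdot>)\<close> by the comparison on \<open>X = A\<close>, and these are functionals \<open>\<phi>(\<cdot> w')\<close>.
\<close>

lemma phi_left_right:
  assumes b: "b \<in> carrier A"
  shows "(\<lambda>a. \<phi> (b \<otimes>\<^bsub>A\<^esub> a)) \<in> A.right_translates \<phi>"
proof -
  obtain w where w: "w \<in> carrier A" "\<And>a. a \<in> carrier A \<Longrightarrow> \<phi> (b \<otimes>\<^bsub>A\<^esub> a) = \<psi> (w \<otimes>\<^bsub>A\<^esub> a)"
    using phi_left_psi_left[OF b] unfolding A.left_translates_def by blast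
  show ?thesis by (rule A.right_translates_cong[OF psi_left_phi_right[OF w(1)] w(2)])
qed

lemma phi_right_left:
  assumes b: "b \<in> carrier A"
  shows "(\<lambda>a. \<phi> (a \<otimes>\<^bsub>A\<^esub> b)) \<in> A.left_translates \<phi>"
proof -
  obtain w where w: "w \<in> carrier A" "\<And>a. a \<in> carrier A \<Longrightarrow> \<phi> (a \<otimes>\<^bsub>A\<^esub> b) = \<psi> (w \<otimes>\<^bsub>A\<^esub> a)"
    using phi_right_psi_left[OF b] unfolding A.left_translates_def by blast
  show ?thesis by (rule A.left_translates_cong[OF psi_left_phi_left[OF w(1)] w(2)])
qed

end

section \<open>Faithfulness of the left invariant functional\<close>

context hopf_haar
begin

lemma psi_vanish:
  assumes n: "n \<in> carrier A" "\<And>d. d \<in> carrier A \<Longrightarrow> \<phi> (d \<otimes>\<^bsub>A\<^esub> n) = \<zero>"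
    and h: "h \<in> functionals K A" and b: "b \<in> carrier A"
  shows "esum K (T2 b n) (\<lambda>u v. \<psi> u \<otimes> h v) = \<zero>"
proof -
  interpret vA: vec K A using vec_of_nd A.nd_algebra_axioms .
  let ?z = "esum A (T2 b n) (\<lambda>u v. \<psi> u \<odot>\<^bsub>A\<^esub> v)"
  have z: "?z \<in> carrier A" by (rule A.B.M.esum_closed[OF T_in(2)]) (simp_all add: n b psi_rules(2))
  have gz: "g ?z = esum K (T2 b n) (\<lambda>u v. \<psi> u \<otimes> g v)" if g: "g \<in> functionals K A" for g
  proof -
    have "g ?z = esum K (T2 b n) (\<lambda>u v. g (\<psi> u \<odot>\<^bsub>A\<^esub> v))"
      by (rule functionals_esum[OF A.B.module_axioms K.field_axioms g T_in(2)]) (simp_all add: n b psi_rules(2))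
    also have "\<dots> = esum K (T2 b n) (\<lambda>u v. \<psi> u \<otimes> g v)"
      by (intro T2_cong b n functionalsD(3)[OF g] psi_rules(2))
    finally show ?thesis .
  qed
  have "?z = \<zero>\<^bsub>A\<^esub>"
  proof (rule A.nondegenerate_left[OF z], intro ballI)
    fix d assume d: "d \<in> carrier A"
    show "?z \<otimes>\<^bsub>A\<^esub> d = \<zero>\<^bsub>A\<^esub>"
    proof (rule vA.functional_zeroI)
      fix g assume g: "g \<in> functionals K A"
      obtain w where w: "w \<in> carrier A" "\<And>a. a \<in> carrier A \<Longrightarrow> esum K (T2 b a) (\<lambda>u v. \<psi> u \<otimes> g (v \<otimes>\<^bsub>A\<^esub> d)) = \<psi> (w \<otimes>\<^bsub>A\<^esub> a)"
        using T2_psi_translate[OF g b d] unfolding A.left_translates_def by blast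
      obtain w' where w': "w' \<in> carrier A" "\<And>a. a \<in> carrier A \<Longrightarrow> \<psi> (w \<otimes>\<^bsub>A\<^esub> a) = \<phi> (w' \<otimes>\<^bsub>A\<^esub> a)"
        using psi_left_phi_left[OF w(1)] unfolding A.left_translates_def by blast
      show "g (?z \<otimes>\<^bsub>A\<^esub> d) = \<zero>"
        using gz[OF functional_comp[OF g A.mult_linear_left[OF d]]] w(2)[OF n(1)] w'(2)[OF n(1)] n(2)[OF w'(1)] by simp
    qed (simp add: z d A.mult_closed)
  qed
  then show ?thesis using gz[OF h] vA.functional_zero[OF h] by simp
qed

text \<open>
  A null element \<open>n\<close> satisfies \<open>T\<^sub>3(x \<otimes> z n) = T\<^sub>1(\<iota> \<otimes> S) T\<^sub>2(x \<otimes> z n)\<close>, and the first leg of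
  \<open>T\<^sub>2(x \<otimes> z n)\<close> consists of null elements. Applying left invariance to \<open>T\<^sub>3\<close> and \<open>T\<^sub>1\<close> kills \<open>e n\<close>.
\<close>

lemma phi_faithful:
  assumes n: "n \<in> carrier A" "\<And>d. d \<in> carrier A \<Longrightarrow> \<phi> (d \<otimes>\<^bsub>A\<^esub> n) = \<zero>"
  shows "n = \<zero>\<^bsub>A\<^esub>"
proof -
  interpret vA: vec K A using vec_of_nd A.nd_algebra_axioms .
  have key: "esum K (T3 x (z \<otimes>\<^bsub>A\<^esub> n)) (\<lambda>p r. \<phi> r \<otimes> g (d \<otimes>\<^bsub>A\<^esub> p)) = \<zero>"
    if x: "x \<in> carrier A" "z \<in> carrier A" "d \<in> carrier A" and g: "g \<in> functionals K A" for x z d g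
  proof -
    have zn: "z \<otimes>\<^bsub>A\<^esub> n \<in> carrier A" "\<And>d. d \<in> carrier A \<Longrightarrow> \<phi> (d \<otimes>\<^bsub>A\<^esub> (z \<otimes>\<^bsub>A\<^esub> n)) = \<zero>"
      using n x by (simp_all add: A.mult_closed A.mult_assoc[symmetric])
    note c = functional_comp[OF g] functionalsD(1)[OF g] phi_A_rules
    let ?\<beta> = "\<lambda>u v. esum K (T1 u (S v)) (\<lambda>p r. \<phi> r \<otimes> g (d \<otimes>\<^bsub>A\<^esub> p))"
    have \<beta>: "?\<beta> \<in> bilinear_forms K A A" by (intro ml_S c; simp add: x)
    have "\<exists>b\<in>carrier A. \<forall>u\<in>carrier A. ?\<beta> u v = \<psi> (b \<otimes>\<^bsub>A\<^esub> u)" if v: "v \<in> carrier A" for v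
    proof -
      obtain w where w: "w \<in> carrier A" "\<And>u. u \<in> carrier A \<Longrightarrow> ?\<beta> u v = \<phi> (u \<otimes>\<^bsub>A\<^esub> w)"
        using T1_phi_translate[OF g S_closed[OF v] x(3)] unfolding A.right_translates_def by blast
      then show ?thesis
        using phi_right_psi_left[OF w(1)] unfolding A.left_translates_def by auto
    qed
    then obtain b where b: "\<And>v. v \<in> carrier A \<Longrightarrow> b v \<in> carrier A"
      "\<And>u v. u \<in> carrier A \<Longrightarrow> v \<in> carrier A \<Longrightarrow> ?\<beta> u v = \<psi> (b v \<otimes>\<^bsub>A\<^esub> u)" by metis
    have F: "formal K (carrier A) (carrier A) (\<lambda>D. esum K (T2 x (z \<otimes>\<^bsub>A\<^esub> n)) (\<lambda>u v. D v u))"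
      by (intro ml_A; simp add: x n)
    then obtain m where m: "m \<in> lists (functionals K A \<times> carrier A)"
      and mD: "\<And>D. (\<forall>i\<in>carrier A. (\<lambda>z. D z i) \<in> functionals K A) \<Longrightarrow>
        esum K (T2 x (z \<otimes>\<^bsub>A\<^esub> n)) (\<lambda>u v. D v u) = esum K m (\<lambda>f e. esum K (T2 x (z \<otimes>\<^bsub>A\<^esub> n)) (\<lambda>u v. f v \<otimes> D e u))"
      using formal_expand[OF A.B.module_axioms F F] by blast
    have "esum K (T2 x (z \<otimes>\<^bsub>A\<^esub> n)) (\<lambda>u v. ?\<beta> u v) =
      esum K m (\<lambda>f e. esum K (T2 x (z \<otimes>\<^bsub>A\<^esub> n)) (\<lambda>u v. f v \<otimes> ?\<beta> u e))"
      by (rule mD[where D = "\<lambda>v u. ?\<beta> u v"]) (use bilinear_formsD(1)[OF \<beta>] in blast)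
    also have "\<dots> = esum K m (\<lambda>f e. \<zero>)"
    proof (rule esum_cong[OF m])
      fix h e assume h: "h \<in> functionals K A" and e: "e \<in> carrier A"
      note ch = functional_comp[OF h] functionalsD(1)[OF h] psi_rules
      have "esum K (T2 x (z \<otimes>\<^bsub>A\<^esub> n)) (\<lambda>u v. h v \<otimes> ?\<beta> u e) =
        esum K (T2 x (z \<otimes>\<^bsub>A\<^esub> n)) (\<lambda>u v. \<psi> (b e \<otimes>\<^bsub>A\<^esub> u) \<otimes> h v)"
        by (intro T2_cong x zn) (simp add: b(2)[OF _ e] K.m_comm ch(2,4) A.mult_closed b(1)[OF e])
      also have "\<dots> = esum K (T2 (b e \<otimes>\<^bsub>A\<^esub> x) (z \<otimes>\<^bsub>A\<^esub> n)) (\<lambda>u v. \<psi> u \<otimes> h v)"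
        by (rule T22[symmetric, where B = "\<lambda>u v. \<psi> u \<otimes> h v"]; (intro ml_A ch)?; simp add: x zn b(1)[OF e] n)
      also have "\<dots> = \<zero>" by (rule psi_vanish[OF zn h A.mult_closed[OF b(1)[OF e] x(1)]])
      finally show "esum K (T2 x (z \<otimes>\<^bsub>A\<^esub> n)) (\<lambda>u v. h v \<otimes> ?\<beta> u e) = \<zero>" .
    qed
    finally have "esum K (T2 x (z \<otimes>\<^bsub>A\<^esub> n)) (\<lambda>u v. ?\<beta> u v) = \<zero>" by simp
    moreover have "(\<lambda>p r. \<phi> r \<otimes> g (d \<otimes>\<^bsub>A\<^esub> p)) \<in> bilinear_forms K A A" by (intro ml_A c; simp add: x)
    ultimately show ?thesis using T3_antipode[OF _ x(1) zn(1)] by simp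
  qed
  show ?thesis
  proof (rule A.nondegenerate_right[OF n(1)], intro ballI)
    fix a assume a: "a \<in> carrier A"
    have "d \<otimes>\<^bsub>A\<^esub> (a \<otimes>\<^bsub>A\<^esub> n) = \<zero>\<^bsub>A\<^esub>" if d: "d \<in> carrier A" for d
    proof (rule vA.functional_zeroI)
      fix g assume g: "g \<in> functionals K A"
      note c = functional_comp[OF g] functionalsD(1)[OF g] phi_A_rules
      have "\<zero> = esum K (T3' a f) (\<lambda>x z. esum K (T3 x (z \<otimes>\<^bsub>A\<^esub> n)) (\<lambda>p r. \<phi> r \<otimes> g (d \<otimes>\<^bsub>A\<^esub> p)))"
        using esum_cong[OF T_in(7)[OF a f(1)] key[OF _ _ d g], of "\<lambda>a b. a" "\<lambda>a b. b" K] by simp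
      also have "\<dots> = esum K (T3' a f) (\<lambda>x z. esum K (T3 x z) (\<lambda>p r. \<phi> r \<otimes> g (d \<otimes>\<^bsub>A\<^esub> (p \<otimes>\<^bsub>A\<^esub> n))))"
        by (intro T3'_cong a f; rule T33[where B = "\<lambda>p r. \<phi> r \<otimes> g (d \<otimes>\<^bsub>A\<^esub> p)"]; (intro ml_A c)?; simp add: d n)
      also have "\<dots> = \<phi> f \<otimes> g (d \<otimes>\<^bsub>A\<^esub> (a \<otimes>\<^bsub>A\<^esub> n))"
        by (rule T3_inv[where B = "\<lambda>p r. \<phi> r \<otimes> g (d \<otimes>\<^bsub>A\<^esub> (p \<otimes>\<^bsub>A\<^esub> n))"]; (intro ml_A c)?; simp add: d n a f)
      finally show "g (d \<otimes>\<^bsub>A\<^esub> (a \<otimes>\<^bsub>A\<^esub> n)) = \<zero>"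
        using f c(2) d a n by (simp add: A.mult_closed)
    qed (simp add: d a n A.mult_closed)
    then show "a \<otimes>\<^bsub>A\<^esub> n = \<zero>\<^bsub>A\<^esub>"
      by (intro A.nondegenerate_right[OF A.mult_closed[OF a n(1)]]) blast
  qed
qed

end

section \<open>Covering a coaction from the right\<close>

text \<open>
  \<open>A\<close> carries both invariant functionals and hence an antipode, and \<open>X\<close> carries \<open>\<phi>\<^sub>X\<close> and \<open>\<psi>\<^sub>X\<close>. The
  antipode provides the missing product \<open>\<alpha>(y) (x \<otimes> 1)\<close>, which makes the right handed versions of the
  comparison between \<open>\<phi>\<^sub>X\<close> and \<open>\<psi>\<^sub>X\<close> available.
\<close>

locale coaction_haar = hopf_haar K A T1 T2 T3 T4 T1' T2' T3' T4' \<psi> e \<phi> f +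
    coaction_integrals K A T1 T2 T3 T4 T1' T2' T3' T4' X V V' W W4 \<psi>\<^sub>X x0 \<phi> f \<phi>\<^sub>X
  for K :: "'k ring" (structure) and A :: "('k, 'a) module" and T1 T2 T3 T4 T1' T2' T3' T4'
    and \<psi> e \<phi> f and X :: "('k, 'x) module" and V V' W W4 \<psi>\<^sub>X x0 \<phi>\<^sub>X
begin

text \<open>\<open>flip_eval y x\<close> evaluates forms on \<open>\<alpha>(y) (x \<otimes> 1) = W (\<iota> \<otimes> S) V (y \<otimes> x)\<close>.\<close>

abbreviation flip_eval :: "'x \<Rightarrow> 'x \<Rightarrow> ('x \<Rightarrow> 'a \<Rightarrow> 'k) \<Rightarrow> 'k"
  where "flip_eval y x B \<equiv> esum K (V y x) (\<lambda>u a. esum K (W u (S a)) (\<lambda>p q. B p q))"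

lemmas ml_X = ml linear_S S_closed

lemma flip_W:
  assumes B: "B \<in> bilinear_forms K X A" and x: "y \<in> carrier X" "x \<in> carrier X" "d \<in> carrier A"
  shows "flip_eval y x (\<lambda>p q. B p (q \<otimes>\<^bsub>A\<^esub> d)) = esum K (W y d) (\<lambda>u v. B (u \<otimes>\<^bsub>X\<^esub> x) v)"
proof -
  define w where "w = x0"
  define E where "E = (\<lambda>p r s. esum K (V' p r) (\<lambda>s' t. \<psi>\<^sub>X s' \<otimes> B t s))"
  have w: "w \<in> carrier X" using x0 w_def by simp
  note cB = bilinear_comp[OF B] psiX_rules
  have E: "E \<in> trilinear_forms K X A A" unfolding E_def by (intro ml_X cB; assumption)
  note c = trilinear_comp[OF E]
  have recover: "B t s = esum K (V w t) (\<lambda>p r. E p r s)" if ts: "t \<in> carrier X" "s \<in> carrier A" for t s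
  proof -
    have "esum K (V w t) (\<lambda>p r. E p r s) = \<psi>\<^sub>X w \<otimes> B t s"
      unfolding E_def by (rule inv_V[where B' = "\<lambda>s' t. \<psi>\<^sub>X s' \<otimes> B t s"]; (intro ml_X cB)?; simp add: w ts)
    then show ?thesis using x0(2) bilinear_formsD(3)[OF B ts] by (simp add: w_def)
  qed
  have "flip_eval y x (\<lambda>p q. B p (q \<otimes>\<^bsub>A\<^esub> d)) = esum K (V y x) (\<lambda>u a. esum K (W u (S a \<otimes>\<^bsub>A\<^esub> d)) (\<lambda>p q. B p q))"
    by (intro V_cong x; rule WW[symmetric, where B = "\<lambda>p q. B p q"]; (intro ml_X cB)?; simp add: x)
  also have "\<dots> = esum K (V y x) (\<lambda>u a. esum K (W u (S a \<otimes>\<^bsub>A\<^esub> d)) (\<lambda>t s. esum K (V w t) (\<lambda>p r. E p r s)))"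
    by (intro V_cong W_cong recover x S_closed A.mult_closed; assumption)
  also have "\<dots> = esum K (V y x) (\<lambda>u a. esum K (V w u) (\<lambda>p q. esum K (T1 q (S a \<otimes>\<^bsub>A\<^esub> d)) (\<lambda>r s. E p r s)))"
    by (intro V_cong x; rule V_coassoc[where C = "\<lambda>p r s. E p r s"]; (intro ml_X c)?; simp add: x w)
  also have "\<dots> = esum K (V w y) (\<lambda>u v. esum K (V u x) (\<lambda>p q. esum K (T2 v q) (\<lambda>r s. esum K (T1 r (S s \<otimes>\<^bsub>A\<^esub> d)) (\<lambda>r s. E p r s))))"
    by (rule coassoc_left[where C = "\<lambda>p q a. esum K (T1 q (S a \<otimes>\<^bsub>A\<^esub> d)) (\<lambda>r s. E p r s)"]; (intro ml_X c)?; simp add: x w)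
  also have "\<dots> = esum K (V w y) (\<lambda>u v. esum K (V u x) (\<lambda>p q. esum K (T2 v q) (\<lambda>r s. esum K (T1 r (S s)) (\<lambda>r s. E p r (s \<otimes>\<^bsub>A\<^esub> d)))))"
    by (intro V_cong T2_cong x w; (rule T11[where B = "\<lambda>r s. E p r s" for p])?; (intro ml_X c)?; simp add: x)
  also have "\<dots> = esum K (V w y) (\<lambda>u v. esum K (V u x) (\<lambda>p q. esum K (T3 v q) (\<lambda>r s. E p r (s \<otimes>\<^bsub>A\<^esub> d))))"
    by (intro V_cong x w; (rule T3_antipode[symmetric, where D = "\<lambda>r s. E p r (s \<otimes>\<^bsub>A\<^esub> d)" for p])?; (intro ml_X c)?; simp add: x)
  also have "\<dots> = esum K (V w y) (\<lambda>u v. esum K (V u x) (\<lambda>p q. esum K (T1 v d) (\<lambda>r s. E p (r \<otimes>\<^bsub>A\<^esub> q) s)))"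
    by (intro V_cong x w; (rule T31[where B = "\<lambda>r s. E p r s" for p])?; (intro ml_X c)?; simp add: x)
  also have "\<dots> = esum K (V w y) (\<lambda>u v. esum K (T1 v d) (\<lambda>r s. esum K (V u x) (\<lambda>p q. E p (r \<otimes>\<^bsub>A\<^esub> q) s)))"
    by (intro V_cong x w; rule K.esum_swap[OF V_in T_in(1)]; (intro ml_X c)?; simp add: x)
  also have "\<dots> = esum K (W y d) (\<lambda>t s. esum K (V w t) (\<lambda>u r. esum K (V u x) (\<lambda>p q. E p (r \<otimes>\<^bsub>A\<^esub> q) s)))"
    by (rule V_coassoc[symmetric, where C = "\<lambda>u r s. esum K (V u x) (\<lambda>p q. E p (r \<otimes>\<^bsub>A\<^esub> q) s)"]; (intro ml_X c)?; simp add: x w)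
  also have "\<dots> = esum K (W y d) (\<lambda>t s. esum K (V w (t \<otimes>\<^bsub>X\<^esub> x)) (\<lambda>p q. E p q s))"
    by (intro W_cong x; rule V_hom[symmetric, where B = "\<lambda>p q. E p q s" for s]; (intro ml_X c)?; simp add: x w)
  also have "\<dots> = esum K (W y d) (\<lambda>t s. B (t \<otimes>\<^bsub>X\<^esub> x) s)"
    by (intro W_cong x recover[symmetric] X.mult_closed; assumption)
  finally show ?thesis .
qed

lemma flip_hom:
  assumes B: "B \<in> bilinear_forms K X A" and x: "a \<in> carrier X" "y \<in> carrier X" "x \<in> carrier X"
  shows "flip_eval (a \<otimes>\<^bsub>X\<^esub> y) x B = flip_eval y x (\<lambda>u v. esum K (W a v) (\<lambda>p q. B (p \<otimes>\<^bsub>X\<^esub> u) q))"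
proof (rule A.cancel_right_right[OF _ _ _ B])
  fix d B assume d: "d \<in> carrier A" and B: "B \<in> bilinear_forms K X A"
  note c = bilinear_comp[OF B]
  have "flip_eval (a \<otimes>\<^bsub>X\<^esub> y) x (\<lambda>p q. B p (q \<otimes>\<^bsub>A\<^esub> d)) = esum K (W (a \<otimes>\<^bsub>X\<^esub> y) d) (\<lambda>u v. B (u \<otimes>\<^bsub>X\<^esub> x) v)"
    by (rule flip_W[OF B]; simp add: x d X.mult_closed)
  also have "\<dots> = esum K (W y d) (\<lambda>u v. esum K (W a v) (\<lambda>p q. B ((p \<otimes>\<^bsub>X\<^esub> u) \<otimes>\<^bsub>X\<^esub> x) q))"
    by (rule W_hom[where B = "\<lambda>u v. B (u \<otimes>\<^bsub>X\<^esub> x) v"]; (intro ml_X c)?; simp add: x d)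
  also have "\<dots> = esum K (W y d) (\<lambda>u v. esum K (W a v) (\<lambda>p q. B (p \<otimes>\<^bsub>X\<^esub> (u \<otimes>\<^bsub>X\<^esub> x)) q))"
    by (intro W_cong x d arg_cong2[where f = B] X.mult_assoc refl; assumption)
  also have "\<dots> = flip_eval y x (\<lambda>u v. esum K (W a (v \<otimes>\<^bsub>A\<^esub> d)) (\<lambda>p q. B (p \<otimes>\<^bsub>X\<^esub> u) q))"
    by (rule flip_W[symmetric, where B = "\<lambda>u v. esum K (W a v) (\<lambda>p q. B (p \<otimes>\<^bsub>X\<^esub> u) q)"]; (intro ml_X c)?; simp add: x d)
  also have "\<dots> = flip_eval y x (\<lambda>u v. esum K (W a v) (\<lambda>p q. B (p \<otimes>\<^bsub>X\<^esub> u) (q \<otimes>\<^bsub>A\<^esub> d)))"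
    by (intro V_cong W_cong x S_closed; (rule WW[where B = "\<lambda>p q. B (p \<otimes>\<^bsub>X\<^esub> u) q" for u])?; (intro ml_X c)?; simp add: x d)
  finally show "flip_eval (a \<otimes>\<^bsub>X\<^esub> y) x (\<lambda>p q. B p (q \<otimes>\<^bsub>A\<^esub> d)) =
    flip_eval y x (\<lambda>u v. esum K (W a v) (\<lambda>p q. B (p \<otimes>\<^bsub>X\<^esub> u) (q \<otimes>\<^bsub>A\<^esub> d)))" .
qed ((intro ml_X; simp add: x)+)

lemma flip_V:
  assumes B: "B \<in> bilinear_forms K X A" and x: "w \<in> carrier X" "z \<in> carrier X" "x \<in> carrier X"
  shows "flip_eval z x (\<lambda>u v. B (w \<otimes>\<^bsub>X\<^esub> u) v) = esum K (V w z) (\<lambda>u v. B (u \<otimes>\<^bsub>X\<^esub> x) v)"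
proof (rule A.cancel_right_right[OF _ _ _ B])
  fix d B assume d: "d \<in> carrier A" and B: "B \<in> bilinear_forms K X A"
  note c = bilinear_comp[OF B]
  have "flip_eval z x (\<lambda>u v. B (w \<otimes>\<^bsub>X\<^esub> u) (v \<otimes>\<^bsub>A\<^esub> d)) = esum K (W z d) (\<lambda>u v. B (w \<otimes>\<^bsub>X\<^esub> (u \<otimes>\<^bsub>X\<^esub> x)) v)"
    by (rule flip_W[where B = "\<lambda>u v. B (w \<otimes>\<^bsub>X\<^esub> u) v"]; (intro ml_X c)?; simp add: x d)
  also have "\<dots> = esum K (W z d) (\<lambda>u v. B ((w \<otimes>\<^bsub>X\<^esub> u) \<otimes>\<^bsub>X\<^esub> x) v)"
    by (intro W_cong x d) (simp add: X.mult_assoc x)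
  also have "\<dots> = esum K (V w z) (\<lambda>u v. B (u \<otimes>\<^bsub>X\<^esub> x) (v \<otimes>\<^bsub>A\<^esub> d))"
    by (rule VW[symmetric, where B = "\<lambda>u v. B (u \<otimes>\<^bsub>X\<^esub> x) v"]; (intro ml_X c)?; simp add: x d)
  finally show "flip_eval z x (\<lambda>u v. B (w \<otimes>\<^bsub>X\<^esub> u) (v \<otimes>\<^bsub>A\<^esub> d)) =
    esum K (V w z) (\<lambda>u v. B (u \<otimes>\<^bsub>X\<^esub> x) (v \<otimes>\<^bsub>A\<^esub> d))" .
qed ((intro ml_X; simp add: x)+)

lemma flip_phi:
  assumes g: "g \<in> functionals K X" and x: "z \<in> carrier X" "x \<in> carrier X"
  shows "flip_eval z x (\<lambda>u v. \<phi> v \<otimes> g u) = \<phi>\<^sub>X z \<otimes> g x"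
proof -
  interpret vX: vec K X using vec_of_nd X.nd_algebra_axioms .
  note sc = X.B.M.esum_closed[OF W_in] X.B.smult_closed phi_rules S_closed
  let ?z = "esum X (V z x) (\<lambda>u a. esum X (W u (S a)) (\<lambda>p q. \<phi> q \<odot>\<^bsub>X\<^esub> p))"
  have z: "?z \<in> carrier X" by (intro X.B.M.esum_closed[OF V_in] sc x; assumption)
  have gz: "h ?z = flip_eval z x (\<lambda>u v. \<phi> v \<otimes> h u)" if h: "h \<in> functionals K X" for h
  proof -
    have "h ?z = esum K (V z x) (\<lambda>u a. h (esum X (W u (S a)) (\<lambda>p q. \<phi> q \<odot>\<^bsub>X\<^esub> p)))"
      by (rule functionals_esum[OF X.B.module_axioms K.field_axioms h V_in[OF x]]; intro sc; assumption)
    also have "\<dots> = esum K (V z x) (\<lambda>u a. esum K (W u (S a)) (\<lambda>p q. h (\<phi> q \<odot>\<^bsub>X\<^esub> p)))"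
      by (intro V_cong x; rule functionals_esum[OF X.B.module_axioms K.field_axioms h W_in]; (intro sc)?; assumption)
    also have "\<dots> = flip_eval z x (\<lambda>u v. \<phi> v \<otimes> h u)"
      by (intro V_cong W_cong x S_closed functionalsD(3)[OF h] phi_rules; assumption)
    finally show ?thesis .
  qed
  have "?z = \<phi>\<^sub>X z \<odot>\<^bsub>X\<^esub> x"
  proof (rule X.eq_by_left_mult[OF z])
    fix w assume w: "w \<in> carrier X"
    show "w \<otimes>\<^bsub>X\<^esub> ?z = w \<otimes>\<^bsub>X\<^esub> (\<phi>\<^sub>X z \<odot>\<^bsub>X\<^esub> x)"
    proof (rule vX.functional_ext)
      fix h assume h: "h \<in> functionals K X"
      note hw = functional_comp[OF h X.mult_linear_right[OF w]]
      note c = functional_comp[OF h] functionalsD(1)[OF h] phi_rules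
      have "h (w \<otimes>\<^bsub>X\<^esub> ?z) = flip_eval z x (\<lambda>u v. \<phi> v \<otimes> h (w \<otimes>\<^bsub>X\<^esub> u))" by (rule gz[OF hw])
      also have "\<dots> = esum K (V w z) (\<lambda>u v. \<phi> v \<otimes> h (u \<otimes>\<^bsub>X\<^esub> x))"
        by (rule flip_V[where B = "\<lambda>u v. \<phi> v \<otimes> h u"]; (intro ml_X c)?; simp add: x w)
      also have "\<dots> = \<phi>\<^sub>X z \<otimes> h (w \<otimes>\<^bsub>X\<^esub> x)"
        by (rule V_phi[OF functional_comp[OF h X.mult_linear_left[OF x(2)]] w x(1)])
      also have "\<dots> = h (w \<otimes>\<^bsub>X\<^esub> (\<phi>\<^sub>X z \<odot>\<^bsub>X\<^esub> x))"
        using functionalsD(3)[OF hw phiX_rules(2)[OF x(1)] x(2)] by simp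
      finally show "h (w \<otimes>\<^bsub>X\<^esub> ?z) = h (w \<otimes>\<^bsub>X\<^esub> (\<phi>\<^sub>X z \<odot>\<^bsub>X\<^esub> x))" .
    qed (simp_all add: z x w X.mult_closed phiX_rules(2))
  qed (simp_all add: x phiX_rules(2))
  then have "g ?z = \<phi>\<^sub>X z \<otimes> g x" using functionalsD(3)[OF g phiX_rules(2)[OF x(1)] x(2)] by simp
  then show ?thesis using gz[OF g] by simp
qed

text \<open>
  \<open>y \<otimes> x \<mapsto> \<alpha>(y) (x \<otimes> 1)\<close> is onto as a composite of three surjections, \<open>V\<close>, \<open>\<iota> \<otimes> S\<close> and \<open>W\<close>.
\<close>

lemma flip_onto:
  assumes u: "u \<in> carrier X" "v \<in> carrier A"
  shows "\<exists>l\<in>lists (carrier X \<times> carrier X). \<forall>B\<in>bilinear_forms K X A. esum K l (\<lambda>y x. flip_eval y x B) = B u v"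
proof -
  obtain l where l: "l \<in> lists (carrier X \<times> carrier A)"
    and lB: "\<And>B. B \<in> bilinear_forms K X A \<Longrightarrow> esum K l (\<lambda>t c. esum K (W t c) B) = B u v"
    using W_onto[OF u] by blast
  have V'c: "V' t (S' c) \<in> lists (carrier X \<times> carrier X)" if "t \<in> carrier X" "c \<in> carrier A" for t c
    by (rule V'_in[OF that(1) S'_closed[OF that(2)]])
  let ?m = "concat (map (\<lambda>(t, c). V' t (S' c)) l)"
  have m: "?m \<in> lists (carrier X \<times> carrier X)"
    by (rule K.esum_concat(2)[OF l V'c, where F = "\<lambda>_ _. \<zero>"]) auto
  have "esum K ?m (\<lambda>y x. flip_eval y x B) = B u v" if B: "B \<in> bilinear_forms K X A" for B
  proof -
    note c = bilinear_comp[OF B]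
    have "esum K ?m (\<lambda>y x. flip_eval y x B) = esum K l (\<lambda>t c. esum K (V' t (S' c)) (\<lambda>y x. flip_eval y x B))"
      by (rule K.esum_concat(1)[OF l V'c]; (intro ml_X c)?; assumption)
    also have "\<dots> = esum K l (\<lambda>t c. esum K (W t (S (S' c))) (\<lambda>p q. B p q))"
      by (rule esum_cong[OF l]; rule V_inv[where B = "\<lambda>u a. esum K (W u (S a)) (\<lambda>p q. B p q)"]; (intro ml_X c)?; simp add: S'_closed)
    also have "\<dots> = esum K l (\<lambda>t c. esum K (W t c) B)"
      by (rule esum_cong[OF l]) (simp add: S_S')
    finally show ?thesis using lB[OF B] by simp
  qed
  with m show ?thesis by blast
qed

lemma flip_phi_psi:
  assumes x: "a \<in> carrier X" "y \<in> carrier X" "x \<in> carrier X" and g: "g \<in> functionals K X"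
  shows "flip_eval y x (\<lambda>u v. esum K (W a v) (\<lambda>p q. \<phi> q \<otimes> g (p \<otimes>\<^bsub>X\<^esub> u))) = \<phi>\<^sub>X (a \<otimes>\<^bsub>X\<^esub> y) \<otimes> g x"
proof -
  note c = functional_comp[OF g] functionalsD(1)[OF g] phi_rules
  have "flip_eval y x (\<lambda>u v. esum K (W a v) (\<lambda>p q. \<phi> q \<otimes> g (p \<otimes>\<^bsub>X\<^esub> u))) = flip_eval (a \<otimes>\<^bsub>X\<^esub> y) x (\<lambda>p q. \<phi> q \<otimes> g p)"
    by (rule flip_hom[symmetric, where B = "\<lambda>p q. \<phi> q \<otimes> g p"]; (intro ml_X c)?; simp add: x)
  also have "\<dots> = \<phi>\<^sub>X (a \<otimes>\<^bsub>X\<^esub> y) \<otimes> g x" by (rule flip_phi[OF g X.mult_closed[OF x(1,2)] x(3)])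
  finally show ?thesis .
qed

lemma W_phi_psi:
  assumes x: "a \<in> carrier X" "w \<in> carrier X" "d \<in> carrier A"
  shows "esum K (W w d) (\<lambda>u v. esum K (W a v) (\<lambda>p q. \<phi> q \<otimes> \<psi>\<^sub>X (p \<otimes>\<^bsub>X\<^esub> u))) = \<phi> d \<otimes> \<psi>\<^sub>X (a \<otimes>\<^bsub>X\<^esub> w)"
proof -
  note c = psiX_rules phi_rules
  have "esum K (W w d) (\<lambda>u v. esum K (W a v) (\<lambda>p q. \<phi> q \<otimes> \<psi>\<^sub>X (p \<otimes>\<^bsub>X\<^esub> u))) = esum K (W (a \<otimes>\<^bsub>X\<^esub> w) d) (\<lambda>p q. \<phi> q \<otimes> \<psi>\<^sub>X p)"
    by (rule W_hom[symmetric, where B = "\<lambda>p q. \<phi> q \<otimes> \<psi>\<^sub>X p"]; (intro ml_X c)?; simp add: x)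
  also have "\<dots> = esum K (W (a \<otimes>\<^bsub>X\<^esub> w) d) (\<lambda>p q. \<psi>\<^sub>X p \<otimes> \<phi> q)"
    by (intro W_cong x X.mult_closed; (rule K.m_comm)?; (intro c)?; assumption)
  also have "\<dots> = \<psi>\<^sub>X (a \<otimes>\<^bsub>X\<^esub> w) \<otimes> \<phi> d" by (rule W_psi[OF phi X.mult_closed[OF x(1,2)] x(3)])
  also have "\<dots> = \<phi> d \<otimes> \<psi>\<^sub>X (a \<otimes>\<^bsub>X\<^esub> w)"
    by (rule K.m_comm) (simp_all add: c(2,4) x X.mult_closed)
  finally show ?thesis .
qed

text \<open>
  The mirror image of \<open>psiX_left\<close>, with \<open>\<alpha>(y) (x \<otimes> 1)\<close> in place of \<open>(x \<otimes> 1) \<alpha>(y)\<close>.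
\<close>

lemma psiX_right:
  assumes w: "w \<in> carrier X"
  shows "(\<lambda>a. \<psi>\<^sub>X (a \<otimes>\<^bsub>X\<^esub> w)) \<in> X.right_translates \<phi>\<^sub>X"
proof -
  note c = psiX_rules phi_rules
  let ?R = "\<lambda>u v a. esum K (W a v) (\<lambda>p q. \<phi> q \<otimes> \<psi>\<^sub>X (p \<otimes>\<^bsub>X\<^esub> u))"
  have 1: "(\<lambda>a. ?R u v a) \<in> X.right_translates \<phi>\<^sub>X" if u: "u \<in> carrier X" "v \<in> carrier A" for u v
  proof -
    obtain l where l: "l \<in> lists (carrier X \<times> carrier X)"
      and lB: "\<And>B. B \<in> bilinear_forms K X A \<Longrightarrow> esum K l (\<lambda>y x. flip_eval y x B) = B u v"
      using flip_onto[OF u] by blast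
    have 0: "(\<lambda>a. \<psi>\<^sub>X x \<otimes> \<phi>\<^sub>X (a \<otimes>\<^bsub>X\<^esub> y)) \<in> X.right_translates \<phi>\<^sub>X" if "y \<in> carrier X" "x \<in> carrier X" for y x
      by (rule X.right_translates_scale[OF phiX functionalsD(1)[OF psiX that(2)] X.right_translatesI[OF that(1), where \<chi> = \<phi>\<^sub>X]])
    have "(\<lambda>a. esum K l (\<lambda>y x. \<psi>\<^sub>X x \<otimes> \<phi>\<^sub>X (a \<otimes>\<^bsub>X\<^esub> y))) \<in> X.right_translates \<phi>\<^sub>X"
      by (rule X.right_translates_esum[OF phiX l 0])
    then show ?thesis
    proof (rule X.right_translates_cong)
      fix a assume a: "a \<in> carrier X"
      have B: "(\<lambda>u v. ?R u v a) \<in> bilinear_forms K X A" by (intro ml_X c; simp add: a)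
      show "?R u v a = esum K l (\<lambda>y x. \<psi>\<^sub>X x \<otimes> \<phi>\<^sub>X (a \<otimes>\<^bsub>X\<^esub> y))"
        unfolding lB[OF B, symmetric]
        by (rule esum_cong[OF l]) (simp add: flip_phi_psi[OF a _ _ psiX] K.m_comm c(2) phiX_rules(2) a X.mult_closed)
    qed
  qed
  have "(\<lambda>a. esum K (W w f) (\<lambda>u v. ?R u v a)) \<in> X.right_translates \<phi>\<^sub>X"
    by (rule X.right_translates_esum[OF phiX W_in[OF w f(1)] 1])
  then show ?thesis
  proof (rule X.right_translates_cong)
    fix a assume a: "a \<in> carrier X"
    show "\<psi>\<^sub>X (a \<otimes>\<^bsub>X\<^esub> w) = esum K (W w f) (\<lambda>u v. ?R u v a)"
      using W_phi_psi[OF a w f(1)] f(2) c(2) a w by (simp add: X.mult_closed)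
  qed
qed

lemma phiX_right:
  assumes z: "z \<in> carrier X"
  shows "(\<lambda>a. \<phi>\<^sub>X (a \<otimes>\<^bsub>X\<^esub> z)) \<in> X.right_translates \<psi>\<^sub>X"
proof -
  note c = psiX_rules phi_rules
  let ?R = "\<lambda>u v a. esum K (W a v) (\<lambda>p q. \<phi> q \<otimes> \<psi>\<^sub>X (p \<otimes>\<^bsub>X\<^esub> u))"
  have 1: "(\<lambda>a. ?R u v a) \<in> X.right_translates \<psi>\<^sub>X" if u: "u \<in> carrier X" "v \<in> carrier A" for u v
  proof -
    obtain l where l: "l \<in> lists (carrier X \<times> carrier A)"
      and lB: "\<And>B. B \<in> bilinear_forms K X A \<Longrightarrow> esum K l (\<lambda>t d. esum K (W t d) B) = B u v"
      using W_onto[OF u] by blast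
    have 0: "(\<lambda>a. \<phi> d \<otimes> \<psi>\<^sub>X (a \<otimes>\<^bsub>X\<^esub> t)) \<in> X.right_translates \<psi>\<^sub>X" if "t \<in> carrier X" "d \<in> carrier A" for t d
      by (rule X.right_translates_scale[OF psiX functionalsD(1)[OF phi that(2)] X.right_translatesI[OF that(1), where \<chi> = \<psi>\<^sub>X]])
    have "(\<lambda>a. esum K l (\<lambda>t d. \<phi> d \<otimes> \<psi>\<^sub>X (a \<otimes>\<^bsub>X\<^esub> t))) \<in> X.right_translates \<psi>\<^sub>X"
      by (rule X.right_translates_esum[OF psiX l 0])
    then show ?thesis
    proof (rule X.right_translates_cong)
      fix a assume a: "a \<in> carrier X"
      have B: "(\<lambda>u v. ?R u v a) \<in> bilinear_forms K X A" by (intro ml_X c; simp add: a)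
      show "?R u v a = esum K l (\<lambda>t d. \<phi> d \<otimes> \<psi>\<^sub>X (a \<otimes>\<^bsub>X\<^esub> t))"
        unfolding lB[OF B, symmetric] by (rule esum_cong[OF l]) (rule W_phi_psi[OF a])
    qed
  qed
  have 2: "(\<lambda>a. esum K (W u (S b)) (\<lambda>u v. ?R u v a)) \<in> X.right_translates \<psi>\<^sub>X" if "u \<in> carrier X" "b \<in> carrier A" for u b
    by (rule X.right_translates_esum[OF psiX W_in[OF that(1) S_closed[OF that(2)]] 1])
  have "(\<lambda>a. flip_eval z x0 (\<lambda>u v. ?R u v a)) \<in> X.right_translates \<psi>\<^sub>X"
    by (rule X.right_translates_esum[OF psiX V_in[OF z x0(1)] 2])
  then show ?thesis
  proof (rule X.right_translates_cong)
    fix a assume a: "a \<in> carrier X"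
    show "\<phi>\<^sub>X (a \<otimes>\<^bsub>X\<^esub> z) = flip_eval z x0 (\<lambda>u v. ?R u v a)"
      using flip_phi_psi[OF a z x0(1) psiX] x0(2) phiX_rules(2) a z by (simp add: X.mult_closed)
  qed
qed

end

section \<open>Multipliers from non-degeneracy\<close>

context nd_algebra
begin

text \<open>Non-degeneracy turns the compatibility of two maps into all the other multiplier axioms.\<close>

lemma multiplierI:
  assumes L: "\<And>w. w \<in> carrier B \<Longrightarrow> L w \<in> carrier B" and R: "\<And>x. x \<in> carrier B \<Longrightarrow> R x \<in> carrier B"
    and c: "\<And>x w. x \<in> carrier B \<Longrightarrow> w \<in> carrier B \<Longrightarrow> R x \<otimes>\<^bsub>B\<^esub> w = x \<otimes>\<^bsub>B\<^esub> L w"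
  shows "(\<lambda>w\<in>carrier B. L w, \<lambda>x\<in>carrier B. R x) \<in> multipliers K B"
proof -
  note lin = linear_mapsD(2,3)[OF mult_linear_right] linear_mapsD(2,3)[OF mult_linear_left]
  have La: "L (u \<oplus>\<^bsub>B\<^esub> v) = L u \<oplus>\<^bsub>B\<^esub> L v" if "u \<in> carrier B" "v \<in> carrier B" for u v
    by (rule eq_by_left_mult) (use that in \<open>simp_all add: L R lin c[symmetric]\<close>)
  have Ls: "L (k \<odot>\<^bsub>B\<^esub> v) = k \<odot>\<^bsub>B\<^esub> L v" if "k \<in> carrier K" "v \<in> carrier B" for k v
    by (rule eq_by_left_mult) (use that in \<open>simp_all add: L R lin c[symmetric]\<close>)
  have Ra: "R (u \<oplus>\<^bsub>B\<^esub> v) = R u \<oplus>\<^bsub>B\<^esub> R v" if "u \<in> carrier B" "v \<in> carrier B" for u v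
    by (rule eq_by_right_mult) (use that in \<open>simp_all add: L R lin c\<close>)
  have Rs: "R (k \<odot>\<^bsub>B\<^esub> v) = k \<odot>\<^bsub>B\<^esub> R v" if "k \<in> carrier K" "v \<in> carrier B" for k v
    by (rule eq_by_right_mult) (use that in \<open>simp_all add: L R lin c\<close>)
  have Lm: "L (u \<otimes>\<^bsub>B\<^esub> v) = L u \<otimes>\<^bsub>B\<^esub> v" if uv: "u \<in> carrier B" "v \<in> carrier B" for u v
  proof (rule eq_by_left_mult)
    fix x assume x: "x \<in> carrier B"
    show "x \<otimes>\<^bsub>B\<^esub> L (u \<otimes>\<^bsub>B\<^esub> v) = x \<otimes>\<^bsub>B\<^esub> (L u \<otimes>\<^bsub>B\<^esub> v)"
      using uv x mult_assoc[of "R x" u v] mult_assoc[of x "L u" v] by (simp add: c[symmetric] L R mult_closed)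
  qed (simp_all add: uv L mult_closed)
  have Rm: "R (u \<otimes>\<^bsub>B\<^esub> v) = u \<otimes>\<^bsub>B\<^esub> R v" if uv: "u \<in> carrier B" "v \<in> carrier B" for u v
  proof (rule eq_by_right_mult)
    fix x assume x: "x \<in> carrier B"
    show "R (u \<otimes>\<^bsub>B\<^esub> v) \<otimes>\<^bsub>B\<^esub> x = (u \<otimes>\<^bsub>B\<^esub> R v) \<otimes>\<^bsub>B\<^esub> x"
      using uv x by (simp add: c L R mult_closed mult_assoc)
  qed (simp_all add: uv R mult_closed)
  show ?thesis
    unfolding multipliers_def
    by (auto intro!: linear_mapsI simp: L R La Ls Ra Rs Lm Rm c mult_closed)
qed

lemma multiplier_eq:
  assumes m: "m \<in> multipliers K B" and n: "n \<in> multipliers K B"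
    and eq: "\<And>x. x \<in> carrier B \<Longrightarrow> snd m x = snd n x"
  shows "m = n"
proof -
  obtain L R L' R' where d: "m = (L, R)" "n = (L', R')" by fastforce
  note mm = m[unfolded d multipliers_def, simplified] and nn = n[unfolded d multipliers_def, simplified]
  have "R = R'"
    by (rule extensionalityI[of _ "carrier B"]) (use mm nn eq d in auto)
  moreover have "L = L'"
  proof (rule extensionalityI[of _ "carrier B"])
    fix w assume w: "w \<in> carrier B"
    have Lc: "L w \<in> carrier B" "L' w \<in> carrier B" using mm nn w by (auto simp: linear_maps_def)
    show "L w = L' w"
    proof (rule eq_by_left_mult[OF Lc])
      fix x assume x: "x \<in> carrier B"
      have "x \<otimes>\<^bsub>B\<^esub> L w = R x \<otimes>\<^bsub>B\<^esub> w" "x \<otimes>\<^bsub>B\<^esub> L' w = R' x \<otimes>\<^bsub>B\<^esub> w"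
        using mm nn x w by simp_all
      then show "x \<otimes>\<^bsub>B\<^esub> L w = x \<otimes>\<^bsub>B\<^esub> L' w" using \<open>R = R'\<close> by simp
    qed
  qed (use mm nn in auto)
  ultimately show ?thesis using d by simp
qed

end

section \<open>The modular element from the invariant functionals\<close>

context coaction_haar
begin

text \<open>
  \<open>X X\<close> spans \<open>X\<close>, stated dually: expand \<open>x \<otimes> f\<close> in elements \<open>(s \<otimes> 1) \<alpha>(t)\<close> and multiply the second leg
  by an element \<open>d\<close> with \<open>f d \<noteq> 0\<close>; each first leg is then a product.
\<close>

lemma vanish_on_products:
  assumes h: "h \<in> functionals K X" and h0: "\<And>x y. x \<in> carrier X \<Longrightarrow> y \<in> carrier X \<Longrightarrow> h (x \<otimes>\<^bsub>X\<^esub> y) = \<zero>"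
    and x: "x \<in> carrier X"
  shows "h x = \<zero>"
proof -
  interpret vA: vec K A using vec_of_nd A.nd_algebra_axioms .
  have "f \<noteq> \<zero>\<^bsub>A\<^esub>" using f(2) vA.functional_zero[OF phi] by auto
  then obtain d where d: "d \<in> carrier A" "f \<otimes>\<^bsub>A\<^esub> d \<noteq> \<zero>\<^bsub>A\<^esub>"
    using A.nondegenerate_left[OF f(1)] by blast
  obtain g where g: "g \<in> functionals K A" "g (f \<otimes>\<^bsub>A\<^esub> d) = \<one>"
    using vA.functional_separating[of "{\<zero>\<^bsub>A\<^esub>}" "f \<otimes>\<^bsub>A\<^esub> d"] d f A.mult_closed by (auto simp: vA.subspace_def)
  note c = functional_comp[OF h] functionalsD(1)[OF h] functional_comp[OF g(1)] functionalsD(1)[OF g(1)]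
  have "h x \<otimes> g (f \<otimes>\<^bsub>A\<^esub> d) = esum K (V' x f) (\<lambda>s t. esum K (V s t) (\<lambda>u v. h u \<otimes> g (v \<otimes>\<^bsub>A\<^esub> d)))"
    by (rule V_inv[symmetric, where B = "\<lambda>u v. h u \<otimes> g (v \<otimes>\<^bsub>A\<^esub> d)"]; (intro ml_X c)?; simp add: x f d)
  also have "\<dots> = esum K (V' x f) (\<lambda>s t. esum K (W t d) (\<lambda>u v. h (s \<otimes>\<^bsub>X\<^esub> u) \<otimes> g v))"
    by (intro V'_cong x f; rule VW[where B = "\<lambda>u v. h u \<otimes> g v"]; (intro ml_X c)?; simp add: d)
  also have "\<dots> = esum K (V' x f) (\<lambda>s t. esum K (W t d) (\<lambda>u v. \<zero>))"
    by (intro V'_cong W_cong x f d; simp add: h0 c(4))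
  finally show ?thesis using g(2) c(2) x by simp
qed

lemma psiX_product_nonzero: "\<exists>x\<in>carrier X. \<exists>y\<in>carrier X. \<psi>\<^sub>X (x \<otimes>\<^bsub>X\<^esub> y) \<noteq> \<zero>"
proof (rule ccontr)
  assume "\<not> ?thesis"
  then have "\<psi>\<^sub>X x0 = \<zero>" by (intro vanish_on_products[OF psiX _ x0(1)]) auto
  then show False using x0(2) by simp
qed

text \<open>
  The modular property of \<open>\<phi>\<close> on \<open>A\<close> moves the factor from the left to the right of \<open>\<alpha>(y)\<close>
  in \<open>(\<psi>\<^sub>X \<otimes> \<phi>)((b \<otimes> c) \<alpha>(y) (x \<otimes> 1))\<close>.
\<close>

lemma phiX_left_right:
  assumes z: "z \<in> carrier X"
  shows "(\<lambda>y. \<phi>\<^sub>X (z \<otimes>\<^bsub>X\<^esub> y)) \<in> X.right_translates \<phi>\<^sub>X"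
proof -
  obtain x' x where x: "x' \<in> carrier X" "x \<in> carrier X" "\<psi>\<^sub>X (x' \<otimes>\<^bsub>X\<^esub> x) \<noteq> \<zero>"
    using psiX_product_nonzero by blast
  note c = psiX_rules phi_rules
  have 1: "(\<lambda>y. esum K (V b y) (\<lambda>p q. \<phi> (d \<otimes>\<^bsub>A\<^esub> q) \<otimes> \<psi>\<^sub>X (p \<otimes>\<^bsub>X\<^esub> x))) \<in> X.right_translates \<phi>\<^sub>X"
    if b: "b \<in> carrier X" "d \<in> carrier A" for b d
  proof -
    obtain d' where d': "d' \<in> carrier A" "\<And>a. a \<in> carrier A \<Longrightarrow> \<phi> (d \<otimes>\<^bsub>A\<^esub> a) = \<phi> (a \<otimes>\<^bsub>A\<^esub> d')"
      using phi_left_right[OF b(2)] unfolding A.right_translates_def by blast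
    obtain l where l: "l \<in> lists (carrier X \<times> carrier X)"
      and lB: "\<And>B. B \<in> bilinear_forms K X A \<Longrightarrow> esum K l (\<lambda>y x. flip_eval y x B) = B x d'"
      using flip_onto[OF x(2) d'(1)] by blast
    have 0: "(\<lambda>y. \<psi>\<^sub>X (b \<otimes>\<^bsub>X\<^esub> t) \<otimes> \<phi>\<^sub>X (y \<otimes>\<^bsub>X\<^esub> s)) \<in> X.right_translates \<phi>\<^sub>X"
      if "s \<in> carrier X" "t \<in> carrier X" for s t
      by (rule X.right_translates_scale[OF phiX functionalsD(1)[OF psiX X.mult_closed[OF b(1) that(2)]] X.right_translatesI[OF that(1), where \<chi> = \<phi>\<^sub>X]])
    have "(\<lambda>y. esum K l (\<lambda>s t. \<psi>\<^sub>X (b \<otimes>\<^bsub>X\<^esub> t) \<otimes> \<phi>\<^sub>X (y \<otimes>\<^bsub>X\<^esub> s))) \<in> X.right_translates \<phi>\<^sub>X"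
      by (rule X.right_translates_esum[OF phiX l 0])
    then show ?thesis
    proof (rule X.right_translates_cong)
      fix y assume y: "y \<in> carrier X"
      have gb: "(\<lambda>t. \<psi>\<^sub>X (b \<otimes>\<^bsub>X\<^esub> t)) \<in> functionals K X"
        by (rule functional_comp[OF psiX X.mult_linear_right[OF b(1)]])
      have B: "(\<lambda>u v. esum K (W y v) (\<lambda>p q. \<phi> q \<otimes> \<psi>\<^sub>X (b \<otimes>\<^bsub>X\<^esub> (p \<otimes>\<^bsub>X\<^esub> u)))) \<in> bilinear_forms K X A"
        by (intro ml_X c; simp add: y b)
      have "esum K (V b y) (\<lambda>p q. \<phi> (d \<otimes>\<^bsub>A\<^esub> q) \<otimes> \<psi>\<^sub>X (p \<otimes>\<^bsub>X\<^esub> x)) = esum K (V b y) (\<lambda>p q. \<phi> (q \<otimes>\<^bsub>A\<^esub> d') \<otimes> \<psi>\<^sub>X (p \<otimes>\<^bsub>X\<^esub> x))"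
        by (intro V_cong b y) (simp add: d')
      also have "\<dots> = esum K (W y d') (\<lambda>p q. \<phi> q \<otimes> \<psi>\<^sub>X ((b \<otimes>\<^bsub>X\<^esub> p) \<otimes>\<^bsub>X\<^esub> x))"
        by (rule VW[where B = "\<lambda>p q. \<phi> q \<otimes> \<psi>\<^sub>X (p \<otimes>\<^bsub>X\<^esub> x)"]; (intro ml_X c)?; simp add: y b d' x)
      also have "\<dots> = esum K (W y d') (\<lambda>p q. \<phi> q \<otimes> \<psi>\<^sub>X (b \<otimes>\<^bsub>X\<^esub> (p \<otimes>\<^bsub>X\<^esub> x)))"
        by (intro W_cong y d'(1)) (simp add: X.mult_assoc b x)
      also have "\<dots> = esum K l (\<lambda>s t. flip_eval s t (\<lambda>u v. esum K (W y v) (\<lambda>p q. \<phi> q \<otimes> \<psi>\<^sub>X (b \<otimes>\<^bsub>X\<^esub> (p \<otimes>\<^bsub>X\<^esub> u)))))"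
        by (rule lB[OF B, symmetric])
      also have "\<dots> = esum K l (\<lambda>s t. \<psi>\<^sub>X (b \<otimes>\<^bsub>X\<^esub> t) \<otimes> \<phi>\<^sub>X (y \<otimes>\<^bsub>X\<^esub> s))"
        by (rule esum_cong[OF l]) (simp add: flip_phi_psi[OF y _ _ gb] K.m_comm c(2) phiX_rules(2) y b X.mult_closed)
      finally show "esum K (V b y) (\<lambda>p q. \<phi> (d \<otimes>\<^bsub>A\<^esub> q) \<otimes> \<psi>\<^sub>X (p \<otimes>\<^bsub>X\<^esub> x)) = \<dots>" .
    qed
  qed
  have gx: "(\<lambda>t. \<psi>\<^sub>X (t \<otimes>\<^bsub>X\<^esub> x)) \<in> functionals K X"
    by (rule functional_comp[OF psiX X.mult_linear_left[OF x(2)]])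
  let ?k = "\<psi>\<^sub>X (x' \<otimes>\<^bsub>X\<^esub> x)"
  have k: "?k \<in> carrier K" "inv ?k \<in> carrier K" "inv ?k \<otimes> ?k = \<one>"
    using x c(2) by (auto simp: K.field_Units X.mult_closed)
  have "(\<lambda>y. inv ?k \<otimes> esum K (V x' z) (\<lambda>b d. esum K (V b y) (\<lambda>p q. \<phi> (d \<otimes>\<^bsub>A\<^esub> q) \<otimes> \<psi>\<^sub>X (p \<otimes>\<^bsub>X\<^esub> x)))) \<in> X.right_translates \<phi>\<^sub>X"
    by (rule X.right_translates_scale[OF phiX k(2) X.right_translates_esum[OF phiX V_in[OF x(1) z] 1]])
  then show ?thesis
  proof (rule X.right_translates_cong)
    fix y assume y: "y \<in> carrier X"
    have "inv ?k \<otimes> (\<phi>\<^sub>X (z \<otimes>\<^bsub>X\<^esub> y) \<otimes> ?k) = \<phi>\<^sub>X (z \<otimes>\<^bsub>X\<^esub> y)"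
      using k phiX_rules(2) y z by (simp add: K.m_lcomm X.mult_closed)
    then show "\<phi>\<^sub>X (z \<otimes>\<^bsub>X\<^esub> y) = inv ?k \<otimes> esum K (V x' z) (\<lambda>b d. esum K (V b y) (\<lambda>p q. \<phi> (d \<otimes>\<^bsub>A\<^esub> q) \<otimes> \<psi>\<^sub>X (p \<otimes>\<^bsub>X\<^esub> x)))"
      unfolding V_phi_psi[OF x(1) z y gx] by simp
  qed
qed

lemma phiX_right_left:
  assumes z: "z \<in> carrier X"
  shows "(\<lambda>y. \<phi>\<^sub>X (y \<otimes>\<^bsub>X\<^esub> z)) \<in> X.left_translates \<phi>\<^sub>X"
proof -
  obtain x x' where x: "x \<in> carrier X" "x' \<in> carrier X" "\<psi>\<^sub>X (x \<otimes>\<^bsub>X\<^esub> x') \<noteq> \<zero>"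
    using psiX_product_nonzero by blast
  note c = psiX_rules phi_rules
  have 1: "(\<lambda>y. esum K (W y v) (\<lambda>p q. \<phi> q \<otimes> \<psi>\<^sub>X (x \<otimes>\<^bsub>X\<^esub> (p \<otimes>\<^bsub>X\<^esub> u)))) \<in> X.left_translates \<phi>\<^sub>X"
    if u: "u \<in> carrier X" "v \<in> carrier A" for u v
  proof -
    obtain v' where v': "v' \<in> carrier A" "\<And>a. a \<in> carrier A \<Longrightarrow> \<phi> (a \<otimes>\<^bsub>A\<^esub> v) = \<phi> (v' \<otimes>\<^bsub>A\<^esub> a)"
      using phi_right_left[OF u(2)] unfolding A.left_translates_def by blast
    have gu: "(\<lambda>t. \<psi>\<^sub>X (t \<otimes>\<^bsub>X\<^esub> u)) \<in> functionals K X"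
      by (rule functional_comp[OF psiX X.mult_linear_left[OF u(1)]])
    have 0: "(\<lambda>y. \<psi>\<^sub>X (s \<otimes>\<^bsub>X\<^esub> u) \<otimes> \<phi>\<^sub>X (t \<otimes>\<^bsub>X\<^esub> y)) \<in> X.left_translates \<phi>\<^sub>X"
      if "s \<in> carrier X" "t \<in> carrier X" for s t
      by (rule X.left_translates_scale[OF phiX functionalsD(1)[OF psiX X.mult_closed[OF that(1) u(1)]] X.left_translatesI[OF that(2), where \<chi> = \<phi>\<^sub>X]])
    have "(\<lambda>y. esum K (V' x v') (\<lambda>s t. \<psi>\<^sub>X (s \<otimes>\<^bsub>X\<^esub> u) \<otimes> \<phi>\<^sub>X (t \<otimes>\<^bsub>X\<^esub> y))) \<in> X.left_translates \<phi>\<^sub>X"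
      by (rule X.left_translates_esum[OF phiX V'_in[OF x(1) v'(1)] 0])
    then show ?thesis
    proof (rule X.left_translates_cong)
      fix y assume y: "y \<in> carrier X"
      have "esum K (W y v) (\<lambda>p q. \<phi> q \<otimes> \<psi>\<^sub>X (x \<otimes>\<^bsub>X\<^esub> (p \<otimes>\<^bsub>X\<^esub> u))) = esum K (W y v) (\<lambda>p q. \<phi> q \<otimes> \<psi>\<^sub>X ((x \<otimes>\<^bsub>X\<^esub> p) \<otimes>\<^bsub>X\<^esub> u))"
        by (intro W_cong y u) (simp add: X.mult_assoc u x)
      also have "\<dots> = esum K (V x y) (\<lambda>p q. \<phi> (q \<otimes>\<^bsub>A\<^esub> v) \<otimes> \<psi>\<^sub>X (p \<otimes>\<^bsub>X\<^esub> u))"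
        by (rule VW[symmetric, where B = "\<lambda>p q. \<phi> q \<otimes> \<psi>\<^sub>X (p \<otimes>\<^bsub>X\<^esub> u)"]; (intro ml_X c)?; simp add: y u x)
      also have "\<dots> = esum K (V x y) (\<lambda>p q. \<phi> (v' \<otimes>\<^bsub>A\<^esub> q) \<otimes> \<psi>\<^sub>X (p \<otimes>\<^bsub>X\<^esub> u))"
        by (intro V_cong x y) (simp add: v')
      also have "\<dots> = esum K (V' x v') (\<lambda>s t. esum K (V s t) (\<lambda>b d. esum K (V b y) (\<lambda>p q. \<phi> (d \<otimes>\<^bsub>A\<^esub> q) \<otimes> \<psi>\<^sub>X (p \<otimes>\<^bsub>X\<^esub> u))))"
        by (rule V_inv[symmetric, where B = "\<lambda>b d. esum K (V b y) (\<lambda>p q. \<phi> (d \<otimes>\<^bsub>A\<^esub> q) \<otimes> \<psi>\<^sub>X (p \<otimes>\<^bsub>X\<^esub> u))"]; (intro ml_X c)?; simp add: y u x v')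
      also have "\<dots> = esum K (V' x v') (\<lambda>s t. \<psi>\<^sub>X (s \<otimes>\<^bsub>X\<^esub> u) \<otimes> \<phi>\<^sub>X (t \<otimes>\<^bsub>X\<^esub> y))"
        by (intro V'_cong x v'(1)) (simp add: V_phi_psi[OF _ _ y gu] K.m_comm c(2) phiX_rules(2) y u X.mult_closed)
      finally show "esum K (W y v) (\<lambda>p q. \<phi> q \<otimes> \<psi>\<^sub>X (x \<otimes>\<^bsub>X\<^esub> (p \<otimes>\<^bsub>X\<^esub> u))) = \<dots>" .
    qed
  qed
  have gx: "(\<lambda>t. \<psi>\<^sub>X (x \<otimes>\<^bsub>X\<^esub> t)) \<in> functionals K X"
    by (rule functional_comp[OF psiX X.mult_linear_right[OF x(1)]])
  let ?k = "\<psi>\<^sub>X (x \<otimes>\<^bsub>X\<^esub> x')"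
  have k: "?k \<in> carrier K" "inv ?k \<in> carrier K" "inv ?k \<otimes> ?k = \<one>"
    using x c(2) by (auto simp: K.field_Units X.mult_closed)
  have 2: "(\<lambda>y. esum K (W a (S b)) (\<lambda>u v. esum K (W y v) (\<lambda>p q. \<phi> q \<otimes> \<psi>\<^sub>X (x \<otimes>\<^bsub>X\<^esub> (p \<otimes>\<^bsub>X\<^esub> u))))) \<in> X.left_translates \<phi>\<^sub>X"
    if "a \<in> carrier X" "b \<in> carrier A" for a b
    by (rule X.left_translates_esum[OF phiX W_in[OF that(1) S_closed[OF that(2)]] 1])
  have "(\<lambda>y. inv ?k \<otimes> flip_eval z x' (\<lambda>u v. esum K (W y v) (\<lambda>p q. \<phi> q \<otimes> \<psi>\<^sub>X (x \<otimes>\<^bsub>X\<^esub> (p \<otimes>\<^bsub>X\<^esub> u))))) \<in> X.left_translates \<phi>\<^sub>X"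
    by (rule X.left_translates_scale[OF phiX k(2) X.left_translates_esum[OF phiX V_in[OF z x(2)] 2]])
  then show ?thesis
  proof (rule X.left_translates_cong)
    fix y assume y: "y \<in> carrier X"
    have "inv ?k \<otimes> (\<phi>\<^sub>X (y \<otimes>\<^bsub>X\<^esub> z) \<otimes> ?k) = \<phi>\<^sub>X (y \<otimes>\<^bsub>X\<^esub> z)"
      using k phiX_rules(2) y z by (simp add: K.m_lcomm X.mult_closed)
    then show "\<phi>\<^sub>X (y \<otimes>\<^bsub>X\<^esub> z) = inv ?k \<otimes> flip_eval z x' (\<lambda>u v. esum K (W y v) (\<lambda>p q. \<phi> q \<otimes> \<psi>\<^sub>X (x \<otimes>\<^bsub>X\<^esub> (p \<otimes>\<^bsub>X\<^esub> u))))"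
      unfolding flip_phi_psi[OF y z x(2) gx] by simp
  qed
qed

text \<open>
  If \<open>y\<close> is null, then \<open>(\<iota> \<otimes> \<phi>)((u \<otimes> a) \<alpha>(y)) = 0\<close> for all \<open>u\<close> and \<open>a\<close>, because \<open>u \<otimes> a\<close> is a sum of elements
  \<open>(z \<otimes> 1) \<alpha>(x)\<close> and each of these gives \<open>\<phi>\<^sub>X(x y) z\<close>. Faithfulness of \<open>\<phi>\<close> on \<open>A\<close> then yields
  \<open>(u \<otimes> 1) \<alpha>(y) = 0\<close>, and \<open>V\<close> is injective.
\<close>

lemma phiX_faithful:
  assumes y: "y \<in> carrier X" "\<And>x. x \<in> carrier X \<Longrightarrow> \<phi>\<^sub>X (x \<otimes>\<^bsub>X\<^esub> y) = \<zero>"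
  shows "y = \<zero>\<^bsub>X\<^esub>"
proof -
  interpret vX: vec K X using vec_of_nd X.nd_algebra_axioms .
  interpret vA: vec K A using vec_of_nd A.nd_algebra_axioms .
  have 1: "esum K (V u y) (\<lambda>p q. \<phi> (a \<otimes>\<^bsub>A\<^esub> q) \<otimes> g p) = \<zero>"
    if u: "u \<in> carrier X" "a \<in> carrier A" and g: "g \<in> functionals K X" for u a g
  proof -
    note c = functional_comp[OF g] functionalsD(1)[OF g] phi_rules
    have "esum K (V u y) (\<lambda>p q. \<phi> (a \<otimes>\<^bsub>A\<^esub> q) \<otimes> g p) =
      esum K (V' u a) (\<lambda>z x. esum K (V z x) (\<lambda>u a. esum K (V u y) (\<lambda>p q. \<phi> (a \<otimes>\<^bsub>A\<^esub> q) \<otimes> g p)))"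
      by (rule V_inv[symmetric, where B = "\<lambda>u a. esum K (V u y) (\<lambda>p q. \<phi> (a \<otimes>\<^bsub>A\<^esub> q) \<otimes> g p)"]; (intro ml_X c)?; simp add: y u)
    also have "\<dots> = esum K (V' u a) (\<lambda>z x. \<zero>)"
      by (intro V'_cong u) (simp add: V_phi_psi[OF _ _ y(1) g] y c(2))
    finally show ?thesis by simp
  qed
  have 2: "esum K (V u y) (\<lambda>p q. g p \<otimes> h q) = \<zero>"
    if u: "u \<in> carrier X" and g: "g \<in> functionals K X" and h: "h \<in> functionals K A" for u g h
  proof -
    let ?z = "esum A (V u y) (\<lambda>p q. g p \<odot>\<^bsub>A\<^esub> q)"
    have z: "?z \<in> carrier A" by (rule A.B.M.esum_closed[OF V_in]) (simp_all add: u y functionalsD(1)[OF g])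
    have hz: "h ?z = esum K (V u y) (\<lambda>p q. g p \<otimes> h q)" if h: "h \<in> functionals K A" for h
    proof -
      have "h ?z = esum K (V u y) (\<lambda>p q. h (g p \<odot>\<^bsub>A\<^esub> q))"
        by (rule functionals_esum[OF A.B.module_axioms K.field_axioms h V_in]) (simp_all add: u y functionalsD(1)[OF g])
      also have "\<dots> = esum K (V u y) (\<lambda>p q. g p \<otimes> h q)"
        by (intro V_cong u y functionalsD(3)[OF h] functionalsD(1)[OF g])
      finally show ?thesis .
    qed
    have "?z = \<zero>\<^bsub>A\<^esub>"
    proof (rule phi_faithful[OF z])
      fix d assume d: "d \<in> carrier A"
      have "\<phi> (d \<otimes>\<^bsub>A\<^esub> ?z) = esum K (V u y) (\<lambda>p q. g p \<otimes> \<phi> (d \<otimes>\<^bsub>A\<^esub> q))"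
        by (rule hz[OF functional_comp[OF phi A.mult_linear_right[OF d]]])
      also have "\<dots> = esum K (V u y) (\<lambda>p q. \<phi> (d \<otimes>\<^bsub>A\<^esub> q) \<otimes> g p)"
        by (intro V_cong u y) (simp add: K.m_comm functionalsD(1)[OF g] functionalsD(1)[OF phi] d A.mult_closed)
      finally show "\<phi> (d \<otimes>\<^bsub>A\<^esub> ?z) = \<zero>" using 1[OF u d g] by simp
    qed
    then show ?thesis using hz[OF h] vA.functional_zero[OF h] by simp
  qed
  have 3: "esum K (V u y) B = \<zero>" if u: "u \<in> carrier X" and B: "B \<in> bilinear_forms K X A" for u B
  proof (rule formal_eq_by_products[OF X.B.module_axioms _ _ _ B, where F = "\<lambda>B. esum K (V u y) B" and G = "\<lambda>B. \<zero>"])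
    show "formal K (carrier X) (carrier A) (\<lambda>B. esum K (V u y) B)"
      by (intro ml_X; simp add: u y)
    show "formal K (carrier X) (carrier A) (\<lambda>B. \<zero>)"
      unfolding formal_def by (rule bexI[of _ "[]"]) auto
  qed (rule 2[OF u])
  show ?thesis
  proof (rule vX.functional_zeroI[OF y(1)])
    fix h assume h: "h \<in> functionals K X"
    note c = functional_comp[OF h] functionalsD(1)[OF h] psiX_rules
    have "\<psi>\<^sub>X x0 \<otimes> h y = esum K (V x0 y) (\<lambda>p q. esum K (V' p q) (\<lambda>s t. \<psi>\<^sub>X s \<otimes> h t))"
      by (rule inv_V[symmetric, where B' = "\<lambda>s t. \<psi>\<^sub>X s \<otimes> h t"]; (intro ml_X c)?; simp add: x0 y)
    also have "\<dots> = \<zero>"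
      by (rule 3[OF x0(1)]; intro ml_X c; assumption)
    finally show "h y = \<zero>" using x0(2) c(2) y by simp
  qed
qed

lemma phiX_eq:
  assumes "u \<in> carrier X" "v \<in> carrier X" "\<And>x. x \<in> carrier X \<Longrightarrow> \<phi>\<^sub>X (x \<otimes>\<^bsub>X\<^esub> u) = \<phi>\<^sub>X (x \<otimes>\<^bsub>X\<^esub> v)"
  shows "u = v"
proof -
  let ?w = "u \<oplus>\<^bsub>X\<^esub> \<ominus>\<^bsub>X\<^esub> v"
  have w: "?w \<in> carrier X" using assms by simp
  have "?w = \<zero>\<^bsub>X\<^esub>"
  proof (rule phiX_faithful[OF w])
    fix x assume x: "x \<in> carrier X"
    note l = functional_comp[OF phiX X.mult_linear_right[OF x]]
    have "\<phi>\<^sub>X (x \<otimes>\<^bsub>X\<^esub> ?w) \<oplus> \<phi>\<^sub>X (x \<otimes>\<^bsub>X\<^esub> v) = \<phi>\<^sub>X (x \<otimes>\<^bsub>X\<^esub> (?w \<oplus>\<^bsub>X\<^esub> v))"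
      using functionalsD(2)[OF l w assms(2)] by simp
    also have "?w \<oplus>\<^bsub>X\<^esub> v = u" using assms by (simp add: X.B.M.a_assoc X.B.M.l_neg)
    finally have "\<phi>\<^sub>X (x \<otimes>\<^bsub>X\<^esub> ?w) \<oplus> \<phi>\<^sub>X (x \<otimes>\<^bsub>X\<^esub> v) = \<phi>\<^sub>X (x \<otimes>\<^bsub>X\<^esub> v)" using assms(3)[OF x] by simp
    then show "\<phi>\<^sub>X (x \<otimes>\<^bsub>X\<^esub> ?w) = \<zero>"
      using functionalsD(1)[OF l w] functionalsD(1)[OF l assms(2)] by simp
  qed
  then have "\<ominus>\<^bsub>X\<^esub> (\<ominus>\<^bsub>X\<^esub> v) = u" using assms(1,2) by (intro X.B.M.minus_equality) auto
  then show ?thesis using assms(2) by simp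
qed

text \<open>
  \<open>R\<close> is right multiplication by the modular element. Left multiplication is obtained by moving an
  element around \<open>\<phi>\<^sub>X\<close> and then around \<open>\<psi>\<^sub>X\<close>, which is possible because the functionals
  \<open>\<phi>\<^sub>X(z \<cdot>)\<close>, \<open>\<phi>\<^sub>X(\<cdot> z)\<close>, \<open>\<psi>\<^sub>X(z \<cdot>)\<close> and \<open>\<psi>\<^sub>X(\<cdot> z)\<close> are the same.
\<close>

theorem modular_element:
  "\<exists>!\<delta>. \<delta> \<in> Units (mult_alg K X) \<and> (\<forall>x\<in>carrier X. \<phi>\<^sub>X (snd \<delta> x) = \<psi>\<^sub>X x)"
proof -
  let ?M = "mult_alg K X"
  have Mc: "carrier ?M = multipliers K X" by (simp add: mult_alg_def)
  have "\<forall>w\<in>carrier X. \<exists>z\<in>carrier X. \<forall>x\<in>carrier X. \<psi>\<^sub>X (x \<otimes>\<^bsub>X\<^esub> w) = \<phi>\<^sub>X (x \<otimes>\<^bsub>X\<^esub> z)"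
    using psiX_right unfolding X.right_translates_def by auto
  then obtain R where R: "\<And>w. w \<in> carrier X \<Longrightarrow> R w \<in> carrier X"
    and Re: "\<And>w x. w \<in> carrier X \<Longrightarrow> x \<in> carrier X \<Longrightarrow> \<psi>\<^sub>X (x \<otimes>\<^bsub>X\<^esub> w) = \<phi>\<^sub>X (x \<otimes>\<^bsub>X\<^esub> R w)" by metis
  have "\<forall>w\<in>carrier X. \<exists>z\<in>carrier X. \<forall>x\<in>carrier X. \<phi>\<^sub>X (x \<otimes>\<^bsub>X\<^esub> w) = \<psi>\<^sub>X (x \<otimes>\<^bsub>X\<^esub> z)"
    using phiX_right unfolding X.right_translates_def by auto
  then obtain Q where Q: "\<And>w. w \<in> carrier X \<Longrightarrow> Q w \<in> carrier X"
    and Qe: "\<And>w x. w \<in> carrier X \<Longrightarrow> x \<in> carrier X \<Longrightarrow> \<phi>\<^sub>X (x \<otimes>\<^bsub>X\<^esub> w) = \<psi>\<^sub>X (x \<otimes>\<^bsub>X\<^esub> Q w)" by metis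
  have "\<forall>w\<in>carrier X. \<exists>z\<in>carrier X. \<forall>x\<in>carrier X. \<phi>\<^sub>X (x \<otimes>\<^bsub>X\<^esub> w) = \<phi>\<^sub>X (z \<otimes>\<^bsub>X\<^esub> x)"
    using phiX_right_left unfolding X.left_translates_def by auto
  then obtain a where a: "\<And>w. w \<in> carrier X \<Longrightarrow> a w \<in> carrier X"
    and ae: "\<And>w x. w \<in> carrier X \<Longrightarrow> x \<in> carrier X \<Longrightarrow> \<phi>\<^sub>X (x \<otimes>\<^bsub>X\<^esub> w) = \<phi>\<^sub>X (a w \<otimes>\<^bsub>X\<^esub> x)" by metis
  have "\<forall>w\<in>carrier X. \<exists>z\<in>carrier X. \<forall>x\<in>carrier X. \<phi>\<^sub>X (w \<otimes>\<^bsub>X\<^esub> x) = \<phi>\<^sub>X (x \<otimes>\<^bsub>X\<^esub> z)"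
    using phiX_left_right unfolding X.right_translates_def by auto
  then obtain d where d: "\<And>w. w \<in> carrier X \<Longrightarrow> d w \<in> carrier X"
    and de: "\<And>w x. w \<in> carrier X \<Longrightarrow> x \<in> carrier X \<Longrightarrow> \<phi>\<^sub>X (w \<otimes>\<^bsub>X\<^esub> x) = \<phi>\<^sub>X (x \<otimes>\<^bsub>X\<^esub> d w)" by metis
  have "\<forall>w\<in>carrier X. \<exists>z\<in>carrier X. \<forall>x\<in>carrier X. \<psi>\<^sub>X (w \<otimes>\<^bsub>X\<^esub> x) = \<phi>\<^sub>X (z \<otimes>\<^bsub>X\<^esub> x)"
    using psiX_left unfolding X.left_translates_def by auto
  then obtain s where s: "\<And>w. w \<in> carrier X \<Longrightarrow> s w \<in> carrier X"
    and se: "\<And>w x. w \<in> carrier X \<Longrightarrow> x \<in> carrier X \<Longrightarrow> \<psi>\<^sub>X (w \<otimes>\<^bsub>X\<^esub> x) = \<phi>\<^sub>X (s w \<otimes>\<^bsub>X\<^esub> x)" by metis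
  have "\<forall>w\<in>carrier X. \<exists>z\<in>carrier X. \<forall>x\<in>carrier X. \<phi>\<^sub>X (w \<otimes>\<^bsub>X\<^esub> x) = \<psi>\<^sub>X (z \<otimes>\<^bsub>X\<^esub> x)"
    using phiX_left unfolding X.left_translates_def by auto
  then obtain t where t: "\<And>w. w \<in> carrier X \<Longrightarrow> t w \<in> carrier X"
    and te: "\<And>w x. w \<in> carrier X \<Longrightarrow> x \<in> carrier X \<Longrightarrow> \<phi>\<^sub>X (w \<otimes>\<^bsub>X\<^esub> x) = \<psi>\<^sub>X (t w \<otimes>\<^bsub>X\<^esub> x)" by metis
  have psi_eq: "u = v" if uv: "u \<in> carrier X" "v \<in> carrier X"
    and eq: "\<And>x. x \<in> carrier X \<Longrightarrow> \<psi>\<^sub>X (x \<otimes>\<^bsub>X\<^esub> u) = \<psi>\<^sub>X (x \<otimes>\<^bsub>X\<^esub> v)" for u v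
    by (rule phiX_eq[OF uv]) (simp add: te uv eq t)
  have RQ: "R (Q w) = w" if "w \<in> carrier X" for w
    by (rule phiX_eq) (simp_all add: that R Q Re[symmetric] Qe[symmetric])
  have QR: "Q (R w) = w" if "w \<in> carrier X" for w
    by (rule psi_eq) (simp_all add: that R Q Re[symmetric] Qe[symmetric])
  \<comment> \<open>The maps \<open>a\<close> and \<open>d\<close> move a factor around \<open>\<phi>\<^sub>X\<close>; \<open>b\<close> and \<open>c\<close> do so for \<open>\<psi>\<^sub>X\<close>, by way of \<open>\<phi>\<^sub>X\<close>.\<close>
  define c where "c w = Q (d (s w))" for w
  have c: "c w \<in> carrier X" and ce: "x \<in> carrier X \<Longrightarrow> \<psi>\<^sub>X (w \<otimes>\<^bsub>X\<^esub> x) = \<psi>\<^sub>X (x \<otimes>\<^bsub>X\<^esub> c w)" if w: "w \<in> carrier X" for w x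
    unfolding c_def using w by (simp_all add: Q d s se[OF w] de[OF s[OF w]] Qe[OF d[OF s[OF w]]])
  define b where "b w = t (a (R w))" for w
  have b: "b w \<in> carrier X" and be: "x \<in> carrier X \<Longrightarrow> \<psi>\<^sub>X (x \<otimes>\<^bsub>X\<^esub> w) = \<psi>\<^sub>X (b w \<otimes>\<^bsub>X\<^esub> x)" if w: "w \<in> carrier X" for w x
    unfolding b_def using w by (simp_all add: R a t Re[OF w] ae[OF R[OF w]] te[OF a[OF R[OF w]]])
  \<comment> \<open>Move \<open>w\<close> to the front under \<open>\<phi>\<^sub>X\<close>, pass to \<open>\<psi>\<^sub>X\<close>, move it to the back, and return to \<open>\<phi>\<^sub>X\<close>.\<close>
  define L where "L w = R (c (a w))" for w
  define N where "N w = Q (d (b w))" for w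
  have L: "L w \<in> carrier X" and N: "N w \<in> carrier X" if "w \<in> carrier X" for w
    unfolding L_def N_def using that by (simp_all add: R c a Q d b)
  note mc = X.mult_closed and ma = X.mult_assoc
  have RL: "R x \<otimes>\<^bsub>X\<^esub> w = x \<otimes>\<^bsub>X\<^esub> L w" if x: "x \<in> carrier X" and w: "w \<in> carrier X" for x w
  proof (rule phiX_eq)
    fix y assume y: "y \<in> carrier X"
    have "\<phi>\<^sub>X (y \<otimes>\<^bsub>X\<^esub> (R x \<otimes>\<^bsub>X\<^esub> w)) = \<phi>\<^sub>X ((y \<otimes>\<^bsub>X\<^esub> R x) \<otimes>\<^bsub>X\<^esub> w)" by (simp add: ma y x w R)
    also have "\<dots> = \<phi>\<^sub>X (a w \<otimes>\<^bsub>X\<^esub> (y \<otimes>\<^bsub>X\<^esub> R x))" by (rule ae[OF w mc[OF y R[OF x]]])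
    also have "\<dots> = \<phi>\<^sub>X ((a w \<otimes>\<^bsub>X\<^esub> y) \<otimes>\<^bsub>X\<^esub> R x)" by (simp add: ma y x w R a)
    also have "\<dots> = \<psi>\<^sub>X ((a w \<otimes>\<^bsub>X\<^esub> y) \<otimes>\<^bsub>X\<^esub> x)" by (rule Re[OF x mc[OF a[OF w] y], symmetric])
    also have "\<dots> = \<psi>\<^sub>X (a w \<otimes>\<^bsub>X\<^esub> (y \<otimes>\<^bsub>X\<^esub> x))" by (simp add: ma y x w a)
    also have "\<dots> = \<psi>\<^sub>X ((y \<otimes>\<^bsub>X\<^esub> x) \<otimes>\<^bsub>X\<^esub> c (a w))" by (rule ce[OF a[OF w] mc[OF y x]])
    also have "\<dots> = \<phi>\<^sub>X ((y \<otimes>\<^bsub>X\<^esub> x) \<otimes>\<^bsub>X\<^esub> L w)" unfolding L_def by (rule Re[OF c[OF a[OF w]] mc[OF y x]])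
    also have "\<dots> = \<phi>\<^sub>X (y \<otimes>\<^bsub>X\<^esub> (x \<otimes>\<^bsub>X\<^esub> L w))" by (simp add: ma y x w L)
    finally show "\<phi>\<^sub>X (y \<otimes>\<^bsub>X\<^esub> (R x \<otimes>\<^bsub>X\<^esub> w)) = \<phi>\<^sub>X (y \<otimes>\<^bsub>X\<^esub> (x \<otimes>\<^bsub>X\<^esub> L w))" .
  qed (simp_all add: x w R L mc)
  have QN: "Q x \<otimes>\<^bsub>X\<^esub> w = x \<otimes>\<^bsub>X\<^esub> N w" if x: "x \<in> carrier X" and w: "w \<in> carrier X" for x w
  proof (rule psi_eq)
    fix y assume y: "y \<in> carrier X"
    have "\<psi>\<^sub>X (y \<otimes>\<^bsub>X\<^esub> (Q x \<otimes>\<^bsub>X\<^esub> w)) = \<psi>\<^sub>X ((y \<otimes>\<^bsub>X\<^esub> Q x) \<otimes>\<^bsub>X\<^esub> w)" by (simp add: ma y x w Q)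
    also have "\<dots> = \<psi>\<^sub>X (b w \<otimes>\<^bsub>X\<^esub> (y \<otimes>\<^bsub>X\<^esub> Q x))" by (rule be[OF w mc[OF y Q[OF x]]])
    also have "\<dots> = \<psi>\<^sub>X ((b w \<otimes>\<^bsub>X\<^esub> y) \<otimes>\<^bsub>X\<^esub> Q x)" by (simp add: ma y x w Q b)
    also have "\<dots> = \<phi>\<^sub>X ((b w \<otimes>\<^bsub>X\<^esub> y) \<otimes>\<^bsub>X\<^esub> x)" by (rule Qe[OF x mc[OF b[OF w] y], symmetric])
    also have "\<dots> = \<phi>\<^sub>X (b w \<otimes>\<^bsub>X\<^esub> (y \<otimes>\<^bsub>X\<^esub> x))" by (simp add: ma y x w b)
    also have "\<dots> = \<phi>\<^sub>X ((y \<otimes>\<^bsub>X\<^esub> x) \<otimes>\<^bsub>X\<^esub> d (b w))" by (rule de[OF b[OF w] mc[OF y x]])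
    also have "\<dots> = \<psi>\<^sub>X ((y \<otimes>\<^bsub>X\<^esub> x) \<otimes>\<^bsub>X\<^esub> N w)" unfolding N_def by (rule Qe[OF d[OF b[OF w]] mc[OF y x]])
    also have "\<dots> = \<psi>\<^sub>X (y \<otimes>\<^bsub>X\<^esub> (x \<otimes>\<^bsub>X\<^esub> N w))" by (simp add: ma y x w N)
    finally show "\<psi>\<^sub>X (y \<otimes>\<^bsub>X\<^esub> (Q x \<otimes>\<^bsub>X\<^esub> w)) = \<psi>\<^sub>X (y \<otimes>\<^bsub>X\<^esub> (x \<otimes>\<^bsub>X\<^esub> N w))" .
  qed (simp_all add: x w Q N mc)
  have LN: "L (N w) = w" if w: "w \<in> carrier X" for w
    by (rule X.eq_by_left_mult) (simp_all add: w L N RL[symmetric] QN[symmetric] QR R)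
  have NL: "N (L w) = w" if w: "w \<in> carrier X" for w
    by (rule X.eq_by_left_mult) (simp_all add: w L N RL[symmetric] QN[symmetric] RQ Q)
  define \<delta> where "\<delta> = (\<lambda>w\<in>carrier X. L w, \<lambda>x\<in>carrier X. R x)"
  define \<epsilon> where "\<epsilon> = (\<lambda>w\<in>carrier X. N w, \<lambda>x\<in>carrier X. Q x)"
  have \<delta>: "\<delta> \<in> multipliers K X" unfolding \<delta>_def by (rule X.multiplierI[OF L R RL])
  have \<epsilon>: "\<epsilon> \<in> multipliers K X" unfolding \<epsilon>_def by (rule X.multiplierI[OF N Q QN])
  have 1: "\<delta> \<otimes>\<^bsub>?M\<^esub> \<epsilon> = \<one>\<^bsub>?M\<^esub>" "\<epsilon> \<otimes>\<^bsub>?M\<^esub> \<delta> = \<one>\<^bsub>?M\<^esub>"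
    by (auto simp: mult_alg_def \<delta>_def \<epsilon>_def compose_def LN NL QR RQ L N R Q)
  have unit: "\<delta> \<in> Units ?M" unfolding Units_def Mc using \<delta> \<epsilon> 1 by blast
  have R_lin: "(\<lambda>x. R x) \<in> linear_maps K X X"
    using \<delta> by (auto simp: \<delta>_def multipliers_def linear_maps_def Pi_iff restrict_def)
  note Rf = functional_comp[OF phiX R_lin]
  \<comment> \<open>The definition of \<open>R\<close> gives this for products \<open>x = u v\<close>, and products span.\<close>
  have phi_delta: "\<phi>\<^sub>X (R x) = \<psi>\<^sub>X x" if x: "x \<in> carrier X" for x
  proof -
    let ?h = "\<lambda>x. \<phi>\<^sub>X (R x) \<oplus> (\<ominus> \<one>) \<otimes> \<psi>\<^sub>X x"
    have m1: "\<ominus> \<one> \<in> carrier K" by simp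
    have kc: "\<phi>\<^sub>X (R x) \<in> carrier K" "\<psi>\<^sub>X x \<in> carrier K" if "x \<in> carrier X" for x
      using that phiX_rules(2) psiX_rules(2) R by simp_all
    have h: "?h \<in> functionals K X"
    proof (rule functionalsI)
      show "?h u \<in> carrier K" if "u \<in> carrier X" for u using kc[OF that] by simp
      show "?h (u \<oplus>\<^bsub>X\<^esub> v) = ?h u \<oplus> ?h v" if "u \<in> carrier X" "v \<in> carrier X" for u v
        using that kc m1 by (simp add: functionalsD(2)[OF Rf] functionalsD(2)[OF psiX] K.r_distr K.a_ac del: K.l_minus)
      show "?h (k \<odot>\<^bsub>X\<^esub> v) = k \<otimes> ?h v" if "k \<in> carrier K" "v \<in> carrier X" for k v
        using that kc m1 by (simp add: functionalsD(3)[OF Rf] functionalsD(3)[OF psiX] K.r_distr K.m_lcomm del: K.l_minus)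
    qed
    have "?h x = \<zero>"
    proof (rule vanish_on_products[OF h _ x])
      fix u v assume uv: "u \<in> carrier X" "v \<in> carrier X"
      have "R (u \<otimes>\<^bsub>X\<^esub> v) = u \<otimes>\<^bsub>X\<^esub> R v"
        using \<delta> uv by (auto simp: \<delta>_def multipliers_def restrict_def mc)
      then have "\<phi>\<^sub>X (R (u \<otimes>\<^bsub>X\<^esub> v)) = \<psi>\<^sub>X (u \<otimes>\<^bsub>X\<^esub> v)" using Re[OF uv(2,1)] by simp
      then show "?h (u \<otimes>\<^bsub>X\<^esub> v) = \<zero>" using kc[OF mc[OF uv]] by (simp add: K.l_minus K.r_neg)
    qed
    then have "\<ominus> (\<ominus> \<psi>\<^sub>X x) = \<phi>\<^sub>X (R x)"
      using kc[OF x] by (intro K.minus_equality) (simp_all add: K.l_minus)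
    then show ?thesis using kc[OF x] by simp
  qed
  show ?thesis
  proof (rule ex1I[of _ \<delta>])
    show "\<delta> \<in> Units ?M \<and> (\<forall>x\<in>carrier X. \<phi>\<^sub>X (snd \<delta> x) = \<psi>\<^sub>X x)"
      using unit phi_delta by (simp add: \<delta>_def)
    fix \<delta>' assume d': "\<delta>' \<in> Units ?M \<and> (\<forall>x\<in>carrier X. \<phi>\<^sub>X (snd \<delta>' x) = \<psi>\<^sub>X x)"
    then have m': "\<delta>' \<in> multipliers K X" by (simp add: Units_def Mc)
    then have R': "snd \<delta>' \<in> linear_maps K X X"
      and Rm: "\<And>u v. u \<in> carrier X \<Longrightarrow> v \<in> carrier X \<Longrightarrow> snd \<delta>' (u \<otimes>\<^bsub>X\<^esub> v) = u \<otimes>\<^bsub>X\<^esub> snd \<delta>' v"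
      by (auto simp: multipliers_def)
    show "\<delta>' = \<delta>"
    proof (rule X.multiplier_eq[OF m' \<delta>])
      fix w assume w: "w \<in> carrier X"
      show "snd \<delta>' w = snd \<delta> w"
      proof (rule phiX_eq)
        fix x assume x: "x \<in> carrier X"
        have "\<phi>\<^sub>X (x \<otimes>\<^bsub>X\<^esub> snd \<delta>' w) = \<psi>\<^sub>X (x \<otimes>\<^bsub>X\<^esub> w)"
          using d' Rm[OF x w, symmetric] mc[OF x w] by simp
        then show "\<phi>\<^sub>X (x \<otimes>\<^bsub>X\<^esub> snd \<delta>' w) = \<phi>\<^sub>X (x \<otimes>\<^bsub>X\<^esub> snd \<delta> w)"
          using Re[OF w x] w by (simp add: \<delta>_def)
      qed (use linear_mapsD(1)[OF R' w] R[OF w] w in \<open>simp_all add: \<delta>_def\<close>)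
    qed
  qed
qed

end

section \<open>Tensor products as lists of pairs\<close>

definition bilinear_maps ::
  "('k, 'm) ring_scheme \<Rightarrow> ('k, 'v, 'p) module_scheme \<Rightarrow> ('k, 'w, 'q) module_scheme \<Rightarrow>
    ('k, 'u, 'r) module_scheme \<Rightarrow> ('v \<Rightarrow> 'w \<Rightarrow> 'u) set"
  where "bilinear_maps K V W U =
    {\<beta>. (\<forall>v\<in>carrier V. \<beta> v \<in> linear_maps K W U) \<and> (\<forall>w\<in>carrier W. (\<lambda>v. \<beta> v w) \<in> linear_maps K V U)}"

definition tens ::
  "('k, 'm) ring_scheme \<Rightarrow> ('k, 'v, 'p) module_scheme \<Rightarrow> ('k, 'w, 'q) module_scheme \<Rightarrow>
    ('v \<times> 'w) list \<Rightarrow> ('k, 'v, 'w) tensor"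
  where "tens K V W l = (\<lambda>B\<in>bilinear_forms K V W. esum K l B)"

text \<open>
  The choice of the list is harmless, since only its pairings with bilinear forms are used.
\<close>

definition rep ::
  "('k, 'm) ring_scheme \<Rightarrow> ('k, 'v, 'p) module_scheme \<Rightarrow> ('k, 'w, 'q) module_scheme \<Rightarrow>
    ('k, 'v, 'w) tensor \<Rightarrow> ('v \<times> 'w) list"
  where "rep K V W t = (SOME l. l \<in> lists (carrier V \<times> carrier W) \<and> t = tens K V W l)"

lemma bilinear_mapsI:
  assumes "\<And>v. v \<in> carrier V \<Longrightarrow> (\<lambda>w. \<beta> v w) \<in> linear_maps K W U"
    "\<And>w. w \<in> carrier W \<Longrightarrow> (\<lambda>v. \<beta> v w) \<in> linear_maps K V U"
  shows "(\<lambda>v w. \<beta> v w) \<in> bilinear_maps K V W U"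
  using assms by (simp add: bilinear_maps_def)

lemma bilinear_mapsD:
  assumes "\<beta> \<in> bilinear_maps K V W U"
  shows "v \<in> carrier V \<Longrightarrow> \<beta> v \<in> linear_maps K W U"
    "w \<in> carrier W \<Longrightarrow> (\<lambda>v. \<beta> v w) \<in> linear_maps K V U"
    "v \<in> carrier V \<Longrightarrow> w \<in> carrier W \<Longrightarrow> \<beta> v w \<in> carrier U"
  using assms by (auto simp: bilinear_maps_def linear_maps_def)

lemma bilinear_maps_comp:
  assumes "\<beta> \<in> bilinear_maps K V W U"
  shows "g \<in> linear_maps K Z V \<Longrightarrow> w \<in> carrier W \<Longrightarrow> (\<lambda>z. \<beta> (g z) w) \<in> linear_maps K Z U"
    "h \<in> linear_maps K Z W \<Longrightarrow> v \<in> carrier V \<Longrightarrow> (\<lambda>z. \<beta> v (h z)) \<in> linear_maps K Z U"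
  using linear_comp[OF bilinear_mapsD(2)[OF assms], of w g Z] linear_comp[OF bilinear_mapsD(1)[OF assms], of v h Z]
  by auto

lemma bilinear_maps_functional:
  assumes "\<beta> \<in> bilinear_maps K V W U" "f \<in> functionals K U"
  shows "(\<lambda>v w. f (\<beta> v w)) \<in> bilinear_forms K V W"
  by (rule bilinear_formsI; rule functional_comp[OF assms(2)]; rule bilinear_mapsD[OF assms(1)])

lemma functionals_cong:
  assumes Z: "module K Z" and f: "f \<in> functionals K Z" and eq: "\<And>z. z \<in> carrier Z \<Longrightarrow> g z = f z"
  shows "g \<in> functionals K Z"
proof -
  interpret Z: module K Z by fact
  show ?thesis
    by (rule functionalsI) (simp_all add: eq functionalsD[OF f])
qed

locale vec2 = K?: field K + V: module K V + W: module K W for K (structure) and V and W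
begin

abbreviation "VW \<equiv> tensor K V W"

sublocale VV: vec K V by unfold_locales
sublocale WW: vec K W by unfold_locales
sublocale B: base K by unfold_locales

lemma pure_eq: "v \<in> carrier V \<Longrightarrow> w \<in> carrier W \<Longrightarrow> pure_tensor K V W v w = tens K V W [(v, w)]"
  unfolding pure_tensor_def tens_def by (rule restrict_ext) (simp add: bilinear_formsD(3))

lemma tens_append:
  assumes "l \<in> lists (carrier V \<times> carrier W)" "l' \<in> lists (carrier V \<times> carrier W)"
  shows "(\<lambda>B\<in>bilinear_forms K V W. tens K V W l B \<oplus> tens K V W l' B) = tens K V W (l @ l')"
  unfolding tens_def by (rule restrict_ext) (simp, rule K.esum_append[symmetric, OF assms], rule bilinear_formsD(3))

lemma tens_carrier:
  assumes "l \<in> lists (carrier V \<times> carrier W)" shows "tens K V W l \<in> carrier VW"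
  using assms
proof induction
  case Nil
  have "tens K V W [] = pure_tensor K V W \<zero>\<^bsub>V\<^esub> \<zero>\<^bsub>W\<^esub>"
    unfolding tens_def pure_tensor_def
    by (rule restrict_ext) (simp add: WW.functional_zero bilinear_formsD(1))
  then show ?case by (simp add: tensor_def tensor_carrier.pure)
next
  case (Cons p l)
  have "tens K V W (p # l) = tens K V W ([p] @ l)" by simp
  also have "\<dots> = (\<lambda>B\<in>bilinear_forms K V W. tens K V W [p] B \<oplus> tens K V W l B)"
    by (rule tens_append[symmetric]) (use Cons in auto)
  also have "\<dots> \<in> tensor_carrier K V W"
    by (rule tensor_carrier.sum)
      (use Cons pure_eq[of "fst p" "snd p"] tensor_carrier.pure[of "fst p" V "snd p" W K] in \<open>auto simp: tensor_def\<close>)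
  finally show ?case by (simp add: tensor_def)
qed

lemma rep: 
  assumes "t \<in> carrier VW"
  shows "rep K V W t \<in> lists (carrier V \<times> carrier W)" "t = tens K V W (rep K V W t)"
proof -
  have "\<exists>l. l \<in> lists (carrier V \<times> carrier W) \<and> t = tens K V W l"
    using assms unfolding tensor_def module.simps partial_object.simps
  proof induction
    case (pure v w)
    then show ?case using pure_eq by (intro exI[of _ "[(v, w)]"]) auto
  next
    case (sum s t)
    then obtain l l' where l: "l \<in> lists (carrier V \<times> carrier W)" "l' \<in> lists (carrier V \<times> carrier W)"
      "s = tens K V W l" "t = tens K V W l'" by blast
    show ?case unfolding l(3,4) tens_append[OF l(1,2)] using l(1,2) by (intro exI[of _ "l @ l'"]) auto
  qed
  from someI_ex[OF this] show "rep K V W t \<in> lists (carrier V \<times> carrier W)" "t = tens K V W (rep K V W t)"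
    unfolding rep_def by auto
qed

lemma tensor_eval: "t \<in> carrier VW \<Longrightarrow> B \<in> bilinear_forms K V W \<Longrightarrow> t B = esum K (rep K V W t) B"
  by (subst rep(2)) (simp_all add: tens_def)

lemma pure_eval: "B \<in> bilinear_forms K V W \<Longrightarrow> pure_tensor K V W v w B = B v w"
  by (simp add: pure_tensor_def)

lemma tensor_cong:
  assumes "t \<in> carrier VW" "B \<in> bilinear_forms K V W" "B' \<in> bilinear_forms K V W"
    "\<And>v w. v \<in> carrier V \<Longrightarrow> w \<in> carrier W \<Longrightarrow> B v w = B' v w"
  shows "t B = t B'"
  unfolding tensor_eval[OF assms(1,2)] tensor_eval[OF assms(1,3)] by (rule esum_cong[OF rep(1)[OF assms(1)] assms(4)])

text \<open>
  Tensors are functions that are undefined off the bilinear forms, so agreement on these forms is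
  equality.
\<close>

lemma tensor_eqI:
  assumes "s \<in> carrier VW" "t \<in> carrier VW" "\<And>B. B \<in> bilinear_forms K V W \<Longrightarrow> s B = t B"
  shows "s = t"
proof -
  have "tens K V W (rep K V W s) = tens K V W (rep K V W t)"
    unfolding tens_def
    by (rule restrict_ext) (simp only: tensor_eval[OF assms(1), symmetric] tensor_eval[OF assms(2), symmetric] assms(3))
  then show ?thesis using rep(2)[OF assms(1)] rep(2)[OF assms(2)] by simp
qed

lemma eval_closed: "t \<in> carrier VW \<Longrightarrow> B \<in> bilinear_forms K V W \<Longrightarrow> t B \<in> carrier K"
  using K.esum_closed[OF rep(1) bilinear_formsD(3)] by (simp add: tensor_eval)

lemma pure_closed: "v \<in> carrier V \<Longrightarrow> w \<in> carrier W \<Longrightarrow> pure_tensor K V W v w \<in> carrier VW"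
  by (simp add: pure_eq tens_carrier)

lemma add_eval: "B \<in> bilinear_forms K V W \<Longrightarrow> (s \<oplus>\<^bsub>VW\<^esub> t) B = s B \<oplus> t B"
  by (simp add: tensor_def)

lemma smult_eval: "B \<in> bilinear_forms K V W \<Longrightarrow> (c \<odot>\<^bsub>VW\<^esub> t) B = c \<otimes> t B"
  by (simp add: tensor_def)

lemma zero_eval: "B \<in> bilinear_forms K V W \<Longrightarrow> \<zero>\<^bsub>VW\<^esub> B = \<zero>"
  by (simp add: tensor_def)

lemma zero_closed: "\<zero>\<^bsub>VW\<^esub> \<in> carrier VW"
  using tens_carrier[of "[]"] by (simp add: tens_def tensor_def)

lemma add_closed: "s \<in> carrier VW \<Longrightarrow> t \<in> carrier VW \<Longrightarrow> s \<oplus>\<^bsub>VW\<^esub> t \<in> carrier VW"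
  by (simp add: tensor_def tensor_carrier.sum)

lemma smult_closed:
  assumes c: "c \<in> carrier K" and t: "t \<in> carrier VW" shows "c \<odot>\<^bsub>VW\<^esub> t \<in> carrier VW"
proof -
  note l = rep(1)[OF t]
  let ?l = "map (\<lambda>p. (c \<odot>\<^bsub>V\<^esub> fst p, snd p)) (rep K V W t)"
  have "c \<odot>\<^bsub>VW\<^esub> t = tens K V W ?l"
    unfolding tens_def tensor_def module.simps
  proof (rule restrict_ext)
    fix B assume B: "B \<in> bilinear_forms K V W"
    have "esum K ?l B = esum K (rep K V W t) (\<lambda>v w. B (c \<odot>\<^bsub>V\<^esub> v) w)" by (simp add: esum_map)
    also have "\<dots> = esum K (rep K V W t) (\<lambda>v w. c \<otimes> B v w)"
      by (rule esum_cong[OF l]) (rule functionalsD(3)[OF bilinear_formsD(2)[OF B]]; simp add: c)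
    also have "\<dots> = c \<otimes> t B"
      unfolding tensor_eval[OF t B] by (rule B.esum_scale[OF l _ c]) (rule bilinear_formsD(3)[OF B])
    finally show "c \<otimes> t B = esum K ?l B" by simp
  qed
  moreover have "?l \<in> lists (carrier V \<times> carrier W)" using l c by (auto simp: in_lists_conv_set)
  ultimately show ?thesis using tens_carrier by simp
qed

lemma tensor_module: "module K VW"
proof (rule moduleI)
  show "cring K" by (rule K.cring_axioms)
  show "abelian_group VW"
  proof (rule abelian_groupI)
    fix s assume s: "s \<in> carrier VW"
    show "\<exists>t\<in>carrier VW. t \<oplus>\<^bsub>VW\<^esub> s = \<zero>\<^bsub>VW\<^esub>"
    proof (intro bexI tensor_eqI)
      show "(\<ominus> \<one> \<odot>\<^bsub>VW\<^esub> s) \<in> carrier VW" using s by (intro smult_closed) auto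
      then show "(\<ominus> \<one> \<odot>\<^bsub>VW\<^esub> s) \<oplus>\<^bsub>VW\<^esub> s \<in> carrier VW" using s by (intro add_closed)
      fix B assume B: "B \<in> bilinear_forms K V W"
      then show "((\<ominus> \<one> \<odot>\<^bsub>VW\<^esub> s) \<oplus>\<^bsub>VW\<^esub> s) B = \<zero>\<^bsub>VW\<^esub> B"
        using s by (simp add: add_eval smult_eval zero_eval eval_closed K.l_minus K.l_neg)
    qed (rule zero_closed)
  qed (auto intro!: tensor_eqI add_closed zero_closed simp: add_eval zero_eval eval_closed K.a_ac)
qed (auto intro!: tensor_eqI add_closed smult_closed simp: add_eval smult_eval eval_closed add_closed smult_closed K.l_distr K.r_distr K.m_assoc)

sublocale T: vec K VW
  using tensor_module by (simp add: vec_def K.field_axioms)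

lemma eval_functional: "B \<in> bilinear_forms K V W \<Longrightarrow> (\<lambda>t. t B) \<in> functionals K VW"
  by (rule functionalsI) (simp_all add: eval_closed add_eval smult_eval)

lemma pure_bilinear: "pure_tensor K V W \<in> bilinear_maps K V W VW"
proof -
  have "(\<lambda>v w. pure_tensor K V W v w) \<in> bilinear_maps K V W VW"
    by (rule bilinear_mapsI; rule linear_mapsI)
      (auto intro!: tensor_eqI pure_closed add_closed smult_closed
        simp: add_eval smult_eval pure_eval functionalsD(2,3)[OF bilinear_formsD(1)] functionalsD(2,3)[OF bilinear_formsD(2)])
  then show ?thesis by simp
qed

lemma tensor_expand:
  assumes t: "t \<in> carrier VW" shows "t = esum VW (rep K V W t) (pure_tensor K V W)"
proof (rule tensor_eqI[OF t])
  show c: "esum VW (rep K V W t) (pure_tensor K V W) \<in> carrier VW"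
    by (rule T.V.M.esum_closed[OF rep(1)[OF t] pure_closed])
  fix B assume B: "B \<in> bilinear_forms K V W"
  have "esum VW (rep K V W t) (pure_tensor K V W) B = esum K (rep K V W t) (\<lambda>v w. pure_tensor K V W v w B)"
    by (rule T.functional_esum[OF eval_functional[OF B] rep(1)[OF t] pure_closed])
  then show "t B = esum VW (rep K V W t) (pure_tensor K V W) B"
    by (simp add: tensor_eval[OF t B] pure_eval[OF B])
qed

lemma functional_rep:
  assumes h: "h \<in> functionals K VW" and t: "t \<in> carrier VW"
  shows "h t = esum K (rep K V W t) (\<lambda>v w. h (pure_tensor K V W v w))"
proof -
  have "h t = h (esum VW (rep K V W t) (pure_tensor K V W))"
    by (rule arg_cong[OF tensor_expand[OF t]])
  also have "\<dots> = esum K (rep K V W t) (\<lambda>v w. h (pure_tensor K V W v w))"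
    by (rule T.functional_esum[OF h rep(1)[OF t] pure_closed])
  finally show ?thesis .
qed

text \<open>
  The universal property in the form of a principle of linear extension: linear maps on \<open>V \<otimes> W\<close> are
  compared on pure tensors, where \<open>tensor_lift_pure\<close> computes them.
\<close>

lemma linear_eq_on_pure:
  assumes U: "module K U" and f: "f \<in> linear_maps K VW U" and g: "g \<in> linear_maps K VW U"
    and eq: "\<And>v w. v \<in> carrier V \<Longrightarrow> w \<in> carrier W \<Longrightarrow> f (pure_tensor K V W v w) = g (pure_tensor K V W v w)"
    and t: "t \<in> carrier VW"
  shows "f t = g t"
proof -
  interpret U: vec K U using U by (simp add: vec_def K.field_axioms)
  show ?thesis
  proof (rule U.functional_ext)
    fix h assume h: "h \<in> functionals K U"
    have "esum K (rep K V W t) (\<lambda>v w. h (f (pure_tensor K V W v w))) =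
      esum K (rep K V W t) (\<lambda>v w. h (g (pure_tensor K V W v w)))"
      by (rule esum_cong[OF rep(1)[OF t]]) (simp only: eq)
    then show "h (f t) = h (g t)"
      using functional_rep[OF functional_comp[OF h f] t] functional_rep[OF functional_comp[OF h g] t] by simp
  qed (rule linear_mapsD(1)[OF f t] linear_mapsD(1)[OF g t])+
qed

lemma functional_tensor:
  assumes h: "h \<in> functionals K VW" and t: "t \<in> carrier VW"
  shows "h t = t (\<lambda>v w. h (pure_tensor K V W v w))"
proof -
  have "h t = esum K (rep K V W t) (\<lambda>v w. h (pure_tensor K V W v w))"
    by (rule functional_rep[OF h t])
  also have "\<dots> = t (\<lambda>v w. h (pure_tensor K V W v w))"
    by (rule tensor_eval[OF t bilinear_maps_functional[OF pure_bilinear h], symmetric])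
  finally show ?thesis .
qed

text \<open>
  The value at \<open>t\<close> is the sum of \<open>\<beta>\<close> over any list for \<open>t\<close>. It does not depend on the list, since each
  functional \<open>h\<close> sends this sum to \<open>t(h \<circ> \<beta>)\<close> and functionals separate points.
\<close>

lemma
  assumes U: "module K U" and \<beta>: "\<beta> \<in> bilinear_maps K V W U"
  shows tensor_lift_linear: "tensor_lift K V W U \<beta> \<in> linear_maps K VW U"
    and tensor_lift_extensional: "tensor_lift K V W U \<beta> \<in> extensional (carrier VW)"
    and tensor_lift_pure: "v \<in> carrier V \<Longrightarrow> w \<in> carrier W \<Longrightarrow> tensor_lift K V W U \<beta> (pure_tensor K V W v w) = \<beta> v w"
proof -
  interpret U: vec K U using U by (simp add: vec_def K.field_axioms)
  let ?T = "\<lambda>t\<in>carrier VW. esum U (rep K V W t) \<beta>"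
  have c: "esum U (rep K V W t) \<beta> \<in> carrier U" if "t \<in> carrier VW" for t
    by (rule U.V.M.esum_closed[OF rep(1)[OF that] bilinear_mapsD(3)[OF \<beta>]])
  have ev: "h (esum U (rep K V W t) \<beta>) = t (\<lambda>v w. h (\<beta> v w))" if "t \<in> carrier VW" "h \<in> functionals K U" for t h
  proof -
    have "h (esum U (rep K V W t) \<beta>) = esum K (rep K V W t) (\<lambda>v w. h (\<beta> v w))"
      by (rule U.functional_esum[OF that(2) rep(1)[OF that(1)] bilinear_mapsD(3)[OF \<beta>]])
    then show ?thesis using tensor_eval[OF that(1) bilinear_maps_functional[OF \<beta> that(2)]] by simp
  qed
  note bf = bilinear_maps_functional[OF \<beta>]
  have lin: "?T \<in> linear_maps K VW U"
    by (rule linear_mapsI)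
      (auto intro!: U.functional_ext simp: c ev bf functionalsD(2,3) add_closed smult_closed add_eval smult_eval)
  have p: "?T (pure_tensor K V W v w) = \<beta> v w" if "v \<in> carrier V" "w \<in> carrier W" for v w
    by (auto intro!: U.functional_ext simp: that c ev pure_closed bilinear_mapsD(3)[OF \<beta>] bf pure_eval)
  have "tensor_lift K V W U \<beta> = ?T"
    unfolding tensor_lift_def
  proof (rule the_equality)
    fix S assume S: "S \<in> linear_maps K VW U \<inter> extensional (carrier VW) \<and>
      (\<forall>v\<in>carrier V. \<forall>w\<in>carrier W. S (pure_tensor K V W v w) = \<beta> v w)"
    then have "S \<in> linear_maps K VW U" "S \<in> extensional (carrier VW)"
      "\<And>v w. v \<in> carrier V \<Longrightarrow> w \<in> carrier W \<Longrightarrow> S (pure_tensor K V W v w) = ?T (pure_tensor K V W v w)"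
      using p by auto
    from linear_eq_on_pure[OF U this(1) lin this(3)] this(2) show "S = ?T"
      by (intro extensionalityI[of _ "carrier VW"]) auto
  qed (use lin p in auto)
  then show "tensor_lift K V W U \<beta> \<in> linear_maps K VW U" "tensor_lift K V W U \<beta> \<in> extensional (carrier VW)"
    "v \<in> carrier V \<Longrightarrow> w \<in> carrier W \<Longrightarrow> tensor_lift K V W U \<beta> (pure_tensor K V W v w) = \<beta> v w"
    using lin p by auto
qed

lemma tensor_lift_functional:
  assumes U: "module K U" and \<beta>: "\<beta> \<in> bilinear_maps K V W U" and h: "h \<in> functionals K U" and t: "t \<in> carrier VW"
  shows "h (tensor_lift K V W U \<beta> t) = t (\<lambda>v w. h (\<beta> v w))"
proof -
  have "h (tensor_lift K V W U \<beta> t) = t (\<lambda>v w. h (tensor_lift K V W U \<beta> (pure_tensor K V W v w)))"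
    by (rule functional_tensor[OF functional_comp[OF h tensor_lift_linear[OF U \<beta>]] t])
  also have "\<dots> = t (\<lambda>v w. h (\<beta> v w))"
    by (rule tensor_cong[OF t])
      (auto intro!: bilinear_maps_functional[OF pure_bilinear functional_comp[OF h tensor_lift_linear[OF U \<beta>]]]
        bilinear_maps_functional[OF \<beta> h] simp: tensor_lift_pure[OF U \<beta>])
  finally show ?thesis .
qed

lemma tensor_lift_comp:
  assumes U: "module K U" and \<beta>: "\<beta> \<in> bilinear_maps K V W U" and U': "module K U'" and h: "h \<in> linear_maps K U U'"
    and t: "t \<in> carrier VW"
  shows "h (tensor_lift K V W U \<beta> t) = tensor_lift K V W U' (\<lambda>v w. h (\<beta> v w)) t"
proof -
  have b: "(\<lambda>v w. h (\<beta> v w)) \<in> bilinear_maps K V W U'"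
    by (rule bilinear_mapsI; rule linear_comp[OF h]; rule bilinear_mapsD[OF \<beta>])
  show ?thesis
    by (rule linear_eq_on_pure[OF U' linear_comp[OF h tensor_lift_linear[OF U \<beta>]] tensor_lift_linear[OF U' b] _ t])
      (simp add: tensor_lift_pure U U' \<beta> b)
qed

lemma tensor_lift_param:
  assumes U: "module K U" and t: "t \<in> carrier VW"
    and \<beta>: "\<And>z. z \<in> carrier Z \<Longrightarrow> (\<lambda>v w. \<beta> z v w) \<in> bilinear_maps K V W U"
    and lin: "\<And>v w. v \<in> carrier V \<Longrightarrow> w \<in> carrier W \<Longrightarrow> (\<lambda>z. \<beta> z v w) \<in> linear_maps K Z U"
    and Z: "module K Z"
  shows "(\<lambda>z. tensor_lift K V W U (\<lambda>v w. \<beta> z v w) t) \<in> linear_maps K Z U"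
proof -
  interpret U: vec K U using U by (simp add: vec_def K.field_axioms)
  interpret Z: vec K Z using Z by (simp add: vec_def K.field_axioms)
  have c: "tensor_lift K V W U (\<lambda>v w. \<beta> z v w) t \<in> carrier U" if "z \<in> carrier Z" for z
    by (rule linear_mapsD(1)[OF tensor_lift_linear[OF U \<beta>[OF that]] t])
  have f: "(\<lambda>z. t (\<lambda>v w. h (\<beta> z v w))) \<in> functionals K Z" if h: "h \<in> functionals K U" for h
  proof -
    have "(\<lambda>z. esum K (rep K V W t) (\<lambda>v w. h (\<beta> z v w))) \<in> functionals K Z"
      by (rule B.functional_esum_param[OF rep(1)[OF t]], rule functional_comp[OF h lin])
    moreover have "t (\<lambda>v w. h (\<beta> z v w)) = esum K (rep K V W t) (\<lambda>v w. h (\<beta> z v w))" if "z \<in> carrier Z" for z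
      by (rule tensor_eval[OF t bilinear_maps_functional[OF \<beta>[OF that] h]])
    ultimately show ?thesis by (rule functionals_cong[OF Z])
  qed
  note ev = tensor_lift_functional[OF U \<beta> _ t]
  show ?thesis
  proof (rule linear_mapsI)
    fix u v assume uv: "u \<in> carrier Z" "v \<in> carrier Z"
    show "tensor_lift K V W U (\<lambda>x y. \<beta> (u \<oplus>\<^bsub>Z\<^esub> v) x y) t =
      tensor_lift K V W U (\<lambda>x y. \<beta> u x y) t \<oplus>\<^bsub>U\<^esub> tensor_lift K V W U (\<lambda>x y. \<beta> v x y) t"
    proof (rule U.functional_ext)
      fix h assume h: "h \<in> functionals K U"
      have "h (tensor_lift K V W U (\<lambda>x y. \<beta> (u \<oplus>\<^bsub>Z\<^esub> v) x y) t) = t (\<lambda>x y. h (\<beta> (u \<oplus>\<^bsub>Z\<^esub> v) x y))"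
        using uv by (intro ev h) simp
      also have "\<dots> = t (\<lambda>x y. h (\<beta> u x y)) \<oplus> t (\<lambda>x y. h (\<beta> v x y))"
        by (rule functionalsD(2)[OF f[OF h] uv])
      also have "\<dots> = h (tensor_lift K V W U (\<lambda>x y. \<beta> u x y) t) \<oplus> h (tensor_lift K V W U (\<lambda>x y. \<beta> v x y) t)"
        by (simp only: ev[OF uv(1) h] ev[OF uv(2) h])
      also have "\<dots> = h (tensor_lift K V W U (\<lambda>x y. \<beta> u x y) t \<oplus>\<^bsub>U\<^esub> tensor_lift K V W U (\<lambda>x y. \<beta> v x y) t)"
        by (rule functionalsD(2)[OF h c[OF uv(1)] c[OF uv(2)], symmetric])
      finally show "h (tensor_lift K V W U (\<lambda>x y. \<beta> (u \<oplus>\<^bsub>Z\<^esub> v) x y) t) = \<dots>" .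
    qed (use uv c in simp_all)
  next
    fix k v assume kv: "k \<in> carrier K" "v \<in> carrier Z"
    show "tensor_lift K V W U (\<lambda>x y. \<beta> (k \<odot>\<^bsub>Z\<^esub> v) x y) t = k \<odot>\<^bsub>U\<^esub> tensor_lift K V W U (\<lambda>x y. \<beta> v x y) t"
    proof (rule U.functional_ext)
      fix h assume h: "h \<in> functionals K U"
      have "h (tensor_lift K V W U (\<lambda>x y. \<beta> (k \<odot>\<^bsub>Z\<^esub> v) x y) t) = t (\<lambda>x y. h (\<beta> (k \<odot>\<^bsub>Z\<^esub> v) x y))"
        using kv by (intro ev h) simp
      also have "\<dots> = k \<otimes> t (\<lambda>x y. h (\<beta> v x y))"
        by (rule functionalsD(3)[OF f[OF h] kv])
      also have "\<dots> = k \<otimes> h (tensor_lift K V W U (\<lambda>x y. \<beta> v x y) t)"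
        by (simp only: ev[OF kv(2) h])
      also have "\<dots> = h (k \<odot>\<^bsub>U\<^esub> tensor_lift K V W U (\<lambda>x y. \<beta> v x y) t)"
        by (rule functionalsD(3)[OF h kv(1) c[OF kv(2)], symmetric])
      finally show "h (tensor_lift K V W U (\<lambda>x y. \<beta> (k \<odot>\<^bsub>Z\<^esub> v) x y) t) = \<dots>" .
    qed (use kv c in simp_all)
  qed (rule c)
qed

end

section \<open>The algebra structure on multipliers\<close>

context nd_algebra
begin

abbreviation "MB \<equiv> mult_alg K B"

lemma multiplierD:
  assumes "m \<in> carrier MB"
  shows "fst m \<in> linear_maps K B B" "snd m \<in> linear_maps K B B"
    "b \<in> carrier B \<Longrightarrow> fst m b \<in> carrier B" "b \<in> carrier B \<Longrightarrow> snd m b \<in> carrier B"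
    "a \<in> carrier B \<Longrightarrow> b \<in> carrier B \<Longrightarrow> fst m (a \<otimes>\<^bsub>B\<^esub> b) = fst m a \<otimes>\<^bsub>B\<^esub> b"
    "a \<in> carrier B \<Longrightarrow> b \<in> carrier B \<Longrightarrow> snd m (a \<otimes>\<^bsub>B\<^esub> b) = a \<otimes>\<^bsub>B\<^esub> snd m b"
    "a \<in> carrier B \<Longrightarrow> b \<in> carrier B \<Longrightarrow> snd m a \<otimes>\<^bsub>B\<^esub> b = a \<otimes>\<^bsub>B\<^esub> fst m b"
  using assms by (auto simp: mult_alg_def multipliers_def linear_maps_def)

text \<open>
  A multiplier is determined by either of its two components, and right multiplication is the one
  used here.
\<close>

lemma multiplier_eq_snd:
  assumes m: "m \<in> carrier MB" and n: "n \<in> carrier MB"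
    and eq: "\<And>x. x \<in> carrier B \<Longrightarrow> snd m x = snd n x"
  shows "m = n"
  using multiplier_eq[of m n] assms by (simp add: mult_alg_def)

lemma multiplier_mult:
  "b \<in> carrier B \<Longrightarrow> fst (m \<otimes>\<^bsub>MB\<^esub> n) b = fst m (fst n b)"
  "b \<in> carrier B \<Longrightarrow> snd (m \<otimes>\<^bsub>MB\<^esub> n) b = snd n (snd m b)"
  by (simp_all add: mult_alg_def compose_def)

lemma multiplier_add:
  "b \<in> carrier B \<Longrightarrow> fst (m \<oplus>\<^bsub>MB\<^esub> n) b = fst m b \<oplus>\<^bsub>B\<^esub> fst n b"
  "b \<in> carrier B \<Longrightarrow> snd (m \<oplus>\<^bsub>MB\<^esub> n) b = snd m b \<oplus>\<^bsub>B\<^esub> snd n b"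
  by (simp_all add: mult_alg_def)

lemma multiplier_smult:
  "b \<in> carrier B \<Longrightarrow> fst (c \<odot>\<^bsub>MB\<^esub> m) b = c \<odot>\<^bsub>B\<^esub> fst m b"
  "b \<in> carrier B \<Longrightarrow> snd (c \<odot>\<^bsub>MB\<^esub> m) b = c \<odot>\<^bsub>B\<^esub> snd m b"
  by (simp_all add: mult_alg_def)

lemma multiplier_zero_one:
  "b \<in> carrier B \<Longrightarrow> fst \<zero>\<^bsub>MB\<^esub> b = \<zero>\<^bsub>B\<^esub>" "b \<in> carrier B \<Longrightarrow> snd \<zero>\<^bsub>MB\<^esub> b = \<zero>\<^bsub>B\<^esub>"
  "b \<in> carrier B \<Longrightarrow> fst \<one>\<^bsub>MB\<^esub> b = b" "b \<in> carrier B \<Longrightarrow> snd \<one>\<^bsub>MB\<^esub> b = b"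
  by (simp_all add: mult_alg_def)

lemmas multiplier_simps = multiplier_mult multiplier_add multiplier_smult multiplier_zero_one

lemma mult_linear:
  "a \<in> carrier B \<Longrightarrow> b \<in> carrier B \<Longrightarrow> c \<in> carrier B \<Longrightarrow> a \<otimes>\<^bsub>B\<^esub> (b \<oplus>\<^bsub>B\<^esub> c) = a \<otimes>\<^bsub>B\<^esub> b \<oplus>\<^bsub>B\<^esub> a \<otimes>\<^bsub>B\<^esub> c"
  "a \<in> carrier B \<Longrightarrow> b \<in> carrier B \<Longrightarrow> c \<in> carrier B \<Longrightarrow> (b \<oplus>\<^bsub>B\<^esub> c) \<otimes>\<^bsub>B\<^esub> a = b \<otimes>\<^bsub>B\<^esub> a \<oplus>\<^bsub>B\<^esub> c \<otimes>\<^bsub>B\<^esub> a"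
  "a \<in> carrier B \<Longrightarrow> b \<in> carrier B \<Longrightarrow> k \<in> carrier K \<Longrightarrow> a \<otimes>\<^bsub>B\<^esub> (k \<odot>\<^bsub>B\<^esub> b) = k \<odot>\<^bsub>B\<^esub> (a \<otimes>\<^bsub>B\<^esub> b)"
  "a \<in> carrier B \<Longrightarrow> b \<in> carrier B \<Longrightarrow> k \<in> carrier K \<Longrightarrow> (k \<odot>\<^bsub>B\<^esub> b) \<otimes>\<^bsub>B\<^esub> a = k \<odot>\<^bsub>B\<^esub> (b \<otimes>\<^bsub>B\<^esub> a)"
  using linear_mapsD(2,3)[OF mult_linear_right] linear_mapsD(2,3)[OF mult_linear_left] by simp_all

lemma zero_mult:
  assumes a: "a \<in> carrier B"
  shows "\<zero>\<^bsub>B\<^esub> \<otimes>\<^bsub>B\<^esub> a = \<zero>\<^bsub>B\<^esub>" "a \<otimes>\<^bsub>B\<^esub> \<zero>\<^bsub>B\<^esub> = \<zero>\<^bsub>B\<^esub>"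
  using mult_linear(3,4)[OF a B.M.zero_closed K.zero_closed] a by (simp_all add: mult_closed)

lemma multiplier_carrierI:
  assumes "L \<in> extensional (carrier B)" "R \<in> extensional (carrier B)"
    "\<And>w. w \<in> carrier B \<Longrightarrow> L w \<in> carrier B" "\<And>x. x \<in> carrier B \<Longrightarrow> R x \<in> carrier B"
    "\<And>x w. x \<in> carrier B \<Longrightarrow> w \<in> carrier B \<Longrightarrow> R x \<otimes>\<^bsub>B\<^esub> w = x \<otimes>\<^bsub>B\<^esub> L w"
  shows "(L, R) \<in> carrier MB"
proof -
  have "(\<lambda>w\<in>carrier B. L w, \<lambda>x\<in>carrier B. R x) \<in> multipliers K B"
    by (rule multiplierI) (use assms in auto)
  then show ?thesis using assms by (simp add: extensional_restrict mult_alg_def)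
qed

lemma mult_alg_closed:
  "m \<in> carrier MB \<Longrightarrow> n \<in> carrier MB \<Longrightarrow> m \<otimes>\<^bsub>MB\<^esub> n \<in> carrier MB"
  "m \<in> carrier MB \<Longrightarrow> n \<in> carrier MB \<Longrightarrow> m \<oplus>\<^bsub>MB\<^esub> n \<in> carrier MB"
  "c \<in> carrier K \<Longrightarrow> m \<in> carrier MB \<Longrightarrow> c \<odot>\<^bsub>MB\<^esub> m \<in> carrier MB"
  "\<zero>\<^bsub>MB\<^esub> \<in> carrier MB" "\<one>\<^bsub>MB\<^esub> \<in> carrier MB"
proof -
  have ext: "(\<lambda>b\<in>carrier B. L' b, \<lambda>b\<in>carrier B. R' b) \<in> carrier MB"
    if "\<And>w. w \<in> carrier B \<Longrightarrow> L' w \<in> carrier B" "\<And>x. x \<in> carrier B \<Longrightarrow> R' x \<in> carrier B"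
      "\<And>x w. x \<in> carrier B \<Longrightarrow> w \<in> carrier B \<Longrightarrow> R' x \<otimes>\<^bsub>B\<^esub> w = x \<otimes>\<^bsub>B\<^esub> L' w" for L' R'
    using that by (intro multiplier_carrierI) auto
  have "(\<lambda>b\<in>carrier B. fst m (fst n b), \<lambda>b\<in>carrier B. snd n (snd m b)) \<in> carrier MB"
    if "m \<in> carrier MB" "n \<in> carrier MB"
    by (rule ext) (simp_all add: multiplierD that)
  then show "m \<otimes>\<^bsub>MB\<^esub> n \<in> carrier MB" if "m \<in> carrier MB" "n \<in> carrier MB"
    using that by (simp add: mult_alg_def compose_def)
  have "(\<lambda>b\<in>carrier B. fst m b \<oplus>\<^bsub>B\<^esub> fst n b, \<lambda>b\<in>carrier B. snd m b \<oplus>\<^bsub>B\<^esub> snd n b) \<in> carrier MB"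
    if "m \<in> carrier MB" "n \<in> carrier MB"
    by (rule ext) (simp_all add: multiplierD mult_linear that)
  then show "m \<oplus>\<^bsub>MB\<^esub> n \<in> carrier MB" if "m \<in> carrier MB" "n \<in> carrier MB"
    using that by (simp add: mult_alg_def)
  have "(\<lambda>b\<in>carrier B. c \<odot>\<^bsub>B\<^esub> fst m b, \<lambda>b\<in>carrier B. c \<odot>\<^bsub>B\<^esub> snd m b) \<in> carrier MB"
    if "c \<in> carrier K" "m \<in> carrier MB"
    by (rule ext) (simp_all add: multiplierD mult_linear that)
  then show "c \<odot>\<^bsub>MB\<^esub> m \<in> carrier MB" if "c \<in> carrier K" "m \<in> carrier MB"
    using that by (simp add: mult_alg_def)
  have "(\<lambda>b\<in>carrier B. \<zero>\<^bsub>B\<^esub>, \<lambda>b\<in>carrier B. \<zero>\<^bsub>B\<^esub>) \<in> carrier MB"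
    by (rule ext) (simp_all add: zero_mult)
  then show "\<zero>\<^bsub>MB\<^esub> \<in> carrier MB" by (simp add: mult_alg_def)
  have "(\<lambda>b\<in>carrier B. b, \<lambda>b\<in>carrier B. b) \<in> carrier MB" by (rule ext) simp_all
  then show "\<one>\<^bsub>MB\<^esub> \<in> carrier MB" by (simp add: mult_alg_def)
qed

lemma mult_alg_assoc:
  "m \<in> carrier MB \<Longrightarrow> n \<in> carrier MB \<Longrightarrow> p \<in> carrier MB \<Longrightarrow> (m \<otimes>\<^bsub>MB\<^esub> n) \<otimes>\<^bsub>MB\<^esub> p = m \<otimes>\<^bsub>MB\<^esub> (n \<otimes>\<^bsub>MB\<^esub> p)"
  by (intro multiplier_eq_snd mult_alg_closed) (simp_all add: multiplier_mult multiplierD)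

lemma mult_alg_module: "module K MB"
proof (rule moduleI)
  show "cring K" by (rule K.cring_axioms)
  show "abelian_group MB"
  proof (rule abelian_groupI)
    fix m assume m: "m \<in> carrier MB"
    have c: "\<ominus>\<^bsub>K\<^esub> \<one>\<^bsub>K\<^esub> \<odot>\<^bsub>MB\<^esub> m \<in> carrier MB" by (intro mult_alg_closed m) simp
    show "\<exists>n\<in>carrier MB. n \<oplus>\<^bsub>MB\<^esub> m = \<zero>\<^bsub>MB\<^esub>"
      by (rule bexI[OF _ c], rule multiplier_eq_snd)
        (simp_all add: mult_alg_closed c m multiplier_simps multiplierD B.smult_l_minus B.M.l_neg)
  qed (simp_all add: mult_alg_closed | rule multiplier_eq_snd; simp add: mult_alg_closed multiplier_simps multiplierD B.M.a_ac)+
qed (simp_all add: mult_alg_closed | rule multiplier_eq_snd; simp add: mult_alg_closed multiplier_simps multiplierD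
    B.smult_l_distr B.smult_r_distr B.smult_assoc1)+

lemma mult_of_simps:
  "b \<in> carrier B \<Longrightarrow> fst (mult_of B a) b = a \<otimes>\<^bsub>B\<^esub> b" "b \<in> carrier B \<Longrightarrow> snd (mult_of B a) b = b \<otimes>\<^bsub>B\<^esub> a"
  by (simp_all add: mult_of_def)

lemma mult_of_closed: "a \<in> carrier B \<Longrightarrow> mult_of B a \<in> carrier MB"
  unfolding mult_of_def by (rule multiplier_carrierI) (simp_all add: mult_closed mult_assoc)

lemma mult_of_inj: "inj_on (mult_of B) (carrier B)"
proof (rule inj_onI)
  fix a b assume ab: "a \<in> carrier B" "b \<in> carrier B" "mult_of B a = mult_of B b"
  show "a = b"
  proof (rule eq_by_right_mult)
    show "a \<otimes>\<^bsub>B\<^esub> c = b \<otimes>\<^bsub>B\<^esub> c" if "c \<in> carrier B" for c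
      using mult_of_simps(1)[OF that, of a] mult_of_simps(1)[OF that, of b] ab(3) by simp
  qed (rule ab)+
qed

lemma elem_of_mult_of: "a \<in> carrier B \<Longrightarrow> elem_of B (mult_of B a) = a"
  unfolding elem_of_def by (rule inv_into_f_f[OF mult_of_inj])

lemma elem_of:
  assumes "m \<in> inner_mults B"
  shows "elem_of B m \<in> carrier B" "mult_of B (elem_of B m) = m"
  using assms by (auto simp: inner_mults_def elem_of_mult_of)

lemma mult_of_linear: "mult_of B \<in> linear_maps K B MB"
  by (rule linear_mapsI; (rule multiplier_eq_snd)?;
      simp add: mult_alg_closed mult_of_closed multiplier_simps mult_of_simps mult_linear)

lemma mult_of_mult: "a \<in> carrier B \<Longrightarrow> b \<in> carrier B \<Longrightarrow> mult_of B (a \<otimes>\<^bsub>B\<^esub> b) = mult_of B a \<otimes>\<^bsub>MB\<^esub> mult_of B b"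
  by (rule multiplier_eq_snd)
    (simp_all add: mult_alg_closed mult_of_closed multiplier_simps mult_of_simps mult_closed mult_assoc)

lemma mult_of_fst: "m \<in> carrier MB \<Longrightarrow> b \<in> carrier B \<Longrightarrow> mult_of B (fst m b) = m \<otimes>\<^bsub>MB\<^esub> mult_of B b"
  by (rule multiplier_eq_snd)
    (simp_all add: mult_alg_closed mult_of_closed multiplier_simps mult_of_simps multiplierD)

lemma mult_of_snd: "m \<in> carrier MB \<Longrightarrow> b \<in> carrier B \<Longrightarrow> mult_of B (snd m b) = mult_of B b \<otimes>\<^bsub>MB\<^esub> m"
  by (rule multiplier_eq_snd)
    (simp_all add: mult_alg_closed mult_of_closed multiplier_simps mult_of_simps multiplierD)

lemma mult_alg_mult_linear:
  assumes m: "m \<in> carrier MB"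
  shows "(\<lambda>n. m \<otimes>\<^bsub>MB\<^esub> n) \<in> linear_maps K MB MB" "(\<lambda>n. n \<otimes>\<^bsub>MB\<^esub> m) \<in> linear_maps K MB MB"
  by (rule linear_mapsI; (rule multiplier_eq_snd)?;
      simp add: m mult_alg_closed multiplier_simps multiplierD linear_mapsD(2,3)[OF multiplierD(2)[OF m]])+

lemma apply_linear:
  assumes b: "b \<in> carrier B"
  shows "(\<lambda>m. fst m b) \<in> linear_maps K MB B" "(\<lambda>m. snd m b) \<in> linear_maps K MB B"
  by (rule linear_mapsI; simp add: b multiplier_simps multiplierD)+

text \<open>
  \<open>elem_of\<close> is the inverse of the injective linear map \<open>mult_of\<close>, hence linear where it is defined.
\<close>

lemma elem_of_linear:
  assumes Z: "module K Z" and g: "g \<in> linear_maps K Z MB" and i: "\<And>z. z \<in> carrier Z \<Longrightarrow> g z \<in> inner_mults B"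
  shows "(\<lambda>z. elem_of B (g z)) \<in> linear_maps K Z B"
proof -
  interpret Z: module K Z by fact
  note e = elem_of[OF i]
  show ?thesis
    by (rule linear_mapsI; (rule inj_onD[OF mult_of_inj])?;
      simp add: e linear_mapsD(2,3)[OF mult_of_linear] linear_mapsD(2,3)[OF g, symmetric])
qed

end

section \<open>The tensor product of two algebras\<close>

locale nd2 = K?: field K + V: nd_algebra K V + W: nd_algebra K W for K (structure) and V and W
begin

sublocale vec2 K V W by unfold_locales

lemmas Vm = V.B.module_axioms and Wm = W.B.module_axioms and Tm = tensor_module
lemmas pure_comp = bilinear_maps_comp[OF pure_bilinear]
lemmas ml_T = pure_comp linear_id V.linear_mult_left V.linear_mult_right W.linear_mult_left W.linear_mult_right
  V.mult_closed W.mult_closed Vm Wm Tm pure_closed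

lemma mult_pure: "v \<in> carrier V \<Longrightarrow> w \<in> carrier W \<Longrightarrow> v' \<in> carrier V \<Longrightarrow> w' \<in> carrier W \<Longrightarrow>
  pure_tensor K V W v w \<otimes>\<^bsub>VW\<^esub> pure_tensor K V W v' w' = pure_tensor K V W (v \<otimes>\<^bsub>V\<^esub> v') (w \<otimes>\<^bsub>W\<^esub> w')"
  by (rule tensor_mult_pure) unfold_locales

text \<open>
  The product of tensors as an iterated extension from pure tensors. Closedness, bilinearity and
  associativity all follow from this description.
\<close>

lemma tensor_mult_lift:
  assumes s: "s \<in> carrier VW" and t: "t \<in> carrier VW"
  shows "s \<otimes>\<^bsub>VW\<^esub> t = tensor_lift K V W VW (\<lambda>v w. tensor_lift K V W VW
    (\<lambda>v' w'. pure_tensor K V W (v \<otimes>\<^bsub>V\<^esub> v') (w \<otimes>\<^bsub>W\<^esub> w')) t) s" (is "_ = ?r")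
    and "(\<lambda>v w. tensor_lift K V W VW (\<lambda>v' w'. pure_tensor K V W (v \<otimes>\<^bsub>V\<^esub> v') (w \<otimes>\<^bsub>W\<^esub> w')) t) \<in> bilinear_maps K V W VW"
    and "v \<in> carrier V \<Longrightarrow> w \<in> carrier W \<Longrightarrow>
      (\<lambda>v' w'. pure_tensor K V W (v \<otimes>\<^bsub>V\<^esub> v') (w \<otimes>\<^bsub>W\<^esub> w')) \<in> bilinear_maps K V W VW"
proof -
  have i: "(\<lambda>v' w'. pure_tensor K V W (v \<otimes>\<^bsub>V\<^esub> v') (w \<otimes>\<^bsub>W\<^esub> w')) \<in> bilinear_maps K V W VW"
    if "v \<in> carrier V" "w \<in> carrier W" for v w
    by (intro bilinear_mapsI ml_T; simp add: that)
  then show "v \<in> carrier V \<Longrightarrow> w \<in> carrier W \<Longrightarrow>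
      (\<lambda>v' w'. pure_tensor K V W (v \<otimes>\<^bsub>V\<^esub> v') (w \<otimes>\<^bsub>W\<^esub> w')) \<in> bilinear_maps K V W VW" .
  show o: "(\<lambda>v w. tensor_lift K V W VW (\<lambda>v' w'. pure_tensor K V W (v \<otimes>\<^bsub>V\<^esub> v') (w \<otimes>\<^bsub>W\<^esub> w')) t) \<in> bilinear_maps K V W VW"
    by (intro bilinear_mapsI tensor_lift_param t i ml_T; assumption)
  have rc: "?r \<in> carrier VW" by (rule linear_mapsD(1)[OF tensor_lift_linear[OF Tm o] s])
  have ev: "?r B = s (\<lambda>v w. t (\<lambda>v' w'. B (v \<otimes>\<^bsub>V\<^esub> v') (w \<otimes>\<^bsub>W\<^esub> w')))" if B: "B \<in> bilinear_forms K V W" for B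
  proof -
    note h = eval_functional[OF B]
    have eq: "tensor_lift K V W VW (\<lambda>v' w'. pure_tensor K V W (v \<otimes>\<^bsub>V\<^esub> v') (w \<otimes>\<^bsub>W\<^esub> w')) t B =
      t (\<lambda>v' w'. B (v \<otimes>\<^bsub>V\<^esub> v') (w \<otimes>\<^bsub>W\<^esub> w'))" if "v \<in> carrier V" "w \<in> carrier W" for v w
      using tensor_lift_functional[OF Tm i[OF that] h t] by (simp add: pure_eval B)
    note oB = bilinear_maps_functional[OF o h]
    have "(\<lambda>v w. t (\<lambda>v' w'. B (v \<otimes>\<^bsub>V\<^esub> v') (w \<otimes>\<^bsub>W\<^esub> w'))) \<in> bilinear_forms K V W"
    proof (rule bilinear_formsI)
      show "(\<lambda>w. t (\<lambda>v' w'. B (v \<otimes>\<^bsub>V\<^esub> v') (w \<otimes>\<^bsub>W\<^esub> w'))) \<in> functionals K W" if "v \<in> carrier V" for v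
        by (rule functionals_cong[OF Wm bilinear_formsD(1)[OF oB that]]) (rule eq[symmetric, OF that])
      show "(\<lambda>v. t (\<lambda>v' w'. B (v \<otimes>\<^bsub>V\<^esub> v') (w \<otimes>\<^bsub>W\<^esub> w'))) \<in> functionals K V" if "w \<in> carrier W" for w
        by (rule functionals_cong[OF Vm bilinear_formsD(2)[OF oB that]]) (rule eq[symmetric, OF _ that])
    qed
    from tensor_cong[OF s oB this eq] show ?thesis
      using tensor_lift_functional[OF Tm o h s] by simp
  qed
  have "s \<otimes>\<^bsub>VW\<^esub> t = tens K V W (rep K V W ?r)"
    unfolding tens_def tensor_def module.simps monoid.simps partial_object.simps ring.simps
    by (rule restrict_ext) (simp add: ev[unfolded tensor_def] tensor_eval[OF rc, symmetric, unfolded tensor_def])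
  then show "s \<otimes>\<^bsub>VW\<^esub> t = ?r" using rep(2)[OF rc] by simp
qed

lemma tensor_mult_closed: "s \<in> carrier VW \<Longrightarrow> t \<in> carrier VW \<Longrightarrow> s \<otimes>\<^bsub>VW\<^esub> t \<in> carrier VW"
  by (simp only: tensor_mult_lift(1)) (rule linear_mapsD(1)[OF tensor_lift_linear[OF Tm tensor_mult_lift(2)]])

lemma tensor_mult_linear_left:
  assumes t: "t \<in> carrier VW" shows "(\<lambda>s. s \<otimes>\<^bsub>VW\<^esub> t) \<in> linear_maps K VW VW"
proof -
  note l = linear_mapsD[OF tensor_lift_linear[OF Tm tensor_mult_lift(2)[OF t t]]]
  show ?thesis
    by (rule linear_mapsI) (simp_all add: tensor_mult_lift(1) t l add_closed smult_closed)
qed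

lemma tensor_mult_linear_right:
  assumes s: "s \<in> carrier VW" shows "(\<lambda>t. s \<otimes>\<^bsub>VW\<^esub> t) \<in> linear_maps K VW VW"
proof -
  have "(\<lambda>t. tensor_lift K V W VW (\<lambda>v w. tensor_lift K V W VW
    (\<lambda>v' w'. pure_tensor K V W (v \<otimes>\<^bsub>V\<^esub> v') (w \<otimes>\<^bsub>W\<^esub> w')) t) s) \<in> linear_maps K VW VW"
    by (intro tensor_lift_param s tensor_mult_lift(2)[OF s] tensor_lift_linear tensor_mult_lift(3)[OF s s] Tm)
  note l = linear_mapsD[OF this]
  show ?thesis
    by (rule linear_mapsI) (simp_all add: tensor_mult_lift(1) s l add_closed smult_closed)
qed

lemma tensor_mult_assoc:
  assumes "r \<in> carrier VW" "s \<in> carrier VW" "t \<in> carrier VW"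
  shows "(r \<otimes>\<^bsub>VW\<^esub> s) \<otimes>\<^bsub>VW\<^esub> t = r \<otimes>\<^bsub>VW\<^esub> (s \<otimes>\<^bsub>VW\<^esub> t)"
proof -
  note L = tensor_mult_linear_left and R = tensor_mult_linear_right
  note rules = L R linear_comp[OF L] linear_comp[OF R] tensor_mult_closed pure_closed Tm
  have 1: "(pure_tensor K V W a b \<otimes>\<^bsub>VW\<^esub> pure_tensor K V W c d) \<otimes>\<^bsub>VW\<^esub> t =
    pure_tensor K V W a b \<otimes>\<^bsub>VW\<^esub> (pure_tensor K V W c d \<otimes>\<^bsub>VW\<^esub> t)"
    if "a \<in> carrier V" "b \<in> carrier W" "c \<in> carrier V" "d \<in> carrier W" for a b c d
    by (rule linear_eq_on_pure[where U = VW and f = "\<lambda>t. (pure_tensor K V W a b \<otimes>\<^bsub>VW\<^esub> pure_tensor K V W c d) \<otimes>\<^bsub>VW\<^esub> t"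
          and g = "\<lambda>t. pure_tensor K V W a b \<otimes>\<^bsub>VW\<^esub> (pure_tensor K V W c d \<otimes>\<^bsub>VW\<^esub> t)"]; (intro rules)?)
      (simp_all add: mult_pure V.mult_closed W.mult_closed V.mult_assoc W.mult_assoc assms that)
  have 2: "(pure_tensor K V W a b \<otimes>\<^bsub>VW\<^esub> s) \<otimes>\<^bsub>VW\<^esub> t = pure_tensor K V W a b \<otimes>\<^bsub>VW\<^esub> (s \<otimes>\<^bsub>VW\<^esub> t)"
    if "a \<in> carrier V" "b \<in> carrier W" for a b
    by (rule linear_eq_on_pure[where U = VW and f = "\<lambda>s. (pure_tensor K V W a b \<otimes>\<^bsub>VW\<^esub> s) \<otimes>\<^bsub>VW\<^esub> t"
          and g = "\<lambda>s. pure_tensor K V W a b \<otimes>\<^bsub>VW\<^esub> (s \<otimes>\<^bsub>VW\<^esub> t)"]; (intro rules)?)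
      (simp_all add: 1 assms that)
  show ?thesis
    by (rule linear_eq_on_pure[where U = VW and f = "\<lambda>r. (r \<otimes>\<^bsub>VW\<^esub> s) \<otimes>\<^bsub>VW\<^esub> t"
          and g = "\<lambda>r. r \<otimes>\<^bsub>VW\<^esub> (s \<otimes>\<^bsub>VW\<^esub> t)"]; (intro rules)?)
      (simp_all add: 2 assms)
qed

lemma formal_tensor:
  assumes "t \<in> carrier VW"
  shows "formal K (carrier V) (carrier W) (esum K (rep K V W t))"
    "formal K (carrier W) (carrier V) (\<lambda>D. esum K (rep K V W t) (\<lambda>v w. D w v))"
proof -
  show "formal K (carrier V) (carrier W) (esum K (rep K V W t))"
    unfolding formal_def by (rule bexI[OF _ rep(1)[OF assms]]) simp
  show "formal K (carrier W) (carrier V) (\<lambda>D. esum K (rep K V W t) (\<lambda>v w. D w v))"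
    unfolding formal_def by (rule bexI[OF _ swap_lists[OF rep(1)[OF assms]]]) simp
qed

lemma formal_zero: "formal K P I (\<lambda>D. \<zero>)"
  unfolding formal_def by (rule bexI[of _ "[]"]) auto

lemma tensor_zeroI:
  assumes t: "t \<in> carrier VW" and eq: "\<And>B. B \<in> bilinear_forms K V W \<Longrightarrow> esum K (rep K V W t) B = \<zero>"
  shows "t = \<zero>\<^bsub>VW\<^esub>"
  by (rule tensor_eqI[OF t zero_closed]) (simp add: tensor_eval[OF t] eq zero_eval)

lemma tensor_mult_pure_eval:
  assumes t: "t \<in> carrier VW" and x: "v \<in> carrier V" "w \<in> carrier W" and B: "B \<in> bilinear_forms K V W"
  shows "(t \<otimes>\<^bsub>VW\<^esub> pure_tensor K V W v w) B = esum K (rep K V W t) (\<lambda>v' w'. B (v' \<otimes>\<^bsub>V\<^esub> v) (w' \<otimes>\<^bsub>W\<^esub> w))"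
    "(pure_tensor K V W v w \<otimes>\<^bsub>VW\<^esub> t) B = esum K (rep K V W t) (\<lambda>v' w'. B (v \<otimes>\<^bsub>V\<^esub> v') (w \<otimes>\<^bsub>W\<^esub> w'))"
proof -
  note f = functional_rep[OF functional_comp[OF eval_functional[OF B] tensor_mult_linear_left[OF pure_closed[OF x]]] t]
    functional_rep[OF functional_comp[OF eval_functional[OF B] tensor_mult_linear_right[OF pure_closed[OF x]]] t]
  show "(t \<otimes>\<^bsub>VW\<^esub> pure_tensor K V W v w) B = esum K (rep K V W t) (\<lambda>v' w'. B (v' \<otimes>\<^bsub>V\<^esub> v) (w' \<otimes>\<^bsub>W\<^esub> w))"
    unfolding f(1) by (rule esum_cong[OF rep(1)[OF t]]) (simp add: mult_pure x pure_eval[OF B])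
  show "(pure_tensor K V W v w \<otimes>\<^bsub>VW\<^esub> t) B = esum K (rep K V W t) (\<lambda>v' w'. B (v \<otimes>\<^bsub>V\<^esub> v') (w \<otimes>\<^bsub>W\<^esub> w'))"
    unfolding f(2) by (rule esum_cong[OF rep(1)[OF t]]) (simp add: mult_pure x pure_eval[OF B])
qed

text \<open>
  Right multiplication by \<open>v \<otimes> w\<close> is cancelled one leg at a time.
\<close>

lemma tensor_nondegenerate_left:
  assumes t: "t \<in> carrier VW" and z: "\<forall>s\<in>carrier VW. t \<otimes>\<^bsub>VW\<^esub> s = \<zero>\<^bsub>VW\<^esub>"
  shows "t = \<zero>\<^bsub>VW\<^esub>"
proof (rule tensor_zeroI[OF t])
  note f = formal_tensor[OF t] formal_zero
  have 1: "esum K (rep K V W t) (\<lambda>p q. B (p \<otimes>\<^bsub>V\<^esub> v) q) = \<zero>"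
    if v: "v \<in> carrier V" and B: "B \<in> bilinear_forms K V W" for v B
  proof (rule W.cancel_right_right[where F = "\<lambda>B. esum K (rep K V W t) (\<lambda>p q. B (p \<otimes>\<^bsub>V\<^esub> v) q)" and G = "\<lambda>_. \<zero>" and C = B, OF _ _ _ B])
    fix w C assume w: "w \<in> carrier W" and C: "C \<in> bilinear_forms K V W"
    show "esum K (rep K V W t) (\<lambda>p q. C (p \<otimes>\<^bsub>V\<^esub> v) (q \<otimes>\<^bsub>W\<^esub> w)) = \<zero>"
      using z tensor_mult_pure_eval(1)[OF t v w C] by (simp add: pure_closed v w zero_eval C)
  next
    show "formal K (carrier W) (carrier V) (\<lambda>D. esum K (rep K V W t) (\<lambda>p q. D q (p \<otimes>\<^bsub>V\<^esub> v)))"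
      by (rule B.formal_esum[OF rep(1)[OF t] B.formal_base]) (simp_all add: v V.mult_closed)
  qed (rule f)
  show "esum K (rep K V W t) B = \<zero>" if B: "B \<in> bilinear_forms K V W" for B
    by (rule B.cancel_left[OF Vm f(1) f(3), where J = "carrier V" and \<rho> = "\<lambda>d v. v \<otimes>\<^bsub>V\<^esub> d", OF _ _ 1 B])
      (simp_all add: V.mult_linear_left V.eq_by_right_mult)
qed

lemma tensor_nondegenerate_right:
  assumes t: "t \<in> carrier VW" and z: "\<forall>s\<in>carrier VW. s \<otimes>\<^bsub>VW\<^esub> t = \<zero>\<^bsub>VW\<^esub>"
  shows "t = \<zero>\<^bsub>VW\<^esub>"
proof (rule tensor_zeroI[OF t])
  note f = formal_tensor[OF t] formal_zero
  have 1: "esum K (rep K V W t) (\<lambda>p q. B p (w \<otimes>\<^bsub>W\<^esub> q)) = \<zero>"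
    if w: "w \<in> carrier W" and B: "B \<in> bilinear_forms K V W" for w B
  proof (rule V.cancel_left_left[where F = "\<lambda>B. esum K (rep K V W t) (\<lambda>p q. B p (w \<otimes>\<^bsub>W\<^esub> q))" and G = "\<lambda>_. \<zero>" and C = B, OF _ _ _ B])
    fix v C assume v: "v \<in> carrier V" and C: "C \<in> bilinear_forms K V W"
    show "esum K (rep K V W t) (\<lambda>p q. C (v \<otimes>\<^bsub>V\<^esub> p) (w \<otimes>\<^bsub>W\<^esub> q)) = \<zero>"
      using z tensor_mult_pure_eval(2)[OF t v w C] by (simp add: pure_closed v w zero_eval C)
  next
    show "formal K (carrier V) (carrier W) (\<lambda>D. esum K (rep K V W t) (\<lambda>p q. D p (w \<otimes>\<^bsub>W\<^esub> q)))"
      by (rule B.formal_esum[OF rep(1)[OF t] B.formal_base]) (simp_all add: w W.mult_closed)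
  qed (rule f)
  show "esum K (rep K V W t) B = \<zero>" if B: "B \<in> bilinear_forms K V W" for B
    by (rule B.cancel_right[OF Wm f(2) f(3), where J = "carrier W" and \<rho> = "\<lambda>d w. d \<otimes>\<^bsub>W\<^esub> w", OF _ _ 1 B])
      (simp_all add: W.mult_linear_right W.eq_by_left_mult)
qed

lemma tensor_nonzero: "carrier VW \<noteq> {\<zero>\<^bsub>VW\<^esub>}"
proof -
  obtain v w where v: "v \<in> carrier V" "v \<noteq> \<zero>\<^bsub>V\<^esub>" and w: "w \<in> carrier W" "w \<noteq> \<zero>\<^bsub>W\<^esub>"
    using V.non_zero W.non_zero V.B.M.zero_closed W.B.M.zero_closed by blast
  obtain f where f: "f \<in> functionals K V" "f v = \<one>"
    using VV.functional_separating[of "{\<zero>\<^bsub>V\<^esub>}" v] v by (auto simp: VV.subspace_def)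
  obtain g where g: "g \<in> functionals K W" "g w = \<one>"
    using WW.functional_separating[of "{\<zero>\<^bsub>W\<^esub>}" w] w by (auto simp: WW.subspace_def)
  have B: "(\<lambda>v w. f v \<otimes> g w) \<in> bilinear_forms K V W"
    by (intro bilinear_formsI B.functional_scale_left B.functional_scale_right f g functionalsD(1)[OF f(1)] functionalsD(1)[OF g(1)])
  have "pure_tensor K V W v w \<noteq> \<zero>\<^bsub>VW\<^esub>"
  proof
    assume "pure_tensor K V W v w = \<zero>\<^bsub>VW\<^esub>"
    then have "pure_tensor K V W v w (\<lambda>v w. f v \<otimes> g w) = \<zero>" by (simp add: zero_eval B)
    then show False by (simp add: pure_eval B f g)
  qed
  then show ?thesis using pure_closed[OF v(1) w(1)] by auto
qed

lemma tensor_nd_algebra: "nd_algebra K VW"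
proof (intro nd_algebra.intro nd_algebra_axioms.intro)
  show "field K" by (rule K.field_axioms)
  show "module K VW" by (rule Tm)
qed (rule tensor_mult_closed tensor_mult_assoc tensor_mult_linear_left tensor_mult_linear_right
      tensor_nonzero tensor_nondegenerate_left tensor_nondegenerate_right; assumption)+

sublocale T: nd_algebra K VW by (rule tensor_nd_algebra)

end

section \<open>Products with one leg\<close>

context nd2
begin

lemma linear_rep:
  assumes h: "h \<in> linear_maps K VW U" and B: "(\<lambda>u. F u) \<in> functionals K U" and t: "t \<in> carrier VW"
  shows "F (h t) = esum K (rep K V W t) (\<lambda>v w. F (h (pure_tensor K V W v w)))"
  by (rule functional_rep[OF functional_comp[OF B h] t])

lemma tensor_map:
  assumes f: "f \<in> linear_maps K V V" and g: "g \<in> linear_maps K W W"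
  shows "tensor_map K V W V W f g \<in> linear_maps K VW VW" "tensor_map K V W V W f g \<in> extensional (carrier VW)"
    "v \<in> carrier V \<Longrightarrow> w \<in> carrier W \<Longrightarrow> tensor_map K V W V W f g (pure_tensor K V W v w) = pure_tensor K V W (f v) (g w)"
proof -
  have b: "(\<lambda>v w. pure_tensor K V W (f v) (g w)) \<in> bilinear_maps K V W VW"
    by (intro bilinear_mapsI pure_comp f g linear_mapsD(1)[OF f] linear_mapsD(1)[OF g])
  show "tensor_map K V W V W f g \<in> linear_maps K VW VW" "tensor_map K V W V W f g \<in> extensional (carrier VW)"
    "v \<in> carrier V \<Longrightarrow> w \<in> carrier W \<Longrightarrow> tensor_map K V W V W f g (pure_tensor K V W v w) = pure_tensor K V W (f v) (g w)"
    unfolding tensor_map_def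
    by (rule tensor_lift_linear[OF Tm b] tensor_lift_extensional[OF Tm b] tensor_lift_pure[OF Tm b]; assumption)+
qed

text \<open>
  Non-degeneracy of \<open>V \<otimes> W\<close> leaves the compatibility of the two maps as the only condition, and that is
  bilinear, so that pure tensors suffice.
\<close>

lemma tensor_multiplierI:
  assumes L: "L \<in> linear_maps K VW VW" "L \<in> extensional (carrier VW)"
    and R: "R \<in> linear_maps K VW VW" "R \<in> extensional (carrier VW)"
    and eq: "\<And>a b c d. a \<in> carrier V \<Longrightarrow> b \<in> carrier W \<Longrightarrow> c \<in> carrier V \<Longrightarrow> d \<in> carrier W \<Longrightarrow>
      R (pure_tensor K V W a b) \<otimes>\<^bsub>VW\<^esub> pure_tensor K V W c d = pure_tensor K V W a b \<otimes>\<^bsub>VW\<^esub> L (pure_tensor K V W c d)"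
  shows "(L, R) \<in> carrier (mult_alg K VW)"
proof (rule T.multiplier_carrierI)
  note LR = linear_mapsD(1)[OF L(1)] linear_mapsD(1)[OF R(1)]
  note rules = tensor_mult_linear_left tensor_mult_linear_right linear_comp[OF tensor_mult_linear_left]
    linear_comp[OF tensor_mult_linear_right] L R LR Tm pure_closed
  have 1: "R (pure_tensor K V W a b) \<otimes>\<^bsub>VW\<^esub> t = pure_tensor K V W a b \<otimes>\<^bsub>VW\<^esub> L t"
    if "a \<in> carrier V" "b \<in> carrier W" "t \<in> carrier VW" for a b t
    by (rule linear_eq_on_pure[where f = "\<lambda>t. R (pure_tensor K V W a b) \<otimes>\<^bsub>VW\<^esub> t" and U = VW
          and g = "\<lambda>t. pure_tensor K V W a b \<otimes>\<^bsub>VW\<^esub> L t", OF _ _ _ eq that(3)]; (intro rules that)?)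
  show "R s \<otimes>\<^bsub>VW\<^esub> t = s \<otimes>\<^bsub>VW\<^esub> L t" if "s \<in> carrier VW" "t \<in> carrier VW" for s t
    by (rule linear_eq_on_pure[where f = "\<lambda>s. R s \<otimes>\<^bsub>VW\<^esub> t" and U = VW
          and g = "\<lambda>s. s \<otimes>\<^bsub>VW\<^esub> L t", OF _ _ _ 1 that(1)]; (intro rules that)?)
qed (use L R in \<open>simp_all add: linear_mapsD(1)\<close>)

lemma multiplier_eq_on_pure:
  assumes m: "m \<in> carrier (mult_alg K VW)" and n: "n \<in> carrier (mult_alg K VW)"
    and eq: "\<And>v w. v \<in> carrier V \<Longrightarrow> w \<in> carrier W \<Longrightarrow> snd m (pure_tensor K V W v w) = snd n (pure_tensor K V W v w)"
  shows "m = n"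
  by (rule T.multiplier_eq_snd[OF m n]) (rule linear_eq_on_pure[OF Tm T.multiplierD(2)[OF m] T.multiplierD(2)[OF n] eq])

lemma mult_tensor:
  assumes m: "m \<in> carrier (mult_alg K V)" and n: "n \<in> carrier (mult_alg K W)"
  shows "mult_tensor K V W m n \<in> carrier (mult_alg K VW)"
    "v \<in> carrier V \<Longrightarrow> w \<in> carrier W \<Longrightarrow> fst (mult_tensor K V W m n) (pure_tensor K V W v w) = pure_tensor K V W (fst m v) (fst n w)"
    "v \<in> carrier V \<Longrightarrow> w \<in> carrier W \<Longrightarrow> snd (mult_tensor K V W m n) (pure_tensor K V W v w) = pure_tensor K V W (snd m v) (snd n w)"
proof -
  note f = tensor_map[OF V.multiplierD(1)[OF m] W.multiplierD(1)[OF n]]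
    and s = tensor_map[OF V.multiplierD(2)[OF m] W.multiplierD(2)[OF n]]
  show "mult_tensor K V W m n \<in> carrier (mult_alg K VW)"
    unfolding mult_tensor_def
    by (rule tensor_multiplierI[OF f(1,2) s(1,2)]) (simp add: f(3) s(3) mult_pure V.multiplierD[OF m] W.multiplierD[OF n])
qed (simp_all add: mult_tensor_def tensor_map V.multiplierD[OF m] W.multiplierD[OF n])

lemmas one_V = V.mult_alg_closed(5) and one_W = W.mult_alg_closed(5)

lemma legs_closed: "v \<in> carrier V \<Longrightarrow> leg1 K V W v \<in> carrier (mult_alg K VW)"
  "w \<in> carrier W \<Longrightarrow> leg2 K V W w \<in> carrier (mult_alg K VW)"
  unfolding leg1_def leg2_def by (intro mult_tensor one_V one_W V.mult_of_closed W.mult_of_closed; assumption)+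

lemma legs_pure:
  assumes "v \<in> carrier V" "w \<in> carrier W"
  shows "c \<in> carrier V \<Longrightarrow> fst (leg1 K V W c) (pure_tensor K V W v w) = pure_tensor K V W (c \<otimes>\<^bsub>V\<^esub> v) w"
    "c \<in> carrier V \<Longrightarrow> snd (leg1 K V W c) (pure_tensor K V W v w) = pure_tensor K V W (v \<otimes>\<^bsub>V\<^esub> c) w"
    "d \<in> carrier W \<Longrightarrow> fst (leg2 K V W d) (pure_tensor K V W v w) = pure_tensor K V W v (d \<otimes>\<^bsub>W\<^esub> w)"
    "d \<in> carrier W \<Longrightarrow> snd (leg2 K V W d) (pure_tensor K V W v w) = pure_tensor K V W v (w \<otimes>\<^bsub>W\<^esub> d)"
  unfolding leg1_def leg2_def
  by (simp_all add: assms mult_tensor one_V one_W V.mult_of_closed W.mult_of_closed V.mult_of_simps W.mult_of_simps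
      V.multiplier_zero_one W.multiplier_zero_one)

lemma legs_mult:
  "c \<in> carrier V \<Longrightarrow> d \<in> carrier W \<Longrightarrow> leg1 K V W c \<otimes>\<^bsub>T.MB\<^esub> leg2 K V W d = mult_of VW (pure_tensor K V W c d)"
  "c \<in> carrier V \<Longrightarrow> d \<in> carrier W \<Longrightarrow> leg2 K V W d \<otimes>\<^bsub>T.MB\<^esub> leg1 K V W c = mult_of VW (pure_tensor K V W c d)"
  "c \<in> carrier V \<Longrightarrow> c' \<in> carrier V \<Longrightarrow> leg1 K V W (c \<otimes>\<^bsub>V\<^esub> c') = leg1 K V W c \<otimes>\<^bsub>T.MB\<^esub> leg1 K V W c'"
  "d \<in> carrier W \<Longrightarrow> d' \<in> carrier W \<Longrightarrow> leg2 K V W (d \<otimes>\<^bsub>W\<^esub> d') = leg2 K V W d \<otimes>\<^bsub>T.MB\<^esub> leg2 K V W d'"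
  by (rule multiplier_eq_on_pure;
      simp add: T.mult_alg_closed legs_closed T.mult_of_closed pure_closed T.multiplier_mult legs_pure mult_pure
        T.mult_of_simps V.mult_closed W.mult_closed V.mult_assoc W.mult_assoc)+

lemma legs_linear: "leg1 K V W \<in> linear_maps K V T.MB" "leg2 K V W \<in> linear_maps K W T.MB"
  by (rule linear_mapsI; (rule multiplier_eq_on_pure)?;
      simp add: T.mult_alg_closed legs_closed pure_closed T.multiplier_simps legs_pure V.mult_linear W.mult_linear
        V.mult_closed W.mult_closed linear_mapsD(2,3)[OF bilinear_mapsD(2)[OF pure_bilinear]]
        linear_mapsD(2,3)[OF bilinear_mapsD(1)[OF pure_bilinear]])+

text \<open>
  The action of the legs on lists. These equations translate identities between multipliers into the
  axioms on lists.
\<close>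

lemma legs_rep:
  assumes t: "t \<in> carrier VW" and B: "B \<in> bilinear_forms K V W"
  shows "c \<in> carrier V \<Longrightarrow> esum K (rep K V W (fst (leg1 K V W c) t)) B = esum K (rep K V W t) (\<lambda>u v. B (c \<otimes>\<^bsub>V\<^esub> u) v)"
    "c \<in> carrier V \<Longrightarrow> esum K (rep K V W (snd (leg1 K V W c) t)) B = esum K (rep K V W t) (\<lambda>u v. B (u \<otimes>\<^bsub>V\<^esub> c) v)"
    "d \<in> carrier W \<Longrightarrow> esum K (rep K V W (fst (leg2 K V W d) t)) B = esum K (rep K V W t) (\<lambda>u v. B u (d \<otimes>\<^bsub>W\<^esub> v))"
    "d \<in> carrier W \<Longrightarrow> esum K (rep K V W (snd (leg2 K V W d) t)) B = esum K (rep K V W t) (\<lambda>u v. B u (v \<otimes>\<^bsub>W\<^esub> d))"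
proof -
  have e: "esum K (rep K V W (h t)) B = esum K (rep K V W t) F"
    if h: "h \<in> linear_maps K VW VW"
      and F: "\<And>u v. u \<in> carrier V \<Longrightarrow> v \<in> carrier W \<Longrightarrow> h (pure_tensor K V W u v) B = F u v" for h F
  proof -
    have "esum K (rep K V W (h t)) B = h t B"
      by (rule tensor_eval[OF linear_mapsD(1)[OF h t] B, symmetric])
    also have "\<dots> = esum K (rep K V W t) (\<lambda>v w. h (pure_tensor K V W v w) B)"
      by (rule linear_rep[OF h eval_functional[OF B] t])
    also have "\<dots> = esum K (rep K V W t) F" by (rule esum_cong[OF rep(1)[OF t] F])
    finally show ?thesis .
  qed
  show "c \<in> carrier V \<Longrightarrow> esum K (rep K V W (fst (leg1 K V W c) t)) B = esum K (rep K V W t) (\<lambda>u v. B (c \<otimes>\<^bsub>V\<^esub> u) v)"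
    "c \<in> carrier V \<Longrightarrow> esum K (rep K V W (snd (leg1 K V W c) t)) B = esum K (rep K V W t) (\<lambda>u v. B (u \<otimes>\<^bsub>V\<^esub> c) v)"
    "d \<in> carrier W \<Longrightarrow> esum K (rep K V W (fst (leg2 K V W d) t)) B = esum K (rep K V W t) (\<lambda>u v. B u (d \<otimes>\<^bsub>W\<^esub> v))"
    "d \<in> carrier W \<Longrightarrow> esum K (rep K V W (snd (leg2 K V W d) t)) B = esum K (rep K V W t) (\<lambda>u v. B u (v \<otimes>\<^bsub>W\<^esub> d))"
    by (rule e; simp add: T.multiplierD legs_closed legs_pure pure_eval B)+
qed

lemma rep_bilinear_list:
  assumes Y: "module K Y" and Z: "module K Z" and b: "b \<in> bilinear_maps K Y Z VW"
  shows "(\<lambda>y z. rep K V W (b y z)) \<in> bilinear_lists K Y Z V W"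
  unfolding bilinear_lists_def
proof (intro CollectI conjI ballI)
  show "rep K V W (b y z) \<in> lists (carrier V \<times> carrier W)" if "y \<in> carrier Y" "z \<in> carrier Z" for y z
    by (rule rep(1)[OF bilinear_mapsD(3)[OF b that]])
  fix B assume B: "B \<in> bilinear_forms K V W"
  note f = bilinear_maps_functional[OF b eval_functional[OF B]]
  note e = tensor_eval[OF bilinear_mapsD(3)[OF b] B, symmetric]
  show "(\<lambda>y z. esum K (rep K V W (b y z)) B) \<in> bilinear_forms K Y Z"
  proof (rule bilinear_formsI)
    show "(\<lambda>z. esum K (rep K V W (b y z)) B) \<in> functionals K Z" if "y \<in> carrier Y" for y
      by (rule functionals_cong[OF Z bilinear_formsD(1)[OF f that]]) (rule e[OF that])
    show "(\<lambda>y. esum K (rep K V W (b y z)) B) \<in> functionals K Y" if "z \<in> carrier Z" for z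
      by (rule functionals_cong[OF Y bilinear_formsD(2)[OF f that]]) (rule e[OF _ that])
  qed
qed

lemma bilinear_elem_of:
  assumes Y: "module K Y" and Z: "module K Z" and \<beta>: "\<beta> \<in> bilinear_maps K Y Z T.MB"
    and i: "\<And>y z. y \<in> carrier Y \<Longrightarrow> z \<in> carrier Z \<Longrightarrow> \<beta> y z \<in> inner_mults VW"
  shows "(\<lambda>y z. elem_of VW (\<beta> y z)) \<in> bilinear_maps K Y Z VW"
  by (rule bilinear_mapsI; rule T.elem_of_linear; (rule Y Z bilinear_mapsD[OF \<beta>] i)?; assumption)

text \<open>
  A bijection onto the copy of \<open>V \<otimes> W\<close> in its multiplier algebra gives mutually inverse linear maps
  between tensor products, and their values on pure tensors give mutually inverse maps on lists.
\<close>

lemma inverse_lists_of_bijection: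
  assumes YZ: "vec2 K Y Z" and \<beta>: "\<beta> \<in> bilinear_maps K Y Z T.MB"
    and bij: "bij_betw (tensor_lift K Y Z T.MB \<beta>) (carrier (tensor K Y Z)) (inner_mults VW)"
  shows "y \<in> carrier Y \<Longrightarrow> z \<in> carrier Z \<Longrightarrow> \<beta> y z \<in> inner_mults VW"
    and "\<exists>T'. inverse_lists K Y Z V W (\<lambda>y z. rep K V W (elem_of VW (\<beta> y z))) T'"
proof -
  interpret YZ: vec2 K Y Z by fact
  let ?L = "tensor_lift K Y Z T.MB \<beta>" and ?YZ = "tensor K Y Z"
  note L = YZ.tensor_lift_linear[OF T.mult_alg_module \<beta>] and Lp = YZ.tensor_lift_pure[OF T.mult_alg_module \<beta>]
  have Li: "?L s \<in> inner_mults VW" if "s \<in> carrier ?YZ" for s using bij_betwE[OF bij] that by blast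
  show i: "\<beta> y z \<in> inner_mults VW" if "y \<in> carrier Y" "z \<in> carrier Z" for y z
    using Li[OF YZ.pure_closed[OF that]] by (simp add: Lp that)
  let ?E = "\<lambda>s. elem_of VW (?L s)" and ?F = "\<lambda>t. inv_into (carrier ?YZ) ?L (mult_of VW t)"
  have E: "?E \<in> linear_maps K ?YZ VW" by (rule T.elem_of_linear[OF YZ.tensor_module L Li])
  have mi: "mult_of VW t \<in> inner_mults VW" if "t \<in> carrier VW" for t using that by (simp add: inner_mults_def)
  have Fc: "?F t \<in> carrier ?YZ" if "t \<in> carrier VW" for t
    using bij_betw_apply[OF bij_betw_inv_into[OF bij] mi[OF that]] .
  have LF: "?L (?F t) = mult_of VW t" if "t \<in> carrier VW" for t
    by (rule bij_betw_inv_into_right[OF bij mi[OF that]])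
  have EF: "?E (?F t) = t" if "t \<in> carrier VW" for t by (simp add: LF that T.elem_of_mult_of)
  have FE: "?F (?E s) = s" if "s \<in> carrier ?YZ" for s
    using bij_betw_inv_into_left[OF bij that] by (simp add: T.elem_of Li that)
  have inj: "s = s'" if "?L s = ?L s'" "s \<in> carrier ?YZ" "s' \<in> carrier ?YZ" for s s'
    using bij that by (auto simp: bij_betw_def inj_on_def)
  have F: "?F \<in> linear_maps K VW ?YZ"
    by (rule linear_mapsI; (rule inj)?; simp add: Fc LF linear_mapsD(2,3)[OF L] linear_mapsD(2,3)[OF T.mult_of_linear, symmetric]
      add_closed smult_closed YZ.add_closed YZ.smult_closed)
  let ?T = "\<lambda>y z. rep K V W (elem_of VW (\<beta> y z))" and ?T' = "\<lambda>v w. rep K Y Z (?F (pure_tensor K V W v w))"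
  have Tb: "?T \<in> bilinear_lists K Y Z V W"
    by (rule rep_bilinear_list[OF YZ.V.module_axioms YZ.W.module_axioms
          bilinear_elem_of[OF YZ.V.module_axioms YZ.W.module_axioms \<beta> i]])
  have bF: "(\<lambda>v w. ?F (pure_tensor K V W v w)) \<in> bilinear_maps K V W ?YZ"
    by (intro bilinear_mapsI linear_comp[OF F] pure_comp linear_id; assumption)
  have T'b: "?T' \<in> bilinear_lists K V W Y Z"
    unfolding bilinear_lists_def
  proof (intro CollectI conjI ballI)
    show "?T' v w \<in> lists (carrier Y \<times> carrier Z)" if "v \<in> carrier V" "w \<in> carrier W" for v w
      by (rule YZ.rep(1)[OF Fc[OF pure_closed[OF that]]])
    fix B assume B: "B \<in> bilinear_forms K Y Z"
    note f = bilinear_maps_functional[OF bF YZ.eval_functional[OF B]]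
    note e = YZ.tensor_eval[OF Fc[OF pure_closed] B, symmetric]
    show "(\<lambda>v w. esum K (?T' v w) B) \<in> bilinear_forms K V W"
    proof (rule bilinear_formsI)
      show "(\<lambda>w. esum K (?T' v w) B) \<in> functionals K W" if "v \<in> carrier V" for v
        by (rule functionals_cong[OF Wm bilinear_formsD(1)[OF f that]]) (rule e[OF that])
      show "(\<lambda>v. esum K (?T' v w) B) \<in> functionals K V" if "w \<in> carrier W" for w
        by (rule functionals_cong[OF Vm bilinear_formsD(2)[OF f that]]) (rule e[OF _ that])
    qed
  qed
  have "esum K (?T' v w) (\<lambda>y z. esum K (?T y z) B) = B v w"
    if B: "B \<in> bilinear_forms K V W" and x: "v \<in> carrier V" "w \<in> carrier W" for B v w
  proof -
    have "B v w = ?E (?F (pure_tensor K V W v w)) B" by (simp add: EF pure_closed x pure_eval B)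
    also have "\<dots> = esum K (?T' v w) (\<lambda>y z. ?E (pure_tensor K Y Z y z) B)"
      by (rule YZ.functional_rep[OF functional_comp[OF eval_functional[OF B] E] Fc[OF pure_closed[OF x]]])
    also have "\<dots> = esum K (?T' v w) (\<lambda>y z. esum K (?T y z) B)"
      by (rule esum_cong[OF bilinear_listsD(1)[OF T'b x]]) (simp add: Lp tensor_eval T.elem_of i B)
    finally show ?thesis by simp
  qed
  moreover have "esum K (?T y z) (\<lambda>v w. esum K (?T' v w) B) = B y z"
    if B: "B \<in> bilinear_forms K Y Z" and x: "y \<in> carrier Y" "z \<in> carrier Z" for B y z
  proof -
    have "B y z = ?F (?E (pure_tensor K Y Z y z)) B" using FE[OF YZ.pure_closed[OF x]] by (simp add: YZ.pure_eval B)
    also have "\<dots> = ?F (elem_of VW (\<beta> y z)) B" by (simp only: Lp[OF x])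
    also have "\<dots> = esum K (?T y z) (\<lambda>v w. ?F (pure_tensor K V W v w) B)"
      by (rule functional_rep[OF functional_comp[OF YZ.eval_functional[OF B] F]]) (simp add: T.elem_of i x)
    also have "\<dots> = esum K (?T y z) (\<lambda>v w. esum K (?T' v w) B)"
      by (rule esum_cong[OF bilinear_listsD(1)[OF Tb x]]) (simp add: YZ.tensor_eval Fc pure_closed B)
    finally show ?thesis by simp
  qed
  ultimately have "inverse_lists K Y Z V W ?T ?T'" using Tb T'b by (simp add: inverse_lists_def)
  then show "\<exists>T'. inverse_lists K Y Z V W ?T T'" by (rule exI[where x = ?T'])
qed

end

lemma inverse_lists_exchange:
  assumes "inverse_lists K V W X Y T T'"
  shows "inverse_lists K W V X Y (\<lambda>w v. T v w) (\<lambda>x y. map prod.swap (T' x y))"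
  using inverse_lists_swap[OF inverse_lists_flip[OF assms]] by (simp add: comp_def)

section \<open>Covered homomorphisms into the multipliers of a tensor product\<close>

text \<open>
  The common part of \<open>\<Delta>\<close> and \<open>\<alpha>\<close>: a homomorphism into \<open>M(X \<otimes> A)\<close> whose values become elements of
  \<open>X \<otimes> A\<close> after multiplication by \<open>1 \<otimes> c\<close> on either side, or by \<open>y \<otimes> 1\<close> on the left.
\<close>

locale covered_map = nd2 K X A for K :: "'k ring" (structure) and X :: "('k, 'x) module" and A :: "('k, 'a) module" +
  fixes \<alpha> :: "'x \<Rightarrow> ('k, 'x, 'a) tensor multiplier"
  assumes hom: "\<alpha> \<in> alg_homs K X (mult_alg K (tensor K X A))"
    and cover1: "\<lbrakk>x \<in> carrier X; c \<in> carrier A\<rbrakk> \<Longrightarrow>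
      \<alpha> x \<otimes>\<^bsub>mult_alg K (tensor K X A)\<^esub> leg2 K X A c \<in> inner_mults (tensor K X A)"
    and cover2: "\<lbrakk>y \<in> carrier X; x \<in> carrier X\<rbrakk> \<Longrightarrow>
      leg1 K X A y \<otimes>\<^bsub>mult_alg K (tensor K X A)\<^esub> \<alpha> x \<in> inner_mults (tensor K X A)"
    and cover4: "\<lbrakk>x \<in> carrier X; c \<in> carrier A\<rbrakk> \<Longrightarrow>
      leg2 K X A c \<otimes>\<^bsub>mult_alg K (tensor K X A)\<^esub> \<alpha> x \<in> inner_mults (tensor K X A)"
begin

definition t1 where "t1 x c = elem_of VW (\<alpha> x \<otimes>\<^bsub>T.MB\<^esub> leg2 K X A c)"
definition t2 where "t2 y x = elem_of VW (leg1 K X A y \<otimes>\<^bsub>T.MB\<^esub> \<alpha> x)"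
definition t4 where "t4 x c = elem_of VW (leg2 K X A c \<otimes>\<^bsub>T.MB\<^esub> \<alpha> x)"

lemma alpha: "x \<in> carrier X \<Longrightarrow> \<alpha> x \<in> carrier T.MB"
  "\<alpha> \<in> linear_maps K X T.MB"
  "x \<in> carrier X \<Longrightarrow> y \<in> carrier X \<Longrightarrow> \<alpha> (x \<otimes>\<^bsub>X\<^esub> y) = \<alpha> x \<otimes>\<^bsub>T.MB\<^esub> \<alpha> y"
  using hom by (auto simp: alg_homs_def linear_mapsD(1))

lemma t_closed [simp]:
  "x \<in> carrier X \<Longrightarrow> c \<in> carrier A \<Longrightarrow> t1 x c \<in> carrier VW"
  "y \<in> carrier X \<Longrightarrow> x \<in> carrier X \<Longrightarrow> t2 y x \<in> carrier VW"
  "x \<in> carrier X \<Longrightarrow> c \<in> carrier A \<Longrightarrow> t4 x c \<in> carrier VW"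
  unfolding t1_def t2_def t4_def by (intro T.elem_of cover1 cover2 cover4; assumption)+

lemma mult_of_t:
  "x \<in> carrier X \<Longrightarrow> c \<in> carrier A \<Longrightarrow> mult_of VW (t1 x c) = \<alpha> x \<otimes>\<^bsub>T.MB\<^esub> leg2 K X A c"
  "y \<in> carrier X \<Longrightarrow> x \<in> carrier X \<Longrightarrow> mult_of VW (t2 y x) = leg1 K X A y \<otimes>\<^bsub>T.MB\<^esub> \<alpha> x"
  "x \<in> carrier X \<Longrightarrow> c \<in> carrier A \<Longrightarrow> mult_of VW (t4 x c) = leg2 K X A c \<otimes>\<^bsub>T.MB\<^esub> \<alpha> x"
  unfolding t1_def t2_def t4_def by (intro T.elem_of cover1 cover2 cover4; assumption)+

lemma t_bilinear: "t1 \<in> bilinear_maps K X A VW" "t2 \<in> bilinear_maps K X X VW" "t4 \<in> bilinear_maps K X A VW"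
proof -
  note ml = T.mult_alg_mult_linear linear_comp[OF T.mult_alg_mult_linear(1)] linear_comp[OF T.mult_alg_mult_linear(2)]
    alpha(1,2) legs_closed legs_linear
  have "(\<lambda>x c. t1 x c) \<in> bilinear_maps K X A VW" unfolding t1_def
    by (rule bilinear_elem_of[OF Vm Wm]) (intro bilinear_mapsI ml cover1; assumption)+
  moreover have "(\<lambda>x c. t2 x c) \<in> bilinear_maps K X X VW" unfolding t2_def
    by (rule bilinear_elem_of[OF Vm Vm]) (intro bilinear_mapsI ml cover2; assumption)+
  moreover have "(\<lambda>x c. t4 x c) \<in> bilinear_maps K X A VW" unfolding t4_def
    by (rule bilinear_elem_of[OF Vm Wm]) (intro bilinear_mapsI ml cover4; assumption)+
  ultimately show "t1 \<in> bilinear_maps K X A VW" "t2 \<in> bilinear_maps K X X VW" "t4 \<in> bilinear_maps K X A VW"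
    by simp_all
qed

lemma inj: "s \<in> carrier VW \<Longrightarrow> t \<in> carrier VW \<Longrightarrow> mult_of VW s = mult_of VW t \<Longrightarrow> s = t"
  using T.mult_of_inj by (auto dest: inj_onD)

lemmas cov_simps = alpha mult_of_t T.mult_of_fst T.mult_of_snd T.multiplierD legs_closed T.mult_alg_closed
  T.mult_alg_assoc V.mult_closed W.mult_closed

lemma legs_commute:
  "c \<in> carrier X \<Longrightarrow> d \<in> carrier A \<Longrightarrow> leg2 K X A d \<otimes>\<^bsub>T.MB\<^esub> leg1 K X A c = leg1 K X A c \<otimes>\<^bsub>T.MB\<^esub> leg2 K X A d"
  by (simp add: legs_mult)

lemma legs_commute':
  assumes x: "c \<in> carrier X" "d \<in> carrier A" and m: "m \<in> carrier T.MB"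
  shows "leg2 K X A d \<otimes>\<^bsub>T.MB\<^esub> (leg1 K X A c \<otimes>\<^bsub>T.MB\<^esub> m) = leg1 K X A c \<otimes>\<^bsub>T.MB\<^esub> (leg2 K X A d \<otimes>\<^bsub>T.MB\<^esub> m)"
  using T.mult_alg_assoc[OF legs_closed(2)[OF x(2)] legs_closed(1)[OF x(1)] m]
    T.mult_alg_assoc[OF legs_closed(1)[OF x(1)] legs_closed(2)[OF x(2)] m] by (simp add: legs_commute x)

text \<open>
  All of these are instances of associativity in \<open>M(X \<otimes> A)\<close>, which \<open>mult_of\<close> reflects. The elements
  \<open>c \<otimes> 1\<close> and \<open>1 \<otimes> d\<close> commute.
\<close>

lemma t_module:
  assumes "x \<in> carrier X" "y \<in> carrier X" "z \<in> carrier X" "c \<in> carrier A" "d \<in> carrier A"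
  shows "t1 x (c \<otimes>\<^bsub>A\<^esub> d) = snd (leg2 K X A d) (t1 x c)"
    "t2 (z \<otimes>\<^bsub>X\<^esub> x) y = fst (leg1 K X A z) (t2 x y)"
    "t4 x (d \<otimes>\<^bsub>A\<^esub> c) = fst (leg2 K X A d) (t4 x c)"
    "snd (leg2 K X A d) (t2 x y) = fst (leg1 K X A x) (t1 y d)"
    "fst (leg2 K X A d) (t2 x y) = fst (leg1 K X A x) (t4 y d)"
    "snd (leg2 K X A d) (t4 x c) = fst (leg2 K X A c) (t1 x d)"
  by (rule inj; simp add: cov_simps assms legs_mult(3,4) legs_commute legs_commute')+

text \<open>
  The multiplier \<open>\<alpha>(x)\<close> acts on \<open>u \<otimes> v\<close> by first multiplying with one of the two legs.
\<close>

lemma alpha_pure: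
  assumes "x \<in> carrier X" "u \<in> carrier X" "v \<in> carrier A"
  shows "fst (\<alpha> x) (pure_tensor K X A u v) = snd (leg1 K X A u) (t1 x v)"
    "snd (\<alpha> x) (pure_tensor K X A u v) = fst (leg2 K X A v) (t2 u x)"
  by (rule inj; simp add: cov_simps assms pure_closed legs_mult(1,2)[symmetric] legs_commute legs_commute')+

lemma t_hom:
  assumes "x \<in> carrier X" "y \<in> carrier X" "z \<in> carrier X" "c \<in> carrier A"
  shows "t1 (x \<otimes>\<^bsub>X\<^esub> y) c = fst (\<alpha> x) (t1 y c)"
    "t2 z (x \<otimes>\<^bsub>X\<^esub> y) = snd (\<alpha> y) (t2 z x)"
    "t4 (x \<otimes>\<^bsub>X\<^esub> y) c = snd (\<alpha> y) (t4 x c)"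
  by (rule inj; simp add: cov_simps assms)+

lemma alpha_rep:
  assumes t: "t \<in> carrier VW" and B: "B \<in> bilinear_forms K X A" and x: "x \<in> carrier X"
  shows "esum K (rep K X A (fst (\<alpha> x) t)) B = esum K (rep K X A t) (\<lambda>u v. esum K (rep K X A (t1 x v)) (\<lambda>p q. B (p \<otimes>\<^bsub>X\<^esub> u) q))"
    "esum K (rep K X A (snd (\<alpha> x) t)) B = esum K (rep K X A t) (\<lambda>u v. esum K (rep K X A (t2 u x)) (\<lambda>p q. B p (v \<otimes>\<^bsub>A\<^esub> q)))"
proof -
  note c = T.multiplierD[OF alpha(1)[OF x]]
  have "esum K (rep K X A (fst (\<alpha> x) t)) B = esum K (rep K X A t) (\<lambda>u v. fst (\<alpha> x) (pure_tensor K X A u v) B)"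
    using linear_rep[OF c(1) eval_functional[OF B] t] tensor_eval[OF c(3)[OF t] B] by simp
  also have "\<dots> = esum K (rep K X A t) (\<lambda>u v. esum K (rep K X A (t1 x v)) (\<lambda>p q. B (p \<otimes>\<^bsub>X\<^esub> u) q))"
    by (rule esum_cong[OF rep(1)[OF t]])
      (simp add: alpha_pure x B tensor_eval legs_rep T.multiplierD legs_closed)
  finally show "esum K (rep K X A (fst (\<alpha> x) t)) B = \<dots>" .
  have "esum K (rep K X A (snd (\<alpha> x) t)) B = esum K (rep K X A t) (\<lambda>u v. snd (\<alpha> x) (pure_tensor K X A u v) B)"
    using linear_rep[OF c(2) eval_functional[OF B] t] tensor_eval[OF c(4)[OF t] B] by simp
  also have "\<dots> = esum K (rep K X A t) (\<lambda>u v. esum K (rep K X A (t2 u x)) (\<lambda>p q. B p (v \<otimes>\<^bsub>A\<^esub> q)))"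
    by (rule esum_cong[OF rep(1)[OF t]])
      (simp add: alpha_pure x B tensor_eval legs_rep T.multiplierD legs_closed)
  finally show "esum K (rep K X A (snd (\<alpha> x) t)) B = \<dots>" .
qed

definition V where "V y x = rep K X A (t2 y x)"
definition W where "W x c = rep K X A (t1 x c)"
definition W4 where "W4 x c = rep K X A (t4 x c)"

lemmas list_defs = V_def W_def W4_def

lemma lists_bilinear: "V \<in> bilinear_lists K X X X A" "W \<in> bilinear_lists K X A X A" "W4 \<in> bilinear_lists K X A X A"
  using rep_bilinear_list[OF Vm Vm t_bilinear(2)] rep_bilinear_list[OF Vm Wm t_bilinear(1)]
    rep_bilinear_list[OF Vm Wm t_bilinear(3)]
  by (simp_all add: list_defs[abs_def])

lemma lists_module:
  assumes "B \<in> bilinear_forms K X A" and x: "x \<in> carrier X" "y \<in> carrier X" "z \<in> carrier X" "c \<in> carrier A" "d \<in> carrier A"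
  shows "esum K (V (z \<otimes>\<^bsub>X\<^esub> x) y) B = esum K (V x y) (\<lambda>u v. B (z \<otimes>\<^bsub>X\<^esub> u) v)"
    "esum K (W x (c \<otimes>\<^bsub>A\<^esub> d)) B = esum K (W x c) (\<lambda>u v. B u (v \<otimes>\<^bsub>A\<^esub> d))"
    "esum K (W4 x (d \<otimes>\<^bsub>A\<^esub> c)) B = esum K (W4 x c) (\<lambda>u v. B u (d \<otimes>\<^bsub>A\<^esub> v))"
    "esum K (V x y) (\<lambda>u v. B u (v \<otimes>\<^bsub>A\<^esub> d)) = esum K (W y d) (\<lambda>u v. B (x \<otimes>\<^bsub>X\<^esub> u) v)"
    "esum K (V x y) (\<lambda>u v. B u (d \<otimes>\<^bsub>A\<^esub> v)) = esum K (W4 y d) (\<lambda>u v. B (x \<otimes>\<^bsub>X\<^esub> u) v)"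
    "esum K (W4 x c) (\<lambda>u v. B u (v \<otimes>\<^bsub>A\<^esub> d)) = esum K (W x d) (\<lambda>u v. B u (c \<otimes>\<^bsub>A\<^esub> v))"
  unfolding list_defs
  by (simp_all add: assms legs_rep[symmetric] t_module[OF x])

lemma lists_hom:
  assumes "B \<in> bilinear_forms K X A" and x: "x \<in> carrier X" "y \<in> carrier X" "z \<in> carrier X" "c \<in> carrier A"
  shows "esum K (V z (x \<otimes>\<^bsub>X\<^esub> y)) B = esum K (V z x) (\<lambda>u v. esum K (V u y) (\<lambda>p q. B p (v \<otimes>\<^bsub>A\<^esub> q)))"
    "esum K (W (x \<otimes>\<^bsub>X\<^esub> y) c) B = esum K (W y c) (\<lambda>u v. esum K (W x v) (\<lambda>p q. B (p \<otimes>\<^bsub>X\<^esub> u) q))"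
    "esum K (W4 (x \<otimes>\<^bsub>X\<^esub> y) c) B = esum K (W4 x c) (\<lambda>u v. esum K (V u y) (\<lambda>p q. B p (v \<otimes>\<^bsub>A\<^esub> q)))"
  unfolding list_defs by (simp_all add: assms t_hom[OF x] alpha_rep)

end

locale covered_map3 = covered_map K X A \<alpha>
  for K :: "'k ring" (structure) and X :: "('k, 'x) module" and A :: "('k, 'a) module" and \<alpha> +
  assumes cover3: "\<lbrakk>x \<in> carrier X; c \<in> carrier X\<rbrakk> \<Longrightarrow>
    \<alpha> x \<otimes>\<^bsub>mult_alg K (tensor K X A)\<^esub> leg1 K X A c \<in> inner_mults (tensor K X A)"
begin

definition t3 where "t3 x c = elem_of VW (\<alpha> x \<otimes>\<^bsub>T.MB\<^esub> leg1 K X A c)"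

lemma t3:
  assumes "x \<in> carrier X" "c \<in> carrier X"
  shows "t3 x c \<in> carrier VW" "mult_of VW (t3 x c) = \<alpha> x \<otimes>\<^bsub>T.MB\<^esub> leg1 K X A c"
  unfolding t3_def by (intro T.elem_of cover3 assms)+

lemma t3_module:
  assumes "x \<in> carrier X" "y \<in> carrier X" "c \<in> carrier X" "d \<in> carrier X" "a \<in> carrier A"
  shows "t3 x (c \<otimes>\<^bsub>X\<^esub> d) = snd (leg1 K X A d) (t3 x c)"
    "snd (leg2 K X A a) (t3 x c) = snd (leg1 K X A c) (t1 x a)"
    "fst (leg2 K X A a) (t3 x c) = snd (leg1 K X A c) (t4 x a)"
    "snd (leg1 K X A d) (t2 c x) = fst (leg1 K X A c) (t3 x d)"
    "t3 (x \<otimes>\<^bsub>X\<^esub> y) c = fst (\<alpha> x) (t3 y c)"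
  by (rule inj; simp add: cov_simps assms t3 legs_mult(3,4) legs_commute legs_commute')+

definition W3 where "W3 x c = rep K X A (t3 x c)"

lemma W3_module:
  assumes "B \<in> bilinear_forms K X A" and x: "x \<in> carrier X" "y \<in> carrier X" "c \<in> carrier X" "d \<in> carrier X" "a \<in> carrier A"
  shows "esum K (W3 x (c \<otimes>\<^bsub>X\<^esub> d)) B = esum K (W3 x c) (\<lambda>u v. B (u \<otimes>\<^bsub>X\<^esub> d) v)"
    "esum K (W3 x c) (\<lambda>u v. B u (v \<otimes>\<^bsub>A\<^esub> a)) = esum K (W x a) (\<lambda>u v. B (u \<otimes>\<^bsub>X\<^esub> c) v)"
    "esum K (W3 x c) (\<lambda>u v. B u (a \<otimes>\<^bsub>A\<^esub> v)) = esum K (W4 x a) (\<lambda>u v. B (u \<otimes>\<^bsub>X\<^esub> c) v)"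
    "esum K (V c x) (\<lambda>u v. B (u \<otimes>\<^bsub>X\<^esub> d) v) = esum K (W3 x d) (\<lambda>u v. B (c \<otimes>\<^bsub>X\<^esub> u) v)"
    "esum K (W3 (x \<otimes>\<^bsub>X\<^esub> y) c) B = esum K (W3 y c) (\<lambda>u v. esum K (W x v) (\<lambda>p q. B (p \<otimes>\<^bsub>X\<^esub> u) q))"
  unfolding list_defs W3_def
  by (simp_all add: assms legs_rep[symmetric] t3 t3_module[OF x] alpha_rep)

end

section \<open>Coassociativity in covered form\<close>

lemma tensor_lift_cong:
  assumes "\<And>v w. v \<in> carrier V \<Longrightarrow> w \<in> carrier W \<Longrightarrow> \<beta> v w = \<gamma> v w"
  shows "tensor_lift K V W U \<beta> t = tensor_lift K V W U \<gamma> t"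
  unfolding tensor_lift_def using assms by (simp cong: ball_cong)

context nd2
begin

lemma mult_tensor_bilinear:
  "mult_tensor K V W \<in> bilinear_maps K V.MB W.MB T.MB"
proof -
  have "(\<lambda>m n. mult_tensor K V W m n) \<in> bilinear_maps K V.MB W.MB T.MB"
    by (rule bilinear_mapsI; rule linear_mapsI; (rule multiplier_eq_on_pure)?;
      simp add: mult_tensor V.mult_alg_closed W.mult_alg_closed T.mult_alg_closed pure_closed T.multiplier_simps
        V.multiplier_simps W.multiplier_simps V.multiplierD W.multiplierD
        linear_mapsD(2,3)[OF bilinear_mapsD(2)[OF pure_bilinear]]
        linear_mapsD(2,3)[OF bilinear_mapsD(1)[OF pure_bilinear]])
  then show ?thesis by simp
qed

lemma eq_by_pure_mult:
  assumes y: "y \<in> carrier VW" "y' \<in> carrier VW"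
    and eq: "\<And>v w. v \<in> carrier V \<Longrightarrow> w \<in> carrier W \<Longrightarrow>
      y \<otimes>\<^bsub>VW\<^esub> pure_tensor K V W v w = y' \<otimes>\<^bsub>VW\<^esub> pure_tensor K V W v w"
  shows "y = y'"
  by (rule T.eq_by_right_mult[OF y])
    (rule linear_eq_on_pure[OF Tm tensor_mult_linear_right[OF y(1)] tensor_mult_linear_right[OF y(2)] eq])

lemma leg2_cancel:
  assumes y: "y \<in> carrier VW" "y' \<in> carrier VW"
    and eq: "\<And>w. w \<in> carrier W \<Longrightarrow> snd (leg2 K V W w) y = snd (leg2 K V W w) y'"
  shows "y = y'"
proof (rule eq_by_pure_mult[OF y])
  fix v w assume x: "v \<in> carrier V" "w \<in> carrier W"
  have "s \<otimes>\<^bsub>VW\<^esub> pure_tensor K V W v w = snd (leg1 K V W v) (snd (leg2 K V W w) s)" if "s \<in> carrier VW" for s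
    using T.mult_of_simps(2)[OF that, of "pure_tensor K V W v w"] T.multiplier_mult(2)[OF that]
    by (simp add: legs_mult(2)[OF x, symmetric])
  then show "y \<otimes>\<^bsub>VW\<^esub> pure_tensor K V W v w = y' \<otimes>\<^bsub>VW\<^esub> pure_tensor K V W v w"
    by (simp add: y eq x)
qed

end

text \<open>
  Coassociativity is given by two multipliers that are defined by descriptions, \<open>coact_id_ext\<close> on
  \<open>(X \<otimes> A) \<otimes> A\<close> and \<open>mult_ext\<close> on \<open>X \<otimes> (A \<otimes> A)\<close>. Each of them is identified below by exhibiting a multiplier
  with the required property and showing that there is at most one. For \<open>X = A\<close> and \<open>\<alpha> = \<Delta>\<close> the two
  instances of \<open>covered_map\<close> coincide.
\<close>

locale covered_coaction = K?: field K + C: covered_map K X A \<alpha> + D: covered_map K A A \<Delta>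
  for K :: "'k ring" (structure) and X :: "('k, 'x) module" and A :: "('k, 'a) module" and \<alpha> \<Delta> +
  assumes span1: "r \<in> carrier (tensor K A A) \<Longrightarrow>
      \<exists>s\<in>carrier (tensor K A A). tensor_lift K A A (tensor K A A) D.t1 s = r"
    and coassoc: "coassociative K A \<Delta> X \<alpha>"
begin

sublocale P: nd2 K "tensor K X A" A by unfold_locales
sublocale Q: nd2 K X "tensor K A A" by unfold_locales

lemmas alpha_snd = linear_comp[OF C.T.apply_linear(2) C.alpha(2)] linear_comp[OF C.T.multiplierD(2)[OF C.alpha(1)]]
  C.T.multiplierD(2)[OF C.alpha(1)] C.T.multiplierD(4)[OF C.alpha(1)]
lemmas alpha_fst = linear_comp[OF C.T.apply_linear(1) C.alpha(2)] linear_comp[OF C.T.multiplierD(1)[OF C.alpha(1)]]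
  C.T.multiplierD(1)[OF C.alpha(1)] C.T.multiplierD(3)[OF C.alpha(1)]

text \<open>
  For a tensor \<open>t\<close> with entries \<open>u \<otimes> v\<close>, \<open>F s t\<close> is \<open>(s \<otimes> 1) (\<alpha> \<otimes> \<iota>)(t)\<close>, \<open>F' s t\<close> is \<open>(\<alpha> \<otimes> \<iota>)(t) (s \<otimes> 1)\<close> and
  \<open>H s s' t\<close> is \<open>(s \<otimes> 1) (\<alpha> \<otimes> \<iota>)(t) (s' \<otimes> 1)\<close>.
\<close>

definition F where "F s = tensor_lift K X A P.VW (\<lambda>u v. pure_tensor K C.VW A (snd (\<alpha> u) s) v)"
definition F' where "F' s = tensor_lift K X A P.VW (\<lambda>u v. pure_tensor K C.VW A (fst (\<alpha> u) s) v)"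
definition H where "H s s' = tensor_lift K X A P.VW (\<lambda>u v. pure_tensor K C.VW A (snd (\<alpha> u) s \<otimes>\<^bsub>C.VW\<^esub> s') v)"

lemma F_bil:
  assumes s: "s \<in> carrier C.VW"
  shows "(\<lambda>u v. pure_tensor K C.VW A (snd (\<alpha> u) s) v) \<in> bilinear_maps K X A P.VW"
    "(\<lambda>u v. pure_tensor K C.VW A (fst (\<alpha> u) s) v) \<in> bilinear_maps K X A P.VW"
    "s' \<in> carrier C.VW \<Longrightarrow> (\<lambda>u v. pure_tensor K C.VW A (snd (\<alpha> u) s \<otimes>\<^bsub>C.VW\<^esub> s') v) \<in> bilinear_maps K X A P.VW"
  by (intro bilinear_mapsI P.pure_comp alpha_snd alpha_fst linear_id s C.T.linear_mult_right C.T.mult_closed; assumption)+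

lemma F_linear:
  assumes s: "s \<in> carrier C.VW"
  shows "F s \<in> linear_maps K C.VW P.VW" "F' s \<in> linear_maps K C.VW P.VW"
    "s' \<in> carrier C.VW \<Longrightarrow> H s s' \<in> linear_maps K C.VW P.VW"
  unfolding F_def F'_def H_def by (intro C.tensor_lift_linear P.Tm F_bil s; assumption)+

lemma F_pure:
  assumes s: "s \<in> carrier C.VW" and u: "u \<in> carrier X" "v \<in> carrier A"
  shows "F s (pure_tensor K X A u v) = pure_tensor K C.VW A (snd (\<alpha> u) s) v"
    "F' s (pure_tensor K X A u v) = pure_tensor K C.VW A (fst (\<alpha> u) s) v"
    "s' \<in> carrier C.VW \<Longrightarrow> H s s' (pure_tensor K X A u v) = pure_tensor K C.VW A (snd (\<alpha> u) s \<otimes>\<^bsub>C.VW\<^esub> s') v"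
  unfolding F_def F'_def H_def by (intro C.tensor_lift_pure P.Tm F_bil s u; assumption)+

lemma F_param:
  assumes t: "t \<in> carrier C.VW"
  shows "(\<lambda>s. F s t) \<in> linear_maps K C.VW P.VW" "(\<lambda>s. F' s t) \<in> linear_maps K C.VW P.VW"
  unfolding F_def F'_def
  by (intro C.tensor_lift_param P.Tm t F_bil P.pure_comp alpha_snd alpha_fst linear_id C.Tm; assumption)+

lemma F_bilinear:
  assumes t: "t \<in> bilinear_maps K Y A C.VW"
  shows "y \<in> carrier Y \<Longrightarrow> (\<lambda>s a. F s (t y a)) \<in> bilinear_maps K C.VW A P.VW"
    "y \<in> carrier Y \<Longrightarrow> (\<lambda>s a. F' s (t y a)) \<in> bilinear_maps K C.VW A P.VW"
  by (intro bilinear_mapsI F_param linear_comp[OF F_linear(1)] linear_comp[OF F_linear(2)] bilinear_mapsD[OF t]; assumption)+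

lemma F_mult:
  assumes s: "s \<in> carrier C.VW" and t: "t \<in> carrier C.VW" and s': "s' \<in> carrier C.VW" and a: "a \<in> carrier A"
  shows "F s t \<otimes>\<^bsub>P.VW\<^esub> pure_tensor K C.VW A s' a = H s s' (snd (leg2 K X A a) t)"
    "pure_tensor K C.VW A s a \<otimes>\<^bsub>P.VW\<^esub> F' s' t = H s s' (fst (leg2 K X A a) t)"
    "snd (leg2 K C.VW A a) (F s t) = F s (snd (leg2 K X A a) t)"
proof -
  note l2 = C.T.multiplierD(1,2)[OF C.legs_closed(2)[OF a]]
  note H2 = linear_comp[OF F_linear(3)[OF s s'] l2(2)] linear_comp[OF F_linear(3)[OF s s'] l2(1)]
  note simps = F_pure s s' a C.legs_pure P.mult_pure P.legs_pure C.T.multiplierD C.alpha C.W.mult_closed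
  show "F s t \<otimes>\<^bsub>P.VW\<^esub> pure_tensor K C.VW A s' a = H s s' (snd (leg2 K X A a) t)"
    by (rule C.linear_eq_on_pure[OF P.Tm linear_comp[OF P.tensor_mult_linear_left[OF P.pure_closed[OF s' a]] F_linear(1)[OF s]] H2(1) _ t])
      (simp add: simps)
  show "pure_tensor K C.VW A s a \<otimes>\<^bsub>P.VW\<^esub> F' s' t = H s s' (fst (leg2 K X A a) t)"
    by (rule C.linear_eq_on_pure[OF P.Tm linear_comp[OF P.tensor_mult_linear_right[OF P.pure_closed[OF s a]] F_linear(2)[OF s']] H2(2) _ t])
      (simp add: simps)
  show "snd (leg2 K C.VW A a) (F s t) = F s (snd (leg2 K X A a) t)"
    by (rule C.linear_eq_on_pure[OF P.Tm linear_comp[OF P.T.multiplierD(2)[OF P.legs_closed(2)[OF a]] F_linear(1)[OF s]]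
          linear_comp[OF F_linear(1)[OF s] l2(2)] _ t])
      (simp add: simps)
qed

lemma coact_id:
  assumes t: "t \<in> carrier C.VW"
  shows "coact_id K X A \<alpha> t \<in> carrier P.T.MB"
    "s \<in> carrier C.VW \<Longrightarrow> b \<in> carrier A \<Longrightarrow> snd (coact_id K X A \<alpha> t) (pure_tensor K C.VW A s b) = F s (fst (leg2 K X A b) t)"
proof -
  have b: "(\<lambda>x a. mult_tensor K C.VW A (\<alpha> x) (mult_of A a)) \<in> bilinear_maps K X A P.T.MB"
    by (intro bilinear_mapsI bilinear_maps_comp[OF P.mult_tensor_bilinear] C.alpha C.W.mult_of_linear C.W.mult_of_closed; assumption)
  note L = C.tensor_lift_linear[OF P.T.mult_alg_module b] and Lp = C.tensor_lift_pure[OF P.T.mult_alg_module b]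
  show "coact_id K X A \<alpha> t \<in> carrier P.T.MB"
    unfolding coact_id_def by (rule linear_mapsD(1)[OF L t])
  assume s: "s \<in> carrier C.VW" and a: "b \<in> carrier A"
  show "snd (coact_id K X A \<alpha> t) (pure_tensor K C.VW A s b) = F s (fst (leg2 K X A b) t)"
    unfolding coact_id_def
    by (rule C.linear_eq_on_pure[where U = P.VW and g = "\<lambda>t. F s (fst (leg2 K X A b) t)",
          OF P.Tm linear_comp[OF P.T.apply_linear(2) L] linear_comp[OF F_linear(1)[OF s]] _ t])
      (simp_all add: Lp s a P.pure_closed C.T.multiplierD(1) C.legs_closed F_pure C.legs_pure P.mult_tensor C.alpha
        C.W.mult_of_closed C.W.mult_of_simps C.W.mult_closed)
qed

text \<open>
  Right multiplication by \<open>(\<alpha> \<otimes> \<iota>)(\<alpha>(x))\<close> must send \<open>s \<otimes> q\<close> to \<open>(s \<otimes> 1) (\<alpha> \<otimes> \<iota>)((1 \<otimes> q) \<alpha>(x))\<close>. This and its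
  mirror image define a multiplier with the two characteristic properties. It is the only one, since
  \<open>1 \<otimes> a\<close> can be cancelled.
\<close>

lemma coact_id_ext_snd:
  assumes x: "x \<in> carrier X" and s: "s \<in> carrier C.VW" and q: "q \<in> carrier A"
  shows "snd (coact_id_ext K X A \<alpha> (\<alpha> x)) (pure_tensor K C.VW A s q) = F s (C.t4 x q)"
proof -
  let ?R = "tensor_lift K C.VW A P.VW (\<lambda>s a. F s (C.t4 x a))" and ?L = "tensor_lift K C.VW A P.VW (\<lambda>s a. F' s (C.t1 x a))"
  note bR = F_bilinear(1)[OF C.t_bilinear(3) x] and bL = F_bilinear(2)[OF C.t_bilinear(1) x]
  note R = P.tensor_lift_linear[OF P.Tm bR] P.tensor_lift_extensional[OF P.Tm bR] P.tensor_lift_pure[OF P.Tm bR]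
    and L = P.tensor_lift_linear[OF P.Tm bL] P.tensor_lift_extensional[OF P.Tm bL] P.tensor_lift_pure[OF P.Tm bL]
  have n: "(?L, ?R) \<in> carrier P.T.MB"
  proof (rule P.tensor_multiplierI[OF L(1,2) R(1,2)])
    fix s a s' a' assume y: "s \<in> carrier C.VW" "a \<in> carrier A" "s' \<in> carrier C.VW" "a' \<in> carrier A"
    then show "?R (pure_tensor K C.VW A s a) \<otimes>\<^bsub>P.VW\<^esub> pure_tensor K C.VW A s' a' =
      pure_tensor K C.VW A s a \<otimes>\<^bsub>P.VW\<^esub> ?L (pure_tensor K C.VW A s' a')"
      using C.t_module(6)[OF x x x y(2,4)] by (simp add: R(3) L(3) F_mult x)
  qed
  have char: "(?L, ?R) \<otimes>\<^bsub>P.T.MB\<^esub> leg2 K C.VW A a = coact_id K X A \<alpha> (C.t1 x a) \<and>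
    leg2 K C.VW A a \<otimes>\<^bsub>P.T.MB\<^esub> (?L, ?R) = coact_id K X A \<alpha> (C.t4 x a)" if a: "a \<in> carrier A" for a
  proof (intro conjI P.multiplier_eq_on_pure)
    fix s b assume y: "s \<in> carrier C.VW" "b \<in> carrier A"
    show "snd ((?L, ?R) \<otimes>\<^bsub>P.T.MB\<^esub> leg2 K C.VW A a) (pure_tensor K C.VW A s b) =
      snd (coact_id K X A \<alpha> (C.t1 x a)) (pure_tensor K C.VW A s b)"
      using C.t_module(6)[OF x x x y(2) a]
      by (simp add: P.T.multiplier_mult P.pure_closed y R(3) F_mult(3)[OF y(1) _ y(1) a] coact_id x a)
    show "snd (leg2 K C.VW A a \<otimes>\<^bsub>P.T.MB\<^esub> (?L, ?R)) (pure_tensor K C.VW A s b) =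
      snd (coact_id K X A \<alpha> (C.t4 x a)) (pure_tensor K C.VW A s b)"
      using C.t_module(3)[OF x x x a y(2)]
      by (simp add: P.T.multiplier_mult P.pure_closed y R(3) P.legs_pure coact_id x a C.W.mult_closed)
  qed (simp_all add: P.T.mult_alg_closed n P.legs_closed coact_id a x)
  have "coact_id_ext K X A \<alpha> (\<alpha> x) = (?L, ?R)"
    unfolding coact_id_ext_def Let_def C.t1_def[symmetric] C.t4_def[symmetric]
  proof (rule the_equality)
    fix m assume m: "m \<in> carrier P.T.MB \<and> (\<forall>a\<in>carrier A.
      m \<otimes>\<^bsub>P.T.MB\<^esub> leg2 K C.VW A a = coact_id K X A \<alpha> (C.t1 x a) \<and>
      leg2 K C.VW A a \<otimes>\<^bsub>P.T.MB\<^esub> m = coact_id K X A \<alpha> (C.t4 x a))"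
    show "m = (?L, ?R)"
    proof (rule P.T.multiplier_eq_snd[OF _ n])
      fix w assume w: "w \<in> carrier P.VW"
      show "snd m w = snd (?L, ?R) w"
      proof (rule P.leg2_cancel)
        fix a assume a: "a \<in> carrier A"
        have "m \<otimes>\<^bsub>P.T.MB\<^esub> leg2 K C.VW A a = (?L, ?R) \<otimes>\<^bsub>P.T.MB\<^esub> leg2 K C.VW A a"
          using m char a by simp
        then have "snd (m \<otimes>\<^bsub>P.T.MB\<^esub> leg2 K C.VW A a) w = snd ((?L, ?R) \<otimes>\<^bsub>P.T.MB\<^esub> leg2 K C.VW A a) w" by simp
        then show "snd (leg2 K C.VW A a) (snd m w) = snd (leg2 K C.VW A a) (snd (?L, ?R) w)"
          by (simp only: P.T.multiplier_mult(2)[OF w])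
      qed (use m w n in \<open>simp_all only: P.T.multiplierD(4)\<close>)
    qed (use m in simp)
  qed (use n char in simp)
  then show ?thesis using R(3) s q by simp
qed

end

lemma bilinear_span_induct:
  assumes "t \<in> carrier (tensor K V W)"
    and "\<And>v w. v \<in> carrier V \<Longrightarrow> w \<in> carrier W \<Longrightarrow> Q (pure_tensor K V W v w)"
    and "\<And>s t. s \<in> carrier (tensor K V W) \<Longrightarrow> t \<in> carrier (tensor K V W) \<Longrightarrow> Q s \<Longrightarrow> Q t \<Longrightarrow> Q (s \<oplus>\<^bsub>tensor K V W\<^esub> t)"
  shows "Q t"
proof -
  have "t \<in> tensor_carrier K V W" using assms(1) by (simp add: tensor_def)
  then show ?thesis
  proof induction
    case (sum s t)
    then have "Q (s \<oplus>\<^bsub>tensor K V W\<^esub> t)" by (intro assms(3)) (simp_all add: tensor_def)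
    then show ?case unfolding tensor_def ring.simps .
  qed (rule assms(2))
qed

context covered_coaction
begin

lemmas delta_snd = linear_comp[OF D.T.apply_linear(2) D.alpha(2)] linear_comp[OF D.T.multiplierD(2)[OF D.alpha(1)]]
  D.T.multiplierD(2)[OF D.alpha(1)] D.T.multiplierD(4)[OF D.alpha(1)]

text \<open>
  For a tensor \<open>t\<close> with entries \<open>u \<otimes> v\<close>, \<open>G r t\<close> is \<open>(1 \<otimes> r) (\<iota> \<otimes> \<Delta>)(t)\<close>.
\<close>

definition G where "G r = tensor_lift K X A Q.VW (\<lambda>u v. pure_tensor K X D.VW u (snd (\<Delta> v) r))"

lemma G_bil: "r \<in> carrier D.VW \<Longrightarrow> (\<lambda>u v. pure_tensor K X D.VW u (snd (\<Delta> v) r)) \<in> bilinear_maps K X A Q.VW"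
  by (intro bilinear_mapsI Q.pure_comp delta_snd linear_id; assumption)

lemma G_linear: "r \<in> carrier D.VW \<Longrightarrow> G r \<in> linear_maps K C.VW Q.VW"
  unfolding G_def by (intro C.tensor_lift_linear Q.Tm G_bil; assumption)

lemma G_pure: "r \<in> carrier D.VW \<Longrightarrow> u \<in> carrier X \<Longrightarrow> v \<in> carrier A \<Longrightarrow>
  G r (pure_tensor K X A u v) = pure_tensor K X D.VW u (snd (\<Delta> v) r)"
  unfolding G_def by (intro C.tensor_lift_pure Q.Tm G_bil; assumption)

lemma G_param: "t \<in> carrier C.VW \<Longrightarrow> (\<lambda>r. G r t) \<in> linear_maps K D.VW Q.VW"
  unfolding G_def by (intro C.tensor_lift_param Q.Tm G_bil Q.pure_comp delta_snd linear_id D.Tm; assumption)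

lemma G_fst_leg2:
  assumes r: "r \<in> carrier D.VW" and a: "a \<in> carrier A" and t: "t \<in> carrier C.VW"
  shows "G (snd (\<Delta> a) r) t = G r (fst (leg2 K X A a) t)"
  by (rule C.linear_eq_on_pure[OF Q.Tm G_linear[OF D.T.multiplierD(4)[OF D.alpha(1)[OF a] r]]
        linear_comp[OF G_linear[OF r] C.T.multiplierD(1)[OF C.legs_closed(2)[OF a]]] _ t])
    (simp add: G_pure r a C.legs_pure D.T.multiplierD D.alpha C.W.mult_closed D.T.multiplier_mult)

lemma id_comult:
  shows "id_comult K X A \<Delta> \<in> linear_maps K C.VW Q.T.MB"
    "x \<in> carrier X \<Longrightarrow> a \<in> carrier A \<Longrightarrow>
      id_comult K X A \<Delta> (pure_tensor K X A x a) = mult_tensor K X D.VW (mult_of X x) (\<Delta> a)"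
    "t \<in> carrier C.VW \<Longrightarrow> z \<in> carrier X \<Longrightarrow> r \<in> carrier D.VW \<Longrightarrow>
      snd (id_comult K X A \<Delta> t) (pure_tensor K X D.VW z r) = G r (fst (leg1 K X A z) t)"
proof -
  have b: "(\<lambda>x a. mult_tensor K X D.VW (mult_of X x) (\<Delta> a)) \<in> bilinear_maps K X A Q.T.MB"
    by (intro bilinear_mapsI bilinear_maps_comp[OF Q.mult_tensor_bilinear] D.alpha C.V.mult_of_linear C.V.mult_of_closed; assumption)
  note L = C.tensor_lift_linear[OF Q.T.mult_alg_module b] and Lp = C.tensor_lift_pure[OF Q.T.mult_alg_module b]
  show "id_comult K X A \<Delta> \<in> linear_maps K C.VW Q.T.MB"
    "x \<in> carrier X \<Longrightarrow> a \<in> carrier A \<Longrightarrow>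
      id_comult K X A \<Delta> (pure_tensor K X A x a) = mult_tensor K X D.VW (mult_of X x) (\<Delta> a)"
    unfolding id_comult_def by (rule L Lp; assumption)+
  assume t: "t \<in> carrier C.VW" and z: "z \<in> carrier X" and r: "r \<in> carrier D.VW"
  show "snd (id_comult K X A \<Delta> t) (pure_tensor K X D.VW z r) = G r (fst (leg1 K X A z) t)"
    unfolding id_comult_def
    by (rule C.linear_eq_on_pure[OF Q.Tm linear_comp[OF Q.T.apply_linear(2)[OF Q.pure_closed[OF z r]] L]
          linear_comp[OF G_linear[OF r] C.T.multiplierD(1)[OF C.legs_closed(1)[OF z]]] _ t])
      (simp add: Lp z r G_pure C.legs_pure Q.mult_tensor D.alpha C.V.mult_of_closed C.V.mult_of_simps C.V.mult_closed)
qed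

lemma t2_alpha:
  assumes "z \<in> carrier X" "x \<in> carrier X" "t \<in> carrier C.VW"
  shows "C.t2 z x \<otimes>\<^bsub>C.VW\<^esub> t = fst (leg1 K X A z) (fst (\<alpha> x) t)"
  by (rule C.inj) (simp_all add: assms C.cov_simps C.T.mult_of_mult C.T.mult_of_closed C.T.mult_closed)

lemma delta_t1:
  assumes q: "q \<in> carrier D.VW" and v: "v \<in> carrier A" "a \<in> carrier A" "c \<in> carrier A"
  shows "q \<otimes>\<^bsub>D.VW\<^esub> D.t1 (v \<otimes>\<^bsub>A\<^esub> a) c = snd (\<Delta> v) q \<otimes>\<^bsub>D.VW\<^esub> D.t1 a c"
  by (simp add: D.t_hom(1)[OF v(1,2) v(1,3)] q v D.T.multiplierD D.alpha)

text \<open>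
  \<open>A \<otimes> A\<close> is spanned by the elements \<open>\<Delta>(a) (1 \<otimes> c)\<close>.
\<close>

lemma span1_induct:
  assumes "r \<in> carrier D.VW" and "\<And>a c. a \<in> carrier A \<Longrightarrow> c \<in> carrier A \<Longrightarrow> Q (D.t1 a c)"
    and add: "\<And>s t. s \<in> carrier D.VW \<Longrightarrow> t \<in> carrier D.VW \<Longrightarrow> Q s \<Longrightarrow> Q t \<Longrightarrow> Q (s \<oplus>\<^bsub>D.VW\<^esub> t)"
  shows "Q r"
proof -
  let ?E = "tensor_lift K A A D.VW D.t1"
  note E = D.tensor_lift_linear[OF D.Tm D.t_bilinear(1)]
  obtain s where s: "s \<in> carrier D.VW" "?E s = r" using span1[OF assms(1)] by blast
  have "Q (?E s)"
  proof (rule bilinear_span_induct[OF s(1)])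
    fix s t assume "s \<in> carrier D.VW" "t \<in> carrier D.VW" "Q (?E s)" "Q (?E t)"
    then show "Q (?E (s \<oplus>\<^bsub>D.VW\<^esub> t))" using add linear_mapsD(1,2)[OF E] by simp
  qed (simp add: D.tensor_lift_pure[OF D.Tm D.t_bilinear(1)] assms(2))
  then show ?thesis using s by simp
qed

lemma id_comult_cancel:
  assumes y: "y \<in> carrier Q.VW" "y' \<in> carrier Q.VW"
    and eq: "\<And>t. t \<in> carrier C.VW \<Longrightarrow> snd (id_comult K X A \<Delta> t) y = snd (id_comult K X A \<Delta> t) y'"
  shows "y = y'"
proof (rule Q.eq_by_pure_mult[OF y])
  fix u r assume u: "u \<in> carrier X" and r: "r \<in> carrier D.VW"
  show "y \<otimes>\<^bsub>Q.VW\<^esub> pure_tensor K X D.VW u r = y' \<otimes>\<^bsub>Q.VW\<^esub> pure_tensor K X D.VW u r"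
  proof (rule span1_induct[OF r])
    fix a c assume a: "a \<in> carrier A" and c: "c \<in> carrier A"
    let ?l = "mult_tensor K X D.VW \<one>\<^bsub>C.V.MB\<^esub> (leg2 K A A c)"
    note lc = Q.mult_tensor[OF C.V.mult_alg_closed(5) D.legs_closed(2)[OF c]]
    note ic = linear_mapsD(1)[OF id_comult(1) C.pure_closed[OF u a]]
    have "w \<otimes>\<^bsub>Q.VW\<^esub> pure_tensor K X D.VW u (D.t1 a c) = snd ?l (snd (id_comult K X A \<Delta> (pure_tensor K X A u a)) w)"
      if "w \<in> carrier Q.VW" for w
    proof (rule Q.linear_eq_on_pure[OF Q.Tm Q.tensor_mult_linear_left
          linear_comp[OF Q.T.multiplierD(2)[OF lc(1)] Q.T.multiplierD(2)[OF ic]] _ that])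
      fix z q assume z: "z \<in> carrier X" "q \<in> carrier D.VW"
      have "q \<otimes>\<^bsub>D.VW\<^esub> D.t1 a c = snd (leg2 K A A c) (snd (\<Delta> a) q)"
        using D.T.mult_of_simps(2)[OF z(2), of "D.t1 a c"] by (simp add: D.mult_of_t a c D.T.multiplier_mult z)
      then show "pure_tensor K X D.VW z q \<otimes>\<^bsub>Q.VW\<^esub> pure_tensor K X D.VW u (D.t1 a c) =
        snd ?l (snd (id_comult K X A \<Delta> (pure_tensor K X A u a)) (pure_tensor K X D.VW z q))"
        by (simp add: id_comult(2) u a c z Q.mult_pure lc Q.mult_tensor C.V.mult_of_closed D.alpha C.V.mult_of_simps
            C.V.mult_closed D.T.multiplierD C.V.multiplier_zero_one)
    qed (simp add: Q.pure_closed u a c)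
    then show "y \<otimes>\<^bsub>Q.VW\<^esub> pure_tensor K X D.VW u (D.t1 a c) = y' \<otimes>\<^bsub>Q.VW\<^esub> pure_tensor K X D.VW u (D.t1 a c)"
      by (simp add: y eq[OF C.pure_closed[OF u a]])
  next
    fix s t assume s: "s \<in> carrier D.VW" "t \<in> carrier D.VW"
      "y \<otimes>\<^bsub>Q.VW\<^esub> pure_tensor K X D.VW u s = y' \<otimes>\<^bsub>Q.VW\<^esub> pure_tensor K X D.VW u s"
      "y \<otimes>\<^bsub>Q.VW\<^esub> pure_tensor K X D.VW u t = y' \<otimes>\<^bsub>Q.VW\<^esub> pure_tensor K X D.VW u t"
    then show "y \<otimes>\<^bsub>Q.VW\<^esub> pure_tensor K X D.VW u (s \<oplus>\<^bsub>D.VW\<^esub> t) = y' \<otimes>\<^bsub>Q.VW\<^esub> pure_tensor K X D.VW u (s \<oplus>\<^bsub>D.VW\<^esub> t)"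
      by (simp add: linear_mapsD(2)[OF bilinear_mapsD(1)[OF Q.pure_bilinear u]] Q.T.mult_linear Q.pure_closed u y)
  qed
qed

text \<open>
  Right multiplication by \<open>(\<iota> \<otimes> \<Delta>)(\<alpha>(x))\<close> must send \<open>z \<otimes> r\<close> to \<open>(1 \<otimes> r) (\<iota> \<otimes> \<Delta>)((z \<otimes> 1) \<alpha>(x))\<close>. To see that this
  is one half of a multiplier, a left multiplication is needed. On \<open>z \<otimes> \<Delta>(a) (1 \<otimes> c)\<close> it is
  \<open>(\<iota> \<otimes> \<Delta>)(\<alpha>(x) (z \<otimes> a)) (1 \<otimes> 1 \<otimes> c)\<close>, and such elements span.
\<close>

lemma mult_ext_snd:
  assumes x: "x \<in> carrier X" and z: "z \<in> carrier X" and r: "r \<in> carrier D.VW"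
  shows "snd (mult_ext K C.VW Q.VW (id_comult K X A \<Delta>) (\<alpha> x)) (pure_tensor K X D.VW z r) = G r (C.t2 z x)"
proof -
  let ?R = "tensor_lift K X D.VW Q.VW (\<lambda>z r. G r (C.t2 z x))"
  let ?I = "id_comult K X A \<Delta>"
  have bR: "(\<lambda>z r. G r (C.t2 z x)) \<in> bilinear_maps K X D.VW Q.VW"
    by (intro bilinear_mapsI G_param linear_comp[OF G_linear] bilinear_mapsD[OF C.t_bilinear(2)] x; assumption)
  note R = Q.tensor_lift_linear[OF Q.Tm bR] Q.tensor_lift_extensional[OF Q.Tm bR] Q.tensor_lift_pure[OF Q.Tm bR]
  note Rc = linear_mapsD(1)[OF R(1)]
  \<comment> \<open>The elements \<open>w\<close> for which some \<open>y\<close> can serve as the value of the left multiplication at \<open>w\<close>.\<close>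
  define good where "good w \<longleftrightarrow> (\<exists>y\<in>carrier Q.VW. \<forall>p\<in>carrier Q.VW. ?R p \<otimes>\<^bsub>Q.VW\<^esub> w = p \<otimes>\<^bsub>Q.VW\<^esub> y)" for w
  have good_add: "good (w \<oplus>\<^bsub>Q.VW\<^esub> w')" if w: "w \<in> carrier Q.VW" "w' \<in> carrier Q.VW" "good w" "good w'" for w w'
  proof -
    from w obtain y y' where y: "y \<in> carrier Q.VW" "y' \<in> carrier Q.VW"
      "\<forall>p\<in>carrier Q.VW. ?R p \<otimes>\<^bsub>Q.VW\<^esub> w = p \<otimes>\<^bsub>Q.VW\<^esub> y" "\<forall>p\<in>carrier Q.VW. ?R p \<otimes>\<^bsub>Q.VW\<^esub> w' = p \<otimes>\<^bsub>Q.VW\<^esub> y'"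
      unfolding good_def by blast
    then show ?thesis unfolding good_def
      by (intro bexI[of _ "y \<oplus>\<^bsub>Q.VW\<^esub> y'"]) (simp_all add: Q.T.mult_linear Rc w(1,2) Q.add_closed)
  qed
  have good_t1: "good (pure_tensor K X D.VW z (D.t1 a c))" if y: "z \<in> carrier X" "a \<in> carrier A" "c \<in> carrier A" for z a c
  proof -
    have bY: "(\<lambda>u v. pure_tensor K X D.VW u (D.t1 v c)) \<in> bilinear_maps K X A Q.VW"
      by (intro bilinear_mapsI Q.pure_comp linear_id bilinear_mapsD[OF D.t_bilinear(1)] y; assumption)
    let ?Y = "tensor_lift K X A Q.VW (\<lambda>u v. pure_tensor K X D.VW u (D.t1 v c))"
    note Y = C.tensor_lift_linear[OF Q.Tm bY] C.tensor_lift_pure[OF Q.Tm bY]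
    \<comment> \<open>\<open>?Y ?b\<close> is \<open>(\<iota> \<otimes> \<Delta>)(\<alpha>(x) (z \<otimes> a)) (1 \<otimes> 1 \<otimes> c)\<close>.\<close>
    let ?b = "fst (\<alpha> x) (pure_tensor K X A z a)"
    have bc: "?b \<in> carrier C.VW" by (simp add: C.T.multiplierD C.alpha x y C.pure_closed)
    have yc: "?Y ?b \<in> carrier Q.VW" by (rule linear_mapsD(1)[OF Y(1) bc])
    have "?R p \<otimes>\<^bsub>Q.VW\<^esub> pure_tensor K X D.VW z (D.t1 a c) = p \<otimes>\<^bsub>Q.VW\<^esub> ?Y ?b" if p: "p \<in> carrier Q.VW" for p
    proof (rule Q.linear_eq_on_pure[OF Q.Tm linear_comp[OF Q.tensor_mult_linear_left R(1)] Q.tensor_mult_linear_left[OF yc] _ p])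
      fix w q assume w: "w \<in> carrier X" "q \<in> carrier D.VW"
      have bN: "(\<lambda>u v. pure_tensor K X D.VW u (q \<otimes>\<^bsub>D.VW\<^esub> D.t1 v c)) \<in> bilinear_maps K X A Q.VW"
        by (intro bilinear_mapsI Q.pure_comp linear_id linear_comp[OF D.tensor_mult_linear_right]
          bilinear_mapsD[OF D.t_bilinear(1)] D.T.mult_closed y w; assumption)
      let ?N = "tensor_lift K X A Q.VW (\<lambda>u v. pure_tensor K X D.VW u (q \<otimes>\<^bsub>D.VW\<^esub> D.t1 v c))"
      note N = C.tensor_lift_linear[OF Q.Tm bN] C.tensor_lift_pure[OF Q.Tm bN]
      have "pure_tensor K X D.VW w q \<otimes>\<^bsub>Q.VW\<^esub> ?Y b = ?N (fst (leg1 K X A w) b)" if "b \<in> carrier C.VW" for b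
        by (rule C.linear_eq_on_pure[OF Q.Tm linear_comp[OF Q.tensor_mult_linear_right Y(1)]
            linear_comp[OF N(1) C.T.multiplierD(1)[OF C.legs_closed(1)]] _ that])
          (simp_all add: Y N C.legs_pure Q.mult_pure C.V.mult_closed Q.pure_closed w y)
      moreover have "?N (t \<otimes>\<^bsub>C.VW\<^esub> pure_tensor K X A z a) = G q t \<otimes>\<^bsub>Q.VW\<^esub> pure_tensor K X D.VW z (D.t1 a c)"
        if "t \<in> carrier C.VW" for t
        by (rule C.linear_eq_on_pure[OF Q.Tm linear_comp[OF N(1) C.tensor_mult_linear_left]
            linear_comp[OF Q.tensor_mult_linear_left G_linear] _ that])
          (simp_all add: N G_pure C.mult_pure Q.mult_pure C.V.mult_closed C.W.mult_closed C.pure_closed Q.pure_closed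
            delta_t1 w y D.T.multiplierD D.alpha)
      ultimately show "?R (pure_tensor K X D.VW w q) \<otimes>\<^bsub>Q.VW\<^esub> pure_tensor K X D.VW z (D.t1 a c) =
        pure_tensor K X D.VW w q \<otimes>\<^bsub>Q.VW\<^esub> ?Y ?b"
        using t2_alpha[OF w(1) x C.pure_closed[OF y(1,2)], symmetric] bc by (simp add: R(3) w x)
    qed (simp add: Q.pure_closed y)
    then show ?thesis unfolding good_def using yc by blast
  qed
  have good_all: "good w" if "w \<in> carrier Q.VW" for w
  proof (rule bilinear_span_induct[OF that])
    fix z r assume z: "z \<in> carrier X" and r: "r \<in> carrier D.VW"
    show "good (pure_tensor K X D.VW z r)"
    proof (rule span1_induct[OF r])
      fix s t assume "s \<in> carrier D.VW" "t \<in> carrier D.VW" "good (pure_tensor K X D.VW z s)" "good (pure_tensor K X D.VW z t)"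
      then show "good (pure_tensor K X D.VW z (s \<oplus>\<^bsub>D.VW\<^esub> t))"
        using good_add by (simp add: linear_mapsD(2)[OF bilinear_mapsD(1)[OF Q.pure_bilinear z]] Q.pure_closed z)
    qed (rule good_t1[OF z])
  qed (rule good_add)
  have "\<forall>w\<in>carrier Q.VW. \<exists>y. y \<in> carrier Q.VW \<and> (\<forall>p\<in>carrier Q.VW. ?R p \<otimes>\<^bsub>Q.VW\<^esub> w = p \<otimes>\<^bsub>Q.VW\<^esub> y)"
    using good_all unfolding good_def by blast
  from bchoice[OF this] obtain Y where Y: "\<And>w. w \<in> carrier Q.VW \<Longrightarrow> Y w \<in> carrier Q.VW"
    "\<And>p w. p \<in> carrier Q.VW \<Longrightarrow> w \<in> carrier Q.VW \<Longrightarrow> ?R p \<otimes>\<^bsub>Q.VW\<^esub> w = p \<otimes>\<^bsub>Q.VW\<^esub> Y w" by blast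
  define L where "L = restrict Y (carrier Q.VW)"
  have n: "(L, ?R) \<in> carrier Q.T.MB"
    by (rule Q.T.multiplier_carrierI[OF _ R(2) _ Rc]) (simp_all add: L_def Y)
  note Ic = linear_mapsD(1)[OF id_comult(1)]
  note ac = C.T.multiplierD[OF C.alpha(1)[OF x]]
  have char1: "(L, ?R) \<otimes>\<^bsub>Q.T.MB\<^esub> ?I b = ?I (fst (\<alpha> x) b)" if b: "b \<in> carrier C.VW" for b
  proof (rule C.linear_eq_on_pure[OF Q.T.mult_alg_module linear_comp[OF Q.T.mult_alg_mult_linear(1)[OF n] id_comult(1)]
        linear_comp[OF id_comult(1) ac(1)] _ b])
    fix y a assume y: "y \<in> carrier X" "a \<in> carrier A"
    note p = C.pure_closed[OF y]
    show "(L, ?R) \<otimes>\<^bsub>Q.T.MB\<^esub> ?I (pure_tensor K X A y a) = ?I (fst (\<alpha> x) (pure_tensor K X A y a))"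
    proof (rule Q.multiplier_eq_on_pure)
      fix z r assume z: "z \<in> carrier X" "r \<in> carrier D.VW"
      have "snd (?I (pure_tensor K X A y a)) (G r t) = G r (t \<otimes>\<^bsub>C.VW\<^esub> pure_tensor K X A y a)" if "t \<in> carrier C.VW" for t
        by (rule C.linear_eq_on_pure[OF Q.Tm linear_comp[OF Q.T.multiplierD(2)[OF Ic[OF p]] G_linear[OF z(2)]]
            linear_comp[OF G_linear[OF z(2)] C.tensor_mult_linear_left[OF p]] _ that])
          (simp add: G_pure id_comult(2) y z C.mult_pure Q.mult_tensor C.V.mult_of_closed C.V.mult_of_simps D.alpha
            D.T.multiplierD C.V.mult_closed C.W.mult_closed D.T.multiplier_mult)
      then show "snd ((L, ?R) \<otimes>\<^bsub>Q.T.MB\<^esub> ?I (pure_tensor K X A y a)) (pure_tensor K X D.VW z r) =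
        snd (?I (fst (\<alpha> x) (pure_tensor K X A y a))) (pure_tensor K X D.VW z r)"
        by (simp add: Q.T.multiplier_mult Q.pure_closed z R(3) x id_comult(3) ac p t2_alpha)
    qed (simp_all add: Q.T.mult_alg_closed n Ic p ac)
  qed
  have char2: "?I b \<otimes>\<^bsub>Q.T.MB\<^esub> (L, ?R) = ?I (snd (\<alpha> x) b)" if b: "b \<in> carrier C.VW" for b
  proof (rule C.linear_eq_on_pure[OF Q.T.mult_alg_module linear_comp[OF Q.T.mult_alg_mult_linear(2)[OF n] id_comult(1)]
        linear_comp[OF id_comult(1) ac(2)] _ b])
    fix y a assume y: "y \<in> carrier X" "a \<in> carrier A"
    note p = C.pure_closed[OF y]
    show "?I (pure_tensor K X A y a) \<otimes>\<^bsub>Q.T.MB\<^esub> (L, ?R) = ?I (snd (\<alpha> x) (pure_tensor K X A y a))"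
    proof (rule Q.multiplier_eq_on_pure)
      fix z r assume z: "z \<in> carrier X" "r \<in> carrier D.VW"
      have "fst (leg2 K X A a) (C.t2 (z \<otimes>\<^bsub>X\<^esub> y) x) = fst (leg1 K X A z) (snd (\<alpha> x) (pure_tensor K X A y a))"
        by (rule C.inj; simp add: C.cov_simps z y x p C.legs_mult(3) C.legs_mult(1)[symmetric] C.legs_commute C.legs_commute')
      then show "snd (?I (pure_tensor K X A y a) \<otimes>\<^bsub>Q.T.MB\<^esub> (L, ?R)) (pure_tensor K X D.VW z r) =
        snd (?I (snd (\<alpha> x) (pure_tensor K X A y a))) (pure_tensor K X D.VW z r)"
        by (simp add: Q.T.multiplier_mult Q.pure_closed z R(3) x y id_comult(3) ac p)
          (simp add: C.legs_pure G_pure G_fst_leg2 R(3) D.T.multiplierD D.alpha C.V.mult_closed z y x)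
    qed (simp_all add: Q.T.mult_alg_closed n Ic p ac)
  qed
  have "mult_ext K C.VW Q.VW ?I (\<alpha> x) = (L, ?R)"
    unfolding mult_ext_def
  proof (rule the_equality)
    fix m assume m: "m \<in> carrier Q.T.MB \<and> (\<forall>b\<in>carrier C.VW. m \<otimes>\<^bsub>Q.T.MB\<^esub> ?I b = ?I (fst (\<alpha> x) b) \<and>
      ?I b \<otimes>\<^bsub>Q.T.MB\<^esub> m = ?I (snd (\<alpha> x) b))"
    show "m = (L, ?R)"
    proof (rule Q.T.multiplier_eq_snd[OF _ n])
      fix w assume w: "w \<in> carrier Q.VW"
      show "snd m w = snd (L, ?R) w"
      proof (rule id_comult_cancel)
        fix b assume b: "b \<in> carrier C.VW"
        have "m \<otimes>\<^bsub>Q.T.MB\<^esub> ?I b = (L, ?R) \<otimes>\<^bsub>Q.T.MB\<^esub> ?I b" using m char1 b by simp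
        then have "snd (m \<otimes>\<^bsub>Q.T.MB\<^esub> ?I b) w = snd ((L, ?R) \<otimes>\<^bsub>Q.T.MB\<^esub> ?I b) w" by simp
        then show "snd (?I b) (snd m w) = snd (?I b) (snd (L, ?R) w)"
          by (simp only: Q.T.multiplier_mult(2)[OF w])
      qed (use m w n in \<open>simp_all only: Q.T.multiplierD(4)\<close>)
    qed (use m in simp)
  qed (use n char1 char2 in simp)
  then show ?thesis using R(3) z r by simp
qed

end

context covered_coaction
begin

section \<open>Comparing the two sides of coassociativity\<close>

abbreviation "as \<equiv> tensor_assoc K X A A"

lemma assoc_inner:
  assumes w: "w \<in> carrier A"
  shows "(\<lambda>u v. pure_tensor K X D.VW u (pure_tensor K A A v w)) \<in> bilinear_maps K X A Q.VW"
  by (intro bilinear_mapsI Q.pure_comp D.pure_comp linear_id D.pure_closed w; assumption)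

lemma assoc_bilinear:
  "(\<lambda>s w. tensor_lift K X A Q.VW (\<lambda>u v. pure_tensor K X D.VW u (pure_tensor K A A v w)) s) \<in> bilinear_maps K C.VW A Q.VW"
  by (intro bilinear_mapsI C.tensor_lift_param C.tensor_lift_linear Q.Tm assoc_inner Q.pure_comp D.pure_comp linear_id
    D.pure_closed C.Wm; assumption)

lemma assoc_linear: "as \<in> linear_maps K P.VW Q.VW"
  unfolding tensor_assoc_def by (rule P.tensor_lift_linear[OF Q.Tm assoc_bilinear])

lemma assoc_pure: "s \<in> carrier C.VW \<Longrightarrow> w \<in> carrier A \<Longrightarrow> as (pure_tensor K C.VW A s w) =
  tensor_lift K X A Q.VW (\<lambda>u v. pure_tensor K X D.VW u (pure_tensor K A A v w)) s"
  unfolding tensor_assoc_def by (rule P.tensor_lift_pure[OF Q.Tm assoc_bilinear])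

lemma assoc_pure3: "u \<in> carrier X \<Longrightarrow> v \<in> carrier A \<Longrightarrow> w \<in> carrier A \<Longrightarrow>
  as (pure_tensor K C.VW A (pure_tensor K X A u v) w) = pure_tensor K X D.VW u (pure_tensor K A A v w)"
  by (simp add: assoc_pure C.pure_closed C.tensor_lift_pure[OF Q.Tm assoc_inner])

lemma assoc_inj: "inj_on as (carrier P.VW)"
proof -
  have i: "(\<lambda>v w. pure_tensor K C.VW A (pure_tensor K X A u v) w) \<in> bilinear_maps K A A P.VW" if "u \<in> carrier X" for u
    by (intro bilinear_mapsI P.pure_comp C.pure_comp linear_id C.pure_closed that; assumption)
  have o: "(\<lambda>u r. tensor_lift K A A P.VW (\<lambda>v w. pure_tensor K C.VW A (pure_tensor K X A u v) w) r) \<in> bilinear_maps K X D.VW P.VW"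
    by (intro bilinear_mapsI D.tensor_lift_param D.tensor_lift_linear P.Tm i P.pure_comp C.pure_comp linear_id C.pure_closed C.Vm; assumption)
  let ?g = "tensor_lift K X D.VW P.VW (\<lambda>u r. tensor_lift K A A P.VW (\<lambda>v w. pure_tensor K C.VW A (pure_tensor K X A u v) w) r)"
  note g = Q.tensor_lift_linear[OF P.Tm o] Q.tensor_lift_pure[OF P.Tm o]
  note ga = linear_comp[OF g(1) assoc_linear]
  have 1: "?g (as (pure_tensor K C.VW A s w)) = pure_tensor K C.VW A s w" if "s \<in> carrier C.VW" "w \<in> carrier A" for s w
    by (rule C.linear_eq_on_pure[OF P.Tm linear_comp[OF ga bilinear_mapsD(2)[OF P.pure_bilinear that(2)]]
          bilinear_mapsD(2)[OF P.pure_bilinear that(2)] _ that(1)])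
      (simp add: assoc_pure3 that g(2) D.pure_closed D.tensor_lift_pure[OF P.Tm i])
  have "?g (as t) = t" if "t \<in> carrier P.VW" for t
    by (rule P.linear_eq_on_pure[OF P.Tm ga linear_id 1 that])
  then show ?thesis by (intro inj_on_inverseI[where g = ?g])
qed

text \<open>Both sides of coassociativity, applied to \<open>(z \<otimes> p) \<otimes> q\<close> from the right.\<close>

lemma coassoc_tensor:
  assumes x: "x \<in> carrier X" "z \<in> carrier X" "p \<in> carrier A" "q \<in> carrier A"
  shows "as (F (pure_tensor K X A z p) (C.t4 x q)) = G (pure_tensor K A A p q) (C.t2 z x)"
proof -
  let ?w = "pure_tensor K C.VW A (pure_tensor K X A z p) q"
  note c = C.pure_closed[OF x(2,3)] D.pure_closed[OF x(3,4)]
  note w = P.pure_closed[OF c(1) x(4)]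
  note aw = linear_mapsD(1)[OF assoc_linear w]
  have "snd (mult_transport P.VW Q.VW as (coact_id_ext K X A \<alpha> (\<alpha> x))) (as ?w) =
    snd (mult_ext K C.VW Q.VW (id_comult K X A \<Delta>) (\<alpha> x)) (as ?w)"
    using coassoc x unfolding coassociative_def by simp
  moreover have "inv_into (carrier P.VW) as (as ?w) = ?w" by (rule inv_into_f_f[OF assoc_inj w])
  ultimately have "as (snd (coact_id_ext K X A \<alpha> (\<alpha> x)) ?w) =
    snd (mult_ext K C.VW Q.VW (id_comult K X A \<Delta>) (\<alpha> x)) (as ?w)"
    using aw by (simp add: mult_transport_def)
  then show ?thesis using x c by (simp add: coact_id_ext_snd assoc_pure3 mult_ext_snd)
qed

lemmas C_rules = C.B.list_rules[OF C.lists_bilinear(1)] C.B.list_rules[OF C.lists_bilinear(2)]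
  C.B.list_rules[OF C.lists_bilinear(3)]
lemmas D_rules = C.B.list_rules[OF D.lists_bilinear(1)] C.B.list_rules[OF D.lists_bilinear(2)]
  C.B.list_rules[OF D.lists_bilinear(3)]
lemmas ml_C = C.B.ml_base C_rules D_rules C.V.linear_mult_left C.V.linear_mult_right C.V.mult_closed
  C.W.linear_mult_left C.W.linear_mult_right C.W.mult_closed

lemmas CV_cong = esum_cong[OF bilinear_listsD(1)[OF C.lists_bilinear(1)]]
  and CW4_cong = esum_cong[OF bilinear_listsD(1)[OF C.lists_bilinear(3)]]

text \<open>
  Evaluating the preceding identity on trilinear forms gives coassociativity multiplied by \<open>p\<close> in the
  second leg. The factor \<open>p\<close> is cancelled next, and finally the cover \<open>1 \<otimes> 1 \<otimes> q\<close> on the left is traded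
  for a cover on the right.
\<close>

lemma coassoc_covered:
  assumes c: "c \<in> trilinear_forms K X A A" and x: "x \<in> carrier X" "z \<in> carrier X" "p \<in> carrier A" "q \<in> carrier A"
  shows "esum K (C.W4 x q) (\<lambda>u v. esum K (C.V z u) (\<lambda>r s. c r (p \<otimes>\<^bsub>A\<^esub> s) v)) =
    esum K (C.V z x) (\<lambda>u v. esum K (D.W4 v q) (\<lambda>r s. c u (p \<otimes>\<^bsub>A\<^esub> r) s))"
proof -
  note cc = trilinear_comp[OF c]
  let ?B = "\<lambda>u r. r (\<lambda>v w. c u v w)"
  have B: "?B \<in> bilinear_forms K X D.VW"
  proof (rule bilinear_formsI)
    show "(\<lambda>r. r (\<lambda>v w. c u v w)) \<in> functionals K D.VW" if "u \<in> carrier X" for u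
      using D.eval_functional[OF cc(5)[OF that]] by simp
    show "(\<lambda>u. r (\<lambda>v w. c u v w)) \<in> functionals K X" if r: "r \<in> carrier D.VW" for r
    proof (rule functionals_cong[OF C.Vm])
      show "(\<lambda>u. esum K (rep K A A r) (\<lambda>v w. c u v w)) \<in> functionals K X"
        by (intro C.B.functional_esum_param[OF D.rep(1)[OF r]] cc linear_id)
    qed (use D.tensor_eval[OF r cc(5)] in simp)
  qed
  have fb: "(\<lambda>u' v'. c u' v' v) \<in> bilinear_forms K X A" if "v \<in> carrier A" for v
    by (intro bilinear_formsI cc linear_id that)
  have 1: "as (pure_tensor K C.VW A s v) ?B = esum K (rep K X A s) (\<lambda>u' v'. c u' v' v)"
    if "s \<in> carrier C.VW" "v \<in> carrier A" for s v
  proof -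
    have "as (pure_tensor K C.VW A s v) ?B = s (\<lambda>u' v'. pure_tensor K X D.VW u' (pure_tensor K A A v' v) ?B)"
      unfolding assoc_pure[OF that]
      by (rule C.tensor_lift_functional[OF Q.Tm assoc_inner[OF that(2)] Q.eval_functional[OF B] that(1)])
    also have "\<dots> = esum K (rep K X A s) (\<lambda>u' v'. pure_tensor K X D.VW u' (pure_tensor K A A v' v) ?B)"
      by (rule C.tensor_eval[OF that(1) bilinear_maps_functional[OF assoc_inner[OF that(2)] Q.eval_functional[OF B]]])
    also have "\<dots> = esum K (rep K X A s) (\<lambda>u' v'. c u' v' v)"
      by (rule esum_cong[OF C.rep(1)[OF that(1)]]) (simp add: Q.pure_eval[OF B] D.pure_eval cc(5))
    finally show ?thesis .
  qed
  have zp: "pure_tensor K X A z p \<in> carrier C.VW" and pq: "pure_tensor K A A p q \<in> carrier D.VW"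
    by (simp_all add: C.pure_closed D.pure_closed x)
  have "as (F (pure_tensor K X A z p) (C.t4 x q)) ?B =
    esum K (C.W4 x q) (\<lambda>u v. as (F (pure_tensor K X A z p) (pure_tensor K X A u v)) ?B)"
    unfolding C.W4_def
    by (rule C.functional_rep[OF functional_comp[OF Q.eval_functional[OF B] linear_comp[OF assoc_linear F_linear(1)[OF zp]]]])
      (simp add: x)
  also have "\<dots> = esum K (C.W4 x q) (\<lambda>u v. esum K (C.V z u) (\<lambda>r s. c r (p \<otimes>\<^bsub>A\<^esub> s) v))"
  proof (rule CW4_cong)
    fix u v assume u: "u \<in> carrier X" "v \<in> carrier A"
    have "as (F (pure_tensor K X A z p) (pure_tensor K X A u v)) ?B =
      esum K (rep K X A (fst (leg2 K X A p) (C.t2 z u))) (\<lambda>u' v'. c u' v' v)"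
      using u x zp by (simp add: F_pure 1 C.T.multiplierD C.alpha C.alpha_pure C.legs_closed)
    then show "as (F (pure_tensor K X A z p) (pure_tensor K X A u v)) ?B = esum K (C.V z u) (\<lambda>r s. c r (p \<otimes>\<^bsub>A\<^esub> s) v)"
      using u x by (simp add: C.legs_rep(3)[OF _ fb] C.V_def)
  qed (use x in simp_all)
  finally have l: "as (F (pure_tensor K X A z p) (C.t4 x q)) ?B =
    esum K (C.W4 x q) (\<lambda>u v. esum K (C.V z u) (\<lambda>r s. c r (p \<otimes>\<^bsub>A\<^esub> s) v))" .
  have "G (pure_tensor K A A p q) (C.t2 z x) ?B =
    esum K (C.V z x) (\<lambda>u v. G (pure_tensor K A A p q) (pure_tensor K X A u v) ?B)"
    unfolding C.V_def
    by (rule C.functional_rep[OF functional_comp[OF Q.eval_functional[OF B] G_linear[OF pq]]]) (simp add: x)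
  also have "\<dots> = esum K (C.V z x) (\<lambda>u v. esum K (D.W4 v q) (\<lambda>r s. c u (p \<otimes>\<^bsub>A\<^esub> r) s))"
  proof (rule CV_cong)
    fix u v assume u: "u \<in> carrier X" "v \<in> carrier A"
    have "G (pure_tensor K A A p q) (pure_tensor K X A u v) ?B = fst (leg1 K A A p) (D.t4 v q) (\<lambda>r s. c u r s)"
      using u x pq D.t_module(5)[OF x(3) u(2) x(3) x(4) x(4)] by (simp add: G_pure Q.pure_eval[OF B] D.alpha_pure)
    also have "\<dots> = esum K (D.W4 v q) (\<lambda>r s. c u (p \<otimes>\<^bsub>A\<^esub> r) s)"
      using u x by (simp add: D.tensor_eval cc(5) D.T.multiplierD D.legs_closed D.legs_rep D.W4_def)
    finally show "G (pure_tensor K A A p q) (pure_tensor K X A u v) ?B = \<dots>" .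
  qed (use x in simp_all)
  finally show ?thesis using coassoc_tensor[OF x] l by simp
qed

lemma coassoc_lists4:
  assumes c: "c \<in> trilinear_forms K X A A" and x: "x \<in> carrier X" "z \<in> carrier X" "q \<in> carrier A"
  shows "esum K (C.W4 x q) (\<lambda>u v. esum K (C.V z u) (\<lambda>r s. c r s v)) =
    esum K (C.V z x) (\<lambda>u v. esum K (D.W4 v q) (\<lambda>r s. c u r s))"
proof (rule C.W.cancel_leg2_left[OF _ _ _ c])
  fix d c assume d: "d \<in> carrier A" and c: "c \<in> trilinear_forms K X A A"
  show "esum K (C.W4 x q) (\<lambda>u v. esum K (C.V z u) (\<lambda>r s. c r (d \<otimes>\<^bsub>A\<^esub> s) v)) =
    esum K (C.V z x) (\<lambda>u v. esum K (D.W4 v q) (\<lambda>r s. c u (d \<otimes>\<^bsub>A\<^esub> r) s))"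
    by (rule coassoc_covered[OF c x(1,2) d x(3)])
qed ((intro ml_C; simp add: x)+)

lemma coassoc_lists:
  assumes c: "c \<in> trilinear_forms K X A A" and x: "x \<in> carrier X" "y \<in> carrier X" "a \<in> carrier A"
  shows "esum K (C.W y a) (\<lambda>u v. esum K (C.V x u) (\<lambda>p q. c p q v)) =
    esum K (C.V x y) (\<lambda>p u. esum K (D.W u a) (\<lambda>q v. c p q v))"
proof (rule C.B.cancel_leg3[OF C.Wm, where J = "carrier A" and \<rho> = "\<lambda>d s. d \<otimes>\<^bsub>A\<^esub> s", OF _ _ _ _ _ c])
  fix d c assume d: "d \<in> carrier A" and C: "c \<in> trilinear_forms K X A A"
  note c = trilinear_comp[OF C]
  have "esum K (C.W y a) (\<lambda>u v. esum K (C.V x u) (\<lambda>p q. c p q (d \<otimes>\<^bsub>A\<^esub> v)))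
    = esum K (C.W4 y d) (\<lambda>u v. esum K (C.V x u) (\<lambda>p q. c p q (v \<otimes>\<^bsub>A\<^esub> a)))"
    by (rule C.lists_module(6)[where B = "\<lambda>u v. esum K (C.V x u) (\<lambda>p q. c p q v)", OF _ x(2,2,2) d x(3), symmetric];
        (intro ml_C c)?; simp add: x d)
  also have "\<dots> = esum K (C.V x y) (\<lambda>p u. esum K (D.W4 u d) (\<lambda>q v. c p q (v \<otimes>\<^bsub>A\<^esub> a)))"
    by (rule coassoc_lists4[where c = "\<lambda>p q v. c p q (v \<otimes>\<^bsub>A\<^esub> a)"]; (intro ml_C c)?; simp add: x d)
  also have "\<dots> = esum K (C.V x y) (\<lambda>p u. esum K (D.W u a) (\<lambda>q v. c p q (d \<otimes>\<^bsub>A\<^esub> v)))"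
    by (rule CV_cong[OF x(1,2)]) (rule D.lists_module(6)[OF c(5)]; (assumption | rule x d))
  finally show "esum K (C.W y a) (\<lambda>u v. esum K (C.V x u) (\<lambda>p q. c p q (d \<otimes>\<^bsub>A\<^esub> v))) =
    esum K (C.V x y) (\<lambda>p u. esum K (D.W u a) (\<lambda>q v. c p q (d \<otimes>\<^bsub>A\<^esub> v)))" .
qed (((intro ml_C)?; simp add: x C.W.mult_linear_right C.W.eq_by_left_mult)+)

end

section \<open>The modular element of a Galois object\<close>

lemma (in vec2) slice_functional:
  assumes t: "t \<in> carrier VW"
  shows "\<phi> \<in> functionals K W \<Longrightarrow> g \<in> functionals K V \<Longrightarrow>
      g (slice_right K V W \<phi> t) = esum K (rep K V W t) (\<lambda>v w. \<phi> w \<otimes> g v)"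
    "\<omega> \<in> functionals K V \<Longrightarrow> h \<in> functionals K W \<Longrightarrow>
      h (slice_left K V W \<omega> t) = esum K (rep K V W t) (\<lambda>v w. \<omega> v \<otimes> h w)"
proof -
  assume p: "\<phi> \<in> functionals K W" and g: "g \<in> functionals K V"
  have b: "(\<lambda>v w. \<phi> w \<odot>\<^bsub>V\<^esub> v) \<in> bilinear_maps K V W V"
    by (rule bilinear_mapsI; rule linear_mapsI)
      (simp_all add: functionalsD[OF p] V.smult_l_distr V.smult_r_distr V.smult_assoc1[symmetric] K.m_comm)
  have "g (slice_right K V W \<phi> t) = esum K (rep K V W t) (\<lambda>v w. g (\<phi> w \<odot>\<^bsub>V\<^esub> v))"
    unfolding slice_right_def tensor_lift_functional[OF V.module_axioms b g t]
    by (rule tensor_eval[OF t bilinear_maps_functional[OF b g]])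
  also have "\<dots> = esum K (rep K V W t) (\<lambda>v w. \<phi> w \<otimes> g v)"
    by (rule esum_cong[OF rep(1)[OF t]]) (simp add: functionalsD(3)[OF g] functionalsD(1)[OF p])
  finally show "g (slice_right K V W \<phi> t) = \<dots>" .
next
  assume p: "\<omega> \<in> functionals K V" and g: "h \<in> functionals K W"
  have b: "(\<lambda>v w. \<omega> v \<odot>\<^bsub>W\<^esub> w) \<in> bilinear_maps K V W W"
    by (rule bilinear_mapsI; rule linear_mapsI)
      (simp_all add: functionalsD[OF p] W.smult_l_distr W.smult_r_distr W.smult_assoc1[symmetric] K.m_comm)
  have "h (slice_left K V W \<omega> t) = esum K (rep K V W t) (\<lambda>v w. h (\<omega> v \<odot>\<^bsub>W\<^esub> w))"
    unfolding slice_left_def tensor_lift_functional[OF W.module_axioms b g t]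
    by (rule tensor_eval[OF t bilinear_maps_functional[OF b g]])
  also have "\<dots> = esum K (rep K V W t) (\<lambda>v w. \<omega> v \<otimes> h w)"
    by (rule esum_cong[OF rep(1)[OF t]]) (simp add: functionalsD(3)[OF g] functionalsD(1)[OF p])
  finally show "h (slice_left K V W \<omega> t) = \<dots>" .
qed

lemma (in nd2) leg_products_bilinear:
  assumes \<alpha>: "\<alpha> \<in> linear_maps K Y T.MB"
  shows "(\<lambda>y c. \<alpha> y \<otimes>\<^bsub>T.MB\<^esub> leg2 K V W c) \<in> bilinear_maps K Y W T.MB"
    "(\<lambda>c y. leg1 K V W c \<otimes>\<^bsub>T.MB\<^esub> \<alpha> y) \<in> bilinear_maps K V Y T.MB"
    "(\<lambda>y c. \<alpha> y \<otimes>\<^bsub>T.MB\<^esub> leg1 K V W c) \<in> bilinear_maps K Y V T.MB"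
    "(\<lambda>c y. leg2 K V W c \<otimes>\<^bsub>T.MB\<^esub> \<alpha> y) \<in> bilinear_maps K W Y T.MB"
  by (intro bilinear_mapsI T.mult_alg_mult_linear linear_comp[OF T.mult_alg_mult_linear(1)]
    linear_comp[OF T.mult_alg_mult_linear(2)] linear_mapsD(1)[OF \<alpha>] \<alpha> legs_closed legs_linear; assumption)+

lemma (in covered_map) span_of_bijection:
  assumes bij: "bij_betw (tensor_lift K X A T.MB (\<lambda>a b. \<alpha> a \<otimes>\<^bsub>T.MB\<^esub> leg2 K X A b)) (carrier VW) (inner_mults VW)"
    and r: "r \<in> carrier VW"
  shows "\<exists>s\<in>carrier VW. tensor_lift K X A VW t1 s = r"
proof -
  have "mult_of VW r \<in> inner_mults VW" using r by (simp add: inner_mults_def)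
  then have "mult_of VW r \<in> tensor_lift K X A T.MB (\<lambda>a b. \<alpha> a \<otimes>\<^bsub>T.MB\<^esub> leg2 K X A b) ` carrier VW"
    using bij by (simp only: bij_betw_def)
  then obtain s where s: "s \<in> carrier VW"
    "tensor_lift K X A T.MB (\<lambda>a b. \<alpha> a \<otimes>\<^bsub>T.MB\<^esub> leg2 K X A b) s = mult_of VW r"
    by (elim imageE) simp
  have "mult_of VW (tensor_lift K X A VW t1 s) = tensor_lift K X A T.MB (\<lambda>a b. mult_of VW (t1 a b)) s"
    by (rule tensor_lift_comp[OF Tm t_bilinear(1) T.mult_alg_module T.mult_of_linear s(1)])
  also have "\<dots> = mult_of VW r"
    unfolding s(2)[symmetric] by (rule tensor_lift_cong) (rule mult_of_t)
  finally have "tensor_lift K X A VW t1 s = r"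
    by (intro inj linear_mapsD(1)[OF tensor_lift_linear[OF Tm t_bilinear(1)] s(1)] r)
  then show ?thesis using s(1) by blast
qed

lemma (in vec) normalise_functional:
  assumes f: "f \<in> functionals K V" and v: "v \<in> carrier V" "f v \<noteq> \<zero>"
  shows "\<exists>u\<in>carrier V. f u = \<one>"
proof
  have i: "inv (f v) \<in> carrier K" "inv (f v) \<otimes> f v = \<one>"
    using v functionalsD(1)[OF f v(1)] by (auto simp: field_Units)
  show "inv (f v) \<odot>\<^bsub>V\<^esub> v \<in> carrier V" using i v by simp
  show "f (inv (f v) \<odot>\<^bsub>V\<^esub> v) = \<one>" using i v by (simp add: functionalsD(3)[OF f])
qed

text \<open>
  For \<open>\<Delta>\<close> the four covers and the invertibility of the canonical maps are both contained in the four
  bijections. The fourth is indexed in the opposite order, hence the exchange.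
\<close>

lemma covered_comult:
  assumes "regular_multiplier_hopf_algebra K A \<Delta>"
  shows "covered_map3 K A A \<Delta>" "covered_coaction K A A \<Delta> \<Delta>"
    "\<exists>T1' T2' T3' T4'. hopf_lists K A (covered_map.W K A A \<Delta>) (covered_map.V K A A \<Delta>) (covered_map3.W3 K A A \<Delta>)
      (covered_map.W4 K A A \<Delta>) T1' T2' T3' T4'"
proof -
  interpret A: regular_multiplier_hopf_algebra K A \<Delta> by fact
  interpret AA: nd2 K A A by unfold_locales
  have lin: "\<Delta> \<in> linear_maps K A AA.T.MB" using A.comult_hom by (simp add: alg_homs_def)
  note b = AA.leg_products_bilinear[OF lin]
  have v: "vec2 K A A" by unfold_locales
  note i1 = AA.inverse_lists_of_bijection[OF v b(1) A.canonical_bij1]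
    and i2 = AA.inverse_lists_of_bijection[OF v b(2) A.canonical_bij2]
    and i3 = AA.inverse_lists_of_bijection[OF v b(3) A.canonical_bij3]
    and i4 = AA.inverse_lists_of_bijection[OF v b(4) A.canonical_bij4]
  show c3: "covered_map3 K A A \<Delta>"
    by unfold_locales (rule A.comult_hom i1(1) i2(1) i3(1) i4(1); assumption)+
  interpret D: covered_map3 K A A \<Delta> by (rule c3)
  show cc: "covered_coaction K A A \<Delta> \<Delta>"
    by unfold_locales (rule D.span_of_bijection[OF A.canonical_bij1] A.comult_coassociative; assumption?)+
  interpret CD: covered_coaction K A A \<Delta> \<Delta> by (rule cc)
  obtain T1' T2' T3' T4'' where T: "inverse_lists K A A A A D.W T1'" "inverse_lists K A A A A D.V T2'"
    "inverse_lists K A A A A D.W3 T3'" "inverse_lists K A A A A (\<lambda>c a. D.W4 a c) T4''"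
    using i1(2) i2(2) i3(2) i4(2)
    unfolding D.V_def[abs_def] D.W_def[abs_def] D.W3_def[abs_def] D.W4_def[abs_def]
      D.t1_def D.t2_def D.t3_def D.t4_def by blast
  have "hopf_lists K A D.W D.V D.W3 D.W4 T1' T2' T3' (\<lambda>x y. map prod.swap (T4'' x y))"
  proof (intro hopf_lists.intro base.intro hopf_lists_axioms.intro)
    show "inverse_lists K A A A A D.W4 (\<lambda>x y. map prod.swap (T4'' x y))"
      using inverse_lists_exchange[OF T(4)] by simp
  qed (rule T A.K.field_axioms A.nd_algebra_axioms D.lists_module D.lists_hom D.W3_module CD.coassoc_lists; assumption)+
  then show "\<exists>T1' T2' T3' T4'. hopf_lists K A D.W D.V D.W3 D.W4 T1' T2' T3' T4'" by blast
qed

theorem proposition2p7: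
  fixes K :: "'k ring"
    and A :: "('k, 'a) module" and \<Delta> :: "'a \<Rightarrow> ('k, 'a, 'a) tensor multiplier"
    and \<phi> :: "'a \<Rightarrow> 'k"
    and X :: "('k, 'x) module" and \<alpha> :: "'x \<Rightarrow> ('k, 'x, 'a) tensor multiplier"
    and \<phi>\<^sub>X \<psi>\<^sub>X :: "'x \<Rightarrow> 'k"
  assumes "algebraic_quantum_group K A \<Delta> \<phi>"
    and "galois_object K A \<Delta> X \<alpha>"
    and "\<phi>\<^sub>X \<in> functionals K X"
    and "\<forall>x\<in>carrier X.
      mult_slice_right K X A \<phi> (\<alpha> x) = \<phi>\<^sub>X x \<odot>\<^bsub>mult_alg K X\<^esub> \<one>\<^bsub>mult_alg K X\<^esub>"
    and "invariant_functional K A X \<alpha> \<psi>\<^sub>X"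
    and "\<exists>x\<in>carrier X. \<psi>\<^sub>X x \<noteq> \<zero>\<^bsub>K\<^esub>"
  shows "\<exists>!\<delta>\<^sub>X. \<delta>\<^sub>X \<in> Units (mult_alg K X) \<and>
    (\<forall>x\<in>carrier X. \<phi>\<^sub>X (snd \<delta>\<^sub>X x) = \<psi>\<^sub>X x)"
proof -
  interpret A: algebraic_quantum_group K A \<Delta> \<phi> by fact
  interpret X: galois_object K A \<Delta> X \<alpha> by fact
  note hopf = covered_comult[OF A.regular_multiplier_hopf_algebra_axioms]
  interpret D: covered_map3 K A A \<Delta> by (rule hopf(1))
  interpret CD: covered_coaction K A A \<Delta> \<Delta> by (rule hopf(2))
  interpret XA: nd2 K X A by unfold_locales
  have lin: "\<alpha> \<in> linear_maps K X XA.T.MB" using X.coact_hom by (simp add: alg_homs_def)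
  have v: "vec2 K X X" by unfold_locales
  note iV = XA.inverse_lists_of_bijection[OF v XA.leg_products_bilinear(2)[OF lin] X.galois_map_bij]
  interpret C: covered_map K X A \<alpha>
    by unfold_locales (rule X.coact_hom X.coact_leg2 iV(1) X.leg2_coact; assumption)+
  interpret CC: covered_coaction K X A \<alpha> \<Delta>
    by unfold_locales (rule CD.span1 X.coact_coassociative; assumption?)+
  obtain T1' T2' T3' T4' where T: "hopf_lists K A D.W D.V D.W3 D.W4 T1' T2' T3' T4'"
    using hopf(3) by blast
  obtain V' where V': "inverse_lists K X X X A C.V V'"
    using iV(2) unfolding C.V_def[abs_def] C.t2_def by blast
  have zA: "\<zero>\<^bsub>A\<^esub> \<in> carrier A" by simp
  have L: "coaction_lists K A D.W D.V D.W3 D.W4 T1' T2' T3' T4' X C.V V' C.W C.W4"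
    by (intro coaction_lists.intro coaction_lists_axioms.intro T X.X.nd_algebra_axioms;
      (rule V' C.lists_bilinear C.lists_module(1)[OF _ _ _ _ zA zA] C.lists_module(2-)
        C.lists_hom(1)[OF _ _ _ _ zA] C.lists_hom(2-) CC.coassoc_lists; assumption?))
  have psi: "\<psi>\<^sub>X \<in> functionals K X" using assms(5) by (simp add: invariant_functional_def)
  obtain x0 where x0: "x0 \<in> carrier X" "\<psi>\<^sub>X x0 = \<one>\<^bsub>K\<^esub>"
    using vec.normalise_functional[OF vec_of_nd[OF X.X.nd_algebra_axioms] psi] assms(6) by blast
  obtain f where f: "f \<in> carrier A" "\<phi> f = \<one>\<^bsub>K\<^esub>"
    using vec.normalise_functional[OF vec_of_nd[OF A.nd_algebra_axioms] A.phi_functional] A.phi_nonzero by blast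
  have sl: "slice_left K X A \<psi>\<^sub>X (C.t1 x c) = \<psi>\<^sub>X x \<odot>\<^bsub>A\<^esub> c" "slice_left K X A \<psi>\<^sub>X (C.t4 x c) = \<psi>\<^sub>X x \<odot>\<^bsub>A\<^esub> c"
    if "x \<in> carrier X" "c \<in> carrier A" for x c
  proof -
    have "mult_slice_left K X A \<psi>\<^sub>X (\<alpha> x) = \<psi>\<^sub>X x \<odot>\<^bsub>mult_alg K A\<^esub> \<one>\<^bsub>mult_alg K A\<^esub>"
      using assms(5) that by (simp add: invariant_functional_def)
    then have "fst (mult_slice_left K X A \<psi>\<^sub>X (\<alpha> x)) c = \<psi>\<^sub>X x \<odot>\<^bsub>A\<^esub> c" "snd (mult_slice_left K X A \<psi>\<^sub>X (\<alpha> x)) c = \<psi>\<^sub>X x \<odot>\<^bsub>A\<^esub> c"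
      using that by (simp_all add: A.multiplier_smult A.multiplier_zero_one)
    then show "slice_left K X A \<psi>\<^sub>X (C.t1 x c) = \<psi>\<^sub>X x \<odot>\<^bsub>A\<^esub> c" "slice_left K X A \<psi>\<^sub>X (C.t4 x c) = \<psi>\<^sub>X x \<odot>\<^bsub>A\<^esub> c"
      using that by (simp_all add: mult_slice_left_def C.t1_def C.t4_def)
  qed
  have sr: "slice_right K X A \<phi> (C.t2 x y) = \<phi>\<^sub>X y \<odot>\<^bsub>X\<^esub> x" if "x \<in> carrier X" "y \<in> carrier X" for x y
  proof -
    have "snd (mult_slice_right K X A \<phi> (\<alpha> y)) x = \<phi>\<^sub>X y \<odot>\<^bsub>X\<^esub> x"
      using assms(4) that by (simp add: X.X.multiplier_smult X.X.multiplier_zero_one)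
    then show ?thesis using that by (simp add: mult_slice_right_def C.t2_def)
  qed
  have Y: "coaction_psi K A D.W D.V D.W3 D.W4 T1' T2' T3' T4' X C.V V' C.W C.W4 \<psi>\<^sub>X x0"
  proof (intro coaction_psi.intro coaction_psi_axioms.intro L psi x0)
    fix g x c assume g: "g \<in> functionals K A" and x: "x \<in> carrier X" "c \<in> carrier A"
    show "esum K (C.W x c) (\<lambda>u v. \<psi>\<^sub>X u \<otimes>\<^bsub>K\<^esub> g v) = \<psi>\<^sub>X x \<otimes>\<^bsub>K\<^esub> g c"
      using XA.slice_functional(2)[OF C.t_closed(1)[OF x] psi g] x
      by (simp add: C.W_def sl functionalsD(3)[OF g] functionalsD(1)[OF psi])
    show "esum K (C.W4 x c) (\<lambda>u v. \<psi>\<^sub>X u \<otimes>\<^bsub>K\<^esub> g v) = \<psi>\<^sub>X x \<otimes>\<^bsub>K\<^esub> g c"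
      using XA.slice_functional(2)[OF C.t_closed(3)[OF x] psi g] x
      by (simp add: C.W4_def sl functionalsD(3)[OF g] functionalsD(1)[OF psi])
  qed
  obtain \<psi> e where I: "hopf_integral K A D.W D.V D.W3 D.W4 T1' T2' T3' T4' \<psi> e"
    using coaction_psi.hopf_integral_exists[OF Y] by blast
  have H: "hopf_haar K A D.W D.V D.W3 D.W4 T1' T2' T3' T4' \<psi> e \<phi> f"
  proof (intro hopf_haar.intro hopf_haar_axioms.intro I A.phi_functional f)
    fix g a c assume g: "g \<in> functionals K A" and x: "a \<in> carrier A" "c \<in> carrier A"
    show "esum K (D.W3 a c) (\<lambda>u v. \<phi> v \<otimes>\<^bsub>K\<^esub> g u) = \<phi> a \<otimes>\<^bsub>K\<^esub> g c"
      using D.slice_functional(1)[OF D.t3(1)[OF x] A.phi_functional g] A.phi_left_invariant[OF x] x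
      by (simp add: D.W3_def D.t3_def functionalsD(3)[OF g] functionalsD(1)[OF A.phi_functional])
  qed
  have J: "coaction_integrals K A D.W D.V D.W3 D.W4 T1' T2' T3' T4' X C.V V' C.W C.W4 \<psi>\<^sub>X x0 \<phi> f \<phi>\<^sub>X"
  proof (intro coaction_integrals.intro coaction_integrals_axioms.intro Y A.phi_functional f assms(3))
    fix g x y assume g: "g \<in> functionals K X" and x: "x \<in> carrier X" "y \<in> carrier X"
    show "esum K (C.V x y) (\<lambda>u v. \<phi> v \<otimes>\<^bsub>K\<^esub> g u) = \<phi>\<^sub>X y \<otimes>\<^bsub>K\<^esub> g x"
      using XA.slice_functional(1)[OF C.t_closed(2)[OF x] A.phi_functional g] x
      by (simp add: C.V_def sr functionalsD(3)[OF g] functionalsD(1)[OF assms(3)])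
  qed
  show ?thesis
    by (rule coaction_haar.modular_element[OF coaction_haar.intro[OF H J]])
qed

end
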